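(* Suppose $G$ is a stratified homogeneous group with homogeneous dimension $Q\ge2$, and let $m=\dim\mathfrak g_1$. Then there is $C$ such that for all $u_1,\dots,u_m\in C^\infty_c(G;\mathbf R)$, $$\sum_{j=1}^m\|u_j\|_{L^{Q/(Q-1)}(G)}\le C\sum_{i,j=1}^m\|X_iu_j+X_ju_i\|_{L^1(G)},\qquad \sum_{j=1}^m\int_G\frac{|u_j(x)|}{\|x\|}\,dx\le C\sum_{i,j=1}^m\|X_iu_j+X_ju_i\|_{L^1(G)},$$ and more generally, for every $p\in[1,\frac{Q}{Q-1})$ there is $C$ such that $$\sum_{j=1}^m\Big(\int_G\big(\|x\|^{Q-1}|u_j(x)|\big)^p\frac{dx}{\|x\|^Q}\Big)^{1/p}\le C\sum_{i,j=1}^m\|X_iu_j+X_ju_i\|_{L^1(G)}$$ for all $u_1,\dots,u_m\in C^\infty_c(G;\mathbf R)$.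
   Context: A stratified homogeneous group $G$ is a connected, simply connected real Lie group whose Lie algebra $\mathfrak g$ is nilpotent and decomposes as $\mathfrak g=\mathfrak g_1\oplus\cdots\oplus\mathfrak g_r$ with $[\mathfrak g_i,\mathfrak g_j]\subset\mathfrak g_{i+j}$ ($\mathfrak g_s=\{0\}$ for $s>r$) and $\mathfrak g_1$ generating $\mathfrak g$; $G$ is identified with $\mathfrak g$ via the exponential map, with Lebesgue (Haar) measure $dx$; write $x=(x_1,\dots,x_r)$, $x_j\in\mathfrak g_j$. Homogeneous dimension $Q=\sum_j j\dim\mathfrak g_j$; homogeneous norm $\|x\|=\big(\sum_j|x_j|^{2r!/j}\big)^{1/(2r!)}$. $X_1,\dots,X_m$ is a basis of $\mathfrak g_1$, identified with left-invariant vector fields $X_i\phi(x)=\frac{d}{ds}|_{s=0}\phi(x\exp(sX_i))$. *)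

theory Defs
  imports "HOL-Analysis.Analysis"
begin

fun Ck :: "nat \<Rightarrow> ('a::euclidean_space \<Rightarrow> real) \<Rightarrow> bool" where
  "Ck 0 f = continuous_on UNIV f"
| "Ck (Suc k) f = (f differentiable_on UNIV \<and>
      (\<forall>b\<in>Basis. Ck k (\<lambda>x. frechet_derivative f (at x) b)))"

definition smooth_fun :: "('a::euclidean_space \<Rightarrow> real) \<Rightarrow> bool" where
  "smooth_fun f \<longleftrightarrow> (\<forall>k. Ck k f)"

definition smooth_map :: "('a::euclidean_space \<Rightarrow> 'b::euclidean_space) \<Rightarrow> bool" where
  "smooth_map F \<longleftrightarrow> (\<forall>b\<in>Basis. smooth_fun (\<lambda>x. F x \<bullet> b))"

definition test_function :: "('a::euclidean_space \<Rightarrow> real) \<Rightarrow> bool" where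
  "test_function u \<longleftrightarrow> smooth_fun u \<and> compact (closure {x. u x \<noteq> 0})"

text \<open>Lie bracket of the Lie group (a, gmul) whose identity is 0 and whose exponential map
  is the identity: [X,Y] = d/dt|0 d/ds|0 exp(tX) exp(sY) exp(-tX).\<close>
definition lie_bracket :: "('a::real_normed_vector \<Rightarrow> 'a \<Rightarrow> 'a) \<Rightarrow> 'a \<Rightarrow> 'a \<Rightarrow> 'a" where
  "lie_bracket gmul X Y =
     vector_derivative
       (\<lambda>t. vector_derivative (\<lambda>s. gmul (gmul (t *\<^sub>R X) (s *\<^sub>R Y)) (- (t *\<^sub>R X))) (at 0))
       (at 0)"

text \<open>Stratified homogeneous group in exponential coordinates: the group law gmul on the
  Euclidean space a (= Lie algebra g), identity 0, lines through 0 are the one-parameter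
  subgroups (so exp = id), smooth; layers V 1, ..., V r with projections P j give a direct sum
  decomposition g = V 1 + ... + V r with [V i, V j] in V (i+j) (= {0} if i+j > r),
  and V 1 generates g as a Lie algebra.\<close>
definition stratified_group ::
  "('a::euclidean_space \<Rightarrow> 'a \<Rightarrow> 'a) \<Rightarrow> nat \<Rightarrow> (nat \<Rightarrow> 'a set) \<Rightarrow> (nat \<Rightarrow> 'a \<Rightarrow> 'a) \<Rightarrow> bool" where
  "stratified_group gmul r V P \<longleftrightarrow>
     (\<forall>x y z. gmul (gmul x y) z = gmul x (gmul y z)) \<and>
     (\<forall>x. gmul 0 x = x \<and> gmul x 0 = x) \<and>
     (\<forall>x s t. gmul (s *\<^sub>R x) (t *\<^sub>R x) = (s + t) *\<^sub>R x) \<and>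
     smooth_map (\<lambda>z::'a \<times> 'a. gmul (fst z) (snd z)) \<and>
     1 \<le> r \<and>
     (\<forall>j\<in>{1..r}. subspace (V j)) \<and>
     (\<forall>x. x = (\<Sum>j=1..r. P j x) \<and> (\<forall>j\<in>{1..r}. P j x \<in> V j)) \<and>
     (\<forall>y. (\<forall>j\<in>{1..r}. y j \<in> V j) \<and> (\<Sum>j=1..r. y j) = 0 \<longrightarrow> (\<forall>j\<in>{1..r}. y j = 0)) \<and>
     (\<forall>i\<in>{1..r}. \<forall>j\<in>{1..r}. \<forall>x\<in>V i. \<forall>y\<in>V j.
        lie_bracket gmul x y \<in> (if i + j \<le> r then V (i + j) else {0})) \<and>
     (\<forall>W. subspace W \<and> V 1 \<subseteq> W \<and> (\<forall>x\<in>W. \<forall>y\<in>W. lie_bracket gmul x y \<in> W)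
          \<longrightarrow> W = UNIV)"

definition hom_dim :: "nat \<Rightarrow> (nat \<Rightarrow> 'a::euclidean_space set) \<Rightarrow> nat" where
  "hom_dim r V = (\<Sum>j=1..r. j * dim (V j))"

definition hom_norm :: "nat \<Rightarrow> (nat \<Rightarrow> 'a \<Rightarrow> 'a::euclidean_space) \<Rightarrow> 'a \<Rightarrow> real" where
  "hom_norm r P x =
     (\<Sum>j=1..r. norm (P j x) powr (2 * fact r / real j)) powr (1 / (2 * fact r))"

definition lvf :: "('a::real_normed_vector \<Rightarrow> 'a \<Rightarrow> 'a) \<Rightarrow> 'a \<Rightarrow> ('a \<Rightarrow> real) \<Rightarrow> 'a \<Rightarrow> real" where
  "lvf gmul X phi x = deriv (\<lambda>s. phi (gmul x (s *\<^sub>R X))) 0"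

definition L1_norm :: "('a::euclidean_space \<Rightarrow> real) \<Rightarrow> real" where
  "L1_norm f = (\<integral>x. \<bar>f x\<bar> \<partial>lborel)"

definition Lp_norm :: "real \<Rightarrow> ('a::euclidean_space \<Rightarrow> real) \<Rightarrow> real" where
  "Lp_norm p f = (\<integral>x. \<bar>f x\<bar> powr p \<partial>lborel) powr (1 / p)"

end

theory Submission
  imports Defs "HOL-Computational_Algebra.Fundamental_Theorem_Algebra"
begin

text \<open>
  For a horizontal direction \<open>\<xi> = X i + \<sigma> X j\<close> the derivative of \<open>w = u i + \<sigma> u j\<close> along \<open>\<xi>\<close> is controlled by
  the symmetrised gradient. At a point where \<open>\<bar>u i\<bar>\<close> is the largest component, the directions \<open>X i\<close> and
  \<open>X i \<plusminus> X j\<close>, with signs chosen so that there is no cancellation, all satisfy \<open>\<bar>w\<bar> \<ge> \<bar>u i\<bar>\<close>, and they span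
  \<open>V 1\<close>. So one-dimensional estimates along horizontal lines suffice.

  Hardy: outside a thin cone around the line of \<open>\<xi>\<close> the weight \<open>1 / N\<close> has bounded integral along every line in
  direction \<open>\<xi>\<close>, and at each point one of the two usable directions \<open>X i\<close>, \<open>X i \<plusminus> X j\<close> has the point outside its cone.

  Sobolev: let \<open>F\<close> be the set where every such \<open>\<bar>w\<bar>\<close> is at least \<open>2 \<tau>\<close>. Through each of its points, every line in
  such a direction carries derivative mass at least \<open>\<tau>\<close> at heights between \<open>\<tau>\<close> and \<open>2 \<tau>\<close>. If \<open>F\<close> were large compared
  with the total mass \<open>a\<close>, discarding points with short fibres would leave a tower of subsets of \<open>F\<close> whose
  successive fibres along chosen directions have length at least \<open>\<alpha>\<close>. Horizontal words of length \<open>dim G\<close>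
  parametrise \<open>G\<close> by a polynomial map with bounded multiplicity and nonzero Jacobian, so such a tower has
  measure at least \<open>c \<alpha>\<^sup>Q\<close>. This gives the bound \<open>(a / \<tau>)\<^bsup>Q/(Q-1)\<^esup>\<close> for the measure of \<open>F\<close>, which is summed over
  dyadic \<open>\<tau>\<close>.

  The intermediate exponents follow by Young's inequality applied pointwise to the two integrands.
\<close>

section \<open>Differential calculus on the group\<close>

text \<open>Which directions are usable depends on the point, through the dominant index and the
  signs. There are finitely many patterns \<open>(i, \<sigma>)\<close>; each gets its own word and
  constant, with letters from its own spanning set. The exponent comes from a balance: asking for
  fibres of length \<open>\<alpha>\<close> costs at most \<open>n \<alpha> a / \<tau>\<close> of the
  measure \<open>f\<close> of \<open>F\<close>, where \<open>n = DIM('a)\<close>. So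
  \<open>\<alpha> = \<tau> f / (2 n a)\<close> is affordable, and
  \<open>c \<alpha>^Q \<le> f\<close> rearranges to the stated bound. The masses \<open>a\<close>
  are confined to bands of heights so that over dyadic \<open>\<tau>\<close> they add up to at most
  a multiple of the energy; since \<open>Q/(Q-1) > 1\<close>, the bounds can then be summed.
  Multiplicity and Jacobian bounds need a polynomial group law, which the definition does not
  provide. Dilations respect the bracket, hence, by a differential equation argument, the product;
  so each layer of the product is smooth and homogeneous, thus polynomial. Dilations also give
  translations Jacobian 1 and produce the power \<open>\<alpha>^Q\<close>.\<close>

lemma Ck_differentiable_at: "Ck (Suc k) f \<Longrightarrow> f differentiable at x"
  by (simp add: differentiable_on_def)

lemma Ck_add: "Ck k f \<Longrightarrow> Ck k g \<Longrightarrow> Ck k (\<lambda>x. f x + g x)"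
proof (induction k arbitrary: f g)
  case 0 then show ?case by (auto intro: continuous_intros)
next
  case (Suc k)
  have "f differentiable at x" "g differentiable at x" for x
    using Suc.prems Ck_differentiable_at by blast+
  then have "frechet_derivative (\<lambda>x. f x + g x) (at x) b
      = frechet_derivative f (at x) b + frechet_derivative g (at x) b" for x b
    using has_derivative_add[of f _ "at x" g] frechet_derivative_works frechet_derivative_at by metis
  with Suc show ?case by (auto intro: differentiable_on_add)
qed

lemma Ck_cmul: "Ck k f \<Longrightarrow> Ck k (\<lambda>x. c * f x)"
proof (induction k arbitrary: f)
  case 0 then show ?case by (auto intro: continuous_intros)
next
  case (Suc k)
  have "(f has_derivative frechet_derivative f (at x)) (at x)" for x
    using Suc.prems Ck_differentiable_at frechet_derivative_works by blast
  then have d: "((\<lambda>x. c * f x) has_derivative (\<lambda>b. c * frechet_derivative f (at x) b)) (at x)" for x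
    by (intro has_derivative_mult_right)
  then have "frechet_derivative (\<lambda>x. c * f x) (at x) = (\<lambda>b. c * frechet_derivative f (at x) b)" for x
    using frechet_derivative_at by metis
  with Suc d show ?case by (auto simp: differentiable_on_def differentiable_def)
qed

lemma Ck_zero: "Ck k (\<lambda>x. 0)"
  by (induction k) auto

lemma Ck_sum: "finite I \<Longrightarrow> (\<And>i. i \<in> I \<Longrightarrow> Ck k (f i)) \<Longrightarrow> Ck k (\<lambda>x. \<Sum>i\<in>I. f i x)"
  by (induction I rule: finite_induct) (auto intro: Ck_add Ck_zero)

lemma frechet_derivative_Basis_expansion:
  fixes f :: "'a::euclidean_space \<Rightarrow> real"
  assumes "f differentiable at x"
  shows "frechet_derivative f (at x) v = (\<Sum>b\<in>Basis. (v \<bullet> b) * frechet_derivative f (at x) b)"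
proof -
  have l: "linear (frechet_derivative f (at x))"
    using assms by (rule linear_frechet_derivative)
  have "frechet_derivative f (at x) v = frechet_derivative f (at x) (\<Sum>b\<in>Basis. (v \<bullet> b) *\<^sub>R b)"
    by (simp add: euclidean_representation)
  also have "\<dots> = (\<Sum>b\<in>Basis. (v \<bullet> b) * frechet_derivative f (at x) b)"
    using l by (simp add: linear_sum linear_cmul)
  finally show ?thesis .
qed

text \<open>\<open>Ck\<close> speaks of basis directions only; linearity of the derivative extends
  it to every \<open>v\<close>.\<close>

lemma Ck_frechet:
  assumes "Ck (Suc k) f" shows "Ck k (\<lambda>x. frechet_derivative f (at x) v)"
proof -
  have "(\<lambda>x. frechet_derivative f (at x) v) = (\<lambda>x. \<Sum>b\<in>Basis. (v \<bullet> b) * frechet_derivative f (at x) b)"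
    using frechet_derivative_Basis_expansion Ck_differentiable_at[OF assms] by blast
  with assms show ?thesis by (auto intro!: Ck_sum Ck_cmul)
qed

lemma smooth_fun_differentiable: "smooth_fun f \<Longrightarrow> f differentiable at x"
  using Ck_differentiable_at unfolding smooth_fun_def by blast

lemma smooth_fun_frechet: "smooth_fun f \<Longrightarrow> smooth_fun (\<lambda>x. frechet_derivative f (at x) v)"
  using Ck_frechet unfolding smooth_fun_def by blast

lemma smooth_fun_continuous: "smooth_fun f \<Longrightarrow> continuous_on S f"
  using smooth_fun_differentiable differentiable_imp_continuous_within
  by (metis continuous_at_imp_continuous_on)

lemma smooth_fun_sum:
  "finite I \<Longrightarrow> (\<And>i. i \<in> I \<Longrightarrow> smooth_fun (f i)) \<Longrightarrow> smooth_fun (\<lambda>x. \<Sum>i\<in>I. f i x)"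
  unfolding smooth_fun_def by (auto intro: Ck_sum)

lemma smooth_fun_cmul: "smooth_fun f \<Longrightarrow> smooth_fun (\<lambda>x. c * f x)"
  unfolding smooth_fun_def by (auto intro: Ck_cmul)

locale strat_group =
  fixes gmul :: "'a::euclidean_space \<Rightarrow> 'a \<Rightarrow> 'a" (infixl "\<odot>" 70)
    and r :: nat and V :: "nat \<Rightarrow> 'a set" and P :: "nat \<Rightarrow> 'a \<Rightarrow> 'a"
  assumes G: "stratified_group gmul r V P"
begin

lemma gassoc: "(x \<odot> y) \<odot> z = x \<odot> (y \<odot> z)"
  using G by (simp add: stratified_group_def)
lemma g0 [simp]: "0 \<odot> x = x" "x \<odot> 0 = x"
  using G by (simp_all add: stratified_group_def)
lemma gline: "(s *\<^sub>R x) \<odot> (t *\<^sub>R x) = (s + t) *\<^sub>R x"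
  using G by (simp add: stratified_group_def)
lemma ginv [simp]: "x \<odot> (- x) = 0" "(- x) \<odot> x = 0"
  using gline[of 1 x "-1"] gline[of "-1" x 1] by simp_all
lemma ginv_cancel [simp]: "x \<odot> (- x \<odot> y) = y" "- x \<odot> (x \<odot> y) = y"
  by (simp_all flip: gassoc)
lemma ginv_cancel2 [simp]: "y \<odot> x \<odot> - x = y" "y \<odot> - x \<odot> x = y"
  by (simp_all add: gassoc)
lemma ginv_mult: "- (x \<odot> y) = - y \<odot> - x"
proof -
  have "(x \<odot> y) \<odot> (- y \<odot> - x) = 0"
    by (metis gassoc ginv(1) g0(1) ginv_cancel(1))
  then show ?thesis
    by (metis ginv_cancel(2) g0(2))
qed

lemma gmul_smooth: "b \<in> Basis \<Longrightarrow> smooth_fun (\<lambda>z. (fst z \<odot> snd z) \<bullet> b)"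
  using G by (simp add: stratified_group_def smooth_map_def)

text \<open>Assembled from components because smoothness is given componentwise;
  \<open>gmul_has_derivative\<close> shows that it is the full derivative of the
  multiplication.\<close>

definition Dg :: "'a \<times> 'a \<Rightarrow> 'a \<times> 'a \<Rightarrow> 'a" where
  "Dg z w = (\<Sum>b\<in>Basis. frechet_derivative (\<lambda>z. (fst z \<odot> snd z) \<bullet> b) (at z) w *\<^sub>R b)"

lemma Dg_inner: "b \<in> Basis \<Longrightarrow> Dg z w \<bullet> b = frechet_derivative (\<lambda>z. (fst z \<odot> snd z) \<bullet> b) (at z) w"
  unfolding Dg_def by (simp add: inner_sum_left inner_Basis if_distrib cong: if_cong)

lemma gmul_has_derivative: "((\<lambda>z. fst z \<odot> snd z) has_derivative Dg z) (at z)"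
proof (subst has_derivative_componentwise_within, intro ballI)
  fix b :: 'a assume b: "b \<in> Basis"
  have "((\<lambda>z. (fst z \<odot> snd z) \<bullet> b) has_derivative frechet_derivative (\<lambda>z. (fst z \<odot> snd z) \<bullet> b) (at z)) (at z)"
    using smooth_fun_differentiable[OF gmul_smooth[OF b]] frechet_derivative_works by blast
  then show "((\<lambda>z. (fst z \<odot> snd z) \<bullet> b) has_derivative (\<lambda>w. Dg z w \<bullet> b)) (at z)"
    by (simp add: Dg_inner[OF b])
qed

lemma linear_Dg: "linear (Dg z)"
  using gmul_has_derivative has_derivative_linear by blast

lemma gmul_has_derivative_comp:
  assumes "(f has_derivative f') (at x within S)" "(h has_derivative h') (at x within S)"
  shows "((\<lambda>x. f x \<odot> h x) has_derivative (\<lambda>v. Dg (f x, h x) (f' v, h' v))) (at x within S)"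
proof -
  have "((\<lambda>x. (f x, h x)) has_derivative (\<lambda>v. (f' v, h' v))) (at x within S)"
    using assms by (rule has_derivative_Pair)
  from has_derivative_compose[OF this, of "\<lambda>z. fst z \<odot> snd z" "Dg (f x, h x)"] gmul_has_derivative
  show ?thesis by simp
qed

lemma gmul_vector_derivative:
  assumes "(f has_vector_derivative f') (at t)" "(h has_vector_derivative h') (at t)"
  shows "((\<lambda>x. f x \<odot> h x) has_vector_derivative Dg (f t, h t) (f', h')) (at t)"
proof -
  have "Dg (f t, h t) (v *\<^sub>R f', v *\<^sub>R h') = v *\<^sub>R Dg (f t, h t) (f', h')" for v
    using linear_cmul[OF linear_Dg, of "(f t, h t)" v "(f', h')"] by simp
  then show ?thesis
    using gmul_has_derivative_comp[of f _ t UNIV h] assms unfolding has_vector_derivative_def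
    by fastforce
qed

lemma Dg_differentiable:
  fixes f h :: "'c::real_normed_vector \<Rightarrow> 'a \<times> 'a"
  assumes "f differentiable at x" "h differentiable at x"
  shows "(\<lambda>x. Dg (f x) (h x)) differentiable at x"
proof -
  have eq: "Dg (f x) (h x) = (\<Sum>b\<in>Basis. (\<Sum>c\<in>Basis. (h x \<bullet> c) * 
      frechet_derivative (\<lambda>z. (fst z \<odot> snd z) \<bullet> b) (at (f x)) c) *\<^sub>R b)" for x
    unfolding Dg_def
    by (intro sum.cong refl arg_cong2[where f=scaleR] frechet_derivative_Basis_expansion
        smooth_fun_differentiable gmul_smooth)
  have "(\<lambda>z. frechet_derivative (\<lambda>z. (fst z \<odot> snd z) \<bullet> b) (at z) c) differentiable at (f x)"
    if "b \<in> Basis" for b c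
    by (intro smooth_fun_differentiable smooth_fun_frechet gmul_smooth that)
  then have "(\<lambda>x. frechet_derivative (\<lambda>z. (fst z \<odot> snd z) \<bullet> b) (at (f x)) c) differentiable at x"
    if "b \<in> Basis" for b c
    using differentiable_chain_at[of f x "\<lambda>z. frechet_derivative (\<lambda>z. (fst z \<odot> snd z) \<bullet> b) (at z) c"] assms that
    by (simp add: o_def)
  moreover have "(\<lambda>x. h x \<bullet> c) differentiable at x" for c
    using assms(2) by (intro differentiable_inner) auto
  ultimately show ?thesis
    unfolding eq by (intro differentiable_sum differentiable_scaleR differentiable_mult) auto
qed

lemma gmul_continuous [continuous_intros]:
  fixes f h :: "'c::topological_space \<Rightarrow> 'a"
  assumes "continuous_on S f" "continuous_on S h"
  shows "continuous_on S (\<lambda>x. f x \<odot> h x)"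
proof -
  have "continuous_on UNIV (\<lambda>z. fst z \<odot> snd z)"
    using gmul_has_derivative has_derivative_continuous continuous_at_imp_continuous_on by blast
  from continuous_on_compose2[OF this, of S "\<lambda>x. (f x, h x)"] assms show ?thesis
    by (auto intro: continuous_intros)
qed

lemma gmul_measurable [measurable]:
  assumes [measurable]: "f \<in> borel_measurable M" "h \<in> borel_measurable M"
  shows "(\<lambda>x. f x \<odot> h x) \<in> borel_measurable M"
  by (rule borel_measurable_continuous_Pair[OF assms]) (intro continuous_intros)

lemma Dg_left: "Dg (x, 0) (a, 0) = a"
proof -
  have "((\<lambda>y. y \<odot> 0) has_derivative (\<lambda>v. Dg (x, 0) (v, 0))) (at x)"
    by (rule gmul_has_derivative_comp) auto
  moreover have "((\<lambda>y. y \<odot> 0) has_derivative (\<lambda>v. v)) (at x)" by simp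
  ultimately have "(\<lambda>v. Dg (x, 0) (v, 0)) = (\<lambda>v. v)" by (rule has_derivative_unique)
  then show ?thesis by meson
qed

lemma Dg_right: "Dg (0, x) (0, a) = a"
proof -
  have "((\<lambda>y. 0 \<odot> y) has_derivative (\<lambda>v. Dg (0, x) (0, v))) (at x)"
    by (rule gmul_has_derivative_comp) auto
  moreover have "((\<lambda>y. 0 \<odot> y) has_derivative (\<lambda>v. v)) (at x)" by simp
  ultimately have "(\<lambda>v. Dg (0, x) (0, v)) = (\<lambda>v. v)" by (rule has_derivative_unique)
  then show ?thesis by meson
qed

lemma Dg_00: "Dg (0, 0) (a, b) = a + b"
proof -
  have "Dg (0, 0) (a, b) = Dg (0, 0) (a, 0) + Dg (0, 0) (0, b)"
    using linear_add[OF linear_Dg, of "(0,0)" "(a,0)" "(0,b)"] by simp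
  then show ?thesis by (simp add: Dg_left Dg_right)
qed

text \<open>In exponential coordinates the inverse of \<open>x\<close> is \<open>- x\<close>. Thus \<open>\<lambda>x. A x Y\<close> is the left-invariant
  vector field of \<open>Y\<close>, and \<open>L x\<close> is the inverse of \<open>A x\<close>.\<close>

definition A :: "'a \<Rightarrow> 'a \<Rightarrow> 'a" where "A x Y = Dg (x, 0) (0, Y)"
text \<open>The adjoint representation: \<open>A x Y\<close> is carried back to the identity by
  right translation with \<open>- x\<close>, the inverse of \<open>x\<close>.\<close>

definition Ad :: "'a \<Rightarrow> 'a \<Rightarrow> 'a" where "Ad x Y = Dg (x, - x) (A x Y, 0)"
definition L :: "'a \<Rightarrow> 'a \<Rightarrow> 'a" where "L x Y = Dg (- x, x) (0, Y)"

lemma linear_A: "linear (A x)"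
  unfolding A_def using linear_compose[of "\<lambda>Y. (0, Y)" "Dg (x, 0)"] linear_Dg
  by (simp add: o_def linear_iff)

lemma linear_L: "linear (L x)"
  unfolding L_def using linear_compose[of "\<lambda>Y. (0, Y)" "Dg (- x, x)"] linear_Dg
  by (simp add: o_def linear_iff)

lemma linear_Ad: "linear (Ad x)"
proof -
  have "linear (\<lambda>Y. (A x Y, 0::'a))"
    using linear_A[of x] by (simp add: linear_iff)
  from linear_compose[OF this linear_Dg] show ?thesis unfolding Ad_def by (simp add: o_def)
qed

lemma A_differentiable:
  fixes f h :: "'c::real_normed_vector \<Rightarrow> 'a"
  assumes "f differentiable at x" "h differentiable at x"
  shows "(\<lambda>x. A (f x) (h x)) differentiable at x"
  unfolding A_def using assms by (intro Dg_differentiable) (auto intro!: derivative_intros simp: differentiable_Pair)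

lemma L_differentiable:
  fixes f h :: "'c::real_normed_vector \<Rightarrow> 'a"
  assumes "f differentiable at x" "h differentiable at x"
  shows "(\<lambda>x. L (f x) (h x)) differentiable at x"
  unfolding L_def using assms by (intro Dg_differentiable) (auto intro!: derivative_intros simp: differentiable_Pair)

lemma Ad_differentiable:
  fixes f h :: "'c::real_normed_vector \<Rightarrow> 'a"
  assumes "f differentiable at x" "h differentiable at x"
  shows "(\<lambda>x. Ad (f x) (h x)) differentiable at x"
  unfolding Ad_def using assms
  by (intro Dg_differentiable) (auto intro!: derivative_intros simp: differentiable_Pair A_differentiable)

end

section \<open>The adjoint representation, the bracket and Lie algebra morphisms\<close>

context strat_group begin

text \<open>Stated for an arbitrary curve through the identity, not just for a line, so that it can
  be iterated: \<open>Ad_mult\<close> applies it to its own conclusion.\<close>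

lemma Ad_velocity:
  assumes "(c has_vector_derivative v) (at t)" "c t = 0"
  shows "((\<lambda>s. x \<odot> c s \<odot> - x) has_vector_derivative Ad x v) (at t)"
proof -
  have "((\<lambda>s. x \<odot> c s) has_vector_derivative Dg (x, c t) (0, v)) (at t)"
    by (intro gmul_vector_derivative assms) auto
  then have "((\<lambda>s. x \<odot> c s) has_vector_derivative A x v) (at t)"
    using assms(2) by (simp add: A_def)
  from gmul_vector_derivative[OF this, of "\<lambda>_. - x" 0] show ?thesis
    using assms(2) by (simp add: Ad_def)
qed

lemma line_velocity: "((\<lambda>s. s *\<^sub>R Y) has_vector_derivative Y) (at t)"
  by (auto intro!: derivative_eq_intros simp: has_vector_derivative_def)

lemma Ad_mult: "Ad (x \<odot> y) Y = Ad x (Ad y Y)"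
proof -
  have "((\<lambda>s. (x \<odot> y) \<odot> s *\<^sub>R Y \<odot> - (x \<odot> y)) has_vector_derivative Ad (x \<odot> y) Y) (at 0)"
    by (rule Ad_velocity[OF line_velocity]) simp
  moreover have "((\<lambda>s. x \<odot> (y \<odot> s *\<^sub>R Y \<odot> - y) \<odot> - x) has_vector_derivative Ad x (Ad y Y)) (at 0)"
    by (rule Ad_velocity[OF Ad_velocity[OF line_velocity]]) simp_all
  moreover have "(\<lambda>s. (x \<odot> y) \<odot> s *\<^sub>R Y \<odot> - (x \<odot> y)) = (\<lambda>s. x \<odot> (y \<odot> s *\<^sub>R Y \<odot> - y) \<odot> - x)"
    by (simp add: ginv_mult gassoc)
  ultimately show ?thesis by (metis vector_derivative_unique_at)
qed

lemma Ad_0 [simp]: "Ad 0 Y = Y"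
  by (simp add: Ad_def A_def Dg_00)

lemma Ad_inv: "Ad (- x) (Ad x Y) = Y" "Ad x (Ad (- x) Y) = Y"
  by (simp_all flip: Ad_mult)

lemma Ad_line: "Ad ((s + t) *\<^sub>R x) Y = Ad (s *\<^sub>R x) (Ad (t *\<^sub>R x) Y)"
  by (simp flip: Ad_mult gline)

abbreviation br :: "'a \<Rightarrow> 'a \<Rightarrow> 'a" where "br \<equiv> lie_bracket gmul"

text \<open>The bracket is defined by iterated one-variable derivatives. Realising it as a Frechet
  derivative in the group variable makes its linearity in the first argument automatic.\<close>

definition adD :: "'a \<Rightarrow> 'a \<Rightarrow> 'a" where "adD Y = frechet_derivative (\<lambda>z. Ad z Y) (at 0)"

lemma Ad_has_derivative_0: "((\<lambda>z. Ad z Y) has_derivative adD Y) (at 0)"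
  unfolding adD_def by (intro frechet_derivative_works[THEN iffD1] Ad_differentiable) auto

lemma Ad_line_velocity_adD: "((\<lambda>t. Ad (t *\<^sub>R x) Y) has_vector_derivative adD Y x) (at 0)"
proof -
  have "((\<lambda>t. t *\<^sub>R x) has_derivative (\<lambda>t. t *\<^sub>R x)) (at 0)"
    by (auto intro!: derivative_eq_intros)
  from has_derivative_compose[OF this, of "\<lambda>z. Ad z Y" "adD Y"] Ad_has_derivative_0
  have "((\<lambda>t. Ad (t *\<^sub>R x) Y) has_derivative (\<lambda>t. adD Y (t *\<^sub>R x))) (at 0)" by simp
  moreover have "adD Y (t *\<^sub>R x) = t *\<^sub>R adD Y x" for t
    using Ad_has_derivative_0 has_derivative_linear linear_cmul by blast
  ultimately show ?thesis by (simp add: has_vector_derivative_def)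
qed

lemma br_eq: "br x Y = adD Y x"
proof -
  have "vector_derivative (\<lambda>s. t *\<^sub>R x \<odot> s *\<^sub>R Y \<odot> - (t *\<^sub>R x)) (at 0) = Ad (t *\<^sub>R x) Y" for t
    by (rule vector_derivative_at[OF Ad_velocity[OF line_velocity]]) simp
  then show ?thesis
    unfolding lie_bracket_def using vector_derivative_at[OF Ad_line_velocity_adD] by simp
qed

lemma Ad_line_velocity: "((\<lambda>t. Ad (t *\<^sub>R x) Y) has_vector_derivative br x Y) (at 0)"
  using Ad_line_velocity_adD br_eq by simp

lemma linear_br_left: "linear (\<lambda>x. br x Y)"
  unfolding br_eq using Ad_has_derivative_0 has_derivative_linear by blast

lemma linear_br_right: "linear (br x)"
proof (rule linearI)
  fix Y Z c
  show "br x (Y + Z) = br x Y + br x Z"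
  proof (rule vector_derivative_unique_at[OF Ad_line_velocity])
    show "((\<lambda>t. Ad (t *\<^sub>R x) (Y + Z)) has_vector_derivative br x Y + br x Z) (at 0)"
      using has_vector_derivative_add[OF Ad_line_velocity[of x Y] Ad_line_velocity[of x Z]]
      by (simp add: linear_add[OF linear_Ad])
  qed
  show "br x (c *\<^sub>R Y) = c *\<^sub>R br x Y"
  proof (rule vector_derivative_unique_at[OF Ad_line_velocity])
    show "((\<lambda>t. Ad (t *\<^sub>R x) (c *\<^sub>R Y)) has_vector_derivative c *\<^sub>R br x Y) (at 0)"
      using has_vector_derivative_scaleR[of "\<lambda>_. c" 0, OF _ Ad_line_velocity[of x Y]]
      by (simp add: linear_cmul[OF linear_Ad] has_real_derivative_iff_has_vector_derivative)
  qed
qed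

text \<open>Carries a velocity at time 0 to any other time, so that one-parameter group laws turn
  into differential equations.\<close>

lemma has_vector_derivative_shift:
  fixes f :: "real \<Rightarrow> 'b::real_normed_vector"
  shows "((\<lambda>e. f (t + e)) has_vector_derivative D) (at 0) \<longleftrightarrow> (f has_vector_derivative D) (at t)"
proof
  assume "((\<lambda>e. f (t + e)) has_vector_derivative D) (at 0)"
  then have "((\<lambda>e. f (t + e)) has_vector_derivative D) (at (t - t))" by simp
  moreover have "((\<lambda>x. x - t) has_vector_derivative 1) (at t)"
    by (auto intro!: derivative_eq_intros simp: has_vector_derivative_def)
  ultimately show "(f has_vector_derivative D) (at t)"
    using vector_diff_chain_at[of "\<lambda>x. x - t" 1 t] by (fastforce simp: o_def)
next
  assume "(f has_vector_derivative D) (at t)"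
  then have "(f has_vector_derivative D) (at (t + 0))" by simp
  moreover have "((\<lambda>e. t + e) has_vector_derivative 1) (at 0)"
    by (auto intro!: derivative_eq_intros simp: has_vector_derivative_def)
  ultimately show "((\<lambda>e. f (t + e)) has_vector_derivative D) (at 0)"
    using vector_diff_chain_at[of "\<lambda>e. t + e" 1 0] by (fastforce simp: o_def)
qed

lemma Ad_line_velocity_at: "((\<lambda>t. Ad (t *\<^sub>R x) Y) has_vector_derivative br x (Ad (t *\<^sub>R x) Y)) (at t)"
proof (rule has_vector_derivative_shift[THEN iffD1])
  have "Ad ((t + e) *\<^sub>R x) Y = Ad (e *\<^sub>R x) (Ad (t *\<^sub>R x) Y)" for e
    using Ad_line[of e t] by (simp add: add.commute)
  then show "((\<lambda>e. Ad ((t + e) *\<^sub>R x) Y) has_vector_derivative br x (Ad (t *\<^sub>R x) Y)) (at 0)"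
    using Ad_line_velocity[of x "Ad (t *\<^sub>R x) Y"] by simp
qed

text \<open>Product rule for a moving operator applied to a moving vector; the basis expansion
  reduces it to scalar coefficients times curves with a fixed argument.\<close>

lemma Ad_pair_velocity:
  assumes "(w has_vector_derivative w') (at 0)"
  shows "((\<lambda>t. Ad (t *\<^sub>R x) (w t)) has_vector_derivative br x (w 0) + w') (at 0)"
proof -
  have eq: "Ad (t *\<^sub>R x) (w t) = (\<Sum>b\<in>Basis. (w t \<bullet> b) *\<^sub>R Ad (t *\<^sub>R x) b)" for t
  proof -
    have "Ad (t *\<^sub>R x) (w t) = Ad (t *\<^sub>R x) (\<Sum>b\<in>Basis. (w t \<bullet> b) *\<^sub>R b)"
      by (simp add: euclidean_representation)
    then show ?thesis by (simp add: linear_sum[OF linear_Ad] linear_cmul[OF linear_Ad])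
  qed
  have br_eq: "br x (w 0) = (\<Sum>b\<in>Basis. (w 0 \<bullet> b) *\<^sub>R br x b)"
  proof -
    have "br x (w 0) = br x (\<Sum>b\<in>Basis. (w 0 \<bullet> b) *\<^sub>R b)"
      by (simp add: euclidean_representation)
    then show ?thesis by (simp add: linear_sum[OF linear_br_right] linear_cmul[OF linear_br_right])
  qed
  have c: "((\<lambda>t. w t \<bullet> b) has_field_derivative w' \<bullet> b) (at 0)" for b
    unfolding has_real_derivative_iff_has_vector_derivative
    by (rule bounded_linear.has_vector_derivative[OF bounded_linear_inner_left assms])
  have "((\<lambda>t. \<Sum>b\<in>Basis. (w t \<bullet> b) *\<^sub>R Ad (t *\<^sub>R x) b) has_vector_derivative
    (\<Sum>b\<in>Basis. (w 0 \<bullet> b) *\<^sub>R br x b + (w' \<bullet> b) *\<^sub>R Ad (0 *\<^sub>R x) b)) (at 0)"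
    by (intro has_vector_derivative_sum has_vector_derivative_scaleR c Ad_line_velocity)
  then show ?thesis
    by (simp add: eq br_eq sum.distrib euclidean_representation)
qed

text \<open>The left logarithmic derivative of \<open>e \<mapsto> t (x + e Y)\<close>; its \<open>t\<close>-derivative is \<open>Ad (- t x) Y\<close>,
  so it is determined by the Lie algebra. This replaces the Baker-Campbell-Hausdorff formula.\<close>

definition K :: "'a \<Rightarrow> 'a \<Rightarrow> real \<Rightarrow> 'a" where "K x Y t = L (t *\<^sub>R x) (t *\<^sub>R Y)"

lemma L_velocity:
  assumes "(c has_vector_derivative v) (at t)"
  shows "((\<lambda>s. - c t \<odot> c s) has_vector_derivative L (c t) v) (at t)"
  using gmul_vector_derivative[of "\<lambda>_. - c t" 0 t c v] assms by (simp add: L_def)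

lemma K_velocity: "((\<lambda>e. - (t *\<^sub>R x) \<odot> t *\<^sub>R (x + e *\<^sub>R Y)) has_vector_derivative K x Y t) (at 0)"
proof -
  have "((\<lambda>e. t *\<^sub>R (x + e *\<^sub>R Y)) has_vector_derivative t *\<^sub>R Y) (at 0)"
    by (auto intro!: derivative_eq_intros simp: has_vector_derivative_def algebra_simps)
  from L_velocity[OF this] show ?thesis by (simp add: K_def)
qed

lemma product_velocity_0:
  assumes "(c has_vector_derivative v) (at t)" "(d has_vector_derivative w) (at t)" "c t = 0" "d t = 0"
  shows "((\<lambda>s. c s \<odot> d s) has_vector_derivative v + w) (at t)"
  using gmul_vector_derivative[OF assms(1,2)] assms(3,4) by (simp add: Dg_00)

text \<open>Cocycle rule for left logarithmic derivatives: on a line \<open>(s + t) z\<close> is the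
  product of \<open>s z\<close> and \<open>t z\<close>, and the contribution of the first factor is
  conjugated past the second.\<close>

lemma K_add: "K x Y (s + t) = Ad (- (t *\<^sub>R x)) (K x Y s) + K x Y t"
proof -
  let ?k = "\<lambda>t e. - (t *\<^sub>R x) \<odot> t *\<^sub>R (x + e *\<^sub>R Y)"
  have "((\<lambda>e. - (t *\<^sub>R x) \<odot> ?k s e \<odot> - (- (t *\<^sub>R x))) has_vector_derivative Ad (- (t *\<^sub>R x)) (K x Y s)) (at 0)"
    by (rule Ad_velocity[OF K_velocity]) simp
  from product_velocity_0[OF this K_velocity]
  have "((\<lambda>e. - (t *\<^sub>R x) \<odot> ?k s e \<odot> (t *\<^sub>R x) \<odot> ?k t e) has_vector_derivative
      Ad (- (t *\<^sub>R x)) (K x Y s) + K x Y t) (at 0)"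
    by simp
  moreover have "- (t *\<^sub>R x) \<odot> ?k s e \<odot> (t *\<^sub>R x) \<odot> ?k t e = ?k (s + t) e" for e
  proof -
    have "- (t *\<^sub>R x) \<odot> ?k s e \<odot> (t *\<^sub>R x) \<odot> ?k t e
      = - (t *\<^sub>R x) \<odot> - (s *\<^sub>R x) \<odot> (s *\<^sub>R (x + e *\<^sub>R Y) \<odot> t *\<^sub>R (x + e *\<^sub>R Y))"
      by (simp only: gassoc ginv_cancel)
    also have "- (t *\<^sub>R x) \<odot> - (s *\<^sub>R x) = - ((s + t) *\<^sub>R x)"
      by (simp only: ginv_mult[symmetric] gline)
    finally show ?thesis by (simp only: gline)
  qed
  ultimately have "((\<lambda>e. ?k (s + t) e) has_vector_derivative
      Ad (- (t *\<^sub>R x)) (K x Y s) + K x Y t) (at 0)"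
    by (simp only:)
  from vector_derivative_unique_at[OF K_velocity this] show ?thesis .
qed

lemma K_has_derivative_0: "(K x Y has_vector_derivative Y) (at 0)"
proof -
  let ?h = "\<lambda>t. L (t *\<^sub>R x) Y"
  have "?h differentiable at (0::real)"
    by (intro L_differentiable) auto
  then have "(?h has_vector_derivative vector_derivative ?h (at 0)) (at 0)"
    using vector_derivative_works by blast
  from has_vector_derivative_scaleR[OF DERIV_ident this]
  have "((\<lambda>t. t *\<^sub>R L (t *\<^sub>R x) Y) has_vector_derivative L 0 Y) (at 0)" by simp
  moreover have "K x Y = (\<lambda>t. t *\<^sub>R L (t *\<^sub>R x) Y)"
    unfolding K_def by (auto simp: linear_cmul[OF linear_L])
  moreover have "L 0 Y = Y" by (simp add: L_def Dg_00)
  ultimately show ?thesis by simp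
qed

lemma K_has_derivative: "(K x Y has_vector_derivative Ad (- (t *\<^sub>R x)) Y) (at t)"
proof -
  have "bounded_linear (Ad (- (t *\<^sub>R x)))" using linear_Ad linear_linear by blast
  from bounded_linear.has_vector_derivative[OF this K_has_derivative_0]
  have "((\<lambda>s. Ad (- (t *\<^sub>R x)) (K x Y s) + K x Y t) has_vector_derivative Ad (- (t *\<^sub>R x)) Y) (at 0)"
    by (auto intro!: derivative_eq_intros)
  moreover have "K x Y (t + e) = Ad (- (t *\<^sub>R x)) (K x Y e) + K x Y t" for e
    using K_add[of x Y e t] by (simp add: add.commute)
  ultimately show ?thesis
    by (subst has_vector_derivative_shift[symmetric]) simp
qed

lemma constant_if_derivative_0:
  fixes f :: "real \<Rightarrow> 'b::real_normed_vector"
  assumes "\<And>t. (f has_vector_derivative 0) (at t)"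
  shows "f s = f t"
proof -
  have "(f has_derivative (\<lambda>_. 0)) (at t within UNIV)" for t
    using assms[of t] by (simp add: has_vector_derivative_def)
  from has_derivative_zero_constant[OF convex_UNIV this] obtain c where "\<forall>x. f x = c" by auto
  then show ?thesis by simp
qed

text \<open>Both sides satisfy the same linear flow equation. In place of a uniqueness theorem, the
  curve \<open>t \<mapsto> T (Ad (t *\<^sub>R x) Y)\<close> is undone by
  \<open>Ad (t *\<^sub>R - T x)\<close>, and the result has zero derivative.\<close>

lemma morphism_Ad:
  assumes T: "linear T" and br: "\<And>x y. T (br x y) = br (T x) (T y)"
  shows "T (Ad x Y) = Ad (T x) (T Y)"
proof -
  let ?w = "\<lambda>t. T (Ad (t *\<^sub>R x) Y)"
  have bl: "bounded_linear T" using T linear_linear by blast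
  let ?N = "\<lambda>t. Ad (t *\<^sub>R - T x) (?w t)"
  have "(?N has_vector_derivative 0) (at t)" for t
  proof -
    have "(?w has_vector_derivative br (T x) (?w t)) (at t)"
      using bounded_linear.has_vector_derivative[OF bl Ad_line_velocity_at] by (simp add: br)
    then have "((\<lambda>e. ?w (t + e)) has_vector_derivative br (T x) (?w t)) (at 0)"
      by (rule has_vector_derivative_shift[THEN iffD2])
    from Ad_pair_velocity[OF this, of "- T x"]
    have "((\<lambda>e. Ad (e *\<^sub>R - T x) (?w (t + e))) has_vector_derivative 0) (at 0)"
      by (simp add: linear_neg[OF linear_br_left])
    moreover have "bounded_linear (Ad (t *\<^sub>R - T x))" using linear_Ad linear_linear by blast
    ultimately have "((\<lambda>e. Ad (t *\<^sub>R - T x) (Ad (e *\<^sub>R - T x) (?w (t + e)))) has_vector_derivative Ad (t *\<^sub>R - T x) 0) (at 0)"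
      using bounded_linear.has_vector_derivative by blast
    then have "((\<lambda>e. ?N (t + e)) has_vector_derivative 0) (at 0)"
      using linear_0[OF linear_Ad] by (simp only: Ad_line)
    then show ?thesis by (rule has_vector_derivative_shift[THEN iffD1])
  qed
  from constant_if_derivative_0[OF this, of 1 0] have "Ad (- T x) (T (Ad x Y)) = T Y" by simp
  then show ?thesis using Ad_inv by metis
qed

text \<open>The velocity of \<open>K x Y\<close> is \<open>Ad (- (t *\<^sub>R x)) Y\<close>, which
  \<open>T\<close> intertwines by \<open>morphism_Ad\<close>. Both sides vanish at time 0, and time
  1 is the claim.\<close>

lemma morphism_L:
  assumes T: "linear T" and br: "\<And>x y. T (br x y) = br (T x) (T y)"
  shows "T (L x Y) = L (T x) (T Y)"
proof -
  have bl: "bounded_linear T" using T linear_linear by blast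
  let ?f = "\<lambda>t. T (K x Y t) - K (T x) (T Y) t"
  have "(?f has_vector_derivative T (Ad (- (t *\<^sub>R x)) Y) - Ad (- (t *\<^sub>R T x)) (T Y)) (at t)" for t
    by (intro has_vector_derivative_diff bounded_linear.has_vector_derivative[OF bl] K_has_derivative)
  then have "(?f has_vector_derivative 0) (at t)" for t
    by (simp add: morphism_Ad[OF assms] linear_neg[OF T] linear_cmul[OF T])
  from constant_if_derivative_0[OF this, of 1 0] show ?thesis
    using linear_0[OF linear_L] by (simp add: K_def linear_0[OF T])
qed

text \<open>The curve \<open>x \<odot> t *\<^sub>R y\<close> has constant left logarithmic
  derivative \<open>y\<close>. By \<open>morphism_L\<close> its image under \<open>T\<close> has
  left logarithmic derivative \<open>T y\<close>, so multiplying the image on the right by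
  \<open>t *\<^sub>R - T y\<close> makes it constant.\<close>

lemma morphism_mult:
  assumes T: "linear T" and br: "\<And>x y. T (br x y) = br (T x) (T y)"
  shows "T (x \<odot> y) = T x \<odot> T y"
proof -
  have bl: "bounded_linear T" using T linear_linear by blast
  let ?z = "\<lambda>t. x \<odot> t *\<^sub>R y"
  let ?c = "\<lambda>t. T (?z t)"
  let ?h = "\<lambda>t. ?c t \<odot> t *\<^sub>R - T y"
  have "(?h has_vector_derivative 0) (at t)" for t
  proof -
    have z: "(?z has_vector_derivative Dg (x, t *\<^sub>R y) (0, y)) (at t)" (is "(_ has_vector_derivative ?z') _")
      by (intro gmul_vector_derivative line_velocity) auto
    have "L (?z t) ?z' = y"
    proof (rule vector_derivative_unique_at[OF L_velocity[OF z]])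
      have "- ?z t \<odot> ?z s = (s - t) *\<^sub>R y" for s
        using gline[of "- t" y s] by (simp add: ginv_mult gassoc)
      moreover have "((\<lambda>s. (s - t) *\<^sub>R y) has_vector_derivative y) (at t)"
        by (auto intro!: derivative_eq_intros simp: has_vector_derivative_def algebra_simps)
      ultimately show "((\<lambda>s. - ?z t \<odot> ?z s) has_vector_derivative y) (at t)"
        by simp
    qed
    moreover have c: "(?c has_vector_derivative T ?z') (at t)"
      using bounded_linear.has_vector_derivative[OF bl z] .
    ultimately have l: "((\<lambda>s. - ?c t \<odot> ?c s) has_vector_derivative T y) (at t)"
      using L_velocity[OF c] by (simp add: morphism_L[OF assms, symmetric])
    have "((\<lambda>s. (s - t) *\<^sub>R - T y) has_vector_derivative - T y) (at t)"
      by (auto intro!: derivative_eq_intros simp: has_vector_derivative_def algebra_simps)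
    from product_velocity_0[OF l this]
    have "((\<lambda>s. - ?c t \<odot> ?c s \<odot> (s - t) *\<^sub>R - T y) has_vector_derivative 0) (at t)"
      by simp
    from gmul_vector_derivative[OF has_vector_derivative_const[of "?c t"] gmul_vector_derivative[OF this has_vector_derivative_const[of "t *\<^sub>R - T y"]]]
    have "((\<lambda>s. ?c t \<odot> (- ?c t \<odot> ?c s \<odot> (s - t) *\<^sub>R - T y \<odot> t *\<^sub>R - T y)) has_vector_derivative 0) (at t)"
      using linear_0[OF linear_Dg] by (simp flip: zero_prod_def)
    moreover have "?c t \<odot> (- ?c t \<odot> ?c s \<odot> (s - t) *\<^sub>R - T y \<odot> t *\<^sub>R - T y) = ?h s" for s
      using gline[of "s - t" "- T y" t] by (simp add: gassoc)
    ultimately show ?thesis by simp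
  qed
  from constant_if_derivative_0[OF this, of 1 0]
  have "T (x \<odot> y) \<odot> - T y = T x" by simp
  then show ?thesis by (metis ginv_cancel2(2))
qed

end

section \<open>Polynomiality of the group law\<close>

text \<open>Kept independent of the group so that the same dilation can act on pairs, when the
  product is regarded as a function on \<open>'a \<times> 'a\<close>.\<close>

definition wdil :: "nat \<Rightarrow> (nat \<Rightarrow> 'c::real_vector \<Rightarrow> 'c) \<Rightarrow> real \<Rightarrow> 'c \<Rightarrow> 'c" where
  "wdil r Q l x = (\<Sum>j=1..r. l ^ j *\<^sub>R Q j x)"

text \<open>Taylor's formula in disguise: derivatives of too high weight are homogeneous of negative
  degree and continuous at 0, hence vanish; the rest is Euler's identity.\<close>

lemma homogeneous_smooth_imp_polynomial:
  fixes f :: "'c::euclidean_space \<Rightarrow> real" and Q :: "nat \<Rightarrow> 'c \<Rightarrow> 'c"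
  assumes lin: "\<And>j. j \<in> {1..r} \<Longrightarrow> linear (Q j)"
    and dec: "\<And>x. (\<Sum>j=1..r. Q j x) = x"
    and dil: "\<And>i l x. i \<in> {1..r} \<Longrightarrow> wdil r Q l (Q i x) = l ^ i *\<^sub>R Q i x"
    and "smooth_fun f" "\<And>l x. l > 0 \<Longrightarrow> f (wdil r Q l x) = l ^ k * f x"
  shows "real_polynomial_function f"
  using assms(4,5)
proof (induction k arbitrary: f rule: less_induct)
  case (less k)
  let ?d = "wdil r Q"
  define f' where "f' z = frechet_derivative f (at z)" for z
  have f': "(f has_derivative f' z) (at z)" for z
    using smooth_fun_differentiable[OF less.prems(1)] frechet_derivative_works unfolding f'_def by blast
  have lf': "linear (f' z)" for z using f' has_derivative_linear by blast
  have ld: "linear (?d l)" for l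
    unfolding wdil_def by (intro linear_compose_sum ballI linear_compose_scale_right lin)
  have d_lim: "((\<lambda>l. ?d l z) \<longlongrightarrow> 0) (at_right 0)" for z
  proof -
    have "continuous_on UNIV (\<lambda>l. ?d l z)" unfolding wdil_def by (intro continuous_intros)
    then have "isCont (\<lambda>l. ?d l z) 0" by (simp add: continuous_on_eq_continuous_at)
    then have "((\<lambda>l. ?d l z) \<longlongrightarrow> ?d 0 z) (at_right 0)"
      by (simp add: isCont_def filterlim_at_split)
    moreover have "?d 0 z = 0" unfolding wdil_def by (intro sum.neutral) auto
    ultimately show ?thesis by simp
  qed
  have cont_lim: "((\<lambda>l. g (?d l z)) \<longlongrightarrow> g 0) (at_right 0)" if "smooth_fun g" for g :: "'c \<Rightarrow> real" and z
    by (rule continuous_on_tendsto_compose[OF smooth_fun_continuous[OF that, of UNIV] d_lim]) auto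
  show ?case
  proof (cases "k = 0")
    case True
    have "f z = f 0" for z
    proof (rule tendsto_unique[OF _ _ cont_lim[OF less.prems(1)]])
      have "eventually (\<lambda>l. f (?d l z) = f z) (at_right 0)"
        by (rule eventually_mono[OF eventually_at_right_less]) (simp add: less.prems(2) True)
      then show "((\<lambda>l. f (?d l z)) \<longlongrightarrow> f z) (at_right 0)" by (rule tendsto_eventually)
    qed simp
    then have "f = (\<lambda>_. f 0)" by blast
    then show ?thesis by (metis real_polynomial_function.intros(2))
  next
    case False
    \<comment> \<open>Differentiating the homogeneity relation: the derivative in a direction of
      weight \<open>i\<close> is homogeneous of degree \<open>k - i\<close>, which feeds the
      induction if \<open>i \<le> k\<close>.\<close>
    have scale: "f' (?d l z) (?d l w) = l ^ k * f' z w" if "l > 0" for l z w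
    proof -
      have "(?d l has_derivative ?d l) (at z)" using ld linear_imp_has_derivative by blast
      from has_derivative_compose[OF this f']
      have "((\<lambda>z. f (?d l z)) has_derivative (\<lambda>w. f' (?d l z) (?d l w))) (at z)" .
      moreover have "((\<lambda>z. f (?d l z)) has_derivative (\<lambda>w. l ^ k * f' z w)) (at z)"
        using less.prems(2)[OF that] has_derivative_mult_right[OF f'] by simp
      ultimately show ?thesis using has_derivative_unique by metis
    qed
    have part: "real_polynomial_function (\<lambda>z. f' z (Q i b))" if i: "i \<in> {1..r}" for i b
    proof -
      let ?g = "\<lambda>z. f' z (Q i b)"
      have sm: "smooth_fun ?g" unfolding f'_def by (rule smooth_fun_frechet[OF less.prems(1)])
      have sc: "l ^ i * ?g (?d l z) = l ^ k * ?g z" if "l > 0" for l z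
        using scale[OF that, of z "Q i b"] dil[OF i] by (simp add: linear_cmul[OF lf'])
      show ?thesis
      proof (cases "i \<le> k")
        case True
        have "?g (?d l z) = l ^ (k - i) * ?g z" if "l > 0" for l z
        proof -
          have "l ^ k = l ^ i * l ^ (k - i)" using True by (simp flip: power_add)
          then show ?thesis using sc[OF that, of z] that by (simp add: mult.assoc)
        qed
        then show ?thesis using less.IH[of "k - i" ?g] sm i False by simp
      next
        case F: False
        have "?g z = 0" for z
        proof (rule tendsto_unique[of "at_right (0::real)"])
          have "((\<lambda>l::real. l ^ (i - k)) \<longlongrightarrow> 0 ^ (i - k)) (at_right 0)"
            by (intro tendsto_intros)
          from tendsto_mult[OF this cont_lim[OF sm, of z]] have "((\<lambda>l. l ^ (i - k) * ?g (?d l z)) \<longlongrightarrow> 0 ^ (i - k) * ?g 0) (at_right 0)" .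
          moreover have "0 ^ (i - k) = (0::real)" using F by simp
          ultimately show "((\<lambda>l. l ^ (i - k) * ?g (?d l z)) \<longlongrightarrow> 0) (at_right 0)"
            by (simp only: mult_zero_left)
          have "l ^ (i - k) * ?g (?d l z) = ?g z" if "l > 0" for l
          proof -
            have "l ^ i = l ^ k * l ^ (i - k)" using F by (simp flip: power_add)
            then show ?thesis using sc[OF that, of z] that by (simp add: mult.assoc)
          qed
          then have "eventually (\<lambda>l. l ^ (i - k) * ?g (?d l z) = ?g z) (at_right 0)"
            by (rule eventually_mono[OF eventually_at_right_less])
          then show "((\<lambda>l. l ^ (i - k) * ?g (?d l z)) \<longlongrightarrow> ?g z) (at_right 0)"
            by (rule tendsto_eventually)
        qed simp
        then show ?thesis by (simp add: real_polynomial_function.intros(2))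
      qed
    qed
    have euler: "real k * f z = (\<Sum>i=1..r. real i * f' z (Q i z))" for z
    proof -
      have "((\<lambda>l. ?d l z) has_vector_derivative (\<Sum>i=1..r. real i *\<^sub>R Q i z)) (at 1)"
        unfolding wdil_def
        by (auto intro!: derivative_eq_intros simp: has_vector_derivative_def scaleR_sum_right sum_distrib_left mult_ac)
      then have "((\<lambda>l. ?d l z) has_derivative (\<lambda>h. h *\<^sub>R (\<Sum>i=1..r. real i *\<^sub>R Q i z))) (at 1)"
        by (simp add: has_vector_derivative_def)
      moreover have "?d 1 z = z" unfolding wdil_def using dec[of z] by simp
      ultimately have "((\<lambda>l. f (?d l z)) has_derivative (\<lambda>h. f' z (h *\<^sub>R (\<Sum>i=1..r. real i *\<^sub>R Q i z)))) (at 1)"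
        using has_derivative_compose[of "\<lambda>l. ?d l z" _ 1 UNIV f "f' z"] f' by simp
      then have "((\<lambda>l. f (?d l z)) has_real_derivative (\<Sum>i=1..r. real i * f' z (Q i z))) (at 1)"
        by (simp add: has_field_derivative_def linear_cmul[OF lf'] linear_sum[OF lf'] mult.commute[of _ "sum _ _"])
      moreover have "((\<lambda>l. f (?d l z)) has_real_derivative real k * f z) (at 1)"
      proof (rule DERIV_cong_ev[THEN iffD1])
        show "((\<lambda>l. l ^ k * f z) has_real_derivative real k * f z) (at 1)"
          by (auto intro!: derivative_eq_intros)
        have "eventually (\<lambda>l::real. l > 0) (nhds 1)"
          using eventually_nhds_in_open[of "{0<..}" "1::real"] by simp
        then show "\<forall>\<^sub>F l in nhds 1. l ^ k * f z = f (?d l z)"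
          by (rule eventually_mono) (simp add: less.prems(2))
      qed simp_all
      ultimately show ?thesis using DERIV_unique by blast
    qed
    have "f' z (Q i z) = (\<Sum>b\<in>Basis. (z \<bullet> b) * f' z (Q i b))" if "i \<in> {1..r}" for z i
    proof -
      have "f' z (Q i z) = f' z (Q i (\<Sum>b\<in>Basis. (z \<bullet> b) *\<^sub>R b))"
        by (simp add: euclidean_representation)
      then show ?thesis
        by (simp add: linear_sum[OF lf'] linear_cmul[OF lf'] linear_sum[OF lin[OF that]] linear_cmul[OF lin[OF that]])
    qed
    then have "f z = (1 / real k) * (\<Sum>i=1..r. real i * (\<Sum>b\<in>Basis. (z \<bullet> b) * f' z (Q i b)))" for z
      using euler[of z] False by (simp add: field_simps)
    then have "f = (\<lambda>z. (1 / real k) * (\<Sum>i=1..r. real i * (\<Sum>b\<in>Basis. (z \<bullet> b) * f' z (Q i b))))"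
      by blast
    moreover have "real_polynomial_function (\<lambda>z. (1 / real k) * (\<Sum>i=1..r. real i * (\<Sum>b\<in>Basis. (z \<bullet> b) * f' z (Q i b))))"
      by (intro real_polynomial_function.intros(4) real_polynomial_function.intros(2) real_polynomial_function_sum
          real_polynomial_function.intros(1) part bounded_linear_inner_left) auto
    ultimately show ?thesis by simp
  qed
qed

section \<open>Layers, dilations and homogeneity of the product\<close>

context strat_group begin

lemma r_ge1: "1 \<le> r" using G by (simp add: stratified_group_def)
lemma V_subspace: "j \<in> {1..r} \<Longrightarrow> subspace (V j)" using G by (simp add: stratified_group_def)
lemma P_sum: "(\<Sum>j=1..r. P j x) = x" using G unfolding stratified_group_def by metis
lemma P_sum' [simp]: "(\<Sum>j=Suc 0..r. P j x) = x" using P_sum by simp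
lemma P_in_V: "j \<in> {1..r} \<Longrightarrow> P j x \<in> V j"
proof -
  assume j: "j \<in> {1..r}"
  have "\<forall>x. x = (\<Sum>j=1..r. P j x) \<and> (\<forall>j\<in>{1..r}. P j x \<in> V j)"
    using G unfolding stratified_group_def by (elim conjE) assumption
  from spec[OF this, of x] j show ?thesis by blast
qed
lemma V_direct: "(\<And>j. j \<in> {1..r} \<Longrightarrow> y j \<in> V j) \<Longrightarrow> (\<Sum>j=1..r. y j) = 0 \<Longrightarrow> j \<in> {1..r} \<Longrightarrow> y j = 0"
proof -
  assume a: "\<And>j. j \<in> {1..r} \<Longrightarrow> y j \<in> V j" "(\<Sum>j=1..r. y j) = 0" "j \<in> {1..r}"
  have "\<forall>y. (\<forall>j\<in>{1..r}. y j \<in> V j) \<and> (\<Sum>j=1..r. y j) = 0 \<longrightarrow> (\<forall>j\<in>{1..r}. y j = 0)"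
    using G unfolding stratified_group_def by (elim conjE) assumption
  from spec[OF this, of y] a show ?thesis by blast
qed
lemma br_in_V: "i \<in> {1..r} \<Longrightarrow> j \<in> {1..r} \<Longrightarrow> x \<in> V i \<Longrightarrow> y \<in> V j \<Longrightarrow>
    br x y \<in> (if i + j \<le> r then V (i + j) else {0})"
proof -
  assume a: "i \<in> {1..r}" "j \<in> {1..r}" "x \<in> V i" "y \<in> V j"
  have "\<forall>i\<in>{1..r}. \<forall>j\<in>{1..r}. \<forall>x\<in>V i. \<forall>y\<in>V j. br x y \<in> (if i + j \<le> r then V (i + j) else {0})"
    using G unfolding stratified_group_def by (elim conjE) assumption
  from bspec[OF bspec[OF bspec[OF bspec[OF this a(1)] a(2)] a(3)] a(4)] show ?thesis .
qed
lemma V1_generates: "subspace W \<Longrightarrow> V 1 \<subseteq> W \<Longrightarrow> (\<And>x y. x \<in> W \<Longrightarrow> y \<in> W \<Longrightarrow> br x y \<in> W) \<Longrightarrow> W = UNIV"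
proof -
  assume a: "subspace W" "V 1 \<subseteq> W" "\<And>x y. x \<in> W \<Longrightarrow> y \<in> W \<Longrightarrow> br x y \<in> W"
  have "\<forall>W. subspace W \<and> V 1 \<subseteq> W \<and> (\<forall>x\<in>W. \<forall>y\<in>W. br x y \<in> W) \<longrightarrow> W = UNIV"
    using G unfolding stratified_group_def by (elim conjE) assumption
  from spec[OF this, of W] a show ?thesis by blast
qed

lemma P_unique:
  assumes "\<And>j. j \<in> {1..r} \<Longrightarrow> y j \<in> V j" "(\<Sum>j=1..r. y j) = x" "j \<in> {1..r}"
  shows "P j x = y j"
proof -
  have "P j x - y j = 0"
    by (rule V_direct[of "\<lambda>j. P j x - y j"])
      (use assms in \<open>auto simp: sum_subtractf P_sum intro!: subspace_diff V_subspace P_in_V\<close>)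
  then show ?thesis by simp
qed

lemma P_linear: assumes "j \<in> {1..r}" shows "linear (P j)"
proof (rule linearI)
  fix x y c
  show "P j (x + y) = P j x + P j y"
    by (rule P_unique[of "\<lambda>j. P j x + P j y"])
      (use assms in \<open>auto simp: sum.distrib P_sum intro!: subspace_add V_subspace P_in_V\<close>)
  show "P j (c *\<^sub>R x) = c *\<^sub>R P j x"
    by (rule P_unique[of "\<lambda>j. c *\<^sub>R P j x"])
      (use assms in \<open>auto simp: scaleR_sum_right[symmetric] P_sum intro!: subspace_scale V_subspace P_in_V\<close>)
qed

lemma P_V:
  assumes "i \<in> {1..r}" "j \<in> {1..r}" "v \<in> V i"
  shows "P j v = (if j = i then v else 0)"
  by (rule P_unique[of "\<lambda>j. if j = i then v else 0"])
    (use assms in \<open>auto simp: intro!: subspace_0 V_subspace\<close>)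

abbreviation \<delta> :: "real \<Rightarrow> 'a \<Rightarrow> 'a" where "\<delta> \<equiv> wdil r P"

lemma linear_\<delta>: "linear (\<delta> l)"
  unfolding wdil_def by (intro linear_compose_sum ballI linear_compose_scale_right P_linear) auto

lemma \<delta>_V: assumes "i \<in> {1..r}" "v \<in> V i" shows "\<delta> l v = l ^ i *\<^sub>R v"
proof -
  have "\<delta> l v = (\<Sum>j=1..r. if j = i then l ^ i *\<^sub>R v else 0)"
    unfolding wdil_def by (rule sum.cong) (use assms P_V in auto)
  then show ?thesis using assms by simp
qed

lemma P_\<delta>: assumes "j \<in> {1..r}" shows "P j (\<delta> l x) = l ^ j *\<^sub>R P j x"
  by (rule P_unique[of "\<lambda>j. l ^ j *\<^sub>R P j x"])
    (use assms in \<open>auto simp: wdil_def intro!: subspace_scale V_subspace P_in_V\<close>)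

lemma \<delta>_1 [simp]: "\<delta> 1 x = x" by (simp add: wdil_def P_sum)
lemma \<delta>_0 [simp]: "\<delta> l 0 = 0" using linear_0[OF linear_\<delta>] .
lemma \<delta>_at_0 [simp]: "\<delta> 0 x = 0"
  unfolding wdil_def by (rule sum.neutral) auto
lemma \<delta>_\<delta>: "\<delta> l (\<delta> k x) = \<delta> (l * k) x"
proof -
  have "\<delta> l (\<delta> k x) = (\<Sum>j=1..r. l ^ j *\<^sub>R P j (\<delta> k x))" by (simp add: wdil_def)
  also have "\<dots> = \<delta> (l * k) x"
    unfolding wdil_def[of r P "l * k"]
    by (rule sum.cong) (auto simp: P_\<delta> power_mult_distrib)
  finally show ?thesis .
qed

text \<open>By bilinearity it suffices to take arguments in layers \<open>i\<close> and
  \<open>j\<close>. There both sides scale by \<open>l ^ (i + j)\<close>, and the bracket is 0 if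
  \<open>i + j > r\<close>.\<close>

lemma \<delta>_br: "\<delta> l (br x y) = br (\<delta> l x) (\<delta> l y)"
proof -
  have expand: "br (\<Sum>i=1..r. f i) (\<Sum>j=1..r. g j) = (\<Sum>i=1..r. \<Sum>j=1..r. br (f i) (g j))" for f g
  proof -
    have "br (\<Sum>i=1..r. f i) (\<Sum>j=1..r. g j) = (\<Sum>i=1..r. br (f i) (\<Sum>j=1..r. g j))"
      by (rule linear_sum[OF linear_br_left])
    then show ?thesis by (simp only: linear_sum[OF linear_br_right])
  qed
  have "\<delta> l (br (P i x) (P j y)) = br (l ^ i *\<^sub>R P i x) (l ^ j *\<^sub>R P j y)" if "i \<in> {1..r}" "j \<in> {1..r}" for i j
  proof -
    have b: "br (P i x) (P j y) \<in> (if i + j \<le> r then V (i + j) else {0})"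
      by (intro br_in_V P_in_V that)
    have "\<delta> l (br (P i x) (P j y)) = l ^ (i + j) *\<^sub>R br (P i x) (P j y)"
    proof (cases "i + j \<le> r")
      case True
      then show ?thesis using b that by (intro \<delta>_V) auto
    next
      case False
      then show ?thesis using b by simp
    qed
    then show ?thesis
      using linear_cmul[OF linear_br_left] linear_cmul[OF linear_br_right]
      by (simp add: power_add mult.commute)
  qed
  then have "\<delta> l (br (\<Sum>i=1..r. P i x) (\<Sum>j=1..r. P j y)) = br (\<Sum>i=1..r. l ^ i *\<^sub>R P i x) (\<Sum>j=1..r. l ^ j *\<^sub>R P j y)"
    unfolding expand by (simp add: linear_sum[OF linear_\<delta>])
  then show ?thesis by (simp only: P_sum wdil_def[symmetric])
qed

lemma \<delta>_mult: "\<delta> l (x \<odot> y) = \<delta> l x \<odot> \<delta> l y"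
  by (rule morphism_mult[OF linear_\<delta> \<delta>_br])

text \<open>Because dilations are automorphisms, the layer \<open>P j\<close> of the product is
  homogeneous of degree \<open>j\<close> under simultaneous dilation of both factors.\<close>

lemma gmul_polynomial: "polynomial_function (\<lambda>z. fst z \<odot> snd z)"
  unfolding polynomial_function_iff_Basis_inner
proof
  fix b :: 'a assume b: "b \<in> Basis"
  let ?Q = "\<lambda>j z. (P j (fst z), P j (snd z))"
  have Q: "wdil r ?Q l z = (\<delta> l (fst z), \<delta> l (snd z))" for l z
    by (simp add: wdil_def prod_eq_iff fst_sum snd_sum)
  have "real_polynomial_function (\<lambda>z. P j (fst z \<odot> snd z) \<bullet> b)" if j: "j \<in> {1..r}" for j
  proof (rule homogeneous_smooth_imp_polynomial[where Q="?Q" and r=r and k=j])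
    show "linear (?Q i)" if "i \<in> {1..r}" for i
      using P_linear[OF that] by (simp add: linear_iff)
    show "(\<Sum>j=1..r. ?Q j z) = z" for z
      by (simp add: prod_eq_iff fst_sum snd_sum P_sum)
    show "wdil r ?Q l (?Q i z) = l ^ i *\<^sub>R ?Q i z" if "i \<in> {1..r}" for i l z
      using \<delta>_V[OF that P_in_V[OF that]] by (simp add: Q)
    show "P j (fst (wdil r ?Q l z) \<odot> snd (wdil r ?Q l z)) \<bullet> b = l ^ j * (P j (fst z \<odot> snd z) \<bullet> b)" for l z
      using P_\<delta>[OF j] by (simp add: Q flip: \<delta>_mult)
    have "P j w \<bullet> b = (\<Sum>c\<in>Basis. (P j c \<bullet> b) * (w \<bullet> c))" for w
    proof -
      have "P j w \<bullet> b = P j (\<Sum>c\<in>Basis. (w \<bullet> c) *\<^sub>R c) \<bullet> b"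
        by (simp add: euclidean_representation)
      then show ?thesis
        by (simp add: linear_sum[OF P_linear[OF j]] linear_cmul[OF P_linear[OF j]] inner_sum_left mult.commute)
    qed
    then have "(\<lambda>z. P j (fst z \<odot> snd z) \<bullet> b) = (\<lambda>z. \<Sum>c\<in>Basis. (P j c \<bullet> b) * ((fst z \<odot> snd z) \<bullet> c))"
      by blast
    moreover have "smooth_fun (\<lambda>z. \<Sum>c\<in>Basis. (P j c \<bullet> b) * ((fst z \<odot> snd z) \<bullet> c))"
      by (intro smooth_fun_sum smooth_fun_cmul gmul_smooth finite_Basis)
    ultimately show "smooth_fun (\<lambda>z. P j (fst z \<odot> snd z) \<bullet> b)" by (simp only:)
  qed
  then have "real_polynomial_function (\<lambda>z. \<Sum>j=1..r. P j (fst z \<odot> snd z) \<bullet> b)"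
    by (intro real_polynomial_function_sum) auto
  then show "real_polynomial_function (\<lambda>z. (fst z \<odot> snd z) \<bullet> b)"
    by (simp flip: inner_sum_left add: P_sum)
qed

lemma polynomial_gmul:
  assumes "polynomial_function f" "polynomial_function h"
  shows "polynomial_function (\<lambda>x. f x \<odot> h x)"
proof -
  have "polynomial_function (\<lambda>x. (f x, h x))"
    using assms by (auto simp: polynomial_function_iff_Basis_inner Basis_prod_def)
  from polynomial_function_compose[OF this gmul_polynomial] show ?thesis by (simp add: o_def)
qed

text \<open>\<open>P 1 z\<close> is the velocity of \<open>l \<mapsto> \<delta> l z\<close> at
  \<open>l = 0\<close>, and at the identity the velocity of a product is the sum of the
  velocities.\<close>

lemma P1_mult: "P 1 (x \<odot> y) = P 1 x + P 1 y"
proof -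
  have 1: "1 \<in> {1..r}" using r_ge1 by simp
  have bl: "bounded_linear (P 1)" using P_linear[OF 1] linear_linear by blast
  have \<delta>': "((\<lambda>l. \<delta> l z) has_vector_derivative P 1 z) (at 0)" for z
  proof -
    have "((\<lambda>l. \<delta> l z) has_vector_derivative (\<Sum>j=1..r. (real j * 0 ^ (j - 1)) *\<^sub>R P j z)) (at 0)"
      unfolding wdil_def
      by (auto intro!: derivative_eq_intros simp: has_vector_derivative_def scaleR_sum_right sum_distrib_left mult_ac)
    also have "(\<Sum>j=1..r. (real j * 0 ^ (j - 1)) *\<^sub>R P j z) = (\<Sum>j=1..r. if j = 1 then P 1 z else 0)"
      by (rule sum.cong) (auto simp: power_0_left)
    also have "\<dots> = P 1 z" using 1 by simp
    finally show ?thesis .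
  qed
  have v: "((\<lambda>l. \<delta> l x \<odot> \<delta> l y) has_vector_derivative P 1 x + P 1 y) (at 0)"
    by (rule product_velocity_0[OF \<delta>' \<delta>' \<delta>_at_0 \<delta>_at_0])
  have "((\<lambda>l. P 1 (\<delta> l x \<odot> \<delta> l y)) has_vector_derivative P 1 x + P 1 y) (at 0)"
  proof -
    have "P 1 (P 1 z) = P 1 z" for z using P_V[OF 1 1 P_in_V[OF 1], of z] by simp
    then have "P 1 (P 1 x + P 1 y) = P 1 x + P 1 y" by (simp only: linear_add[OF P_linear[OF 1]])
    then show ?thesis using bounded_linear.has_vector_derivative[OF bl v] by (simp only:)
  qed
  moreover have "((\<lambda>l. P 1 (\<delta> l x \<odot> \<delta> l y)) has_vector_derivative P 1 (x \<odot> y)) (at 0)"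
    using line_velocity[of "P 1 (x \<odot> y)" 0]
    by (simp only: \<delta>_mult[symmetric] P_\<delta>[OF 1] power_one_right)
  ultimately show ?thesis by (metis vector_derivative_unique_at)
qed

end

section \<open>Jacobians and the area inequality\<close>

text \<open>An index type with \<open>DIM('a)\<close> elements, so that the change of variables theorems, which are stated for
  \<open>real^'n\<close>, apply to \<open>'a\<close>.\<close>

typedef (overloaded) ('a::euclidean_space) bas = "Basis :: 'a set"
  using nonempty_Basis by blast

lemma range_Rep_bas: "range (Rep_bas :: 'a::euclidean_space bas \<Rightarrow> 'a) = Basis"
  by (rule type_definition.Rep_range[OF type_definition_bas])

lemma inj_Rep_bas: "inj Rep_bas"
  by (simp add: inj_on_def Rep_bas_inject)

instance bas :: (euclidean_space) finite
  by standard (metis finite_Basis finite_imageD range_Rep_bas inj_Rep_bas)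

text \<open>Any injection will do; the order that it induces meets the class constraint of the
  change of variables theorem.\<close>

definition bas_key :: "'a::euclidean_space bas \<Rightarrow> nat" where
  "bas_key = (SOME f. inj f)"

lemma inj_bas_key: "inj (bas_key :: 'a::euclidean_space bas \<Rightarrow> nat)"
proof -
  have "\<exists>f :: 'a bas \<Rightarrow> nat. inj f"
    using finite_imp_inj_to_nat_seg[of "UNIV :: 'a bas set"] by auto
  then show ?thesis unfolding bas_key_def by (rule someI_ex)
qed

instantiation bas :: (euclidean_space) wellorder
begin
definition less_eq_bas :: "'a bas \<Rightarrow> 'a bas \<Rightarrow> bool" where "less_eq_bas x y \<longleftrightarrow> bas_key x \<le> bas_key y"
definition less_bas :: "'a bas \<Rightarrow> 'a bas \<Rightarrow> bool" where "less_bas x y \<longleftrightarrow> bas_key x < bas_key y"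
instance
proof
  fix x y :: "'a bas"
  show "x \<le> y \<Longrightarrow> y \<le> x \<Longrightarrow> x = y"
    using inj_bas_key by (auto simp: less_eq_bas_def inj_def)
next
  fix Q :: "'a bas \<Rightarrow> bool" and a :: "'a bas"
  assume "\<And>x. (\<And>y. y < x \<Longrightarrow> Q y) \<Longrightarrow> Q x"
  then show "Q a" unfolding less_bas_def by (rule measure_induct_rule)
qed (auto simp: less_eq_bas_def less_bas_def)
end

definition cart :: "'a::euclidean_space \<Rightarrow> real ^ 'a bas" where
  "cart x = (\<chi> i. x \<bullet> Rep_bas i)"
definition uncart :: "real ^ ('a::euclidean_space) bas \<Rightarrow> 'a" where
  "uncart v = (\<Sum>i\<in>UNIV. v $ i *\<^sub>R Rep_bas i)"

lemma Rep_bas_Basis [simp]: "Rep_bas i \<in> Basis" by (rule Rep_bas)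

lemma sum_bas: "(\<Sum>i\<in>UNIV. f (Rep_bas i)) = (\<Sum>b\<in>Basis. f b)"
  using sum.reindex[OF inj_Rep_bas, of f] by (simp add: range_Rep_bas)

lemma prod_bas: "(\<Prod>i\<in>UNIV. f (Rep_bas i)) = (\<Prod>b\<in>Basis. f b)"
  using prod.reindex[OF inj_Rep_bas, of f] by (simp add: range_Rep_bas)

lemma uncart_cart [simp]: "uncart (cart x) = x"
  unfolding uncart_def cart_def
  using sum_bas[of "\<lambda>b. (x \<bullet> b) *\<^sub>R b"] by (simp add: euclidean_representation)

lemma uncart_inner: "uncart v \<bullet> Rep_bas i = v $ i"
proof -
  have "uncart v \<bullet> Rep_bas i = (\<Sum>j\<in>UNIV. v $ j * (Rep_bas j \<bullet> Rep_bas i))"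
    by (simp add: uncart_def inner_sum_left)
  also have "\<dots> = (\<Sum>j\<in>UNIV. if j = i then v $ j else 0)"
    by (rule sum.cong) (auto simp: inner_Basis Rep_bas_inject)
  finally show ?thesis by simp
qed

lemma cart_uncart [simp]: "cart (uncart v) = v"
  by (simp add: cart_def uncart_inner vec_eq_iff)

lemma linear_cart: "linear cart"
  by (rule linearI) (simp_all add: cart_def vec_eq_iff inner_add_left)

lemma linear_uncart: "linear uncart"
  by (rule linearI) (simp_all add: uncart_def scaleR_add_left sum.distrib scaleR_sum_right)

lemma bounded_linear_cart: "bounded_linear cart" using linear_cart linear_linear by blast
lemma bounded_linear_uncart: "bounded_linear uncart" using linear_uncart linear_linear by blast

lemma continuous_cart: "continuous_on S cart"
  using bounded_linear_cart by (rule linear_continuous_on)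
lemma continuous_uncart: "continuous_on S uncart"
  using bounded_linear_uncart by (rule linear_continuous_on)

lemma measurable_cart [measurable]: "cart \<in> borel_measurable borel"
  by (rule borel_measurable_continuous_onI[OF continuous_cart])
lemma measurable_uncart [measurable]: "uncart \<in> borel_measurable borel"
  by (rule borel_measurable_continuous_onI[OF continuous_uncart])

lemma distr_cart: "distr lborel borel cart = lborel"
proof (rule lborel_eqI[symmetric])
  fix l u :: "real ^ 'a bas"
  assume le: "\<And>b. b \<in> Basis \<Longrightarrow> l \<bullet> b \<le> u \<bullet> b"
  have le': "l $ i \<le> u $ i" for i using le[of "axis i 1"] by (simp add: inner_axis)
  have "cart -` box l u = box (uncart l) (uncart u)"
  proof (intro set_eqI)
    fix x
    have "x \<in> box (uncart l) (uncart u) \<longleftrightarrow> (\<forall>b\<in>range Rep_bas. uncart l \<bullet> b < x \<bullet> b \<and> x \<bullet> b < uncart u \<bullet> b)"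
      by (simp add: box_def range_Rep_bas)
    then show "x \<in> cart -` box l u \<longleftrightarrow> x \<in> box (uncart l) (uncart u)"
      by (auto simp: mem_box_cart uncart_inner cart_def)
  qed
  moreover have "uncart l \<bullet> b \<le> uncart u \<bullet> b" if "b \<in> Basis" for b
    using that le' by (auto simp: uncart_inner simp flip: range_Rep_bas)
  moreover have "(\<Prod>b\<in>Basis. (uncart u - uncart l) \<bullet> b) = (\<Prod>i\<in>UNIV. (u - l) $ i)"
    by (simp add: prod_bas[symmetric] inner_diff_left uncart_inner)
  moreover have "(\<Prod>b\<in>Basis. (u - l) \<bullet> b) = (\<Prod>i\<in>UNIV. (u - l) $ i)"
  proof -
    have "(Basis :: (real ^ 'a bas) set) = range (\<lambda>i. axis i 1)" by (auto simp: Basis_vec_def)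
    moreover have "inj (\<lambda>i::'a bas. axis i (1::real))" by (auto simp: inj_def axis_eq_axis)
    ultimately have "(\<Prod>b\<in>Basis. (u - l) \<bullet> b) = (\<Prod>i\<in>UNIV. (u - l) \<bullet> axis i 1)"
      using prod.reindex[of "\<lambda>i::'a bas. axis i (1::real)" UNIV "\<lambda>b. (u - l) \<bullet> b"] by (simp only: o_def)
    then show ?thesis by (simp add: inner_axis)
  qed
  ultimately show "emeasure (distr lborel borel cart) (box l u) = (\<Prod>b\<in>Basis. (u - l) \<bullet> b)"
    by (simp add: emeasure_distr emeasure_lborel_box_eq)
qed simp

lemma distr_uncart: "distr lborel borel uncart = lborel"
proof -
  have "distr lborel borel uncart = distr (distr lborel borel cart) borel uncart"
    by (simp add: distr_cart)
  also have "\<dots> = distr lborel borel (uncart \<circ> cart)" by (rule distr_distr) auto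
  also have "\<dots> = distr lborel lborel (\<lambda>x. x)" by (intro distr_cong) auto
  finally show ?thesis by (simp add: distr_id)
qed

definition ldet :: "('a::euclidean_space \<Rightarrow> 'a) \<Rightarrow> real" where
  "ldet f = det (matrix (cart \<circ> f \<circ> uncart))"

lemma linear_cart_conj: "linear f \<Longrightarrow> linear (cart \<circ> f \<circ> uncart)"
  by (intro linear_compose linear_cart linear_uncart)

lemma ldet_compose:
  assumes "linear f" "linear g" shows "ldet (\<lambda>x. f (g x)) = ldet f * ldet g"
proof -
  have "cart \<circ> (\<lambda>x. f (g x)) \<circ> uncart = (cart \<circ> f \<circ> uncart) \<circ> (cart \<circ> g \<circ> uncart)"
    by (auto simp: fun_eq_iff)
  then show ?thesis
    unfolding ldet_def using matrix_compose[OF linear_cart_conj[OF assms(2)] linear_cart_conj[OF assms(1)]]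
    by (simp add: det_mul)
qed

lemma ldet_id: "ldet (\<lambda>x :: 'a::euclidean_space. x) = 1"
proof -
  have "cart \<circ> (\<lambda>x :: 'a. x) \<circ> uncart = id" by (auto simp: fun_eq_iff)
  then show ?thesis unfolding ldet_def by simp
qed

lemma ldet_nonzero_iff:
  assumes "linear f" shows "ldet f \<noteq> 0 \<longleftrightarrow> inj f"
proof -
  have "inj (cart \<circ> f \<circ> uncart) \<longleftrightarrow> inj f"
  proof
    assume i: "inj (cart \<circ> f \<circ> uncart)"
    show "inj f"
    proof (rule injI)
      fix x y assume "f x = f y"
      then have "(cart \<circ> f \<circ> uncart) (cart x) = (cart \<circ> f \<circ> uncart) (cart y)" by simp
      then have "cart x = cart y" by (rule injD[OF i])
      then show "x = y" by (metis uncart_cart)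
    qed
  next
    assume "inj f"
    then show "inj (cart \<circ> f \<circ> uncart)"
      by (auto simp: inj_def) (metis cart_uncart uncart_cart)
  qed
  then show ?thesis unfolding ldet_def using det_nz_iff_inj[OF linear_cart_conj[OF assms]] by simp
qed

lemma ldet_expand:
  "ldet f = (\<Sum>p | p permutes UNIV. of_int (sign p) * (\<Prod>i\<in>UNIV. f (Rep_bas (p i)) \<bullet> Rep_bas i))"
proof -
  have "matrix (cart \<circ> f \<circ> uncart) $ i $ j = f (Rep_bas j) \<bullet> Rep_bas i" for i j
  proof -
    have "uncart (axis j 1) = Rep_bas j"
      by (simp add: uncart_def axis_def if_distrib[of "\<lambda>c. c *\<^sub>R _"] cong: if_cong)
    then show ?thesis by (simp add: matrix_def cart_def)
  qed
  then show ?thesis by (simp only: ldet_def det_def)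
qed

text \<open>Around each point with nonzero determinant \<open>f\<close> is injective on a ball, and
  countably many such balls suffice. Once they are made disjoint, each piece contributes exactly the
  measure of its image, and outside \<open>N\<close> a point lies in at most \<open>K\<close> of
  these images.\<close>

lemma area_inequality_cart:
  fixes f :: "real^'n::{finite,wellorder} \<Rightarrow> real^'n::_" and K :: nat
  assumes f': "\<And>x. (f has_derivative f' x) (at x)"
    and cont: "continuous_on UNIV (\<lambda>x. det (matrix (f' x)))"
    and C1: "\<And>a e. e > 0 \<Longrightarrow> \<exists>d>0. \<forall>x. dist a x < d \<longrightarrow> onorm (\<lambda>v. f' x v - f' a v) < e"
    and E: "E \<in> sets borel" "emeasure lborel E < \<infinity>"
    and N: "N \<in> null_sets lebesgue"
    and card: "\<And>y. y \<notin> N \<Longrightarrow> finite {t. f t = y} \<and> card {t. f t = y} \<le> K"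
  shows "(\<integral>\<^sup>+t. ennreal \<bar>det (matrix (f' t))\<bar> * indicator E (f t) \<partial>lborel) \<le> of_nat K * emeasure lborel E"
proof -
  let ?J = "\<lambda>t. \<bar>det (matrix (f' t))\<bar>"
  have fc: "continuous_on UNIV f"
    by (intro continuous_at_imp_continuous_on ballI has_derivative_continuous[OF f'])
  have [measurable]: "f \<in> borel_measurable borel" by (rule borel_measurable_continuous_onI[OF fc])
  have [measurable]: "(\<lambda>t. ?J t) \<in> borel_measurable borel"
    by (intro borel_measurable_continuous_onI continuous_intros cont)
  note E(1) [measurable]
  let ?D = "{t. det (matrix (f' t)) \<noteq> 0}"
  define F where "F = {ball a e | a e. inj_on f (ball a e) \<and> e > 0}"
  obtain F' where F': "F' \<subseteq> F" "countable F'" "\<Union>F' = \<Union>F"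
    by (rule Lindelof[of F]) (auto simp: F_def)
  have DF: "?D \<subseteq> \<Union>F"
  proof
    fix a assume "a \<in> ?D"
    then have inj: "inj (f' a)"
      using det_nz_iff_inj has_derivative_linear[OF f'] by blast
    then obtain g' where g': "linear g'" "g' \<circ> f' a = id"
      using linear_injective_left_inverse has_derivative_linear[OF f'] by blast
    then have "bounded_linear g'" using linear_linear by blast
    then obtain e where "e > 0" "inj_on f (ball a e)"
      by (rule has_derivative_locally_injective[OF UNIV_I open_UNIV _ g'(2) f' C1])
    then have "ball a e \<in> F" "a \<in> ball a e" by (auto simp: F_def)
    then show "a \<in> \<Union>F" by blast
  qed
  \<comment> \<open>The empty set is added so that the countable family is nonempty and can be
    enumerated by \<open>nat\<close>.\<close>
  have "F' \<union> {{}} \<noteq> {}" "countable (F' \<union> {{}})" using F' by auto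
  then obtain B :: "nat \<Rightarrow> _" where B: "range B = F' \<union> {{}}" by (metis range_from_nat_into)
  have Binj: "inj_on f (B i)" "open (B i)" for i
  proof -
    have "B i \<in> F' \<union> {{}}" using B by blast
    then show "inj_on f (B i)" "open (B i)" using F'(1) by (auto simp: F_def)
  qed
  define A where "A i = disjointed B i \<inter> (f -` E \<inter> ?D)" for i
  have Dm: "?D \<in> sets borel"
  proof -
    have "open ?D" using open_Collect_neq[OF cont continuous_on_const] by simp
    then show ?thesis by simp
  qed
  have Bm: "range B \<subseteq> sets borel" using Binj by auto
  have Am [measurable]: "A i \<in> sets borel" for i
  proof -
    have "disjointed B i \<in> sets borel" using sets.range_disjointed_sets[OF Bm] by blast
    moreover have "f -` E \<in> sets borel" using measurable_sets[of f borel borel E] E by simp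
    ultimately show ?thesis unfolding A_def using Dm by blast
  qed
  have Ainj: "inj_on f (A i)" for i
    by (rule inj_on_subset[OF Binj(1)[of i]]) (use disjointed_subset[of B i] in \<open>auto simp: A_def\<close>)
  have Adisj: "disjoint_family A"
    using disjoint_family_disjointed[of B] by (auto simp: disjoint_family_on_def A_def)
  have Aun: "(\<Union>i. A i) = f -` E \<inter> ?D"
  proof -
    have "\<Union>F' = \<Union>(range B)" using B by auto
    then have "?D \<subseteq> (\<Union>i. disjointed B i)" using DF F'(3) by (simp add: UN_disjointed_eq)
    then show ?thesis unfolding A_def by blast
  qed
  have img: "emeasure lebesgue (f ` A i) = (\<integral>\<^sup>+t. ennreal (?J t) * indicator (A i) t \<partial>lborel)"
    and img_sets: "f ` A i \<in> sets lebesgue" for i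
  proof -
    have AL: "A i \<in> sets lebesgue" using Am by simp
    have d: "\<And>x. x \<in> A i \<Longrightarrow> (f has_derivative f' x) (at x within A i)"
      using f' has_derivative_at_withinI by blast
    show s: "f ` A i \<in> sets lebesgue"
      by (rule differentiable_image_in_sets_lebesgue[OF AL]) (use d in \<open>auto simp: differentiable_on_def differentiable_def\<close>)
    have "f ` A i \<subseteq> E" by (auto simp: A_def)
    then have "emeasure lebesgue (f ` A i) \<le> emeasure lborel E"
      using emeasure_mono[of "f ` A i" E lebesgue] E by simp
    then have fin: "emeasure lebesgue (f ` A i) < \<infinity>" using E(2) by (rule le_less_trans)
    then have lm: "f ` A i \<in> lmeasurable" using s by (simp add: fmeasurable_def)
    then have "(?J has_integral measure lebesgue (f ` A i)) (A i)"
      using has_measure_differentiable_image[OF AL d Ainj] by blast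
    then have "(\<integral>\<^sup>+t. ennreal (?J t) * indicator (A i) t \<partial>lborel) = ennreal (measure lebesgue (f ` A i))"
      by (intro nn_integral_has_integral_lebesgue') auto
    also have "\<dots> = emeasure lebesgue (f ` A i)" using fin by (simp add: emeasure_eq_ennreal_measure)
    finally show "emeasure lebesgue (f ` A i) = (\<integral>\<^sup>+t. ennreal (?J t) * indicator (A i) t \<partial>lborel)" ..
  qed
  \<comment> \<open>The pieces are disjoint, so different pieces whose images contain
    \<open>y\<close> supply different preimages of \<open>y\<close>.\<close>
  have mult: "(\<Sum>i. indicator (f ` A i) y) \<le> of_nat K * (indicator E y :: ennreal)" if "y \<notin> N" for y
  proof (rule suminf_le_const)
    fix n
    let ?I = "{i. i < n \<and> y \<in> f ` A i}"
    have "(\<Sum>i<n. indicator (f ` A i) y :: ennreal) = of_nat (card ?I)"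
      by (simp add: indicator_def sum.If_cases Int_def)
    also have "\<dots> \<le> of_nat K * (indicator E y :: ennreal)"
    proof (cases "y \<in> E")
      case False
      then have "?I = {}" by (auto simp: A_def)
      then have "card ?I = 0" by (simp only: card.empty)
      then show ?thesis by (simp only: of_nat_0 zero_le)
    next
      case True
      have "\<forall>i\<in>?I. \<exists>t. t \<in> A i \<and> f t = y" by blast
      then obtain s where s: "\<And>i. i \<in> ?I \<Longrightarrow> s i \<in> A i \<and> f (s i) = y" by metis
      have "inj_on s ?I"
      proof (rule inj_onI)
        fix i j assume ij: "i \<in> ?I" "j \<in> ?I" "s i = s j"
        then have "s i \<in> A i \<inter> A j" using s by fastforce
        then show "i = j" using Adisj unfolding disjoint_family_on_def by blast
      qed
      then have "card ?I = card (s ` ?I)" by (simp add: card_image)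
      also have "\<dots> \<le> card {t. f t = y}" using card[OF that] s by (intro card_mono) auto
      also have "\<dots> \<le> K" using card[OF that] by simp
      finally show ?thesis using True by (simp add: of_nat_mono)
    qed
    finally show "(\<Sum>i<n. indicator (f ` A i) y) \<le> of_nat K * (indicator E y :: ennreal)" .
  qed simp
  have "(\<integral>\<^sup>+t. ennreal (?J t) * indicator E (f t) \<partial>lborel) = (\<integral>\<^sup>+t. (\<Sum>i. ennreal (?J t) * indicator (A i) t) \<partial>lborel)"
  proof (rule nn_integral_cong)
    fix t
    have "(\<Sum>i. ennreal (?J t) * indicator (A i) t) = ennreal (?J t) * indicator (\<Union>i. A i) t"
      using suminf_indicator[OF Adisj] by (simp add: ennreal_suminf_cmult)
    then show "ennreal (?J t) * indicator E (f t) = (\<Sum>i. ennreal (?J t) * indicator (A i) t)"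
      unfolding Aun by (auto simp: indicator_def)
  qed
  also have "\<dots> = (\<Sum>i. \<integral>\<^sup>+t. ennreal (?J t) * indicator (A i) t \<partial>lborel)"
    by (rule nn_integral_suminf) measurable
  also have "\<dots> = (\<Sum>i. \<integral>\<^sup>+y. indicator (f ` A i) y \<partial>lebesgue)"
    using img img_sets by simp
  also have "\<dots> = (\<integral>\<^sup>+y. (\<Sum>i. indicator (f ` A i) y) \<partial>lebesgue)"
    by (rule nn_integral_suminf[symmetric]) (use img_sets in auto)
  also have "\<dots> \<le> (\<integral>\<^sup>+y. of_nat K * (indicator E y :: ennreal) \<partial>lebesgue)"
    by (rule nn_integral_mono_AE) (use AE_not_in[OF N] mult in \<open>auto elim!: eventually_mono\<close>)
  also have "\<dots> = of_nat K * emeasure lborel E" using E(1) by (subst nn_integral_cmult_indicator) auto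
  finally show ?thesis .
qed

lemma real_polynomial_function_derivative:
  assumes "real_polynomial_function (f :: 'a::euclidean_space \<Rightarrow> real)"
  shows "\<exists>f'. (\<forall>x. (f has_derivative f' x) (at x)) \<and> (\<forall>v. real_polynomial_function (\<lambda>x. f' x v))"
  using assms
proof induction
  case (linear f)
  then have "(f has_derivative f) (at x)" for x by (rule bounded_linear_imp_has_derivative)
  then show ?case using real_polynomial_function.intros(2) by (intro exI[of _ "\<lambda>_. f"]) blast
next
  case (const c)
  then show ?case using real_polynomial_function.intros(2) by (intro exI[of _ "\<lambda>_ _. 0"]) auto
next
  case (add f g)
  then obtain f' g' where "\<forall>x. (f has_derivative f' x) (at x)" "\<forall>v. real_polynomial_function (\<lambda>x. f' x v)"
    "\<forall>x. (g has_derivative g' x) (at x)" "\<forall>v. real_polynomial_function (\<lambda>x. g' x v)" by blast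
  then show ?case
    by (intro exI[of _ "\<lambda>x v. f' x v + g' x v"]) (auto intro: has_derivative_add)
next
  case (mult f g)
  then obtain f' g' where "\<forall>x. (f has_derivative f' x) (at x)" "\<forall>v. real_polynomial_function (\<lambda>x. f' x v)"
    "\<forall>x. (g has_derivative g' x) (at x)" "\<forall>v. real_polynomial_function (\<lambda>x. g' x v)" by blast
  then show ?case using mult
    by (intro exI[of _ "\<lambda>x v. f x * g' x v + f' x v * g x"] conjI allI has_derivative_mult
        real_polynomial_function.intros(3,4)) blast+
qed

lemma polynomial_function_derivative:
  assumes "polynomial_function (f :: 'a::euclidean_space \<Rightarrow> 'b::euclidean_space)"
  shows "\<exists>f'. (\<forall>x. (f has_derivative f' x) (at x)) \<and> (\<forall>v. polynomial_function (\<lambda>x. f' x v))"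
proof -
  have "\<forall>b\<in>Basis. \<exists>f'. (\<forall>x. ((\<lambda>x. f x \<bullet> b) has_derivative f' x) (at x)) \<and> (\<forall>v. real_polynomial_function (\<lambda>x. f' x v))"
    using assms real_polynomial_function_derivative unfolding polynomial_function_iff_Basis_inner by blast
  then obtain D where D: "\<And>b x. b \<in> Basis \<Longrightarrow> ((\<lambda>x. f x \<bullet> b) has_derivative D b x) (at x)"
    "\<And>b v. b \<in> Basis \<Longrightarrow> real_polynomial_function (\<lambda>x. D b x v)"
    by metis
  let ?f' = "\<lambda>x v. \<Sum>b\<in>Basis. D b x v *\<^sub>R b"
  have i: "?f' x v \<bullet> b = D b x v" if "b \<in> Basis" for x v b
    using that by (simp add: inner_sum_left inner_Basis if_distrib cong: if_cong)
  have "(f has_derivative ?f' x) (at x)" for x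
    by (subst has_derivative_componentwise_within) (use D(1) i in auto)
  moreover have "polynomial_function (\<lambda>x. ?f' x v)" for v
    unfolding polynomial_function_iff_Basis_inner using D(2) i by simp
  ultimately show ?thesis by (intro exI[of _ ?f']) blast
qed

lemma onorm_le_sum_Basis:
  fixes D :: "'a::euclidean_space \<Rightarrow> 'b::real_normed_vector"
  assumes "linear D" shows "onorm D \<le> (\<Sum>b\<in>Basis. norm (D b))"
proof (rule onorm_le)
  fix x
  have "D x = D (\<Sum>b\<in>Basis. (x \<bullet> b) *\<^sub>R b)" by (simp add: euclidean_representation)
  also have "\<dots> = (\<Sum>b\<in>Basis. (x \<bullet> b) *\<^sub>R D b)"
    using assms by (simp add: linear_sum linear_cmul)
  also have "norm \<dots> \<le> (\<Sum>b\<in>Basis. norm x * norm (D b))"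
    by (rule sum_norm_le) (simp add: Basis_le_norm mult_right_mono)
  finally show "norm (D x) \<le> (\<Sum>b\<in>Basis. norm (D b)) * norm x"
    by (simp add: sum_distrib_left mult.commute)
qed

lemma has_derivative_cart_conj:
  assumes "(f has_derivative f') (at (uncart v))"
  shows "((cart \<circ> f \<circ> uncart) has_derivative (cart \<circ> f' \<circ> uncart)) (at v)"
proof -
  have "((f \<circ> uncart) has_derivative (f' \<circ> uncart)) (at v)"
    using diff_chain_at[OF bounded_linear_imp_has_derivative[OF bounded_linear_uncart] assms] .
  from diff_chain_at[OF this bounded_linear_imp_has_derivative[OF bounded_linear_cart]]
  show ?thesis by (simp add: comp_assoc)
qed

lemma emeasure_uncart_vimage: "E \<in> sets borel \<Longrightarrow> emeasure lborel (uncart -` E) = emeasure lborel E"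
  using emeasure_distr[of uncart lborel borel E] by (simp add: distr_uncart)

lemma nn_integral_uncart:
  assumes "f \<in> borel_measurable borel"
  shows "(\<integral>\<^sup>+v. f (uncart v) \<partial>lborel) = (\<integral>\<^sup>+x. f x \<partial>lborel)"
  using nn_integral_distr[of uncart lborel borel f] assms by (simp add: distr_uncart)

lemma polynomial_ldet:
  assumes "\<And>v. polynomial_function (\<lambda>x. f' x v)"
  shows "real_polynomial_function (\<lambda>x. ldet (f' x))"
proof -
  have "real_polynomial_function (\<lambda>x. f' x (Rep_bas a) \<bullet> Rep_bas b)" for a b
    using assms unfolding polynomial_function_iff_Basis_inner by simp
  then show ?thesis
    unfolding ldet_expand
    by (intro real_polynomial_function_sum real_polynomial_function.intros(2,4) real_polynomial_function_prod)
      (auto simp: finite_permutations)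
qed

lemma polynomial_function_continuous: "polynomial_function f \<Longrightarrow> continuous_on S f"
  for f :: "'a::euclidean_space \<Rightarrow> 'b::euclidean_space"
  using continuous_on_polymonial_function .

text \<open>Transport of \<open>area_inequality_cart\<close> along \<open>cart\<close>. Polynomial
  partial derivatives are continuous, which yields continuity of the derivative in operator
  norm.\<close>

lemma area_inequality_polynomial:
  fixes f :: "'a::euclidean_space \<Rightarrow> 'a" and K :: nat
  assumes f': "\<And>x. (f has_derivative f' x) (at x)"
    and poly: "\<And>v. polynomial_function (\<lambda>x. f' x v)"
    and E: "E \<in> sets borel" "emeasure lborel E < \<infinity>"
    and N: "N \<in> null_sets lborel"
    and card: "\<And>y. y \<notin> N \<Longrightarrow> finite {t. f t = y} \<and> card {t. f t = y} \<le> K"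
  shows "(\<integral>\<^sup>+t. ennreal \<bar>ldet (f' t)\<bar> * indicator E (f t) \<partial>lborel) \<le> of_nat K * emeasure lborel E"
proof -
  let ?F = "cart \<circ> f \<circ> uncart" and ?F' = "\<lambda>v. cart \<circ> f' (uncart v) \<circ> uncart"
  have [measurable]: "f \<in> borel_measurable borel"
    by (intro borel_measurable_continuous_onI continuous_at_imp_continuous_on ballI has_derivative_continuous[OF f'])
  have lc: "continuous_on UNIV (\<lambda>t. ldet (f' t))"
    using polynomial_ldet[OF poly] by (intro polynomial_function_continuous) (simp add: real_polynomial_function_eq)
  then have [measurable]: "(\<lambda>t. ldet (f' t)) \<in> borel_measurable borel"
    by (rule borel_measurable_continuous_onI)
  note E(1) [measurable]
  have "(\<integral>\<^sup>+t. ennreal \<bar>ldet (f' t)\<bar> * indicator E (f t) \<partial>lborel)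
      = (\<integral>\<^sup>+v. ennreal \<bar>ldet (f' (uncart v))\<bar> * indicator E (f (uncart v)) \<partial>lborel)"
    by (rule nn_integral_uncart[symmetric]) measurable
  also have "\<dots> = (\<integral>\<^sup>+v. ennreal \<bar>det (matrix (?F' v))\<bar> * indicator (uncart -` E) (?F v) \<partial>lborel)"
    by (simp add: ldet_def indicator_def)
  also have "\<dots> \<le> of_nat K * emeasure lborel (uncart -` E)"
  proof (rule area_inequality_cart)
    show "(?F has_derivative ?F' v) (at v)" for v
      by (rule has_derivative_cart_conj[OF f'])
    show "continuous_on UNIV (\<lambda>v. det (matrix (?F' v)))"
      using continuous_on_compose2[OF lc continuous_uncart] by (simp add: ldet_def)
    show "uncart -` E \<in> sets borel" using measurable_sets[OF measurable_uncart E(1)] by simp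
    show "emeasure lborel (uncart -` E) < \<infinity>" using E by (simp add: emeasure_uncart_vimage)
    have Nb: "N \<in> sets borel" using N by auto
    have "uncart -` N \<in> null_sets lborel"
      using N Nb measurable_sets[OF measurable_uncart Nb] by (simp add: null_sets_def emeasure_uncart_vimage)
    then show "uncart -` N \<in> null_sets lebesgue" by (rule null_sets_completionI)
    show "finite {t. ?F t = y} \<and> card {t. ?F t = y} \<le> K" if "y \<notin> uncart -` N" for y
    proof -
      have "{t. ?F t = y} = cart ` {t. f t = uncart y}"
      proof (intro set_eqI iffI)
        fix t assume "t \<in> {t. ?F t = y}"
        then have "cart (f (uncart t)) = y" by simp
        then have "f (uncart t) = uncart y" by auto
        then show "t \<in> cart ` {t. f t = uncart y}"
          by (intro image_eqI[of t cart "uncart t"]) auto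
      qed auto
      then show ?thesis using card[of "uncart y"] that
        by (auto intro: le_trans[OF card_image_le])
    qed
    show "\<exists>d>0. \<forall>x. dist a x < d \<longrightarrow> onorm (\<lambda>v. ?F' x v - ?F' a v) < e" if e: "e > 0" for a e
    proof -
      let ?s = "\<lambda>x. \<Sum>b\<in>Basis. norm (?F' x b - ?F' a b)"
      have "continuous_on UNIV (\<lambda>x. ?F' x b)" for b
        unfolding o_def
        by (intro continuous_on_compose2[OF continuous_cart[of UNIV]]
            continuous_on_compose2[OF polynomial_function_continuous[OF poly, of UNIV]] continuous_uncart) auto
      then have "continuous_on UNIV ?s" by (intro continuous_intros)
      then have "isCont ?s a" by (simp add: continuous_on_eq_continuous_at)
      then have "(?s \<longlongrightarrow> 0) (at a)" by (simp add: isCont_def)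
      then have "eventually (\<lambda>x. ?s x < e) (at a)" using e by (rule order_tendstoD)
      then obtain d where d: "d > 0" "\<And>x. x \<noteq> a \<and> dist x a < d \<Longrightarrow> ?s x < e"
        unfolding eventually_at by blast
      have a: "?s a < e" using e by simp
      have on: "onorm (\<lambda>v. ?F' x v - ?F' a v) \<le> ?s x" for x
        by (intro onorm_le_sum_Basis linear_compose_sub linear_cart_conj has_derivative_linear[OF f'])
      have "onorm (\<lambda>v. ?F' x v - ?F' a v) < e" if "dist a x < d" for x
      proof (cases "x = a")
        case True
        then show ?thesis using le_less_trans[OF on a] by (simp only:)
      next
        case False
        then have "x \<noteq> a \<and> dist x a < d" using that by (simp add: dist_commute)
        then show ?thesis by (rule le_less_trans[OF on d(2)])
      qed
      then show ?thesis using d(1) by blast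
    qed
  qed
  also have "\<dots> = of_nat K * emeasure lborel E" using E by (simp add: emeasure_uncart_vimage)
  finally show ?thesis .
qed

text \<open>Lebesgue measure is determined by its values on boxes, so only preimages of boxes have
  to be treated by change of variables; arbitrary integrands follow from the resulting identity of
  measures.\<close>

lemma nn_integral_bij_const_jacobian:
  fixes T :: "'a::euclidean_space \<Rightarrow> 'a"
  assumes bij: "bij T" and T': "\<And>x. (T has_derivative T' x) (at x)"
    and c: "\<And>x. \<bar>ldet (T' x)\<bar> = c" and f: "f \<in> borel_measurable borel"
  shows "(\<integral>\<^sup>+x. f x \<partial>lborel) = ennreal c * (\<integral>\<^sup>+x. f (T x) \<partial>lborel)"
proof -
  have c0: "c \<ge> 0" using c[of 0] by (metis abs_ge_zero)
  have [measurable]: "T \<in> borel_measurable borel"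
    by (intro borel_measurable_continuous_onI continuous_at_imp_continuous_on ballI has_derivative_continuous[OF T'])
  let ?F = "cart \<circ> T \<circ> uncart" and ?F' = "\<lambda>v. cart \<circ> T' (uncart v) \<circ> uncart"
  have "lborel = density (distr lborel borel T) (\<lambda>_. ennreal c)"
  proof (rule lborel_eqI)
    fix l u :: 'a assume le: "\<And>b. b \<in> Basis \<Longrightarrow> l \<bullet> b \<le> u \<bullet> b"
    have [measurable]: "T -` box l u \<in> sets borel" using measurable_sets[of T borel borel "box l u"] by simp
    let ?S = "uncart -` T -` box l u"
    have SB: "?S \<in> sets borel" using measurable_sets[OF measurable_uncart, of "T -` box l u"] by simp
    have img: "?F ` ?S = uncart -` box l u"
    proof (intro set_eqI iffI)
      fix v assume v: "v \<in> uncart -` box l u"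
      obtain x where x: "T x = uncart v" using bij by (metis bij_pointE)
      then have "?F (cart x) = v" "cart x \<in> ?S" using v by simp_all
      then show "v \<in> ?F ` ?S" by blast
    qed auto
    have inj: "inj_on ?F ?S"
    proof (rule inj_onI)
      fix x y assume "?F x = ?F y"
      then have "uncart (?F x) = uncart (?F y)" by (simp only:)
      then have "T (uncart x) = T (uncart y)" by simp
      then have "uncart x = uncart y" using bij by (simp add: bij_def inj_eq)
      then have "cart (uncart x) = cart (uncart y)" by (simp only:)
      then show "x = y" by simp
    qed
    have bs: "uncart -` box l u \<in> sets borel" using measurable_sets[OF measurable_uncart, of "box l u"] by simp
    have be: "emeasure lebesgue (uncart -` box l u) = emeasure lborel (box l u)"
      using bs by (simp add: emeasure_uncart_vimage)
    have fin: "emeasure lborel (box l u) < \<infinity>" using emeasure_lborel_box_finite[of l u] by (simp add: less_top)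
    have "?F ` ?S \<in> lmeasurable" unfolding img fmeasurable_def using bs be fin by simp
    moreover have "?S \<in> sets lebesgue" using SB by simp
    ultimately have "((\<lambda>v. \<bar>det (matrix (?F' v))\<bar>) has_integral measure lebesgue (?F ` ?S)) ?S"
      using has_measure_differentiable_image[OF _ has_derivative_at_withinI[OF has_derivative_cart_conj[OF T']] inj]
      by blast
    then have "((\<lambda>v. c) has_integral measure lebesgue (?F ` ?S)) ?S"
      using c by (simp add: ldet_def)
    then have "(\<integral>\<^sup>+v. ennreal c * indicator ?S v \<partial>lborel) = ennreal (measure lebesgue (?F ` ?S))"
      using c0 by (intro nn_integral_has_integral_lebesgue') auto
    also have "(\<integral>\<^sup>+v. ennreal c * indicator ?S v \<partial>lborel) = ennreal c * emeasure lborel ?S" using SB by (simp add: nn_integral_cmult_indicator)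
    also have "\<dots> = ennreal c * emeasure lborel (T -` box l u)" by (simp add: emeasure_uncart_vimage)
    also have "ennreal (measure lebesgue (?F ` ?S)) = emeasure lborel (box l u)"
      using fin unfolding img by (simp add: emeasure_eq_ennreal_measure be[symmetric])
    finally have "ennreal c * emeasure lborel (T -` box l u) = emeasure lborel (box l u)" .
    then show "emeasure (density (distr lborel borel T) (\<lambda>_. ennreal c)) (box l u) = (\<Prod>b\<in>Basis. (u - l) \<bullet> b)"
      using le by (simp add: emeasure_density nn_integral_cmult_indicator emeasure_distr emeasure_lborel_box_eq)
  qed simp
  then have "(\<integral>\<^sup>+x. f x \<partial>lborel) = (\<integral>\<^sup>+x. f x \<partial>density (distr lborel borel T) (\<lambda>_. ennreal c))" by simp
  also have "\<dots> = (\<integral>\<^sup>+x. ennreal c * f x \<partial>distr lborel borel T)"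
    using f by (subst nn_integral_density) auto
  also have "\<dots> = ennreal c * (\<integral>\<^sup>+x. f (T x) \<partial>lborel)"
    using f by (simp add: nn_integral_cmult nn_integral_distr)
  finally show ?thesis .
qed

lemma ldet_diagonal:
  fixes D :: "'a::euclidean_space \<Rightarrow> 'a"
  assumes "\<And>b. b \<in> Basis \<Longrightarrow> D b = c b *\<^sub>R b"
  shows "ldet D = (\<Prod>b\<in>Basis. c b)"
proof -
  have m: "matrix (cart \<circ> D \<circ> uncart) $ i $ j = (if i = j then c (Rep_bas i) else 0)" for i j
  proof -
    have "uncart (axis j 1) = Rep_bas j"
      by (simp add: uncart_def axis_def if_distrib[of "\<lambda>c. c *\<^sub>R _"] cong: if_cong)
    then show ?thesis
      by (simp add: matrix_def cart_def assms inner_Basis Rep_bas_inject)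
  qed
  have "ldet D = (\<Prod>i\<in>UNIV. c (Rep_bas i))"
    unfolding ldet_def by (subst det_diagonal) (simp_all only: m if_False refl if_True)
  then show ?thesis by (simp add: prod_bas)
qed

section \<open>Invariant measure, dilations and the homogeneous norm\<close>

context strat_group begin

lemma linear_Dg_1: "linear (\<lambda>v. Dg z (v, 0))"
  using linear_compose[of "\<lambda>v. (v, 0::'a)" "Dg z", OF _ linear_Dg] by (simp add: o_def linear_iff)
lemma linear_Dg_2: "linear (\<lambda>v. Dg z (0, v))"
  using linear_compose[of "\<lambda>v. (0::'a, v)" "Dg z", OF _ linear_Dg] by (simp add: o_def linear_iff)

lemma bounded_linear_\<delta>: "bounded_linear (\<delta> l)" using linear_\<delta> linear_linear by blast

lemma \<delta>_Dg: "\<delta> l (Dg (x, y) (v, w)) = Dg (\<delta> l x, \<delta> l y) (\<delta> l v, \<delta> l w)"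
proof -
  have "((\<lambda>z. \<delta> l (fst z \<odot> snd z)) has_derivative (\<lambda>w. \<delta> l (Dg (x, y) w))) (at (x, y))"
    by (rule bounded_linear.has_derivative[OF bounded_linear_\<delta> gmul_has_derivative])
  moreover have "((\<lambda>z. \<delta> l (fst z) \<odot> \<delta> l (snd z)) has_derivative
      (\<lambda>w. Dg (\<delta> l (fst (x, y)), \<delta> l (snd (x, y))) (\<delta> l (fst w), \<delta> l (snd w)))) (at (x, y))"
    by (intro gmul_has_derivative_comp bounded_linear.has_derivative[OF bounded_linear_\<delta>] derivative_intros)
  ultimately have "(\<lambda>w. \<delta> l (Dg (x, y) w)) = (\<lambda>w. Dg (\<delta> l (fst (x, y)), \<delta> l (snd (x, y))) (\<delta> l (fst w), \<delta> l (snd w)))"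
    unfolding \<delta>_mult by (rule has_derivative_unique)
  from fun_cong[OF this, of "(v, w)"] show ?thesis by simp
qed

lemma bij_\<delta>: assumes "l \<noteq> 0" shows "bij (\<delta> l)"
  by (rule bij_betw_byWitness[where f'="\<delta> (1 / l)"]) (use assms in \<open>auto simp: \<delta>_\<delta>\<close>)

lemma ldet_\<delta>_nonzero: "l \<noteq> 0 \<Longrightarrow> ldet (\<delta> l) \<noteq> 0"
  using ldet_nonzero_iff[OF linear_\<delta>] bij_\<delta> bij_def by blast

lemma continuous_ldet_Dg:
  "continuous_on UNIV (\<lambda>z. ldet (\<lambda>v. Dg z (v, 0)))" "continuous_on UNIV (\<lambda>z. ldet (\<lambda>v. Dg z (0, v)))"
proof -
  have *: "continuous_on UNIV (\<lambda>z. Dg z w)" for w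
    by (intro continuous_at_imp_continuous_on ballI differentiable_imp_continuous_within Dg_differentiable) auto
  show "continuous_on UNIV (\<lambda>z. ldet (\<lambda>v. Dg z (v, 0)))" "continuous_on UNIV (\<lambda>z. ldet (\<lambda>v. Dg z (0, v)))"
    unfolding ldet_expand by (intro continuous_intros *)+
qed

lemma homogeneous_0_const:
  fixes p :: "'a \<times> 'a \<Rightarrow> real"
  assumes "continuous_on UNIV p" "\<And>l x y. l > 0 \<Longrightarrow> p (\<delta> l x, \<delta> l y) = p (x, y)"
  shows "p (x, y) = p (0, 0)"
proof (rule tendsto_unique[of "at_right (0::real)"])
  have "continuous_on UNIV (\<lambda>l. (\<delta> l x, \<delta> l y))" unfolding wdil_def by (intro continuous_intros)
  from continuous_on_compose2[OF assms(1) this] have "isCont (\<lambda>l. p (\<delta> l x, \<delta> l y)) 0"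
    by (simp add: continuous_on_eq_continuous_at)
  then show "((\<lambda>l. p (\<delta> l x, \<delta> l y)) \<longlongrightarrow> p (0, 0)) (at_right 0)"
    by (simp add: isCont_def filterlim_at_split)
  have "eventually (\<lambda>l. p (\<delta> l x, \<delta> l y) = p (x, y)) (at_right 0)"
    by (rule eventually_mono[OF eventually_at_right_less]) (rule assms(2))
  then show "((\<lambda>l. p (\<delta> l x, \<delta> l y)) \<longlongrightarrow> p (x, y)) (at_right 0)" by (rule tendsto_eventually)
qed simp

text \<open>Conjugation by \<open>\<delta> l\<close> multiplies and divides by
  \<open>ldet (\<delta> l)\<close>, so the Jacobian of a translation is constant along dilations.
  Letting \<open>l\<close> tend to 0 reduces it by continuity to the identity element, where
  \<open>Dg_00\<close> gives 1. This makes Lebesgue measure invariant under left and right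
  translations.\<close>

lemma ldet_Dg: "ldet (\<lambda>v. Dg (x, y) (v, 0)) = 1" "ldet (\<lambda>v. Dg (x, y) (0, v)) = 1"
proof -
  have "ldet (\<lambda>v. Dg (\<delta> l x, \<delta> l y) (v, 0)) = ldet (\<lambda>v. Dg (x, y) (v, 0))" if "l > 0" for l x y
  proof -
    have "ldet (\<lambda>v. \<delta> l (Dg (x, y) (v, 0))) = ldet (\<lambda>v. Dg (\<delta> l x, \<delta> l y) (\<delta> l v, 0))"
      by (simp add: \<delta>_Dg)
    then show ?thesis
      using ldet_\<delta>_nonzero[of l] that
      by (simp add: ldet_compose[OF linear_\<delta> linear_Dg_1] ldet_compose[OF linear_Dg_1 linear_\<delta>])
  qed
  from homogeneous_0_const[OF continuous_ldet_Dg(1) this, of x y]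
  show "ldet (\<lambda>v. Dg (x, y) (v, 0)) = 1" by (simp add: Dg_00 ldet_id)
  have "ldet (\<lambda>v. Dg (\<delta> l x, \<delta> l y) (0, v)) = ldet (\<lambda>v. Dg (x, y) (0, v))" if "l > 0" for l x y
  proof -
    have "ldet (\<lambda>v. \<delta> l (Dg (x, y) (0, v))) = ldet (\<lambda>v. Dg (\<delta> l x, \<delta> l y) (0, \<delta> l v))"
      by (simp add: \<delta>_Dg)
    then show ?thesis
      using ldet_\<delta>_nonzero[of l] that
      by (simp add: ldet_compose[OF linear_\<delta> linear_Dg_2] ldet_compose[OF linear_Dg_2 linear_\<delta>])
  qed
  from homogeneous_0_const[OF continuous_ldet_Dg(2) this, of x y]
  show "ldet (\<lambda>v. Dg (x, y) (0, v)) = 1" by (simp add: Dg_00 ldet_id)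
qed

lemma nn_integral_right_translate:
  assumes "f \<in> borel_measurable borel"
  shows "(\<integral>\<^sup>+x. f (x \<odot> y) \<partial>lborel) = (\<integral>\<^sup>+x. f x \<partial>lborel)"
proof -
  have "bij (\<lambda>x. x \<odot> y)"
    by (rule bij_betw_byWitness[where f'="\<lambda>x. x \<odot> - y"]) auto
  moreover have "((\<lambda>x. x \<odot> y) has_derivative (\<lambda>v. Dg (x, y) (v, 0))) (at x)" for x
    by (rule gmul_has_derivative_comp) auto
  ultimately show ?thesis
    using nn_integral_bij_const_jacobian[of "\<lambda>x. x \<odot> y" "\<lambda>x v. Dg (x, y) (v, 0)" 1 f] assms by (simp add: ldet_Dg)
qed

lemma nn_integral_left_translate:
  assumes "f \<in> borel_measurable borel"
  shows "(\<integral>\<^sup>+x. f (y \<odot> x) \<partial>lborel) = (\<integral>\<^sup>+x. f x \<partial>lborel)"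
proof -
  have "bij (\<lambda>x. y \<odot> x)"
    by (rule bij_betw_byWitness[where f'="\<lambda>x. - y \<odot> x"]) auto
  moreover have "((\<lambda>x. y \<odot> x) has_derivative (\<lambda>v. Dg (y, x) (0, v))) (at x)" for x
    by (rule gmul_has_derivative_comp) auto
  ultimately show ?thesis
    using nn_integral_bij_const_jacobian[of "\<lambda>x. y \<odot> x" "\<lambda>x v. Dg (y, x) (0, v)" 1 f] assms by (simp add: ldet_Dg)
qed

text \<open>The union of bases of the layers diagonalises \<open>\<delta> l\<close>, and a basis
  vector of layer \<open>j\<close> contributes the factor \<open>l ^ j\<close>. The linear map
  \<open>T\<close> sends the standard basis to this one, and \<open>ldet T\<close> cancels.\<close>

lemma ldet_\<delta>: "\<bar>ldet (\<delta> l)\<bar> = \<bar>l\<bar> ^ hom_dim r V"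
proof -
  have "\<exists>B. B \<subseteq> V j \<and> independent B \<and> V j \<subseteq> span B \<and> card B = dim (V j)" for j
    using basis_exists[of "V j"] by metis
  then obtain B where B: "\<And>j. B j \<subseteq> V j" "\<And>j. independent (B j)" "\<And>j. V j \<subseteq> span (B j)"
    "\<And>j. card (B j) = dim (V j)" by metis
  have fin: "finite (B j)" for j using B(2) independent_imp_finite by blast
  have disj: "B i \<inter> B j = {}" if "i \<in> {1..r}" "j \<in> {1..r}" "i \<noteq> j" for i j
  proof (rule ccontr)
    assume "B i \<inter> B j \<noteq> {}"
    then obtain v where v: "v \<in> B i" "v \<in> B j" by blast
    then have "v \<in> V i" "v \<in> V j" using B(1) by blast+
    then have "P i v = v" "P i v = 0" using P_V[of i i v] P_V[of j i v] that by auto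
    then have "v = 0" by simp
    then show False using v(1) B(2)[of i] dependent_zero by blast
  qed
  define C where "C = (\<Union>j\<in>{1..r}. B j)"
  have finC: "finite C" unfolding C_def using fin by blast
  have sumC: "(\<Sum>v\<in>C. f v) = (\<Sum>j=1..r. \<Sum>v\<in>B j. f v)" for f :: "'a \<Rightarrow> 'a"
    unfolding C_def by (rule sum.UNION_disjoint) (use fin disj in auto)
  have "independent C"
    unfolding dependent_finite[OF finC]
  proof (rule notI, elim exE conjE bexE)
    fix u v assume v: "v \<in> C" "u v \<noteq> 0" and 0: "(\<Sum>v\<in>C. u v *\<^sub>R v) = 0"
    from v obtain j where j: "j \<in> {1..r}" "v \<in> B j" unfolding C_def by blast
    have "(\<Sum>v\<in>B j. u v *\<^sub>R v) = 0"
    proof (rule V_direct[of "\<lambda>j. \<Sum>v\<in>B j. u v *\<^sub>R v"])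
      show "(\<Sum>v\<in>B j. u v *\<^sub>R v) \<in> V j" if "j \<in> {1..r}" for j
        by (intro subspace_sum subspace_scale V_subspace that) (use B(1) in auto)
      show "(\<Sum>j=1..r. \<Sum>v\<in>B j. u v *\<^sub>R v) = 0" using 0 by (simp add: sumC)
    qed (rule j)
    then have "dependent (B j)" using dependent_finite[OF fin] j v by blast
    then show False using B(2) by blast
  qed
  have "span C = UNIV"
  proof -
    have "x \<in> span C" for x
    proof -
      have "P j x \<in> span C" if "j \<in> {1..r}" for j
      proof -
        have "B j \<subseteq> C" using that unfolding C_def by blast
        then have "span (B j) \<subseteq> span C" by (rule span_mono)
        then show ?thesis using P_in_V[OF that] B(3) by blast
      qed
      then have "(\<Sum>j=1..r. P j x) \<in> span C" by (intro span_sum)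
      then show ?thesis by simp
    qed
    then show ?thesis by blast
  qed
  then have "card C = DIM('a)"
    using dim_eq_card[of C UNIV] \<open>independent C\<close> by simp
  then obtain h :: "'a \<Rightarrow> 'a" where h: "bij_betw h Basis C"
    using finite_same_card_bij[of "Basis :: 'a set" C] finC by auto
  \<comment> \<open>\<open>k v\<close> is the layer of the basis vector \<open>v\<close>, well
    defined because the bases are disjoint.\<close>
  define k where "k v = (SOME j. j \<in> {1..r} \<and> v \<in> B j)" for v
  have k: "k v = j" if "j \<in> {1..r}" "v \<in> B j" for j v
  proof -
    have "k v \<in> {1..r} \<and> v \<in> B (k v)" unfolding k_def by (rule someI) (use that in blast)
    then show ?thesis using disj[of "k v" j] that by blast
  qed
  define T where "T x = (\<Sum>b\<in>Basis. (x \<bullet> b) *\<^sub>R h b)" for x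
  define D where "D x = (\<Sum>b\<in>Basis. (x \<bullet> b) *\<^sub>R (l ^ k (h b) *\<^sub>R b))" for x
  have lT: "linear T" unfolding T_def
    by (rule linearI) (simp_all add: inner_add_left scaleR_add_left sum.distrib scaleR_sum_right)
  have lD: "linear D" unfolding D_def
    by (rule linearI) (simp_all only: inner_add_left inner_scaleR_left scaleR_add_left sum.distrib scaleR_sum_right scaleR_scaleR distrib_right mult.assoc)
  have Tb: "T b = h b" if "b \<in> Basis" for b
    unfolding T_def using that by (simp add: inner_Basis if_distrib[of "\<lambda>c. c *\<^sub>R _"] cong: if_cong)
  have Db: "D b = l ^ k (h b) *\<^sub>R b" if "b \<in> Basis" for b
  proof -
    have "D b = (\<Sum>a\<in>Basis. if a = b then l ^ k (h b) *\<^sub>R b else 0)"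
      unfolding D_def by (rule sum.cong) (use that in \<open>auto simp: inner_Basis\<close>)
    then show ?thesis using that by simp
  qed
  have "range T = span (T ` Basis)" using linear_span_image[OF lT, of Basis] by simp
  also have "T ` Basis = C" using Tb h by (auto simp: bij_betw_def)
  finally have "surj T" using \<open>span C = UNIV\<close> by simp
  then have "inj T" using linear_surjective_imp_injective[OF lT] by simp
  then have T0: "ldet T \<noteq> 0" using ldet_nonzero_iff[OF lT] by simp
  have "\<delta> l (T x) = T (D x)" for x
  proof -
    have "\<delta> l (T b) = T (D b)" if b: "b \<in> Basis" for b
    proof -
      have "h b \<in> C" using h b by (auto simp: bij_betw_def)
      then obtain j where j: "j \<in> {1..r}" "h b \<in> B j" unfolding C_def by blast
      then have "\<delta> l (h b) = l ^ j *\<^sub>R h b" using B(1) by (intro \<delta>_V) auto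
      then show ?thesis using k[OF j] by (simp add: Tb[OF b] Db[OF b] linear_cmul[OF lT])
    qed
    then show ?thesis
      using linear_eq_stdbasis[OF linear_compose[OF lT linear_\<delta>] linear_compose[OF lD lT]]
      by (metis comp_apply)
  qed
  then have "ldet (\<lambda>x. \<delta> l (T x)) = ldet (\<lambda>x. T (D x))" by simp
  then have "ldet (\<delta> l) = ldet D"
    using T0 by (simp add: ldet_compose[OF linear_\<delta> lT] ldet_compose[OF lT lD])
  also have "\<dots> = (\<Prod>b\<in>Basis. l ^ k (h b))" by (rule ldet_diagonal[OF Db])
  also have "\<dots> = (\<Prod>v\<in>C. l ^ k v)" using prod.reindex_bij_betw[OF h, of "\<lambda>v. l ^ k v"] by simp
  also have "\<dots> = (\<Prod>j=1..r. \<Prod>v\<in>B j. l ^ k v)"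
    unfolding C_def by (rule prod.UNION_disjoint) (use fin disj in auto)
  also have "\<dots> = (\<Prod>j=1..r. l ^ (j * dim (V j)))"
    by (rule prod.cong) (simp_all add: k B(4) power_mult)
  also have "\<dots> = l ^ hom_dim r V" by (simp add: hom_dim_def power_sum)
  finally show ?thesis by (simp add: power_abs)
qed

lemma nn_integral_\<delta>:
  assumes "l > 0" "f \<in> borel_measurable borel"
  shows "(\<integral>\<^sup>+x. f x \<partial>lborel) = ennreal (l ^ hom_dim r V) * (\<integral>\<^sup>+x. f (\<delta> l x) \<partial>lborel)"
  by (rule nn_integral_bij_const_jacobian[where T'="\<lambda>_. \<delta> l"])
    (use assms in \<open>auto simp: bij_\<delta> ldet_\<delta> intro: bounded_linear_imp_has_derivative bounded_linear_\<delta>\<close>)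

abbreviation N :: "'a \<Rightarrow> real" where "N \<equiv> hom_norm r P"

lemma N_nonneg: "0 \<le> N x" by (simp add: hom_norm_def)

lemma N_continuous: "continuous_on S N"
  unfolding hom_norm_def
proof (rule continuous_on_powr')
  show "continuous_on S (\<lambda>x. \<Sum>j=1..r. norm (P j x) powr (2 * fact r / real j))"
    by (intro continuous_on_sum continuous_on_powr' continuous_intros linear_continuous_on
        linear_linear[THEN iffD2] P_linear) auto
qed (auto intro: continuous_intros simp: sum_nonneg)

lemma N_measurable [measurable]: "N \<in> borel_measurable borel"
  by (rule borel_measurable_continuous_onI[OF N_continuous])

lemma norm_P1_le_N: "norm (P 1 x) \<le> N x"
proof -
  have 1: "1 \<in> {1..r}" using r_ge1 by simp
  have "norm (P 1 x) = (norm (P 1 x) powr (2 * fact r)) powr (1 / (2 * fact r))"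
    by (simp add: powr_powr)
  also have "\<dots> \<le> N x"
    unfolding hom_norm_def
  proof (rule powr_mono2)
    have "norm (P 1 x) powr (2 * fact r / real 1) \<le> (\<Sum>j=1..r. norm (P j x) powr (2 * fact r / real j))"
      by (rule member_le_sum[OF 1]) auto
    then show "norm (P 1 x) powr (2 * fact r) \<le> (\<Sum>j=1..r. norm (P j x) powr (2 * fact r / real j))" by simp
  qed auto
  finally show ?thesis .
qed

lemma N_eq_0: "N x = 0 \<longleftrightarrow> x = 0"
proof
  assume "N x = 0"
  then have "(\<Sum>j=1..r. norm (P j x) powr (2 * fact r / real j)) = 0" by (simp add: hom_norm_def)
  then have "P j x = 0" if "j \<in> {1..r}" for j
    using that by (subst (asm) sum_nonneg_eq_0_iff) auto
  then have "(\<Sum>j=1..r. P j x) = 0" by (intro sum.neutral) auto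
  then show "x = 0" by simp
next
  assume "x = 0"
  then show "N x = 0" by (simp add: hom_norm_def linear_0[OF P_linear])
qed

end

text \<open>Gaussian elimination: the equation \<open>p\<close> is solved for one unknown
  \<open>s0\<close>, which is substituted in the others. It supplies the algebraic relations behind
  the multiplicity bound.\<close>

lemma homogeneous_system:
  fixes a :: "'s \<Rightarrow> 'r \<Rightarrow> real"
  assumes "finite R" "finite S" "card R < card S"
  shows "\<exists>x. (\<exists>s\<in>S. x s \<noteq> 0) \<and> (\<forall>\<rho>\<in>R. (\<Sum>s\<in>S. x s * a s \<rho>) = 0)"
  using assms
proof (induction R arbitrary: S a rule: finite_induct)
  case empty
  then have "S \<noteq> {}" by auto
  then show ?case by (intro exI[of _ "\<lambda>_. 1"]) auto
next
  case (insert p R)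
  show ?case
  proof (cases "\<forall>s\<in>S. a s p = 0")
    case True
    obtain x where "\<exists>s\<in>S. x s \<noteq> 0" "\<forall>\<rho>\<in>R. (\<Sum>s\<in>S. x s * a s \<rho>) = 0"
      using insert.IH[of S a] insert.prems insert.hyps by auto
    then show ?thesis using True by (intro exI[of _ x]) auto
  next
    case False
    then obtain s0 where s0: "s0 \<in> S" "a s0 p \<noteq> 0" by blast
    let ?S = "S - {s0}" and ?a = "\<lambda>s \<rho>. a s \<rho> - a s p / a s0 p * a s0 \<rho>"
    have "card R < card ?S" using insert.prems insert.hyps s0 by simp
    then obtain x where x: "\<exists>s\<in>?S. x s \<noteq> 0" "\<forall>\<rho>\<in>R. (\<Sum>s\<in>?S. x s * ?a s \<rho>) = 0"
      using insert.IH[of ?S ?a] insert.prems by auto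
    let ?c = "- (\<Sum>s\<in>?S. x s * a s p / a s0 p)"
    let ?x = "x(s0 := ?c)"
    have eq: "(\<Sum>s\<in>S. ?x s * a s \<rho>) = (\<Sum>s\<in>?S. x s * ?a s \<rho>)" for \<rho>
    proof -
      have "(\<Sum>s\<in>S. ?x s * a s \<rho>) = ?c * a s0 \<rho> + (\<Sum>s\<in>?S. ?x s * a s \<rho>)"
        using insert.prems s0 by (subst sum.remove[of S s0]) auto
      also have "(\<Sum>s\<in>?S. ?x s * a s \<rho>) = (\<Sum>s\<in>?S. x s * a s \<rho>)" by (rule sum.cong) auto
      also have "?c * a s0 \<rho> = - (\<Sum>s\<in>?S. x s * (a s p / a s0 p * a s0 \<rho>))"
        by (simp add: sum_distrib_right mult.assoc)
      finally show ?thesis by (simp add: right_diff_distrib sum_subtractf)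
    qed
    have "(\<Sum>s\<in>?S. x s * ?a s p) = 0" using s0 by simp
    then have "\<forall>\<rho>\<in>insert p R. (\<Sum>s\<in>S. ?x s * a s \<rho>) = 0" using x(2) eq by auto
    moreover have "\<exists>s\<in>S. ?x s \<noteq> 0" using x(1) by auto
    ultimately show ?thesis by blast
  qed
qed

section \<open>Multiplicity of polynomial maps\<close>

text \<open>Each exponent is bounded separately by \<open>D\<close>, rather than the total degree,
  so that the number of monomials is exactly \<open>(D + 1) ^ card I\<close>. \<open>PiE\<close>
  makes the exponent functions extensional, so that each is counted once.\<close>

definition midx :: "'i set \<Rightarrow> nat \<Rightarrow> ('i \<Rightarrow> nat) set" where "midx I D = PiE I (\<lambda>_. {..D})"
definition mvmonom :: "'i set \<Rightarrow> ('i \<Rightarrow> nat) \<Rightarrow> ('i \<Rightarrow> real) \<Rightarrow> real" where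
  "mvmonom I g t = (\<Prod>i\<in>I. t i ^ g i)"

lemma finite_midx: "finite I \<Longrightarrow> finite (midx I D)"
  unfolding midx_def by (intro finite_PiE) auto

lemma card_midx: "finite I \<Longrightarrow> card (midx I D) = (D + 1) ^ card I"
  unfolding midx_def by (simp add: card_PiE)

lemma mvmonom_cong: "(\<And>i. i \<in> I \<Longrightarrow> g i = h i) \<Longrightarrow> mvmonom I g t = mvmonom I h t"
  unfolding mvmonom_def by (rule prod.cong) auto

definition deg_le :: "nat \<Rightarrow> ('a::euclidean_space \<Rightarrow> real) \<Rightarrow> bool" where
  "deg_le D f \<longleftrightarrow> (\<exists>c. \<forall>x. f x = (\<Sum>g\<in>midx Basis D. c g * mvmonom Basis g (\<lambda>b. x \<bullet> b)))"

lemma deg_le_mono: "g \<in> midx Basis D \<Longrightarrow> deg_le D (\<lambda>x. mvmonom Basis g (\<lambda>b. x \<bullet> b))"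
  unfolding deg_le_def
  by (rule exI[of _ "\<lambda>h. if h = g then 1 else 0"])
    (simp add: finite_midx if_distrib[of "\<lambda>c. c * _"] cong: if_cong)

lemma deg_le_add: "deg_le D f \<Longrightarrow> deg_le D g \<Longrightarrow> deg_le D (\<lambda>x. f x + g x)"
  unfolding deg_le_def
proof (elim exE)
  fix c d
  assume "\<forall>x. f x = (\<Sum>g\<in>midx Basis D. c g * mvmonom Basis g (\<lambda>b. x \<bullet> b))"
    "\<forall>x. g x = (\<Sum>g\<in>midx Basis D. d g * mvmonom Basis g (\<lambda>b. x \<bullet> b))"
  then show "\<exists>c. \<forall>x. f x + g x = (\<Sum>g\<in>midx Basis D. c g * mvmonom Basis g (\<lambda>b. x \<bullet> b))"
    by (intro exI[of _ "\<lambda>i. c i + d i"]) (simp add: sum.distrib distrib_right)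
qed

lemma deg_le_cmul: "deg_le D f \<Longrightarrow> deg_le D (\<lambda>x. k * f x)"
  unfolding deg_le_def
proof (elim exE)
  fix c
  assume "\<forall>x. f x = (\<Sum>g\<in>midx Basis D. c g * mvmonom Basis g (\<lambda>b. x \<bullet> b))"
  then show "\<exists>c. \<forall>x. k * f x = (\<Sum>g\<in>midx Basis D. c g * mvmonom Basis g (\<lambda>b. x \<bullet> b))"
    by (intro exI[of _ "\<lambda>i. k * c i"]) (simp add: sum_distrib_left mult.assoc)
qed

lemma deg_le_zero: "deg_le D (\<lambda>x. 0)"
  unfolding deg_le_def by (rule exI[of _ "\<lambda>_. 0"]) simp

lemma deg_le_sum: "finite I \<Longrightarrow> (\<And>i. i \<in> I \<Longrightarrow> deg_le D (f i)) \<Longrightarrow> deg_le D (\<lambda>x. \<Sum>i\<in>I. f i x)"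
  by (induction I rule: finite_induct) (auto intro: deg_le_add deg_le_zero)

lemma deg_le_mult:
  assumes "deg_le D f" "deg_le E h" shows "deg_le (D + E) (\<lambda>x::'a::euclidean_space. f x * h x)"
proof -
  obtain c where c: "\<And>x. f x = (\<Sum>g\<in>midx Basis D. c g * mvmonom Basis g (\<lambda>b. x \<bullet> b))"
    using assms(1) unfolding deg_le_def by blast
  obtain d where d: "\<And>x. h x = (\<Sum>g\<in>midx Basis E. d g * mvmonom Basis g (\<lambda>b. x \<bullet> b))"
    using assms(2) unfolding deg_le_def by blast
  let ?s = "\<lambda>g g'. restrict (\<lambda>b::'a. g b + g' b :: nat) Basis"
  have m: "mvmonom Basis g (\<lambda>b. x \<bullet> b) * mvmonom Basis g' (\<lambda>b. x \<bullet> b) = mvmonom Basis (?s g g') (\<lambda>b. x \<bullet> b)" for g g' and x :: 'a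
  proof -
    have "mvmonom Basis (?s g g') (\<lambda>b. x \<bullet> b) = mvmonom Basis (\<lambda>b. g b + g' b) (\<lambda>b. x \<bullet> b)"
      by (rule mvmonom_cong) simp
    then show ?thesis by (simp add: mvmonom_def power_add prod.distrib)
  qed
  have s: "?s g g' \<in> midx Basis (D + E)" if "g \<in> midx Basis D" "g' \<in> midx Basis E" for g g'
    using that unfolding midx_def by (force simp: PiE_iff intro: add_mono)
  have "(\<lambda>x. f x * h x) = (\<lambda>x. \<Sum>g\<in>midx Basis D. \<Sum>g'\<in>midx Basis E. (c g * d g') * mvmonom Basis (?s g g') (\<lambda>b. x \<bullet> b))"
    by (simp add: c d sum_product m[symmetric] mult_ac)
  moreover have "deg_le (D + E) (\<lambda>x. \<Sum>g\<in>midx Basis D. \<Sum>g'\<in>midx Basis E. (c g * d g') * mvmonom Basis (?s g g') (\<lambda>b. x \<bullet> b))"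
    by (intro deg_le_sum finite_midx finite_Basis deg_le_cmul deg_le_mono s)
  ultimately show ?thesis by simp
qed

lemma deg_le_const: "deg_le D (\<lambda>x. k)"
proof -
  have "deg_le D (\<lambda>x::'a. mvmonom Basis (restrict (\<lambda>_. 0) Basis) (\<lambda>b. x \<bullet> b))"
    by (rule deg_le_mono) (auto simp: midx_def)
  from deg_le_cmul[OF this, of k] show ?thesis by (simp add: mvmonom_def)
qed

lemma deg_le_coord: assumes "b \<in> Basis" shows "deg_le 1 (\<lambda>x. x \<bullet> b)"
proof -
  let ?g = "restrict (\<lambda>c. if c = b then 1 else 0) Basis :: 'a \<Rightarrow> nat"
  have "deg_le 1 (\<lambda>x::'a. mvmonom Basis ?g (\<lambda>b. x \<bullet> b))"
    by (rule deg_le_mono) (auto simp: midx_def)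
  moreover have "mvmonom Basis ?g (\<lambda>b. x \<bullet> b) = x \<bullet> b" for x
  proof -
    have "mvmonom Basis ?g (\<lambda>b. x \<bullet> b) = (\<Prod>c\<in>Basis. if c = b then x \<bullet> c else 1)"
      unfolding mvmonom_def by (rule prod.cong) auto
    then show ?thesis using assms by simp
  qed
  ultimately show ?thesis by simp
qed

lemma deg_le_upto: assumes "deg_le D f" "D \<le> E" shows "deg_le E f"
  using deg_le_mult[OF assms(1) deg_le_const[of "E - D" 1]] assms(2) by simp

lemma deg_le_power: "deg_le D f \<Longrightarrow> deg_le (k * D) (\<lambda>x. f x ^ k)"
proof (induction k)
  case 0 show ?case by (simp add: deg_le_const)
next
  case (Suc k) then show ?case using deg_le_mult[of D f "k * D" "\<lambda>x. f x ^ k"] by simp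
qed

lemma deg_le_prod:
  "finite I \<Longrightarrow> (\<And>i. i \<in> I \<Longrightarrow> deg_le D (f i)) \<Longrightarrow> deg_le (card I * D) (\<lambda>x. \<Prod>i\<in>I. f i x)"
proof (induction I rule: finite_induct)
  case empty show ?case by (simp add: deg_le_const)
next
  case (insert i I)
  then show ?case using deg_le_mult[of D "f i" "card I * D" "\<lambda>x. \<Prod>i\<in>I. f i x"] by simp
qed

lemma real_polynomial_function_deg_le:
  "real_polynomial_function f \<Longrightarrow> \<exists>D. deg_le D f"
proof (induction rule: real_polynomial_function.induct)
  case (linear f)
  then have l: "linear f" using bounded_linear.linear by blast
  have "f x = (\<Sum>b\<in>Basis. f b * (x \<bullet> b))" for x
  proof -
    have "f x = f (\<Sum>b\<in>Basis. (x \<bullet> b) *\<^sub>R b)" by (simp add: euclidean_representation)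
    also have "\<dots> = (\<Sum>b\<in>Basis. f b * (x \<bullet> b))"
      by (simp add: linear_sum[OF l] linear_cmul[OF l] mult.commute)
    finally show ?thesis .
  qed
  then have "f = (\<lambda>x. \<Sum>b\<in>Basis. f b * (x \<bullet> b))" by blast
  moreover have "deg_le 1 (\<lambda>x. \<Sum>b\<in>Basis. f b * (x \<bullet> b))"
    by (intro deg_le_sum deg_le_cmul deg_le_coord) auto
  ultimately show ?case by metis
next
  case (const c) show ?case using deg_le_const by blast
next
  case (add f g)
  then obtain D E where "deg_le D f" "deg_le E g" by blast
  then have "deg_le (max D E) f" "deg_le (max D E) g" using deg_le_upto by fastforce+
  then show ?case using deg_le_add by blast
next
  case (mult f g) then show ?case using deg_le_mult by blast
qed

text \<open>The enumeration is left free because two are used: \<open>Basis\<close> indexed by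
  itself, and \<open>Basis\<close> indexed by an initial segment of \<open>nat\<close>, where the
  variables are ordered.\<close>

lemma lborel_eq_PiM:
  fixes \<beta> :: "'i \<Rightarrow> 'a::euclidean_space"
  assumes \<beta>: "bij_betw \<beta> I Basis"
  shows "distr (PiM I (\<lambda>_. lborel)) borel (\<lambda>f. \<Sum>i\<in>I. f i *\<^sub>R \<beta> i) = lborel"
proof (rule lborel_eqI[symmetric])
  have fin: "finite I" using \<beta> bij_betw_finite finite_Basis by blast
  interpret finite_product_sigma_finite "\<lambda>_. lborel :: real measure" I by standard (rule fin)
  fix l u :: 'a assume le: "\<And>b. b \<in> Basis \<Longrightarrow> l \<bullet> b \<le> u \<bullet> b"
  let ?T = "\<lambda>f. \<Sum>i\<in>I. f i *\<^sub>R \<beta> i"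
  have [measurable]: "?T \<in> PiM I (\<lambda>_. lborel) \<rightarrow>\<^sub>M borel" by measurable
  have B: "\<beta> i \<in> Basis" if "i \<in> I" for i using \<beta> that by (auto simp: bij_betw_def)
  have inner: "?T f \<bullet> \<beta> j = f j" if j: "j \<in> I" for f j
  proof -
    have "?T f \<bullet> \<beta> j = (\<Sum>i\<in>I. f i * (\<beta> i \<bullet> \<beta> j))" by (simp add: inner_sum_left)
    also have "\<dots> = (\<Sum>i\<in>I. if i = j then f i else 0)"
      by (rule sum.cong) (use \<beta> B j in \<open>auto simp: inner_Basis bij_betw_def inj_on_def\<close>)
    finally show ?thesis using j fin by simp
  qed
  have "?T -` box l u \<inter> space (PiM I (\<lambda>_. lborel)) = PiE I (\<lambda>i. {l \<bullet> \<beta> i <..< u \<bullet> \<beta> i})"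
  proof (intro set_eqI)
    fix f
    have "?T f \<in> box l u \<longleftrightarrow> (\<forall>b\<in>\<beta> ` I. l \<bullet> b < ?T f \<bullet> b \<and> ?T f \<bullet> b < u \<bullet> b)"
      using \<beta> by (simp add: box_def bij_betw_def)
    also have "\<dots> \<longleftrightarrow> (\<forall>i\<in>I. l \<bullet> \<beta> i < f i \<and> f i < u \<bullet> \<beta> i)" using inner by auto
    finally show "f \<in> ?T -` box l u \<inter> space (PiM I (\<lambda>_. lborel)) \<longleftrightarrow> f \<in> PiE I (\<lambda>i. {l \<bullet> \<beta> i <..< u \<bullet> \<beta> i})"
      by (auto simp: space_PiM PiE_iff)
  qed
  then have "emeasure (distr (PiM I (\<lambda>_. lborel)) borel ?T) (box l u) = (\<Prod>i\<in>I. emeasure lborel {l \<bullet> \<beta> i <..< u \<bullet> \<beta> i})"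
    by (simp add: emeasure_distr measure_times)
  also have "\<dots> = (\<Prod>i\<in>I. ennreal ((u - l) \<bullet> \<beta> i))"
    using B le by (intro prod.cong) (auto simp: inner_diff_left)
  also have "\<dots> = ennreal (\<Prod>i\<in>I. (u - l) \<bullet> \<beta> i)"
    using B le by (intro prod_ennreal) (auto simp: inner_diff_left)
  also have "(\<Prod>i\<in>I. (u - l) \<bullet> \<beta> i) = (\<Prod>b\<in>Basis. (u - l) \<bullet> b)"
    using prod.reindex_bij_betw[OF \<beta>, of "\<lambda>b. (u - l) \<bullet> b"] .
  finally show "emeasure (distr (PiM I (\<lambda>_. lborel)) borel ?T) (box l u) = (\<Prod>b\<in>Basis. (u - l) \<bullet> b)" .
qed simp

text \<open>Fubini with one variable split off: by induction the coefficient of the power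
  \<open>g0 i\<close> of the new variable is nonzero for almost all values of the others, and then
  only finitely many values of the new variable are roots.\<close>

lemma polynomial_nonzero_AE:
  assumes "finite I" "\<exists>g\<in>midx I D. c g \<noteq> (0::real)"
  shows "AE t in PiM I (\<lambda>_. lborel). (\<Sum>g\<in>midx I D. c g * mvmonom I g t) \<noteq> 0"
  using assms
proof (induction I arbitrary: c rule: finite_induct)
  case empty
  then show ?case by (simp add: midx_def mvmonom_def)
next
  case (insert i I)
  interpret product_sigma_finite "\<lambda>_. lborel :: real measure" by standard
  define q where "q J e t = (\<Sum>g\<in>midx J D. e g * mvmonom J g t)" for J :: "'a set" and e t
  have fm: "finite (midx J D)" if "finite J" for J :: "'a set" using finite_midx that by blast
  have qm [measurable]: "q J e \<in> borel_measurable (PiM J (\<lambda>_. lborel))" for J e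
    unfolding q_def mvmonom_def by measurable
  have qs: "q (insert i I) c (t(i := y)) = (\<Sum>j\<le>D. q I (\<lambda>g. c (g(i := j))) t * y ^ j)" for t y
  proof -
    let ?f = "\<lambda>(j, g). g(i := j) :: 'a \<Rightarrow> nat"
    have im: "midx (insert i I) D = ?f ` ({..D} \<times> midx I D)"
      unfolding midx_def PiE_insert_eq by simp
    have inj: "inj_on ?f ({..D} \<times> midx I D)"
      using inj_combinator[OF insert.hyps(2), of "\<lambda>_. {..D}"] by (simp add: midx_def)
    have m: "mvmonom (insert i I) (g(i := j)) (t(i := y)) = mvmonom I g t * y ^ j" for g j
    proof -
      have "(\<Prod>k\<in>I. (t(i := y)) k ^ (g(i := j)) k) = (\<Prod>k\<in>I. t k ^ g k)"
        by (rule prod.cong) (use insert.hyps in auto)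
      then show ?thesis using insert.hyps by (simp add: mvmonom_def)
    qed
    have "q (insert i I) c (t(i := y)) = (\<Sum>(j, g)\<in>{..D} \<times> midx I D. c (g(i := j)) * (mvmonom I g t * y ^ j))"
      unfolding q_def im by (subst sum.reindex[OF inj]) (simp add: case_prod_beta m)
    also have "\<dots> = (\<Sum>j\<le>D. \<Sum>g\<in>midx I D. c (g(i := j)) * (mvmonom I g t * y ^ j))"
      by (rule sum.cartesian_product[symmetric])
    finally show ?thesis by (simp add: q_def sum_distrib_right mult.assoc)
  qed
  obtain g0 where g0: "g0 \<in> midx (insert i I) D" "c g0 \<noteq> 0" using insert.prems by blast
  let ?g1 = "restrict g0 I"
  have g1: "?g1 \<in> midx I D" "?g1(i := g0 i) = g0" "g0 i \<le> D"
    using g0(1) insert.hyps(2) by (auto simp: midx_def PiE_iff extensional_def fun_eq_iff)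
  have "AE t in PiM I (\<lambda>_. lborel). q I (\<lambda>g. c (g(i := g0 i))) t \<noteq> 0"
    unfolding q_def by (rule insert.IH) (use g1 g0 in metis)
  moreover have "(\<integral>\<^sup>+y. indicator {y. q (insert i I) c (t(i := y)) = 0} y \<partial>lborel) = 0"
    if "q I (\<lambda>g. c (g(i := g0 i))) t \<noteq> 0" for t
  proof -
    have "finite {y. (\<Sum>j\<le>D. q I (\<lambda>g. c (g(i := j))) t * y ^ j) = 0}"
      by (rule polyfun_roots_finite[of "\<lambda>j. q I (\<lambda>g. c (g(i := j))) t" "g0 i"]) (use that g1 in auto)
    then have f: "finite {y. q (insert i I) c (t(i := y)) = 0}" by (simp only: qs)
    then have "{y. q (insert i I) c (t(i := y)) = 0} \<in> null_sets lborel"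
      by (rule finite_imp_null_set_lborel)
    then show ?thesis by (simp add: null_sets_def)
  qed
  ultimately have "AE t in PiM I (\<lambda>_. lborel). (\<integral>\<^sup>+y. indicator {y. q (insert i I) c (t(i := y)) = 0} y \<partial>lborel) = 0"
    by (rule eventually_mono)
  then have "(\<integral>\<^sup>+t. (\<integral>\<^sup>+y. indicator {0} (q (insert i I) c (t(i := y))) \<partial>lborel) \<partial>PiM I (\<lambda>_. lborel)) = 0"
    by (subst nn_integral_cong_AE[where v="\<lambda>_. 0"]) (auto simp: indicator_def elim!: eventually_mono)
  then have "(\<integral>\<^sup>+t. indicator {0} (q (insert i I) c t) \<partial>PiM (insert i I) (\<lambda>_. lborel)) = 0"
    using insert.hyps by (subst product_nn_integral_insert) auto
  then have "AE t in PiM (insert i I) (\<lambda>_. lborel). indicator {0} (q (insert i I) c t) = (0::ennreal)"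
    by (subst (asm) nn_integral_0_iff_AE) auto
  then show ?case unfolding q_def by (auto elim!: eventually_mono simp: indicator_def)
qed

lemma polynomial_zero_null:
  assumes "\<exists>g\<in>midx Basis D. c g \<noteq> (0::real)"
  shows "{y::'a::euclidean_space. (\<Sum>g\<in>midx Basis D. c g * mvmonom Basis g (\<lambda>b. y \<bullet> b)) = 0} \<in> null_sets lborel"
proof -
  let ?q = "\<lambda>t. \<Sum>g\<in>midx Basis D. c g * mvmonom Basis g t"
  let ?T = "\<lambda>f. \<Sum>b\<in>Basis. f b *\<^sub>R b :: 'a"
  have T: "distr (PiM Basis (\<lambda>_. lborel)) borel ?T = (lborel :: 'a measure)"
    by (rule lborel_eq_PiM[of "\<lambda>b. b"]) (simp add: bij_betw_def)
  have [measurable]: "(\<lambda>y::'a. ?q (\<lambda>b. y \<bullet> b)) \<in> borel_measurable borel"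
    unfolding mvmonom_def by measurable
  have "?q (\<lambda>b. ?T f \<bullet> b) = ?q f" for f
    unfolding mvmonom_def by (intro sum.cong refl arg_cong2[where f="(*)"] prod.cong)
      (simp add: inner_sum_left inner_Basis if_distrib cong: if_cong)
  then have "AE f in PiM Basis (\<lambda>_. lborel). ?q (\<lambda>b. ?T f \<bullet> b) \<noteq> 0"
    using polynomial_nonzero_AE[OF finite_Basis assms] by simp
  then have "AE y in distr (PiM Basis (\<lambda>_. lborel)) borel ?T. ?q (\<lambda>b. y \<bullet> b) \<noteq> 0"
    by (subst AE_distr_iff) auto
  then show ?thesis unfolding T by (simp add: AE_iff_null_sets)
qed

text \<open>Coordinates of a solution of \<open>f t = y\<close> are roots of a polynomial whose coefficients depend
  only on \<open>y\<close>, since there are more monomials in \<open>f t\<close> and \<open>t \<bullet> b\<close> than polynomials of their degree.\<close>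

lemma polynomial_map_multiplicity:
  fixes f :: "'a::euclidean_space \<Rightarrow> 'a"
  assumes "polynomial_function f"
  shows "\<exists>K N. N \<in> null_sets lborel \<and> (\<forall>y. y \<notin> N \<longrightarrow> finite {t. f t = y} \<and> card {t. f t = y} \<le> (K::nat))"
proof -
  let ?n = "DIM('a)"
  have "\<forall>b\<in>Basis. \<exists>D. deg_le D (\<lambda>t. f t \<bullet> b)"
    using assms real_polynomial_function_deg_le unfolding polynomial_function_iff_Basis_inner by blast
  then obtain m' where m': "\<And>b. b \<in> Basis \<Longrightarrow> deg_le (m' b) (\<lambda>t. f t \<bullet> b)" by metis
  define m where "m = Max (m' ` Basis)"
  have m: "deg_le m (\<lambda>t. f t \<bullet> b)" if "b \<in> Basis" for b
    by (rule deg_le_upto[OF m'[OF that]]) (use that in \<open>auto simp: m_def\<close>)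
  \<comment> \<open>With \<open>n = DIM('a)\<close> the degrees fit as
    \<open>n D m + D = q D = E\<close>. The relation sought has \<open>(D + 1) ^ n * (D + 1)\<close>
    unknown coefficients, and the choice \<open>D = q ^ n\<close> leaves at most
    \<open>(q (D + 1)) ^ n = D * (D + 1) ^ n\<close> equations, which is fewer.\<close>
  define q where "q = ?n * m + 1"
  define D where "D = q ^ ?n"
  define E where "E = q * D"
  have poly: "deg_le E (\<lambda>t. mvmonom Basis g (\<lambda>b. f t \<bullet> b) * (t \<bullet> b0) ^ j)"
    if g: "g \<in> midx Basis D" and j: "j \<le> D" and b0: "b0 \<in> Basis" for g j b0
  proof -
    have "deg_le (D * m) (\<lambda>t. (f t \<bullet> b) ^ g b)" if "b \<in> Basis" for b
      by (rule deg_le_upto[OF deg_le_power[OF m[OF that]]]) (use g that in \<open>auto simp: midx_def PiE_iff\<close>)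
    then have "deg_le (?n * (D * m)) (\<lambda>t. mvmonom Basis g (\<lambda>b. f t \<bullet> b))"
      unfolding mvmonom_def by (intro deg_le_prod) auto
    moreover have "deg_le D (\<lambda>t. (t \<bullet> b0) ^ j)"
      by (rule deg_le_upto[OF deg_le_power[OF deg_le_coord[OF b0]]]) (use j in simp)
    ultimately have "deg_le (?n * (D * m) + D) (\<lambda>t. mvmonom Basis g (\<lambda>b. f t \<bullet> b) * (t \<bullet> b0) ^ j)"
      by (rule deg_le_mult)
    moreover have "?n * (D * m) + D = E" by (simp add: E_def q_def algebra_simps)
    ultimately show ?thesis by simp
  qed
  have rel: "\<exists>x. (\<exists>s\<in>midx Basis D \<times> {..D}. x s \<noteq> 0) \<and>
      (\<forall>t. (\<Sum>(g, j)\<in>midx Basis D \<times> {..D}. x (g, j) * (mvmonom Basis g (\<lambda>b. f t \<bullet> b) * (t \<bullet> b0) ^ j)) = 0)"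
    if b0: "b0 \<in> Basis" for b0
  proof -
    let ?S = "midx (Basis :: 'a set) D \<times> {..D}"
    let ?F = "\<lambda>s t. mvmonom Basis (fst s) (\<lambda>b. f t \<bullet> b) * (t \<bullet> b0) ^ snd s"
    have "\<forall>s\<in>?S. \<exists>c. \<forall>t. ?F s t = (\<Sum>g\<in>midx Basis E. c g * mvmonom Basis g (\<lambda>b. t \<bullet> b))"
      using poly[OF _ _ b0] unfolding deg_le_def by auto
    from bchoice[OF this] obtain a where
      "\<forall>s\<in>?S. \<forall>t. ?F s t = (\<Sum>g\<in>midx Basis E. a s g * mvmonom Basis g (\<lambda>b. t \<bullet> b))" ..
    then have a: "\<And>s t. s \<in> ?S \<Longrightarrow> ?F s t = (\<Sum>g\<in>midx Basis E. a s g * mvmonom Basis g (\<lambda>b. t \<bullet> b))"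
      by blast
    have "E + 1 \<le> q * (D + 1)" by (simp add: E_def q_def)
    then have "(E + 1) ^ ?n \<le> (q * (D + 1)) ^ ?n" by (rule power_mono) simp
    also have "\<dots> = D * (D + 1) ^ ?n" by (simp only: power_mult_distrib D_def)
    also have "\<dots> < (D + 1) ^ ?n * (D + 1)" by simp
    finally have "card (midx (Basis :: 'a set) E) < card ?S"
      by (simp add: card_midx card_cartesian_product)
    from homogeneous_system[OF _ _ this, of a] obtain x where
      x: "\<exists>s\<in>?S. x s \<noteq> 0" "\<forall>g\<in>midx Basis E. (\<Sum>s\<in>?S. x s * a s g) = 0"
      using finite_midx finite_Basis by blast
    have "(\<Sum>s\<in>?S. x s * ?F s t) = 0" for t
    proof -
      have "(\<Sum>s\<in>?S. x s * ?F s t) = (\<Sum>s\<in>?S. \<Sum>g\<in>midx Basis E. x s * a s g * mvmonom Basis g (\<lambda>b. t \<bullet> b))"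
        by (rule sum.cong) (simp_all only: a sum_distrib_left mult.assoc)
      also have "\<dots> = (\<Sum>g\<in>midx Basis E. (\<Sum>s\<in>?S. x s * a s g) * mvmonom Basis g (\<lambda>b. t \<bullet> b))"
        by (subst sum.swap) (simp only: sum_distrib_right)
      also have "\<dots> = 0" using x(2) by simp
      finally show ?thesis .
    qed
    then show ?thesis using x(1) by (intro exI[of _ x]) (simp add: case_prod_beta)
  qed
  let ?R = "\<lambda>b0 x. (\<exists>s\<in>midx Basis D \<times> {..D}. x s \<noteq> 0) \<and>
      (\<forall>t. (\<Sum>(g, j)\<in>midx Basis D \<times> {..D}. x (g, j) * (mvmonom Basis g (\<lambda>b. f t \<bullet> b) * (t \<bullet> b0) ^ j)) = 0)"
  have "\<forall>b0\<in>Basis. \<exists>x. ?R b0 x" by (intro ballI rel)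
  from bchoice[OF this] obtain x where x: "\<forall>b0\<in>Basis. ?R b0 (x b0)" ..
  then have x1: "\<And>b0. b0 \<in> Basis \<Longrightarrow> \<exists>s\<in>midx Basis D \<times> {..D}. x b0 s \<noteq> 0"
    and x2: "\<And>b0 t. b0 \<in> Basis \<Longrightarrow> (\<Sum>(g, j)\<in>midx Basis D \<times> {..D}. x b0 (g, j) * (mvmonom Basis g (\<lambda>b. f t \<bullet> b) * (t \<bullet> b0) ^ j)) = 0"
    by blast+
  \<comment> \<open>\<open>h b0 j y\<close> is the coefficient of \<open>s ^ j\<close> in a
    polynomial in \<open>s\<close> that has \<open>t \<bullet> b0\<close> as a root whenever
    \<open>f t = y\<close>.\<close>
  define h where "h b0 j y = (\<Sum>g\<in>midx Basis D. x b0 (g, j) * mvmonom Basis g (\<lambda>b. y \<bullet> b))" for b0 j and y :: 'a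
  have "\<forall>b0\<in>Basis. \<exists>j\<le>D. {y. h b0 j y = 0} \<in> null_sets lborel"
  proof
    fix b0 :: 'a assume "b0 \<in> Basis"
    then obtain g j where "g \<in> midx Basis D" "j \<le> D" "x b0 (g, j) \<noteq> 0" using x1 by fastforce
    then show "\<exists>j\<le>D. {y. h b0 j y = 0} \<in> null_sets lborel"
      unfolding h_def using polynomial_zero_null[of D "\<lambda>g. x b0 (g, j)"] by blast
  qed
  from bchoice[OF this] obtain J where
    "\<forall>b0\<in>Basis. J b0 \<le> D \<and> {y. h b0 (J b0) y = 0} \<in> null_sets lborel" ..
  then have J: "\<And>b0. b0 \<in> Basis \<Longrightarrow> J b0 \<le> D \<and> {y. h b0 (J b0) y = 0} \<in> null_sets lborel" by blast
  \<comment> \<open>Outside \<open>N\<close> the coefficient with index \<open>J b0\<close> is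
    nonzero for every coordinate \<open>b0\<close>, so each of the one-variable polynomials has at
    most \<open>D\<close> roots.\<close>
  define N where "N = (\<Union>b0\<in>Basis. {y. h b0 (J b0) y = 0})"
  have "N \<in> null_sets lborel" unfolding N_def using J by (intro null_sets_UN') (auto intro: countable_finite)
  moreover have "finite {t. f t = y} \<and> card {t. f t = y} \<le> D ^ ?n" if y: "y \<notin> N" for y
  proof -
    define Z where "Z b0 = {s. (\<Sum>j\<le>D. h b0 j y * s ^ j) = 0}" for b0
    have Z: "finite (Z b0) \<and> card (Z b0) \<le> D" if "b0 \<in> Basis" for b0
      unfolding Z_def by (rule polyfun_rootbound) (use J[OF that] y that in \<open>auto simp: N_def\<close>)
    let ?c = "\<lambda>t. restrict (\<lambda>b. t \<bullet> b) (Basis :: 'a set)"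
    have "?c ` {t. f t = y} \<subseteq> PiE Basis Z"
    proof (rule image_subsetI)
      fix t assume "t \<in> {t. f t = y}"
      then have t: "f t = y" by simp
      have "t \<bullet> b0 \<in> Z b0" if "b0 \<in> Basis" for b0
      proof -
        have "(\<Sum>j\<le>D. h b0 j y * (t \<bullet> b0) ^ j) = (\<Sum>j\<le>D. \<Sum>g\<in>midx Basis D. x b0 (g, j) * (mvmonom Basis g (\<lambda>b. f t \<bullet> b) * (t \<bullet> b0) ^ j))"
          unfolding h_def t by (simp add: sum_distrib_right mult.assoc)
        also have "\<dots> = (\<Sum>g\<in>midx Basis D. \<Sum>j\<le>D. x b0 (g, j) * (mvmonom Basis g (\<lambda>b. f t \<bullet> b) * (t \<bullet> b0) ^ j))"
          by (rule sum.swap)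
        also have "\<dots> = 0" using x2[OF that, of t] by (simp add: sum.cartesian_product)
        finally show ?thesis unfolding Z_def by simp
      qed
      then show "?c t \<in> PiE Basis Z" by auto
    qed
    moreover have inj: "inj_on ?c {t. f t = y}"
      by (rule inj_onI) (metis euclidean_eqI restrict_apply')
    moreover have fin: "finite (PiE Basis Z)" using Z by (intro finite_PiE) auto
    ultimately have "finite {t. f t = y}" "card {t. f t = y} \<le> card (PiE Basis Z)"
      using inj_on_finite card_inj_on_le by blast+
    moreover have "card (PiE Basis Z) \<le> D ^ ?n"
      using prod_mono[of Basis "\<lambda>b. card (Z b)" "\<lambda>_. D"] Z by (simp add: card_PiE)
    ultimately show ?thesis by linarith
  qed
  ultimately show ?thesis by blast
qed

section \<open>Lower bounds for integrals of polynomials over towers\<close>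

text \<open>Polynomials in the first \<open>n\<close> coordinates, written as iterated one-variable polynomials so that
  leading coefficients in the last variable are accessible.\<close>

primrec iter_poly :: "nat \<Rightarrow> ((nat \<Rightarrow> real) \<Rightarrow> real) \<Rightarrow> bool" where
  "iter_poly 0 f \<longleftrightarrow> (\<exists>c. f = (\<lambda>_. c))"
| "iter_poly (Suc n) f \<longleftrightarrow> (\<exists>d a. (\<forall>i. iter_poly n (a i)) \<and> f = (\<lambda>t. \<Sum>i\<le>d::nat. a i t * t n ^ i))"

lemma iter_poly_cong: "iter_poly n f \<Longrightarrow> (\<And>k. k < n \<Longrightarrow> t k = t' k) \<Longrightarrow> f t = f t'"
proof (induction n arbitrary: f)
  case (Suc n)
  then obtain d a where a: "\<And>i. iter_poly n (a i)" "f = (\<lambda>t. \<Sum>i\<le>d::nat. a i t * t n ^ i)" by auto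
  have "a i t = a i t'" for i using Suc.IH[OF a(1)] Suc.prems(2) by simp
  then show ?case using Suc.prems(2)[of n] by (simp add: a(2))
qed auto

lemma iter_poly_const: "iter_poly n (\<lambda>_. c)"
proof (induction n arbitrary: c)
  case (Suc n)
  show ?case unfolding iter_poly.simps
    by (rule exI[of _ 0], rule exI[of _ "\<lambda>_ _. c"]) (simp add: Suc)
qed auto

lemma iter_poly_monom:
  assumes "iter_poly n g" shows "iter_poly (Suc n) (\<lambda>t. g t * t n ^ i)"
  unfolding iter_poly.simps
proof (intro exI conjI allI)
  show "iter_poly n ((\<lambda>j. if j = i then g else (\<lambda>_. 0)) j)" for j
    using assms iter_poly_const by simp
  have "(\<Sum>j\<le>i. (if j = i then g else (\<lambda>_. 0)) t * t n ^ j) = (\<Sum>j\<le>i. if j = i then g t * t n ^ j else 0)" for t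
    by (rule sum.cong) auto
  then show "(\<lambda>t. g t * t n ^ i) = (\<lambda>t. \<Sum>j\<le>i. (\<lambda>j. if j = i then g else (\<lambda>_. 0)) j t * t n ^ j)"
    by simp
qed

lemma iter_poly_Suc: "iter_poly n g \<Longrightarrow> iter_poly (Suc n) g"
  using iter_poly_monom[of n g 0] by simp

lemma iter_poly_add: "iter_poly n f \<Longrightarrow> iter_poly n g \<Longrightarrow> iter_poly n (\<lambda>t. f t + g t)"
proof (induction n arbitrary: f g)
  case 0 then show ?case by auto
next
  case (Suc n)
  obtain d a where a: "\<And>i. iter_poly n (a i)" "f = (\<lambda>t. \<Sum>i\<le>d::nat. a i t * t n ^ i)" using Suc.prems(1) by auto
  obtain e b where b: "\<And>i. iter_poly n (b i)" "g = (\<lambda>t. \<Sum>i\<le>e::nat. b i t * t n ^ i)" using Suc.prems(2) by auto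
  let ?a = "\<lambda>i. if i \<le> d then a i else (\<lambda>_. 0)" and ?b = "\<lambda>i. if i \<le> e then b i else (\<lambda>_. 0)"
  have ext: "(\<Sum>i\<le>d. c i t * t n ^ i) = (\<Sum>i\<le>max d e. (if i \<le> d then c i else (\<lambda>_. 0)) t * t n ^ i)"
    for d e and c :: "nat \<Rightarrow> (nat \<Rightarrow> real) \<Rightarrow> real" and t
    by (rule sum.mono_neutral_cong_left) auto
  have "iter_poly n (\<lambda>t. ?a i t + ?b i t)" for i
    by (rule Suc.IH) (use a(1) b(1) iter_poly_const in auto)
  moreover have "(\<lambda>t. f t + g t) = (\<lambda>t. \<Sum>i\<le>max d e. (?a i t + ?b i t) * t n ^ i)"
    unfolding a(2) b(2) using ext[where d=d and e=e and c=a] ext[where d=e and e=d and c=b]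
    by (simp add: sum.distrib distrib_right max.commute)
  ultimately show ?case unfolding iter_poly.simps by (intro exI[of _ "max d e"] exI[of _ "\<lambda>i t. ?a i t + ?b i t"]) simp
qed

lemma iter_poly_sum:
  "finite I \<Longrightarrow> (\<And>i. i \<in> I \<Longrightarrow> iter_poly n (f i)) \<Longrightarrow> iter_poly n (\<lambda>t. \<Sum>i\<in>I. f i t)"
  by (induction I rule: finite_induct) (auto intro: iter_poly_add iter_poly_const)

lemma iter_poly_mult: "iter_poly n f \<Longrightarrow> iter_poly n g \<Longrightarrow> iter_poly n (\<lambda>t. f t * g t)"
proof (induction n arbitrary: f g)
  case 0 then show ?case by auto
next
  case (Suc n)
  obtain d a where a: "\<And>i. iter_poly n (a i)" "f = (\<lambda>t. \<Sum>i\<le>d::nat. a i t * t n ^ i)" using Suc.prems(1) by auto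
  obtain e b where b: "\<And>i. iter_poly n (b i)" "g = (\<lambda>t. \<Sum>i\<le>e::nat. b i t * t n ^ i)" using Suc.prems(2) by auto
  have "(\<lambda>t. f t * g t) = (\<lambda>t. \<Sum>i\<le>d. \<Sum>j\<le>e. (a i t * b j t) * t n ^ (i + j))"
    unfolding a(2) b(2) by (simp add: sum_product power_add mult_ac)
  moreover have "iter_poly (Suc n) (\<lambda>t. \<Sum>i\<le>d. \<Sum>j\<le>e. (a i t * b j t) * t n ^ (i + j))"
    by (intro iter_poly_sum iter_poly_monom Suc.IH a(1) b(1)) auto
  ultimately show ?case by (simp only:)
qed

lemma iter_poly_coord: "k < n \<Longrightarrow> iter_poly n (\<lambda>t. t k)"
proof (induction n)
  case (Suc n)
  show ?case
  proof (cases "k = n")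
    case True
    then show ?thesis using iter_poly_monom[OF iter_poly_const[of n 1], of 1] by simp
  next
    case False
    then show ?thesis using Suc by (intro iter_poly_Suc) auto
  qed
qed simp

lemma iter_poly_measurable:
  "iter_poly n f \<Longrightarrow> f \<in> borel_measurable (PiM {..<n} (\<lambda>_. lborel))"
proof -
  \<comment> \<open>Generalised to larger index sets: the coefficients involve fewer coordinates but
    have to be measurable on the same product space.\<close>
  have "iter_poly n f \<Longrightarrow> {..<n} \<subseteq> I \<Longrightarrow> f \<in> borel_measurable (PiM I (\<lambda>_. lborel))" for I
  proof (induction n arbitrary: f)
    case (Suc n)
    then obtain d a where a: "\<And>i. iter_poly n (a i)" "f = (\<lambda>t. \<Sum>i\<le>d::nat. a i t * t n ^ i)" by auto
    have [measurable]: "a i \<in> borel_measurable (PiM I (\<lambda>_. lborel))" for i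
      by (rule Suc.IH[OF a(1)]) (use Suc.prems in auto)
    have "n \<in> I" using Suc.prems by auto
    then have [measurable]: "(\<lambda>t. t n) \<in> borel_measurable (PiM I (\<lambda>_. lborel))"
      using measurable_component_singleton[of n I "\<lambda>_. lborel :: real measure"] by simp
    show ?case unfolding a(2) by measurable
  qed auto
  then show "iter_poly n f \<Longrightarrow> f \<in> borel_measurable (PiM {..<n} (\<lambda>_. lborel))" by blast
qed

lemma iter_poly_real_polynomial:
  assumes "real_polynomial_function f"
  shows "iter_poly n (\<lambda>t. f (\<Sum>k<n. t k *\<^sub>R \<beta> k))"
  using assms
proof (induction rule: real_polynomial_function.induct)
  case (linear f)
  then have l: "linear f" using bounded_linear.linear by blast
  have "iter_poly n (\<lambda>t. \<Sum>k<n. t k * f (\<beta> k))"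
    by (intro iter_poly_sum iter_poly_mult iter_poly_coord iter_poly_const) auto
  then show ?case by (simp add: linear_sum[OF l] linear_cmul[OF l])
qed (auto intro: iter_poly_const iter_poly_add iter_poly_mult)

text \<open>Complex coefficients guarantee roots. A real \<open>x\<close> at distance at least
  \<open>\<epsilon>\<close> from the real part of every root violates the inequality, so
  \<open>degree p\<close> intervals of length \<open>2 \<epsilon>\<close> cover the set; the
  induction splits off one root at a time.\<close>

lemma poly_sublevel:
  fixes p :: "complex poly"
  assumes "\<epsilon> > 0"
  shows "emeasure lborel {x::real. norm (poly p (of_real x)) < norm (lead_coeff p) * \<epsilon> ^ degree p}
    \<le> ennreal (2 * real (degree p) * \<epsilon>)"
proof (induction "degree p" arbitrary: p)
  case 0
  then obtain a where "p = [:a:]" by (metis degree_eq_zeroE)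
  then show ?case by simp
next
  case (Suc d)
  let ?S = "\<lambda>p::complex poly. {x::real. norm (poly p (of_real x)) < norm (lead_coeff p) * \<epsilon> ^ degree p}"
  have "\<not> constant (poly p)" using Suc.hyps by (simp add: constant_degree)
  then obtain z where "poly p z = 0" using fundamental_theorem_of_algebra by blast
  then obtain q where q: "p = [:- z, 1:] * q" by (auto simp: poly_eq_0_iff_dvd dvd_def)
  have "q \<noteq> 0" using q Suc.hyps by auto
  then have deg: "degree p = Suc (degree q)" unfolding q by (subst degree_mult_eq) auto
  have lead: "lead_coeff p = lead_coeff q" unfolding q by (simp only: lead_coeff_mult) simp
  have m: "?S p \<in> sets borel" for p
    unfolding poly_altdef by (intro borel_open open_Collect_less continuous_intros)
  have sub: "?S p \<subseteq> {Re z - \<epsilon> <..< Re z + \<epsilon>} \<union> ?S q"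
  proof
    fix x assume x: "x \<in> ?S p"
    show "x \<in> {Re z - \<epsilon> <..< Re z + \<epsilon>} \<union> ?S q"
    proof (rule ccontr)
      assume n: "x \<notin> {Re z - \<epsilon> <..< Re z + \<epsilon>} \<union> ?S q"
      then have "\<epsilon> \<le> \<bar>Re (of_real x - z)\<bar>" by auto
      also have "\<dots> \<le> norm (of_real x - z)" by (rule abs_Re_le_cmod)
      finally have 1: "\<epsilon> \<le> norm (of_real x - z)" .
      have 2: "norm (lead_coeff q) * \<epsilon> ^ degree q \<le> norm (poly q (of_real x))" using n by auto
      have "\<epsilon> * (norm (lead_coeff q) * \<epsilon> ^ degree q) \<le> norm (of_real x - z) * norm (poly q (of_real x))"
        by (rule mult_mono[OF 1 2]) (use assms in auto)
      also have "\<dots> = norm (poly p (of_real x))" by (simp add: q norm_mult[symmetric] algebra_simps)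
      finally show False using x deg lead by (simp add: mult_ac)
    qed
  qed
  have "emeasure lborel (?S p) \<le> emeasure lborel ({Re z - \<epsilon> <..< Re z + \<epsilon>} \<union> ?S q)"
    by (rule emeasure_mono[OF sub]) (use m in auto)
  also have "\<dots> \<le> emeasure lborel {Re z - \<epsilon> <..< Re z + \<epsilon>} + emeasure lborel (?S q)"
    by (rule emeasure_subadditive) (use m in auto)
  also have "\<dots> \<le> ennreal (2 * \<epsilon>) + ennreal (2 * real (degree q) * \<epsilon>)"
    using Suc.hyps(1)[of q] Suc.hyps(2) deg assms by (intro add_mono) auto
  also have "\<dots> = ennreal (2 * real (degree p) * \<epsilon>)"
    using assms by (simp add: deg ennreal_plus[symmetric] algebra_simps del: ennreal_plus)
  finally show ?case .
qed

text \<open>With \<open>\<epsilon> = 1 / (4 (d + 1))\<close> the exceptional set of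
  \<open>poly_sublevel\<close> has measure at most \<open>2 d \<epsilon> \<le> 1/2\<close>. So a set
  of measure at least 1 retains a part of measure at least 1/2 on which the polynomial is at least
  \<open>\<epsilon> ^ d\<close> times its leading coefficient in absolute value.\<close>

definition sublevel_const :: "nat \<Rightarrow> real" where
  "sublevel_const d = (1 / (4 * (real d + 1))) ^ d / 2"

lemma sublevel_const_pos: "sublevel_const d > 0"
  by (simp add: sublevel_const_def)

lemma poly_integral_lower_bound:
  fixes a :: "nat \<Rightarrow> real"
  assumes T: "T \<in> sets borel" "1 \<le> emeasure lborel T"
  shows "ennreal (sublevel_const d * \<bar>a d\<bar>) \<le> (\<integral>\<^sup>+x. ennreal \<bar>\<Sum>i\<le>d. a i * x ^ i\<bar> * indicator T x \<partial>lborel)"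
proof (cases "a d = 0")
  case False
  define p :: "complex poly" where "p = (\<Sum>i\<le>d. monom (of_real (a i)) i)"
  have cp: "coeff p k = (if k \<le> d then of_real (a k) else 0)" for k
    unfolding p_def by (simp add: coeff_sum)
  have deg: "degree p = d"
    by (rule antisym) (use False cp in \<open>auto intro: degree_le le_degree\<close>)
  have pp: "poly p (of_real x) = of_real (\<Sum>i\<le>d. a i * x ^ i)" for x
    by (simp add: p_def poly_sum poly_monom)
  define \<epsilon> :: real where "\<epsilon> = 1 / (4 * (real d + 1))"
  define h :: real where "h = 1 / 2"
  have h: "h > 0" "h + h = 1" by (simp_all add: h_def)
  have \<epsilon>: "\<epsilon> > 0" "2 * real d * \<epsilon> \<le> h" by (simp_all add: \<epsilon>_def h_def field_simps)
  let ?B = "{x. \<bar>\<Sum>i\<le>d. a i * x ^ i\<bar> < \<bar>a d\<bar> * \<epsilon> ^ d}"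
  have B: "?B \<in> sets borel" by (intro borel_open open_Collect_less continuous_intros)
  have lead': "coeff p d = of_real (a d)" by (simp add: cp)
  have "?B = {x. norm (poly p (of_real x)) < norm (lead_coeff p) * \<epsilon> ^ degree p}"
    by (simp only: pp norm_of_real deg lead')
  then have "emeasure lborel ?B \<le> ennreal (2 * real d * \<epsilon>)"
    using poly_sublevel[OF \<epsilon>(1), of p] by (simp only: deg)
  also have "\<dots> \<le> ennreal h" using \<epsilon> by (intro ennreal_leI)
  finally have Bs: "emeasure lborel ?B \<le> ennreal h" .
  have half: "ennreal h \<le> emeasure lborel (T - ?B)"
  proof (rule ccontr)
    assume "\<not> ennreal h \<le> emeasure lborel (T - ?B)"
    then have l: "emeasure lborel (T - ?B) < ennreal h" by simp
    have "1 \<le> emeasure lborel T" by (rule T)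
    also have "\<dots> \<le> emeasure lborel ((T - ?B) \<union> ?B)"
      using T B by (intro emeasure_mono) auto
    also have "\<dots> \<le> emeasure lborel (T - ?B) + emeasure lborel ?B"
      using T B by (intro emeasure_subadditive) auto
    also have "\<dots> < ennreal h + ennreal h"
    proof -
      obtain e where e: "emeasure lborel (T - ?B) = ennreal e" "0 \<le> e" "e < h"
        using l by (cases "emeasure lborel (T - ?B)") (auto simp: ennreal_less_iff)
      obtain b where b: "emeasure lborel ?B = ennreal b" "0 \<le> b" "b \<le> h"
        using Bs h by (cases "emeasure lborel ?B") (auto simp: top_unique)
      have "ennreal (e + b) < ennreal (h + h)" using e b h by (intro ennreal_lessI) auto
      moreover have "ennreal (e + b) = ennreal e + ennreal b" "ennreal (h + h) = ennreal h + ennreal h"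
        by (rule ennreal_plus; use e(2) b(2) h(1) in simp)+
      ultimately show ?thesis by (simp only: e(1) b(1))
    qed
    also have "\<dots> = 1" using h by (simp add: ennreal_plus[symmetric] del: ennreal_plus)
    finally show False by simp
  qed
  have "ennreal (sublevel_const d * \<bar>a d\<bar>) = ennreal (\<bar>a d\<bar> * \<epsilon> ^ d) * ennreal h"
    using \<epsilon> h by (subst ennreal_mult[symmetric]) (auto simp: sublevel_const_def \<epsilon>_def h_def mult_ac)
  also have "\<dots> \<le> ennreal (\<bar>a d\<bar> * \<epsilon> ^ d) * emeasure lborel (T - ?B)"
    using half by (rule mult_left_mono) simp
  also have "\<dots> = (\<integral>\<^sup>+x. ennreal (\<bar>a d\<bar> * \<epsilon> ^ d) * indicator (T - ?B) x \<partial>lborel)"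
    using T B by (subst nn_integral_cmult_indicator) auto
  also have "\<dots> \<le> (\<integral>\<^sup>+x. ennreal \<bar>\<Sum>i\<le>d. a i * x ^ i\<bar> * indicator T x \<partial>lborel)"
    by (intro nn_integral_mono) (auto simp: indicator_def intro: ennreal_leI)
  finally show ?thesis .
qed simp

text \<open>\<open>R k\<close> is the floor of the tower in the first \<open>k\<close> coordinates,
  and \<open>\<lambda>_. undefined\<close> is the only point of the empty product. The last variable
  is integrated first: over a fibre of measure at least 1 the integral dominates the leading
  coefficient, a polynomial in the remaining variables to which induction applies. It is essential
  that \<open>c\<close> does not depend on \<open>R\<close>.\<close>

lemma tower_lower_bound:
  assumes "iter_poly n f" "\<exists>t. f t \<noteq> 0"
  shows "\<exists>c>0. \<forall>R. (\<forall>k\<le>n. Measurable.pred (PiM {..<k} (\<lambda>_. lborel)) (R k)) \<longrightarrow> R 0 (\<lambda>_. undefined) \<longrightarrow>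
      (\<forall>k<n. \<forall>t. R k t \<longrightarrow> 1 \<le> emeasure lborel {s. R (Suc k) (t(k := s))}) \<longrightarrow>
      ennreal c \<le> (\<integral>\<^sup>+t. (if R n t then ennreal \<bar>f t\<bar> else 0) \<partial>PiM {..<n} (\<lambda>_. lborel))"
  using assms
proof (induction n arbitrary: f)
  case 0
  then obtain c where c: "f = (\<lambda>_. c)" "c \<noteq> 0" by auto
  interpret product_sigma_finite "\<lambda>_::nat. lborel :: real measure" by standard
  show ?case
    by (rule exI[of _ "\<bar>c\<bar>"]) (use c in \<open>auto simp: nn_integral_empty\<close>)
next
  case (Suc n)
  interpret product_sigma_finite "\<lambda>_::nat. lborel :: real measure" by standard
  obtain d a where a: "\<And>i. iter_poly n (a i)" "f = (\<lambda>t. \<Sum>i\<le>d::nat. a i t * t n ^ i)" using Suc.prems(1) by auto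
  let ?I = "{i. i \<le> d \<and> (\<exists>t. a i t \<noteq> 0)}"
  have "?I \<noteq> {}"
  proof
    assume "?I = {}"
    then have "f t = 0" for t unfolding a(2) by (intro sum.neutral) auto
    then show False using Suc.prems(2) by blast
  qed
  \<comment> \<open>The formal top coefficient may vanish identically; \<open>e\<close> is the
    largest index whose coefficient is not the zero function.\<close>
  define e where "e = Max ?I"
  have fin: "finite ?I" by simp
  have e: "e \<in> ?I" unfolding e_def by (rule Max_in[OF fin \<open>?I \<noteq> {}\<close>])
  have fe: "f t = (\<Sum>i\<le>e. a i t * t n ^ i)" for t
    unfolding a(2)
  proof (rule sum.mono_neutral_right)
    show "\<forall>i\<in>{..d} - {..e}. a i t * t n ^ i = 0"
      using Max_ge[OF fin] unfolding e_def[symmetric] by fastforce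
  qed (use e in auto)
  have "\<exists>t. a e t \<noteq> 0" using e by blast
  from Suc.IH[OF a(1) this] obtain c where c0: "c > 0" and cR: "\<forall>R. (\<forall>k\<le>n. Measurable.pred (PiM {..<k} (\<lambda>_. lborel)) (R k)) \<longrightarrow> R 0 (\<lambda>_. undefined) \<longrightarrow>
      (\<forall>k<n. \<forall>t. R k t \<longrightarrow> 1 \<le> emeasure lborel {s. R (Suc k) (t(k := s))}) \<longrightarrow>
      ennreal c \<le> (\<integral>\<^sup>+t. (if R n t then ennreal \<bar>a e t\<bar> else 0) \<partial>PiM {..<n} (\<lambda>_. lborel))"
    by (elim exE conjE)
  note c = c0 cR[rule_format]
  show ?case
  proof (intro exI[of _ "sublevel_const e * c"] conjI allI impI)
    show "0 < sublevel_const e * c" using c sublevel_const_pos by simp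
    fix R :: "nat \<Rightarrow> (nat \<Rightarrow> real) \<Rightarrow> bool"
    assume m: "\<forall>k\<le>Suc n. Measurable.pred (PiM {..<k} (\<lambda>_. lborel)) (R k)" and R0: "R 0 (\<lambda>_. undefined)"
      and fib: "\<forall>k<Suc n. \<forall>t. R k t \<longrightarrow> 1 \<le> emeasure lborel {s. R (Suc k) (t(k := s))}"
    have [measurable]: "Measurable.pred (PiM {..<n} (\<lambda>_. lborel)) (R n)" using m by simp
    have [measurable]: "Measurable.pred (PiM (insert n {..<n}) (\<lambda>_. lborel)) (R (Suc n))"
      using m by (simp flip: lessThan_Suc)
    have [measurable]: "f \<in> borel_measurable (PiM (insert n {..<n}) (\<lambda>_. lborel))"
      using iter_poly_measurable[OF Suc.prems(1)] by (simp add: lessThan_Suc)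
    have [measurable]: "a e \<in> borel_measurable (PiM {..<n} (\<lambda>_. lborel))"
      by (rule iter_poly_measurable[OF a(1)])
    have inner: "ennreal (sublevel_const e) * (if R n t then ennreal \<bar>a e t\<bar> else 0)
        \<le> (\<integral>\<^sup>+s. (if R (Suc n) (t(n := s)) then ennreal \<bar>f (t(n := s))\<bar> else 0) \<partial>lborel)"
      if t: "t \<in> space (PiM {..<n} (\<lambda>_. lborel))" for t
    proof (cases "R n t")
      case True
      let ?T = "{s. R (Suc n) (t(n := s))}"
      have "(\<lambda>s. t(n := s)) \<in> lborel \<rightarrow>\<^sub>M PiM (insert n {..<n}) (\<lambda>_. lborel)"
        by (rule measurable_fun_upd[where J="{..<n}"]) (use t in auto)
      then have "Measurable.pred lborel (\<lambda>s. R (Suc n) (t(n := s)))"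
        by (rule measurable_compose) measurable
      then have T: "?T \<in> sets borel" by (simp add: pred_def)
      have "a i (t(n := s)) = a i t" for i s by (rule iter_poly_cong[OF a(1)]) simp
      then have "f (t(n := s)) = (\<Sum>i\<le>e. a i t * s ^ i)" for s by (simp add: fe)
      then have "(\<integral>\<^sup>+s. (if R (Suc n) (t(n := s)) then ennreal \<bar>f (t(n := s))\<bar> else 0) \<partial>lborel)
          = (\<integral>\<^sup>+s. ennreal \<bar>\<Sum>i\<le>e. a i t * s ^ i\<bar> * indicator ?T s \<partial>lborel)"
        by (intro nn_integral_cong) (simp add: indicator_def)
      also have "\<dots> \<ge> ennreal (sublevel_const e * \<bar>a e t\<bar>)"
        by (rule poly_integral_lower_bound[OF T]) (use fib True in auto)
      finally show ?thesis using True sublevel_const_pos[of e] by (simp add: ennreal_mult less_imp_le)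
    qed simp
    have "ennreal (sublevel_const e * c) = ennreal (sublevel_const e) * ennreal c"
      using sublevel_const_pos[of e] c by (simp add: ennreal_mult less_imp_le)
    also have "\<dots> \<le> ennreal (sublevel_const e) * (\<integral>\<^sup>+t. (if R n t then ennreal \<bar>a e t\<bar> else 0) \<partial>PiM {..<n} (\<lambda>_. lborel))"
      by (intro mult_left_mono c(2)) (use m R0 fib in \<open>auto simp: fun_upd_def\<close>)
    also have "\<dots> = (\<integral>\<^sup>+t. ennreal (sublevel_const e) * (if R n t then ennreal \<bar>a e t\<bar> else 0) \<partial>PiM {..<n} (\<lambda>_. lborel))"
      by (rule nn_integral_cmult[symmetric]) measurable
    also have "\<dots> \<le> (\<integral>\<^sup>+t. (\<integral>\<^sup>+s. (if R (Suc n) (t(n := s)) then ennreal \<bar>f (t(n := s))\<bar> else 0) \<partial>lborel) \<partial>PiM {..<n} (\<lambda>_. lborel))"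
      by (rule nn_integral_mono[OF inner])
    also have "\<dots> = (\<integral>\<^sup>+t. (if R (Suc n) t then ennreal \<bar>f t\<bar> else 0) \<partial>PiM (insert n {..<n}) (\<lambda>_. lborel))"
      by (rule product_nn_integral_insert[symmetric]) auto
    finally show "ennreal (sublevel_const e * c) \<le> (\<integral>\<^sup>+t. (if R (Suc n) t then ennreal \<bar>f t\<bar> else 0) \<partial>PiM {..<Suc n} (\<lambda>_. lborel))"
      by (simp only: lessThan_Suc)
  qed
qed

text \<open>Functions with a symmetric second derivative include constants and linear maps and are
  closed under sums and products, so an induction replaces Schwarz's theorem.\<close>

lemma real_polynomial_function_second_derivative:
  assumes "real_polynomial_function (f :: 'a::euclidean_space \<Rightarrow> real)"
  shows "\<exists>f' f''. (\<forall>x. (f has_derivative f' x) (at x)) \<and>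
    (\<forall>x v. ((\<lambda>x. f' x v) has_derivative (\<lambda>u. f'' x u v)) (at x)) \<and> (\<forall>x u v. f'' x u v = (f'' x v u :: real))"
  using assms
proof induction
  case (linear f)
  then have "(f has_derivative f) (at x)" for x by (rule bounded_linear_imp_has_derivative)
  then show ?case by (intro exI[of _ "\<lambda>_. f"] exI[of _ "\<lambda>_ _ _. 0"]) auto
next
  case (const c)
  show ?case by (intro exI[of _ "\<lambda>_ _. 0"] exI[of _ "\<lambda>_ _ _. 0"]) auto
next
  case (add f g)
  then obtain f' f'' g' g'' where
    "\<forall>x. (f has_derivative f' x) (at x)" "\<forall>x v. ((\<lambda>x. f' x v) has_derivative (\<lambda>u. f'' x u v)) (at x)"
    "\<forall>x u v. f'' x u v = (f'' x v u :: real)"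
    "\<forall>x. (g has_derivative g' x) (at x)" "\<forall>x v. ((\<lambda>x. g' x v) has_derivative (\<lambda>u. g'' x u v)) (at x)"
    "\<forall>x u v. g'' x u v = (g'' x v u :: real)" by (elim exE conjE)
  then show ?case
    by (intro exI[of _ "\<lambda>x v. f' x v + g' x v"] exI[of _ "\<lambda>x u v. f'' x u v + g'' x u v"])
      (simp add: has_derivative_add)
next
  case (mult f g)
  then obtain f' f'' g' g'' where d:
    "\<forall>x. (f has_derivative f' x) (at x)" "\<forall>x v. ((\<lambda>x. f' x v) has_derivative (\<lambda>u. f'' x u v)) (at x)"
    "\<forall>x u v. f'' x u v = (f'' x v u :: real)"
    "\<forall>x. (g has_derivative g' x) (at x)" "\<forall>x v. ((\<lambda>x. g' x v) has_derivative (\<lambda>u. g'' x u v)) (at x)"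
    "\<forall>x u v. g'' x u v = (g'' x v u :: real)" by (elim exE conjE)
  show ?case
  proof (intro exI[of _ "\<lambda>x v. f x * g' x v + f' x v * g x"]
      exI[of _ "\<lambda>x u v. (f x * g'' x u v + f' x u * g' x v) + (f' x v * g' x u + f'' x u v * g x)"] conjI allI)
    show "((\<lambda>x. f x * g x) has_derivative (\<lambda>v. f x * g' x v + f' x v * g x)) (at x)" for x
      using d by (intro has_derivative_mult) auto
    show "((\<lambda>x. f x * g' x v + f' x v * g x) has_derivative
       (\<lambda>u. (f x * g'' x u v + f' x u * g' x v) + (f' x v * g' x u + f'' x u v * g x))) (at x)" for x v
      by (intro has_derivative_add has_derivative_mult d(1,2,4,5)[rule_format])
    show "(f x * g'' x u v + f' x u * g' x v) + (f' x v * g' x u + f'' x u v * g x)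
      = (f x * g'' x v u + f' x v * g' x u) + (f' x u * g' x v + f'' x v u * g x)" for x u v
      using d by simp
  qed
qed

lemma polynomial_second_derivative_symmetric:
  fixes F :: "'a::euclidean_space \<Rightarrow> 'b::euclidean_space"
  assumes "polynomial_function F" and F': "\<And>x. (F has_derivative F' x) (at x)"
    and E: "((\<lambda>x. F' x v) has_derivative E) (at x)" and E2: "((\<lambda>x. F' x u) has_derivative E2) (at x)"
  shows "E u = E2 v"
proof (rule euclidean_eqI)
  fix b :: 'b assume b: "b \<in> Basis"
  have "real_polynomial_function (\<lambda>x. F x \<bullet> b)"
    using assms(1) b unfolding polynomial_function_iff_Basis_inner by blast
  from real_polynomial_function_second_derivative[OF this] obtain f' f'' where
    f: "\<forall>x. ((\<lambda>x. F x \<bullet> b) has_derivative f' x) (at x)" "\<forall>x v. ((\<lambda>x. f' x v) has_derivative (\<lambda>u. f'' x u v)) (at x)"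
    "\<forall>x u v. f'' x u v = (f'' x v u :: real)" by (elim exE conjE)
  have "((\<lambda>x. F x \<bullet> b) has_derivative (\<lambda>v. F' x v \<bullet> b)) (at x)" for x
    by (rule has_derivative_inner_left[OF F'])
  then have eq: "(\<lambda>v. F' x v \<bullet> b) = f' x" for x
    using has_derivative_unique f(1) by blast
  have "((\<lambda>x. F' x v \<bullet> b) has_derivative (\<lambda>u. E u \<bullet> b)) (at x)"
    by (rule has_derivative_inner_left[OF E])
  moreover have "((\<lambda>x. F' x v \<bullet> b) has_derivative (\<lambda>u. f'' x u v)) (at x)"
    using f(2) fun_cong[OF eq] by simp
  ultimately have 1: "(\<lambda>u. E u \<bullet> b) = (\<lambda>u. f'' x u v)" by (rule has_derivative_unique)
  have "((\<lambda>x. F' x u \<bullet> b) has_derivative (\<lambda>u. E2 u \<bullet> b)) (at x)"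
    by (rule has_derivative_inner_left[OF E2])
  moreover have "((\<lambda>x. F' x u \<bullet> b) has_derivative (\<lambda>v. f'' x v u)) (at x)"
    using f(2) fun_cong[OF eq] by simp
  ultimately have 2: "(\<lambda>u. E2 u \<bullet> b) = (\<lambda>v. f'' x v u)" by (rule has_derivative_unique)
  show "E u \<bullet> b = E2 v \<bullet> b" using fun_cong[OF 1, of u] fun_cong[OF 2, of v] f(3) by simp
qed

section \<open>Horizontal words\<close>

context strat_group begin

definition Dgg :: "'a \<times> 'a \<Rightarrow> 'a \<times> 'a \<Rightarrow> 'a \<times> 'a \<Rightarrow> 'a" where
  "Dgg z w = frechet_derivative (\<lambda>z. Dg z w) (at z)"

lemma Dgg: "((\<lambda>z. Dg z w) has_derivative Dgg z w) (at z)"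
  unfolding Dgg_def by (intro frechet_derivative_works[THEN iffD1] Dg_differentiable) auto

lemma Dgg_symmetric: "Dgg z w u = Dgg z u w"
  by (rule polynomial_second_derivative_symmetric[OF gmul_polynomial gmul_has_derivative Dgg Dgg])

lemma Dg_expand: "Dg z w = (\<Sum>c\<in>Basis. (w \<bullet> c) *\<^sub>R Dg z c)"
proof -
  have "Dg z w = Dg z (\<Sum>c\<in>Basis. (w \<bullet> c) *\<^sub>R c)" by (simp add: euclidean_representation)
  also have "\<dots> = (\<Sum>c\<in>Basis. (w \<bullet> c) *\<^sub>R Dg z c)"
    by (simp only: linear_sum[OF linear_Dg] linear_cmul[OF linear_Dg])
  finally show ?thesis .
qed

lemma Dgg_expand: "Dgg z w p = (\<Sum>c\<in>Basis. (w \<bullet> c) *\<^sub>R Dgg z c p)"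
proof -
  have "((\<lambda>z. \<Sum>c\<in>Basis. (w \<bullet> c) *\<^sub>R Dg z c) has_derivative (\<lambda>p. \<Sum>c\<in>Basis. (w \<bullet> c) *\<^sub>R Dgg z c p)) (at z)"
    by (intro has_derivative_sum has_derivative_scaleR_right Dgg)
  then have "((\<lambda>z. Dg z w) has_derivative (\<lambda>p. \<Sum>c\<in>Basis. (w \<bullet> c) *\<^sub>R Dgg z c p)) (at z)"
    by (simp only: Dg_expand[symmetric])
  from fun_cong[OF has_derivative_unique[OF Dgg this]] show ?thesis .
qed

lemma vector_derivative_chain:
  assumes "(c has_vector_derivative c') (at t)" "(F has_derivative F') (at (c t))"
  shows "((\<lambda>s. F (c s)) has_vector_derivative F' c') (at t)"
proof -
  have "((\<lambda>s. F (c s)) has_derivative (\<lambda>h. F' (h *\<^sub>R c'))) (at t)"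
    using has_derivative_compose[OF assms(1)[unfolded has_vector_derivative_def] assms(2)] .
  then show ?thesis
    unfolding has_vector_derivative_def using linear_cmul[OF has_derivative_linear[OF assms(2)]] by simp
qed

lemma Dg_product_velocity:
  assumes p: "(p has_vector_derivative p') (at t)" and q: "(q has_vector_derivative q') (at t)"
  shows "((\<lambda>s. Dg (p s) (q s)) has_vector_derivative Dgg (p t) (q t) p' + Dg (p t) q') (at t)"
proof -
  have "((\<lambda>s. \<Sum>c\<in>Basis. (q s \<bullet> c) *\<^sub>R Dg (p s) c) has_vector_derivative
      (\<Sum>c\<in>Basis. (q t \<bullet> c) *\<^sub>R Dgg (p t) c p' + (q' \<bullet> c) *\<^sub>R Dg (p t) c)) (at t)"
  proof (intro has_vector_derivative_sum has_vector_derivative_scaleR)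
    fix c :: "'a \<times> 'a"
    show "((\<lambda>s. q s \<bullet> c) has_field_derivative q' \<bullet> c) (at t)"
      unfolding has_real_derivative_iff_has_vector_derivative
      by (rule bounded_linear.has_vector_derivative[OF bounded_linear_inner_left q])
    show "((\<lambda>s. Dg (p s) c) has_vector_derivative Dgg (p t) c p') (at t)"
      by (rule vector_derivative_chain[OF p Dgg])
  qed
  moreover have "(\<Sum>c\<in>Basis. (q t \<bullet> c) *\<^sub>R Dgg (p t) c p' + (q' \<bullet> c) *\<^sub>R Dg (p t) c)
      = Dgg (p t) (q t) p' + Dg (p t) q'"
    by (simp only: sum.distrib Dg_expand[symmetric] Dgg_expand[symmetric])
  ultimately show ?thesis by (simp only: Dg_expand[symmetric])
qed

definition AD :: "'a \<Rightarrow> 'a \<Rightarrow> 'a \<Rightarrow> 'a" where "AD Z x = frechet_derivative (\<lambda>z. A z Z) (at x)"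

lemma AD: "((\<lambda>z. A z Z) has_derivative AD Z x) (at x)"
  unfolding AD_def by (intro frechet_derivative_works[THEN iffD1] A_differentiable) auto

lemma A_0 [simp]: "A 0 Y = Y" by (simp add: A_def Dg_00)

lemma pair_velocity:
  assumes "(c has_vector_derivative v) (at t)" "(d has_vector_derivative w) (at t)"
  shows "((\<lambda>s. (c s, d s)) has_vector_derivative (v, w)) (at t)"
  using has_derivative_Pair[OF assms[unfolded has_vector_derivative_def]]
  unfolding has_vector_derivative_def by simp

lemma AD_line_velocity: "((\<lambda>s. A (s *\<^sub>R Y) Z) has_vector_derivative AD Z 0 Y) (at 0)"
  using vector_derivative_chain[OF line_velocity, of "\<lambda>z. A z Z" "AD Z 0" 0 Y] AD by simp

lemma AD_0: "AD Z 0 Y = Dgg (0, 0) (0, Z) (Y, 0)"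
proof -
  have "((\<lambda>s. (s *\<^sub>R Y, 0::'a)) has_vector_derivative (Y, 0)) (at 0)"
    by (intro pair_velocity line_velocity) auto
  from Dg_product_velocity[OF this, of "\<lambda>_. (0, Z)" 0]
  have "((\<lambda>s. A (s *\<^sub>R Y) Z) has_vector_derivative Dgg (0, 0) (0, Z) (Y, 0)) (at 0)"
    using linear_0[OF linear_Dg] by (simp add: A_def)
  with AD_line_velocity show ?thesis by (rule vector_derivative_unique_at)
qed

lemma left_line_velocity: "((\<lambda>s. x \<odot> s *\<^sub>R Y) has_vector_derivative A x Y) (at 0)"
  using gmul_vector_derivative[OF has_vector_derivative_const[of x "at 0"] line_velocity[of Y 0]]
  by (simp add: A_def)

text \<open>Left translation is conjugation followed by right translation. This second formula for
  left-invariant fields is what brings the bracket into their derivatives.\<close>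

lemma A_eq_right_Ad: "A y Z = Dg (0, y) (Ad y Z, 0)"
proof (rule vector_derivative_unique_at)
  show "((\<lambda>s. y \<odot> s *\<^sub>R Z) has_vector_derivative A y Z) (at 0)"
    by (rule left_line_velocity)
  have "((\<lambda>s. y \<odot> s *\<^sub>R Z \<odot> - y) has_vector_derivative Ad y Z) (at 0)"
    by (rule Ad_velocity[OF line_velocity]) simp
  from gmul_vector_derivative[OF this, of "\<lambda>_. y" 0]
  show "((\<lambda>s. y \<odot> s *\<^sub>R Z) has_vector_derivative Dg (0, y) (Ad y Z, 0)) (at 0)"
    by simp
qed

text \<open>The curve \<open>s \<mapsto> A (s *\<^sub>R Y) Z\<close> is differentiated in two ways.
  The definition of \<open>A\<close> gives \<open>Dgg (0, 0) (0, Z) (Y, 0)\<close>, and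
  \<open>A_eq_right_Ad\<close> gives \<open>Dgg (0, 0) (Z, 0) (0, Y) + br Y Z\<close>, whose first
  term is \<open>AD Y 0 Z\<close> by symmetry of \<open>Dgg\<close>.\<close>

lemma AD_0_br: "AD Z 0 Y - AD Y 0 Z = br Y Z"
proof -
  have "((\<lambda>s. (0::'a, s *\<^sub>R Y)) has_vector_derivative (0, Y)) (at 0)"
    by (intro pair_velocity line_velocity) auto
  moreover have "((\<lambda>s. (Ad (s *\<^sub>R Y) Z, 0::'a)) has_vector_derivative (br Y Z, 0)) (at 0)"
    by (intro pair_velocity Ad_line_velocity) auto
  ultimately have "((\<lambda>s. A (s *\<^sub>R Y) Z) has_vector_derivative
      Dgg (0, 0) (Z, 0) (0, Y) + Dg (0, 0) (br Y Z, 0)) (at 0)"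
    using Dg_product_velocity[of "\<lambda>s. (0, s *\<^sub>R Y)" "(0, Y)" 0 "\<lambda>s. (Ad (s *\<^sub>R Y) Z, 0)" "(br Y Z, 0)"]
    by (simp add: A_eq_right_Ad)
  then have "AD Z 0 Y = Dgg (0, 0) (Z, 0) (0, Y) + Dg (0, 0) (br Y Z, 0)"
    using AD_line_velocity vector_derivative_unique_at by blast
  then show ?thesis by (simp add: AD_0[of Y Z] Dg_00 Dgg_symmetric)
qed

lemma A_mult: "A (x \<odot> y) Z = Dg (x, y) (0, A y Z)"
proof (rule vector_derivative_unique_at)
  show "((\<lambda>s. (x \<odot> y) \<odot> s *\<^sub>R Z) has_vector_derivative A (x \<odot> y) Z) (at 0)"
    by (rule left_line_velocity)
  have "((\<lambda>s. y \<odot> s *\<^sub>R Z) has_vector_derivative A y Z) (at 0)"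
    by (rule left_line_velocity)
  from gmul_vector_derivative[OF _ this, of "\<lambda>_. x" 0]
  show "((\<lambda>s. (x \<odot> y) \<odot> s *\<^sub>R Z) has_vector_derivative Dg (x, y) (0, A y Z)) (at 0)"
    by (simp add: gassoc)
qed

text \<open>The bracket of left-invariant fields is the field of the bracket. Left translation to
  the identity leaves, besides \<open>A x (AD Z 0 Y)\<close>, a second derivative of the product in
  the directions \<open>(0, Z)\<close> and \<open>(0, Y)\<close>; it is symmetric and cancels, and
  \<open>AD_0_br\<close> applies.\<close>

lemma AD_commutator: "AD Z x (A x Y) - AD Y x (A x Z) = A x (br Y Z)"
proof -
  have *: "AD Z x (A x Y) = Dgg (x, 0) (0, Z) (0, Y) + A x (AD Z 0 Y)" for Y Z
  proof (rule vector_derivative_unique_at)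
    have c: "((\<lambda>s. x \<odot> s *\<^sub>R Y) has_vector_derivative A x Y) (at 0)"
      by (rule left_line_velocity)
    show "((\<lambda>s. A (x \<odot> s *\<^sub>R Y) Z) has_vector_derivative AD Z x (A x Y)) (at 0)"
      using vector_derivative_chain[OF c, of "\<lambda>z. A z Z" "AD Z x"] AD by simp
    have "((\<lambda>s. (x, s *\<^sub>R Y)) has_vector_derivative (0, Y)) (at 0)"
      by (intro pair_velocity line_velocity) auto
    moreover have "((\<lambda>s. (0::'a, A (s *\<^sub>R Y) Z)) has_vector_derivative (0, AD Z 0 Y)) (at 0)"
      by (intro pair_velocity AD_line_velocity) auto
    ultimately have "((\<lambda>s. Dg (x, s *\<^sub>R Y) (0, A (s *\<^sub>R Y) Z)) has_vector_derivative
        Dgg (x, 0 *\<^sub>R Y) (0, A (0 *\<^sub>R Y) Z) (0, Y) + Dg (x, 0 *\<^sub>R Y) (0, AD Z 0 Y)) (at 0)"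
      by (rule Dg_product_velocity)
    then show "((\<lambda>s. A (x \<odot> s *\<^sub>R Y) Z) has_vector_derivative
        Dgg (x, 0) (0, Z) (0, Y) + A x (AD Z 0 Y)) (at 0)"
      by (simp add: A_mult) (simp add: A_def)
  qed
  have "AD Z x (A x Y) - AD Y x (A x Z) = A x (AD Z 0 Y) - A x (AD Y 0 Z)"
    unfolding *[of Y Z] *[of Z Y] by (simp add: Dgg_symmetric[of _ "(0, Z)"])
  then show ?thesis by (simp add: linear_diff[OF linear_A, symmetric] AD_0_br)
qed

lemma inj_on_subspace_bounded_below:
  fixes D :: "'a \<Rightarrow> 'a"
  assumes D: "linear D" and B: "subspace B" and inj: "\<And>v. v \<in> B \<Longrightarrow> D v = 0 \<Longrightarrow> v = 0"
  obtains c where "c > 0" "\<And>v. v \<in> B \<Longrightarrow> c * norm v \<le> norm (D v)"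
proof -
  let ?S = "B \<inter> sphere 0 1"
  show thesis
  proof (cases "?S = {}")
    case True
    have "v = 0" if "v \<in> B" for v
    proof (rule ccontr)
      assume "v \<noteq> 0"
      then have "(1 / norm v) *\<^sub>R v \<in> ?S" using subspace_scale[OF B that] by simp
      then show False using True by blast
    qed
    then have "1 * norm v \<le> norm (D v)" if "v \<in> B" for v using that by (metis mult_1 norm_ge_zero norm_zero)
    then show thesis by (rule that[OF zero_less_one])
  next
    case False
    have "compact ?S" using closed_subspace[OF B] by (simp add: closed_Int_compact)
    moreover have "continuous_on ?S (\<lambda>v. norm (D v))"
      using D by (intro continuous_intros linear_continuous_on) (simp add: linear_linear)
    ultimately obtain v0 where v0: "v0 \<in> ?S" "\<And>v. v \<in> ?S \<Longrightarrow> norm (D v0) \<le> norm (D v)"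
      using continuous_attains_inf[of ?S "\<lambda>v. norm (D v)"] False by blast
    show thesis
    proof (rule that[of "norm (D v0)"])
      have "v0 \<noteq> 0" using v0(1) by auto
      then show "norm (D v0) > 0" using inj[of v0] v0(1) by auto
      fix v assume v: "v \<in> B"
      show "norm (D v0) * norm v \<le> norm (D v)"
      proof (cases "v = 0")
        case nz: False
        then have "(1 / norm v) *\<^sub>R v \<in> ?S" using subspace_scale[OF B v] by simp
        from v0(2)[OF this] have "norm (D v0) \<le> norm (D v) / norm v"
          by (simp add: linear_cmul[OF D])
        then show ?thesis using nz by (simp add: field_simps)
      qed (simp add: linear_0[OF D])
    qed
  qed
qed

lemma linear_expand: "linear D \<Longrightarrow> D v = (\<Sum>e\<in>Basis. (v \<bullet> e) *\<^sub>R D e)" for D :: "'a \<Rightarrow> 'b::real_vector"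
  by (metis (mono_tags, lifting) euclidean_representation linear_cmul linear_sum sum.cong)

lemma difference_quotient_tendsto:
  fixes f :: "real \<Rightarrow> 'b::real_normed_vector"
  assumes "(f has_vector_derivative f') (at 0)"
  shows "((\<lambda>e. (f e - f 0) /\<^sub>R e) \<longlongrightarrow> f') (at 0)"
proof -
  have *: "((\<lambda>h. norm (f h - f 0 - h *\<^sub>R f') / norm h) \<longlongrightarrow> 0) (at 0)"
    using assms unfolding has_vector_derivative_def has_derivative_at by simp
  have "((\<lambda>h. norm ((f h - f 0) /\<^sub>R h - f')) \<longlongrightarrow> 0) (at 0)"
  proof (rule Lim_transform_eventually[OF *])
    have "norm (f h - f 0 - h *\<^sub>R f') / norm h = norm ((f h - f 0) /\<^sub>R h - f')" if "h \<noteq> 0" for h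
    proof -
      have "(f h - f 0) /\<^sub>R h - f' = (f h - f 0 - h *\<^sub>R f') /\<^sub>R h"
        using that by (simp add: scaleR_diff_right)
      then show ?thesis by (simp add: divide_inverse mult.commute)
    qed
    then show "eventually (\<lambda>h. norm (f h - f 0 - h *\<^sub>R f') / norm h = norm ((f h - f 0) /\<^sub>R h - f')) (at 0)"
      by (auto simp: eventually_at_filter)
  qed
  then show ?thesis by (rule LIM_zero_cancel[OF tendsto_norm_zero_cancel])
qed

text \<open>In the application \<open>D\<close> is the derivative of a word and \<open>B\<close> the
  span of the variables that the word has used so far.\<close>

definition immersive :: "('a \<Rightarrow> 'a \<Rightarrow> 'a) \<Rightarrow> 'a set \<Rightarrow> 'a set" where
  "immersive D B = {t. \<forall>v\<in>B. D t v = 0 \<longrightarrow> v = 0}"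

text \<open>If the left-invariant fields of \<open>Y\<close> and \<open>Z\<close> are tangent to the image of \<open>\<Phi>\<close> wherever \<open>\<Phi>\<close> is
  immersive along \<open>B\<close>, then so is their commutator: this replaces the theorem of Frobenius.\<close>

context
  fixes \<Phi> :: "'a \<Rightarrow> 'a" and D :: "'a \<Rightarrow> 'a \<Rightarrow> 'a" and B :: "'a set"
  assumes poly: "polynomial_function \<Phi>" and D: "\<And>t. (\<Phi> has_derivative D t) (at t)"
    and Dpoly: "\<And>v. polynomial_function (\<lambda>t. D t v)" and B: "subspace B"
begin

lemma linear_D: "linear (D t)" using D has_derivative_linear by blast

text \<open>Along the line \<open>t + e a\<close> the field of \<open>Z\<close> is \<open>D\<close>
  applied to some \<open>bf e\<close> in \<open>B\<close>. A covector \<open>w\<close> that kills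
  the image of \<open>B\<close> sees the change of \<open>D\<close> but not that of
  \<open>bf\<close>, so convergence of \<open>bf e\<close> to \<open>b\<close> suffices, without
  differentiating \<open>bf\<close>.\<close>

lemma tangent_derivative:
  assumes t: "t \<in> immersive D B" and a: "a \<in> B" "D t a = A (\<Phi> t) Y" and b: "b \<in> B" "D t b = A (\<Phi> t) Z"
    and Z: "\<And>t. t \<in> immersive D B \<Longrightarrow> A (\<Phi> t) Z \<in> D t ` B"
    and w: "\<And>v. v \<in> B \<Longrightarrow> w \<bullet> D t v = 0"
    and E: "\<And>v. ((\<lambda>t. D t v) has_derivative E v) (at t)"
  shows "w \<bullet> AD Z (\<Phi> t) (A (\<Phi> t) Y) = w \<bullet> E b a"
proof -
  let ?t = "\<lambda>e. t + e *\<^sub>R a"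
  let ?G = "\<lambda>e. A (\<Phi> (?t e)) Z"
  have line: "(?t has_vector_derivative a) (at 0)"
    by (auto intro!: derivative_eq_intros simp: has_vector_derivative_def)
  have M': "((\<lambda>e. D (?t e) v) has_vector_derivative E v a) (at 0)" for v
    using vector_derivative_chain[OF line, of "\<lambda>t. D t v" "E v"] E by simp
  have "((\<lambda>e. \<Phi> (?t e)) has_vector_derivative D t a) (at 0)"
    using vector_derivative_chain[OF line, of \<Phi> "D t"] D by simp
  from vector_derivative_chain[OF this, of "\<lambda>z. A z Z" "AD Z (\<Phi> t)"]
  have G': "(?G has_vector_derivative AD Z (\<Phi> t) (D t a)) (at 0)" using AD by simp
  have Mlim: "((\<lambda>e. D (?t e) v) \<longlongrightarrow> D t v) (at 0)" for v
    using has_vector_derivative_continuous[OF M'[of v]] by (simp add: continuous_within)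
  have Glim: "(?G \<longlongrightarrow> A (\<Phi> t) Z) (at 0)"
    using has_vector_derivative_continuous[OF G'] by (simp add: continuous_within)
  obtain c where c: "c > 0" "\<And>v. v \<in> B \<Longrightarrow> c * norm v \<le> norm (D t v)"
    using inj_on_subspace_bounded_below[OF linear_D B, of t] t unfolding immersive_def by blast
  let ?s = "\<lambda>e. \<Sum>u\<in>Basis. norm (D (?t e) u - D t u)"
  have "(?s \<longlongrightarrow> (\<Sum>u\<in>Basis. norm (D t u - D t u))) (at 0)" by (intro tendsto_intros Mlim)
  then have ev0: "eventually (\<lambda>e. ?s e < c / 2) (at 0)" using c by (intro order_tendstoD) auto
  \<comment> \<open>Injectivity on \<open>B\<close> holds at \<open>t\<close> with a quantitative
    constant \<open>c\<close> and survives with \<open>c / 2\<close> at nearby points.\<close>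
  have low: "c / 2 * norm v \<le> norm (D (?t e) v)" if "?s e < c / 2" "v \<in> B" for e v
  proof -
    have "norm (D (?t e) v - D t v) \<le> onorm (\<lambda>v. D (?t e) v - D t v) * norm v"
      by (rule onorm) (intro bounded_linear_sub linear_linear[THEN iffD2] linear_D)
    also have "\<dots> \<le> ?s e * norm v"
      by (intro mult_right_mono onorm_le_sum_Basis linear_compose_sub linear_D) auto
    also have "\<dots> \<le> c / 2 * norm v" using that by (intro mult_right_mono) auto
    finally have "norm (D (?t e) v - D t v) \<le> c / 2 * norm v" .
    moreover have "norm (D t v) \<le> norm (D (?t e) v) + norm (D (?t e) v - D t v)"
      by (metis norm_minus_commute norm_triangle_sub)
    ultimately show ?thesis using c(2)[OF that(2)] by linarith
  qed
  have imm: "?t e \<in> immersive D B" if "?s e < c / 2" for e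
  proof -
    have "v = 0" if "v \<in> B" "D (?t e) v = 0" for v
    proof -
      have "c / 2 * norm v \<le> 0" using low[OF \<open>?s e < c / 2\<close> that(1)] that(2) by simp
      then show ?thesis using c(1) by (simp add: mult_le_0_iff)
    qed
    then show ?thesis unfolding immersive_def by blast
  qed
  have "\<forall>e. \<exists>v. ?t e \<in> immersive D B \<longrightarrow> v \<in> B \<and> D (?t e) v = ?G e"
    using Z by (metis imageE)
  from choice[OF this] obtain bf where bf: "\<And>e. ?t e \<in> immersive D B \<Longrightarrow> bf e \<in> B \<and> D (?t e) (bf e) = ?G e" by blast
  \<comment> \<open>\<open>bf e - b\<close> lies in \<open>B\<close>, where \<open>D (?t e)\<close>
    is bounded below, and its image \<open>?G e - D (?t e) b\<close> tends to 0.\<close>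
  have blim: "(bf \<longlongrightarrow> b) (at 0)"
  proof (rule Lim_transform_bound[of "\<lambda>e. bf e - b" "\<lambda>e. (2 / c) *\<^sub>R (?G e - D (?t e) b)", THEN LIM_zero_cancel])
    show "eventually (\<lambda>e. norm (bf e - b) \<le> norm ((2 / c) *\<^sub>R (?G e - D (?t e) b))) (at 0)"
      using ev0
    proof eventually_elim
      case (elim e)
      have m: "bf e - b \<in> B" using bf[OF imm[OF elim]] b(1) B by (intro subspace_diff) auto
      have "D (?t e) (bf e - b) = ?G e - D (?t e) b"
        using bf[OF imm[OF elim]] by (simp add: linear_diff[OF linear_D])
      then have "c / 2 * norm (bf e - b) \<le> norm (?G e - D (?t e) b)"
        using low[OF elim m] by simp
      then have "norm (bf e - b) \<le> 2 / c * norm (?G e - D (?t e) b)" using c(1) by (simp add: field_simps)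
      also have "\<dots> = norm ((2 / c) *\<^sub>R (?G e - D (?t e) b))" using c(1) by (simp only: norm_scaleR) simp
      finally show ?case .
    qed
    have "((\<lambda>e. (2 / c) *\<^sub>R (?G e - D (?t e) b)) \<longlongrightarrow> (2 / c) *\<^sub>R (A (\<Phi> t) Z - D t b)) (at 0)"
      by (intro tendsto_intros Glim Mlim)
    then show "((\<lambda>e. (2 / c) *\<^sub>R (?G e - D (?t e) b)) \<longlongrightarrow> 0) (at 0)" using b(2) by simp
  qed
  note quot = difference_quotient_tendsto
  have l1: "((\<lambda>e. w \<bullet> ((?G e - ?G 0) /\<^sub>R e)) \<longlongrightarrow> w \<bullet> AD Z (\<Phi> t) (D t a)) (at 0)"
    by (intro tendsto_intros quot[OF G'])
  have l2: "((\<lambda>e. \<Sum>u\<in>Basis. (bf e \<bullet> u) * (w \<bullet> ((D (?t e) u - D (?t 0) u) /\<^sub>R e))) \<longlongrightarrow>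
      (\<Sum>u\<in>Basis. (b \<bullet> u) * (w \<bullet> E u a))) (at 0)"
    by (intro tendsto_intros blim quot[OF M'])
  \<comment> \<open>\<open>w\<close> annihilates both \<open>?G 0\<close> and
    \<open>D t (bf e)\<close>, so the difference quotient of \<open>?G\<close> can be rewritten
    through those of \<open>D\<close>.\<close>
  have ev: "eventually (\<lambda>e. w \<bullet> ((?G e - ?G 0) /\<^sub>R e)
      = (\<Sum>u\<in>Basis. (bf e \<bullet> u) * (w \<bullet> ((D (?t e) u - D (?t 0) u) /\<^sub>R e)))) (at 0)"
    using ev0
  proof eventually_elim
    case (elim e)
    have G0: "w \<bullet> ?G 0 = 0" using w[OF b(1)] b(2) by simp
    have z: "w \<bullet> D t (bf e) = 0" using w bf[OF imm[OF elim]] by blast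
    have "(\<Sum>u\<in>Basis. (bf e \<bullet> u) * (w \<bullet> ((D (?t e) u - D (?t 0) u) /\<^sub>R e)))
       = w \<bullet> ((\<Sum>u\<in>Basis. (bf e \<bullet> u) *\<^sub>R D (?t e) u) - (\<Sum>u\<in>Basis. (bf e \<bullet> u) *\<^sub>R D t u)) / e"
      by (simp add: inner_sum_right inner_diff_right sum_subtractf[symmetric] divide_inverse sum_distrib_left algebra_simps)
    also have "\<dots> = w \<bullet> (D (?t e) (bf e) - D t (bf e)) / e"
      by (simp only: linear_expand[OF linear_D, symmetric])
    also have "\<dots> = w \<bullet> ?G e / e" using bf[OF imm[OF elim]] z by (simp add: inner_diff_right)
    finally show ?case using G0 by (simp add: inner_diff_right divide_inverse mult.commute)
  qed
  have "w \<bullet> AD Z (\<Phi> t) (D t a) = (\<Sum>u\<in>Basis. (b \<bullet> u) * (w \<bullet> E u a))"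
    by (rule tendsto_unique[OF _ Lim_transform_eventually[OF l1 ev] l2]) simp
  also have "\<dots> = w \<bullet> E b a"
  proof -
    have "((\<lambda>t. \<Sum>u\<in>Basis. (b \<bullet> u) *\<^sub>R D t u) has_derivative (\<lambda>p. \<Sum>u\<in>Basis. (b \<bullet> u) *\<^sub>R E u p)) (at t)"
      by (intro has_derivative_sum has_derivative_scaleR_right E)
    then have "((\<lambda>t. D t b) has_derivative (\<lambda>p. \<Sum>u\<in>Basis. (b \<bullet> u) *\<^sub>R E u p)) (at t)"
      by (simp only: linear_expand[OF linear_D, symmetric])
    from fun_cong[OF has_derivative_unique[OF E this], of a] show ?thesis
      by (simp add: inner_sum_right)
  qed
  finally show ?thesis by (simp only: a(2))
qed

text \<open>The component \<open>z\<close> of \<open>A (\<Phi> t) (br Y Z)\<close> normal to the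
  image serves as the covector \<open>w\<close>. By \<open>AD_commutator\<close> its pairing with
  the field is a difference of second derivatives of \<open>\<Phi>\<close> in the directions
  \<open>a\<close> and \<open>b\<close>, in the two orders, which is 0.\<close>

lemma tangent_bracket:
  assumes Y: "\<And>t. t \<in> immersive D B \<Longrightarrow> A (\<Phi> t) Y \<in> D t ` B"
    and Z: "\<And>t. t \<in> immersive D B \<Longrightarrow> A (\<Phi> t) Z \<in> D t ` B" and t: "t \<in> immersive D B"
  shows "A (\<Phi> t) (br Y Z) \<in> D t ` B"
proof -
  obtain a where a: "a \<in> B" "D t a = A (\<Phi> t) Y" using Y[OF t] by (metis imageE)
  obtain b where b: "b \<in> B" "D t b = A (\<Phi> t) Z" using Z[OF t] by (metis imageE)
  define E where "E v = frechet_derivative (\<lambda>t. D t v) (at t)" for v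
  have E: "((\<lambda>t. D t v) has_derivative E v) (at t)" for v
    unfolding E_def using polynomial_function_derivative[OF Dpoly[of v]] frechet_derivative_at by metis
  have W: "subspace (D t ` B)" by (rule linear_subspace_image[OF linear_D B])
  let ?x = "A (\<Phi> t) (br Y Z)"
  obtain y z where yz: "y \<in> span (D t ` B)" "\<And>w. w \<in> span (D t ` B) \<Longrightarrow> orthogonal z w" "?x = y + z"
    using orthogonal_subspace_decomp_exists[of "D t ` B" ?x] by blast
  have sp: "span (D t ` B) = D t ` B" using W by (simp add: span_eq_iff)
  have z0: "z \<bullet> D t v = 0" if "v \<in> B" for v
    using yz(2)[of "D t v"] that by (simp add: sp orthogonal_def)
  have "z \<bullet> AD Z (\<Phi> t) (A (\<Phi> t) Y) = z \<bullet> E b a"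
    by (rule tangent_derivative[OF t a b Z z0 E])
  moreover have "z \<bullet> AD Y (\<Phi> t) (A (\<Phi> t) Z) = z \<bullet> E a b"
    by (rule tangent_derivative[OF t b a Y z0 E])
  moreover have "E b a = E a b"
    by (rule polynomial_second_derivative_symmetric[OF poly D E E])
  ultimately have "z \<bullet> ?x = 0"
    by (simp only: AD_commutator[symmetric] inner_diff_right diff_self)
  moreover have "z \<bullet> y = 0" using yz(1,2) by (simp add: orthogonal_def)
  ultimately have "z = 0" using yz(3) by (simp add: inner_add_right)
  then show ?thesis using yz(1,3) sp by simp
qed

text \<open>The \<open>Y\<close> whose fields are tangent at all immersive points form a subspace
  closed under brackets that contains \<open>V 1\<close>, hence everything. Since
  \<open>A (\<Phi> t)\<close> is onto, \<open>D t\<close> maps \<open>B\<close> onto the whole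
  space.\<close>

lemma tangent_to_generators_imp_full:
  assumes X: "V 1 \<subseteq> span X" "\<And>t x. t \<in> immersive D B \<Longrightarrow> x \<in> X \<Longrightarrow> A (\<Phi> t) x \<in> D t ` B" and t: "t \<in> immersive D B"
  shows "dim B = DIM('a)"
proof -
  let ?S = "{Y. \<forall>t\<in>immersive D B. A (\<Phi> t) Y \<in> D t ` B}"
  have W: "subspace (D t ` B)" for t by (rule linear_subspace_image[OF linear_D B])
  have sub: "subspace ?S"
    unfolding subspace_def
    using subspace_add[OF W] subspace_scale[OF W] subspace_0[OF W]
    by (simp add: linear_add[OF linear_A] linear_cmul[OF linear_A] linear_0[OF linear_A])
  have "X \<subseteq> ?S" using X(2) by blast
  then have "span X \<subseteq> ?S" using sub by (rule span_minimal)
  then have V: "V 1 \<subseteq> ?S" using X(1) by blast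
  have brS: "br x y \<in> ?S" if "x \<in> ?S" "y \<in> ?S" for x y
    using tangent_bracket[of x y] that by blast
  have "?S = UNIV" by (rule V1_generates[OF sub V brS])
  then have S: "A (\<Phi> t) Y \<in> D t ` B" for Y using t by blast
  have "surj (A (\<Phi> t))"
  proof -
    have "ldet (A (\<Phi> t)) \<noteq> 0" using ldet_Dg(2)[of "\<Phi> t" 0] by (simp add: A_def[abs_def])
    then have "inj (A (\<Phi> t))" using ldet_nonzero_iff[OF linear_A] by blast
    then show ?thesis by (simp add: linear_injective_imp_surjective[OF linear_A])
  qed
  then have "D t ` B = UNIV" using S by (metis UNIV_eq_I surjD)
  then have "dim (UNIV :: 'a set) \<le> dim B" using dim_image_le[OF linear_D, of t B] by (simp only:)
  moreover have "dim (UNIV :: 'a set) = DIM('a)" by (rule dim_UNIV)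
  ultimately show ?thesis using dim_subset_UNIV[of B] by linarith
qed

end

end

definition enum_Basis :: "nat \<Rightarrow> 'a::euclidean_space" where
  "enum_Basis = (SOME \<beta>. bij_betw \<beta> {..<DIM('a)} Basis)"

lemma bij_enum_Basis: "bij_betw (enum_Basis :: nat \<Rightarrow> 'a::euclidean_space) {..<DIM('a)} Basis"
proof -
  have "\<exists>\<beta> :: nat \<Rightarrow> 'a. bij_betw \<beta> {..<DIM('a)} Basis"
    using ex_bij_betw_nat_finite[of "Basis :: 'a set"] by (simp add: lessThan_atLeast0)
  then show ?thesis unfolding enum_Basis_def by (rule someI_ex)
qed

lemma enum_Basis_in: "k < DIM('a) \<Longrightarrow> enum_Basis k \<in> (Basis :: 'a::euclidean_space set)"
  using bij_enum_Basis by (auto simp: bij_betw_def)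

lemma enum_Basis_inner:
  assumes "i < DIM('a)" "j < DIM('a)"
  shows "(enum_Basis i :: 'a::euclidean_space) \<bullet> enum_Basis j = (if i = j then 1 else 0)"
  using assms bij_enum_Basis[where 'a='a] enum_Basis_in[OF assms(1)] enum_Basis_in[OF assms(2)]
  by (auto simp: inner_Basis bij_betw_def inj_on_def)

lemma emeasure_eq_nn_integral_indicator:
  "S \<in> sets borel \<Longrightarrow> emeasure lborel S = (\<integral>\<^sup>+x. indicator S x \<partial>lborel)"
  by simp

section \<open>Words, their rank and the measure of towers\<close>

context strat_group begin

primrec word :: "(nat \<Rightarrow> 'a) \<Rightarrow> nat \<Rightarrow> (nat \<Rightarrow> real) \<Rightarrow> 'a" where
  "word \<eta> 0 t = 0"
| "word \<eta> (Suc k) t = word \<eta> k t \<odot> (t k *\<^sub>R \<eta> k)"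

lemma word_cong:
  "(\<And>i. i < k \<Longrightarrow> t i = t' i) \<Longrightarrow> (\<And>i. i < k \<Longrightarrow> \<eta> i = \<eta>' i) \<Longrightarrow> word \<eta> k t = word \<eta>' k t'"
  by (induction k) auto

text \<open>The times are read off from the coordinates of a vector, so that a word of length
  \<open>DIM('a)\<close> becomes a self-map of \<open>'a\<close> and has a Jacobian
  determinant.\<close>

definition \<Phi> :: "(nat \<Rightarrow> 'a) \<Rightarrow> nat \<Rightarrow> 'a \<Rightarrow> 'a" where
  "\<Phi> \<eta> k v = word \<eta> k (\<lambda>i. v \<bullet> enum_Basis i)"

lemma \<Phi>_Suc: "\<Phi> \<eta> (Suc k) v = \<Phi> \<eta> k v \<odot> ((v \<bullet> enum_Basis k) *\<^sub>R \<eta> k)"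
  by (simp add: \<Phi>_def)

lemma polynomial_\<Phi>: "polynomial_function (\<Phi> \<eta> k)"
proof (induction k)
  case 0
  show ?case unfolding \<Phi>_def by simp
next
  case (Suc k)
  have "polynomial_function (\<lambda>v. (v \<bullet> enum_Basis k) *\<^sub>R \<eta> k)"
    unfolding polynomial_function_iff_Basis_inner inner_scaleR_left
    by (intro ballI real_polynomial_function.intros(1,2,4) bounded_linear_inner_left)
  from polynomial_gmul[OF Suc this] show ?case unfolding \<Phi>_Suc by simp
qed

definition D\<Phi> :: "(nat \<Rightarrow> 'a) \<Rightarrow> nat \<Rightarrow> 'a \<Rightarrow> 'a \<Rightarrow> 'a" where
  "D\<Phi> \<eta> k t = frechet_derivative (\<Phi> \<eta> k) (at t)"

lemma D\<Phi>: "(\<Phi> \<eta> k has_derivative D\<Phi> \<eta> k t) (at t)"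
  unfolding D\<Phi>_def using polynomial_function_derivative[OF polynomial_\<Phi>] frechet_derivative_at by metis

lemma polynomial_D\<Phi>: "polynomial_function (\<lambda>t. D\<Phi> \<eta> k t v)"
proof -
  obtain f' where f': "\<And>x. (\<Phi> \<eta> k has_derivative f' x) (at x)" "\<And>v. polynomial_function (\<lambda>x. f' x v)"
    using polynomial_function_derivative[OF polynomial_\<Phi>, of \<eta> k] by blast
  have "D\<Phi> \<eta> k x = f' x" for x using has_derivative_unique[OF D\<Phi> f'(1)] .
  then show ?thesis using f'(2)[of v] by simp
qed

lemma linear_D\<Phi>: "linear (D\<Phi> \<eta> k t)" using D\<Phi> has_derivative_linear by blast

definition Bk :: "nat \<Rightarrow> 'a set" where "Bk k = span (enum_Basis ` {..<k})"

lemma subspace_Bk: "subspace (Bk k)" by (simp add: Bk_def)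

lemma dim_Bk: "dim (Bk k) \<le> k"
proof -
  have "dim (Bk k) \<le> card (enum_Basis ` {..<k} :: 'a set)" unfolding Bk_def dim_span by (rule dim_le_card') simp
  also have "\<dots> \<le> k" using card_image_le[of "{..<k}" enum_Basis] by simp
  finally show ?thesis .
qed

lemma A_line: "A (s *\<^sub>R \<xi>) \<xi> = \<xi>"
proof (rule vector_derivative_unique_at[OF left_line_velocity])
  show "((\<lambda>e. s *\<^sub>R \<xi> \<odot> e *\<^sub>R \<xi>) has_vector_derivative \<xi>) (at 0)"
    unfolding gline by (auto intro!: derivative_eq_intros simp: has_vector_derivative_def algebra_simps)
qed

text \<open>The flow of the left-invariant field of \<open>\<xi>\<close> is right translation by
  \<open>s *\<^sub>R \<xi>\<close>, and a field is preserved by its own flow.\<close>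

lemma Dg_flow: "Dg (x, s *\<^sub>R \<xi>) (0, \<xi>) = Dg (x, s *\<^sub>R \<xi>) (A x \<xi>, 0)"
proof -
  have "Dg (x, s *\<^sub>R \<xi>) (0, \<xi>) = A (x \<odot> s *\<^sub>R \<xi>) \<xi>" by (simp add: A_mult A_line)
  also have "\<dots> = Dg (x, s *\<^sub>R \<xi>) (A x \<xi>, 0)"
  proof (rule vector_derivative_unique_at[OF left_line_velocity])
    have "((\<lambda>e. (x \<odot> e *\<^sub>R \<xi>) \<odot> s *\<^sub>R \<xi>) has_vector_derivative Dg (x, s *\<^sub>R \<xi>) (A x \<xi>, 0)) (at 0)"
      using gmul_vector_derivative[OF left_line_velocity has_vector_derivative_const, of x \<xi> "s *\<^sub>R \<xi>"] by simp
    then show "((\<lambda>e. x \<odot> s *\<^sub>R \<xi> \<odot> e *\<^sub>R \<xi>) has_vector_derivative Dg (x, s *\<^sub>R \<xi>) (A x \<xi>, 0)) (at 0)"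
      by (simp add: gassoc gline add.commute)
  qed
  finally show ?thesis .
qed

lemma inj_Dg_1: "Dg (x, y) (v, 0) = 0 \<Longrightarrow> v = 0"
proof -
  assume v: "Dg (x, y) (v, 0) = 0"
  have "inj (\<lambda>v. Dg (x, y) (v, 0))"
    using ldet_nonzero_iff[OF linear_Dg_1[of "(x, y)"]] ldet_Dg(1)[of x y] by simp
  then show "v = 0" using v linear_0[OF linear_Dg_1[of "(x, y)"]] by (auto simp: inj_def)
qed

text \<open>By \<open>Dg_flow\<close>, right translation by \<open>?s *\<^sub>R \<xi>\<close>
  factors out of the derivative of the longer word, and it is injective. What remains is
  \<open>D\<Phi> \<eta> k t\<close> plus a multiple of \<open>A (\<Phi> \<eta> k t) \<xi>\<close>, a
  vector outside the old image.\<close>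

lemma rank_step:
  assumes k: "k < DIM('a)" and t: "t \<in> immersive (D\<Phi> \<eta> k) (Bk k)"
    and \<xi>: "A (\<Phi> \<eta> k t) \<xi> \<notin> D\<Phi> \<eta> k t ` Bk k"
  shows "t \<in> immersive (D\<Phi> (\<eta>(k := \<xi>)) (Suc k)) (Bk (Suc k))"
proof -
  let ?b = "enum_Basis k :: 'a" and ?x = "\<Phi> \<eta> k t" and ?s = "t \<bullet> enum_Basis k"
  have "\<Phi> (\<eta>(k := \<xi>)) k v = \<Phi> \<eta> k v" for v unfolding \<Phi>_def by (rule word_cong) auto
  then have S: "\<Phi> (\<eta>(k := \<xi>)) (Suc k) = (\<lambda>v. \<Phi> \<eta> k v \<odot> ((v \<bullet> ?b) *\<^sub>R \<xi>))" by (simp add: \<Phi>_Suc fun_eq_iff)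
  have "((\<lambda>v. \<Phi> \<eta> k v \<odot> ((v \<bullet> ?b) *\<^sub>R \<xi>)) has_derivative
      (\<lambda>v. Dg (?x, ?s *\<^sub>R \<xi>) (D\<Phi> \<eta> k t v, (v \<bullet> ?b) *\<^sub>R \<xi>))) (at t)"
    by (intro gmul_has_derivative_comp D\<Phi> has_derivative_scaleR_left has_derivative_inner_left has_derivative_ident)
  from has_derivative_unique[OF D\<Phi>[of "\<eta>(k := \<xi>)" "Suc k" t, unfolded S] this]
  have D: "D\<Phi> (\<eta>(k := \<xi>)) (Suc k) t v = Dg (?x, ?s *\<^sub>R \<xi>) (D\<Phi> \<eta> k t v, (v \<bullet> ?b) *\<^sub>R \<xi>)" for v
    by (rule fun_cong)
  \<comment> \<open>The shorter word does not involve the coordinate along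
    \<open>?b\<close>.\<close>
  have Db0: "D\<Phi> \<eta> k t ?b = 0"
  proof -
    have "\<Phi> \<eta> k (t + s *\<^sub>R ?b) = \<Phi> \<eta> k t" for s
      unfolding \<Phi>_def by (rule word_cong) (use k enum_Basis_inner[where 'a='a] in \<open>auto simp: inner_add_left\<close>)
    moreover have "((\<lambda>s. t + s *\<^sub>R ?b) has_vector_derivative ?b) (at 0)"
      by (auto intro!: derivative_eq_intros simp: has_vector_derivative_def)
    then have "((\<lambda>s. \<Phi> \<eta> k (t + s *\<^sub>R ?b)) has_vector_derivative D\<Phi> \<eta> k t ?b) (at 0)"
      using vector_derivative_chain[of "\<lambda>s. t + s *\<^sub>R ?b" ?b 0 "\<Phi> \<eta> k" "D\<Phi> \<eta> k t"] D\<Phi> by simp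
    ultimately have "((\<lambda>s::real. \<Phi> \<eta> k t) has_vector_derivative D\<Phi> \<eta> k t ?b) (at 0)" by (simp only:)
    from vector_derivative_unique_at[OF this has_vector_derivative_const] show ?thesis .
  qed
  have "v = 0" if v: "v \<in> Bk (Suc k)" and 0: "D\<Phi> (\<eta>(k := \<xi>)) (Suc k) t v = 0" for v
  proof -
    obtain c where c: "v - c *\<^sub>R ?b \<in> Bk k"
      using v by (auto simp: Bk_def lessThan_Suc span_breakdown_eq)
    let ?v = "v - c *\<^sub>R ?b"
    have "w \<bullet> ?b = 0" if "w \<in> Bk k" for w
      using that unfolding Bk_def
    proof (induction rule: span_induct)
      case base
      show ?case by (rule subspaceI) (auto simp: inner_add_left)
    next
      case (step x)
      then show ?case using k enum_Basis_inner[where 'a='a] by fastforce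
    qed
    then have "?v \<bullet> ?b = 0" using c by blast
    then have vb: "v \<bullet> ?b = c" using enum_Basis_inner[OF k k] by (simp add: inner_diff_left)
    have Dv: "D\<Phi> \<eta> k t v = D\<Phi> \<eta> k t ?v"
      by (simp add: linear_diff[OF linear_D\<Phi>] linear_cmul[OF linear_D\<Phi>] Db0)
    have "0 = Dg (?x, ?s *\<^sub>R \<xi>) (D\<Phi> \<eta> k t ?v, c *\<^sub>R \<xi>)" using 0 by (simp add: D vb Dv)
    also have "\<dots> = Dg (?x, ?s *\<^sub>R \<xi>) (D\<Phi> \<eta> k t ?v, 0) + c *\<^sub>R Dg (?x, ?s *\<^sub>R \<xi>) (0, \<xi>)"
      using linear_add[OF linear_Dg, of "(?x, ?s *\<^sub>R \<xi>)" "(D\<Phi> \<eta> k t ?v, 0)" "(0, c *\<^sub>R \<xi>)"]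
        linear_cmul[OF linear_Dg, of "(?x, ?s *\<^sub>R \<xi>)" c "(0, \<xi>)"] by simp
    also have "\<dots> = Dg (?x, ?s *\<^sub>R \<xi>) (D\<Phi> \<eta> k t ?v + c *\<^sub>R A ?x \<xi>, 0)"
      using linear_add[OF linear_Dg_1] linear_cmul[OF linear_Dg_1] by (simp add: Dg_flow)
    finally have z: "D\<Phi> \<eta> k t ?v + c *\<^sub>R A ?x \<xi> = 0" using inj_Dg_1 by metis
    have "c = 0"
    proof (rule ccontr)
      assume "c \<noteq> 0"
      have "A ?x \<xi> = D\<Phi> \<eta> k t ((- 1 / c) *\<^sub>R ?v)"
      proof -
        have "c *\<^sub>R A ?x \<xi> = - D\<Phi> \<eta> k t ?v" using z by (simp add: add_eq_0_iff)
        then have "(1 / c) *\<^sub>R (c *\<^sub>R A ?x \<xi>) = (1 / c) *\<^sub>R (- D\<Phi> \<eta> k t ?v)" by (simp only:)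
        then have "A ?x \<xi> = (- 1 / c) *\<^sub>R D\<Phi> \<eta> k t ?v" using \<open>c \<noteq> 0\<close> by simp
        then show ?thesis by (simp only: linear_cmul[OF linear_D\<Phi>])
      qed
      moreover have "(- 1 / c) *\<^sub>R ?v \<in> Bk k" using c subspace_Bk by (rule subspace_scale[rotated])
      ultimately show False using \<xi> by blast
    qed
    then have "D\<Phi> \<eta> k t v = 0" "v \<in> Bk k" using z c by simp_all
    then show ?thesis using t unfolding immersive_def by blast
  qed
  then show ?thesis unfolding immersive_def by blast
qed

text \<open>The letters are chosen greedily. If no letter raised the rank at any immersive point,
  the fields of all letters would be tangent there and \<open>dim (Bk k)\<close> would be full,
  which is impossible for \<open>k < DIM('a)\<close>. The base point may change at every
  step.\<close>

lemma full_rank_word: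
  assumes X: "span X = V 1"
  shows "\<exists>\<eta> t. (\<forall>i<DIM('a). \<eta> i \<in> X) \<and> ldet (D\<Phi> \<eta> DIM('a) t) \<noteq> 0"
proof -
  have "\<exists>\<eta> t. (\<forall>i<k. \<eta> i \<in> X) \<and> t \<in> immersive (D\<Phi> \<eta> k) (Bk k)" if "k \<le> DIM('a)" for k
    using that
  proof (induction k)
    case 0
    show ?case by (auto simp: immersive_def Bk_def)
  next
    case (Suc k)
    then obtain \<eta> t0 where IH: "\<forall>i<k. \<eta> i \<in> X" "t0 \<in> immersive (D\<Phi> \<eta> k) (Bk k)" by auto
    have "\<exists>t\<in>immersive (D\<Phi> \<eta> k) (Bk k). \<exists>\<xi>\<in>X. A (\<Phi> \<eta> k t) \<xi> \<notin> D\<Phi> \<eta> k t ` Bk k"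
    proof (rule ccontr)
      assume "\<not> ?thesis"
      then have "dim (Bk k) = DIM('a)"
        using tangent_to_generators_imp_full[OF polynomial_\<Phi> D\<Phi> polynomial_D\<Phi> subspace_Bk _ _ IH(2), of X] X by blast
      then show False using dim_Bk[of k] Suc.prems by simp
    qed
    then obtain t \<xi> where t: "t \<in> immersive (D\<Phi> \<eta> k) (Bk k)" "\<xi> \<in> X" "A (\<Phi> \<eta> k t) \<xi> \<notin> D\<Phi> \<eta> k t ` Bk k" by blast
    have "t \<in> immersive (D\<Phi> (\<eta>(k := \<xi>)) (Suc k)) (Bk (Suc k))"
      using rank_step[OF _ t(1,3)] Suc.prems by simp
    moreover have "\<forall>i<Suc k. (\<eta>(k := \<xi>)) i \<in> X" using IH(1) t(2) by (auto simp: less_Suc_eq)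
    ultimately show ?case by blast
  qed
  from this[OF order_refl] obtain \<eta> t where \<eta>: "\<forall>i<DIM('a). \<eta> i \<in> X" "t \<in> immersive (D\<Phi> \<eta> DIM('a)) (Bk DIM('a))" by blast
  have "enum_Basis ` {..<DIM('a)} = (Basis :: 'a set)" using bij_enum_Basis by (auto simp: bij_betw_def)
  then have "Bk DIM('a) = UNIV" by (simp add: Bk_def)
  then have "inj (D\<Phi> \<eta> DIM('a) t)"
    using \<eta>(2) unfolding immersive_def linear_injective_0[OF linear_D\<Phi>] by simp
  then show ?thesis using \<eta>(1) ldet_nonzero_iff[OF linear_D\<Phi>] by blast
qed

lemma word_measurable:
  "{..<k} \<subseteq> I \<Longrightarrow> word \<eta> k \<in> borel_measurable (PiM I (\<lambda>_. lborel))"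
proof (induction k)
  case (Suc k)
  have [measurable]: "word \<eta> k \<in> borel_measurable (PiM I (\<lambda>_. lborel))"
    by (rule Suc.IH) (use Suc.prems in auto)
  have "k \<in> I" using Suc.prems by auto
  then have [measurable]: "(\<lambda>t. t k) \<in> borel_measurable (PiM I (\<lambda>_. lborel))"
    using measurable_component_singleton[of k I "\<lambda>_. lborel :: real measure"] by simp
  have "(\<lambda>t. word \<eta> k t \<odot> (t k *\<^sub>R \<eta> k)) \<in> borel_measurable (PiM I (\<lambda>_. lborel))" by measurable
  moreover have "word \<eta> (Suc k) = (\<lambda>t. word \<eta> k t \<odot> (t k *\<^sub>R \<eta> k))" by (rule ext) simp
  ultimately show ?case by (simp only:)
next
  case 0
  have "word \<eta> 0 = (\<lambda>_. 0)" by (rule ext) simp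
  then show ?case by simp
qed

text \<open>The times for which the word stays in the tower are those to which
  \<open>tower_lower_bound\<close> applies, with the Jacobian as integrand; the area inequality
  turns the result into a bound for the measure. Left translation makes the constant independent of
  \<open>x0\<close>.\<close>

lemma unit_tower_bound:
  assumes X: "span X = V 1"
  shows "\<exists>\<eta> c. (\<forall>i<DIM('a). \<eta> i \<in> X) \<and> c > 0 \<and> (\<forall>F x0. (\<forall>k\<le>DIM('a). F k \<in> sets borel) \<longrightarrow> x0 \<in> F 0 \<longrightarrow>
    (\<forall>k<DIM('a). \<forall>x\<in>F k. 1 \<le> emeasure lborel {s. x \<odot> (s *\<^sub>R \<eta> k) \<in> F (Suc k)}) \<longrightarrow>
    ennreal c \<le> emeasure lborel (F DIM('a)))"
proof -
  let ?n = "DIM('a)"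
  obtain \<eta> t0 where \<eta>: "\<forall>i<?n. \<eta> i \<in> X" "ldet (D\<Phi> \<eta> ?n t0) \<noteq> 0" using full_rank_word[OF X] by blast
  obtain M N where MN: "N \<in> null_sets lborel"
    "\<And>y. y \<notin> N \<Longrightarrow> finite {t. \<Phi> \<eta> ?n t = y} \<and> card {t. \<Phi> \<eta> ?n t = y} \<le> (M::nat)"
    using polynomial_map_multiplicity[OF polynomial_\<Phi>[of \<eta> ?n]] by blast
  let ?T = "\<lambda>t. \<Sum>k<?n. t k *\<^sub>R (enum_Basis k :: 'a)"
  let ?f = "\<lambda>t. ldet (D\<Phi> \<eta> ?n (?T t))"
  have T_inner: "?T t \<bullet> enum_Basis i = t i" if "i < ?n" for t i
  proof -
    have "?T t \<bullet> enum_Basis i = (\<Sum>k<?n. t k * (enum_Basis k \<bullet> (enum_Basis i :: 'a)))" by (simp add: inner_sum_left)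
    also have "\<dots> = (\<Sum>k<?n. if k = i then t k else 0)"
      by (rule sum.cong) (use enum_Basis_inner[where 'a='a] that in auto)
    finally show ?thesis using that by simp
  qed
  have "?T (\<lambda>k. t0 \<bullet> enum_Basis k) = t0"
    using sum.reindex_bij_betw[OF bij_enum_Basis, of "\<lambda>b. (t0 \<bullet> b) *\<^sub>R b"] by (simp add: euclidean_representation)
  then have f0: "\<exists>t. ?f t \<noteq> 0" using \<eta>(2) by metis
  have ip: "iter_poly ?n ?f"
    by (rule iter_poly_real_polynomial[OF polynomial_ldet[OF polynomial_D\<Phi>]])
  from tower_lower_bound[OF ip f0] obtain c where c0: "c > 0" and cR:
    "\<forall>R. (\<forall>k\<le>?n. Measurable.pred (PiM {..<k} (\<lambda>_. lborel)) (R k)) \<longrightarrow> R 0 (\<lambda>_. undefined) \<longrightarrow>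
      (\<forall>k<?n. \<forall>t. R k t \<longrightarrow> 1 \<le> emeasure lborel {s. R (Suc k) (t(k := s))}) \<longrightarrow>
      ennreal c \<le> (\<integral>\<^sup>+t. (if R ?n t then ennreal \<bar>?f t\<bar> else 0) \<partial>PiM {..<?n} (\<lambda>_. lborel))"
    by (elim exE conjE)
  show ?thesis
  \<comment> \<open>Adding 1 keeps the denominator positive even if the multiplicity bound
    \<open>M\<close> is 0.\<close>
  proof (intro exI[of _ \<eta>] exI[of _ "c / (real M + 1)"] conjI allI impI)
    show "c / (real M + 1) > 0" using c0 by simp
    fix F :: "nat \<Rightarrow> 'a set" and x0
    assume F: "\<forall>k\<le>?n. F k \<in> sets borel" and x0: "x0 \<in> F 0"
      and fib: "\<forall>k<?n. \<forall>x\<in>F k. 1 \<le> emeasure lborel {s. x \<odot> (s *\<^sub>R \<eta> k) \<in> F (Suc k)}"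
    let ?R = "\<lambda>k t. x0 \<odot> word \<eta> k t \<in> F k"
    let ?E = "{y. x0 \<odot> y \<in> F ?n}"
    have Fn [measurable]: "F ?n \<in> sets borel" using F by simp
    have E [measurable]: "?E \<in> sets borel"
      using measurable_sets[of "\<lambda>y. x0 \<odot> y" borel borel "F ?n"] by (simp add: vimage_def)
    have Em: "emeasure lborel ?E = emeasure lborel (F ?n)"
    proof -
      have "emeasure lborel ?E = (\<integral>\<^sup>+y. indicator (F ?n) (x0 \<odot> y) \<partial>lborel)"
        unfolding emeasure_eq_nn_integral_indicator[OF E]
        by (rule nn_integral_cong) (simp split: split_indicator)
      also have "\<dots> = (\<integral>\<^sup>+y. indicator (F ?n) y \<partial>lborel)" by (rule nn_integral_left_translate) measurable
      finally show ?thesis by simp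
    qed
    have 1: "Measurable.pred (PiM {..<k} (\<lambda>_. lborel)) (?R k)" if "k \<le> ?n" for k
    proof -
      have [measurable]: "word \<eta> k \<in> borel_measurable (PiM {..<k} (\<lambda>_. lborel))" by (rule word_measurable) simp
      have [measurable]: "F k \<in> sets borel" using F that by blast
      show ?thesis by measurable
    qed
    have 3: "1 \<le> emeasure lborel {s. ?R (Suc k) (t(k := s))}" if "k < ?n" "?R k t" for k t
    proof -
      have "word \<eta> k (t(k := s)) = word \<eta> k t" for s by (rule word_cong) auto
      then have "{s. ?R (Suc k) (t(k := s))} = {s. (x0 \<odot> word \<eta> k t) \<odot> (s *\<^sub>R \<eta> k) \<in> F (Suc k)}"
        by (simp add: gassoc)
      then show ?thesis using fib that by (simp only:)
    qed
    have c1: "ennreal c \<le> (\<integral>\<^sup>+t. (if ?R ?n t then ennreal \<bar>?f t\<bar> else 0) \<partial>PiM {..<?n} (\<lambda>_. lborel))"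
      by (rule cR[rule_format]) (use 1 3 x0 in \<open>simp_all add: fun_upd_def\<close>)
    show "ennreal (c / (real M + 1)) \<le> emeasure lborel (F ?n)"
    proof (cases "emeasure lborel (F ?n) = \<infinity>")
      case False
      let ?h = "\<lambda>v. ennreal \<bar>ldet (D\<Phi> \<eta> ?n v)\<bar> * indicator ?E (\<Phi> \<eta> ?n v)"
      have hm: "?h \<in> borel_measurable borel"
      proof -
        have "continuous_on UNIV (\<lambda>v. ldet (D\<Phi> \<eta> ?n v))"
          using polynomial_ldet[OF polynomial_D\<Phi>] by (intro polynomial_function_continuous) (simp add: real_polynomial_function_eq)
        then have [measurable]: "(\<lambda>v. ldet (D\<Phi> \<eta> ?n v)) \<in> borel_measurable borel" by (rule borel_measurable_continuous_onI)
        have [measurable]: "\<Phi> \<eta> ?n \<in> borel_measurable borel"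
          by (rule borel_measurable_continuous_onI[OF polynomial_function_continuous[OF polynomial_\<Phi>]])
        show ?thesis by measurable
      qed
      have "(\<integral>\<^sup>+t. (if ?R ?n t then ennreal \<bar>?f t\<bar> else 0) \<partial>PiM {..<?n} (\<lambda>_. lborel))
          = (\<integral>\<^sup>+t. ?h (?T t) \<partial>PiM {..<?n} (\<lambda>_. lborel))"
      proof (rule nn_integral_cong)
        fix t :: "nat \<Rightarrow> real"
        have "\<Phi> \<eta> ?n (?T t) = word \<eta> ?n t" unfolding \<Phi>_def by (rule word_cong) (simp_all only: T_inner)
        then show "(if ?R ?n t then ennreal \<bar>?f t\<bar> else 0) = ?h (?T t)" by (simp add: indicator_def)
      qed
      also have "\<dots> = (\<integral>\<^sup>+v. ?h v \<partial>distr (PiM {..<?n} (\<lambda>_. lborel)) borel ?T)"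
      proof (rule nn_integral_distr[symmetric])
        show "?T \<in> PiM {..<?n} (\<lambda>_. lborel) \<rightarrow>\<^sub>M borel" by measurable
      qed (use hm in simp)
      also have "\<dots> = (\<integral>\<^sup>+v. ?h v \<partial>lborel)" by (simp only: lborel_eq_PiM[OF bij_enum_Basis])
      also have "\<dots> \<le> of_nat M * emeasure lborel ?E"
        by (rule area_inequality_polynomial[OF D\<Phi> polynomial_D\<Phi> E _ MN])
          (use False Em in \<open>simp_all add: less_top\<close>)
      finally have cM: "ennreal c \<le> of_nat M * emeasure lborel (F ?n)" using order_trans[OF c1] by (simp only: Em)
      obtain e where e: "emeasure lborel (F ?n) = ennreal e" "0 \<le> e"
        using False by (cases "emeasure lborel (F ?n)") auto
      have "ennreal c \<le> ennreal (real M * e)"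
        using cM e by (simp add: ennreal_of_nat_eq_real_of_nat ennreal_mult)
      then have "c \<le> real M * e" using e(2) by (subst (asm) ennreal_le_iff) auto
      also have "\<dots> \<le> (real M + 1) * e" using e by (simp add: distrib_right)
      finally show ?thesis unfolding e(1) by (intro ennreal_leI) (simp add: field_simps)
    qed simp
  qed (use \<eta> in auto)
qed

text \<open>Pulling the tower back by \<open>\<delta> \<alpha>\<close>, which stretches horizontal
  lines by the factor \<open>\<alpha>\<close>, makes the fibres at least 1 long; the measure changes
  by \<open>\<alpha> ^ hom_dim r V\<close>.\<close>

lemma tower_bound:
  assumes X: "span X = V 1"
  shows "\<exists>\<eta> c. (\<forall>i<DIM('a). \<eta> i \<in> X) \<and> c > 0 \<and> (\<forall>F x0 \<alpha>. \<alpha> > 0 \<longrightarrow> (\<forall>k\<le>DIM('a). F k \<in> sets borel) \<longrightarrow> x0 \<in> F 0 \<longrightarrow>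
    (\<forall>k<DIM('a). \<forall>x\<in>F k. ennreal \<alpha> \<le> emeasure lborel {s. x \<odot> (s *\<^sub>R \<eta> k) \<in> F (Suc k)}) \<longrightarrow>
    ennreal (c * \<alpha> ^ hom_dim r V) \<le> emeasure lborel (F DIM('a)))"
proof -
  let ?n = "DIM('a)"
  from unit_tower_bound[OF X] obtain \<eta> c where \<eta>: "\<forall>i<?n. \<eta> i \<in> X" and c: "c > 0" and U:
    "\<forall>F x0. (\<forall>k\<le>?n. F k \<in> sets borel) \<longrightarrow> x0 \<in> F 0 \<longrightarrow>
    (\<forall>k<?n. \<forall>x\<in>F k. 1 \<le> emeasure lborel {s. x \<odot> (s *\<^sub>R \<eta> k) \<in> F (Suc k)}) \<longrightarrow>
    ennreal c \<le> emeasure lborel (F ?n)" by (elim exE conjE)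
  have \<eta>V: "\<eta> k \<in> V 1" if "k < ?n" for k using \<eta> X that span_base by blast
  show ?thesis
  proof (intro exI[of _ \<eta>] exI[of _ c] conjI allI impI)
    fix F :: "nat \<Rightarrow> 'a set" and x0 and \<alpha> :: real
    assume \<alpha>: "\<alpha> > 0" and F: "\<forall>k\<le>?n. F k \<in> sets borel" and x0: "x0 \<in> F 0"
      and fib: "\<forall>k<?n. \<forall>x\<in>F k. ennreal \<alpha> \<le> emeasure lborel {s. x \<odot> (s *\<^sub>R \<eta> k) \<in> F (Suc k)}"
    have [measurable]: "\<delta> \<alpha> \<in> borel_measurable borel"
      by (intro borel_measurable_continuous_onI linear_continuous_on bounded_linear_\<delta>)
    let ?F = "\<lambda>k. {y. \<delta> \<alpha> y \<in> F k}"
    have Fm: "?F k \<in> sets borel" if "k \<le> ?n" for k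
      using measurable_sets[of "\<delta> \<alpha>" borel borel "F k"] F that by (simp add: vimage_def)
    have "1 \<le> emeasure lborel {s. x \<odot> (s *\<^sub>R \<eta> k) \<in> ?F (Suc k)}" if k: "k < ?n" and x: "x \<in> ?F k" for k x
    proof -
      let ?S = "{s. \<delta> \<alpha> x \<odot> (s *\<^sub>R \<eta> k) \<in> F (Suc k)}"
      have FS [measurable]: "F (Suc k) \<in> sets borel" using F k by simp
      have Sm [measurable]: "?S \<in> sets borel"
        using measurable_sets[of "\<lambda>s. \<delta> \<alpha> x \<odot> (s *\<^sub>R \<eta> k)" borel borel "F (Suc k)"] by (simp add: vimage_def)
      have "1 \<in> {1..r}" using r_ge1 by simp
      then have "\<delta> \<alpha> (\<eta> k) = \<alpha> *\<^sub>R \<eta> k" using \<delta>_V[of 1 "\<eta> k" \<alpha>] \<eta>V[OF k] by simp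
      then have eq: "{s. x \<odot> (s *\<^sub>R \<eta> k) \<in> ?F (Suc k)} = {s. 0 + \<alpha> * s \<in> ?S}"
        by (simp add: \<delta>_mult linear_cmul[OF linear_\<delta>] mult.commute)
      have Sm': "{s. 0 + \<alpha> * s \<in> ?S} \<in> sets borel"
        using measurable_sets[of "\<lambda>s. 0 + \<alpha> * s" borel borel ?S] Sm by (simp add: vimage_def)
      have "ennreal \<alpha> \<le> emeasure lborel ?S" using fib k x by simp
      also have "\<dots> = (\<integral>\<^sup>+s. indicator ?S s \<partial>lborel)" using Sm by simp
      also have "\<dots> = ennreal \<bar>\<alpha>\<bar> * (\<integral>\<^sup>+s. indicator ?S (0 + \<alpha> * s) \<partial>lborel)"
        by (rule nn_integral_real_affine) (use \<alpha> in auto)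
      also have "(\<integral>\<^sup>+s. indicator ?S (0 + \<alpha> * s) \<partial>lborel) = emeasure lborel {s. 0 + \<alpha> * s \<in> ?S}"
        unfolding emeasure_eq_nn_integral_indicator[OF Sm']
        by (rule nn_integral_cong) (simp split: split_indicator)
      finally have "ennreal \<alpha> * 1 \<le> ennreal \<alpha> * emeasure lborel {s. 0 + \<alpha> * s \<in> ?S}" using \<alpha> by simp
      then show ?thesis unfolding eq using \<alpha> by (subst (asm) ennreal_mult_le_mult_iff) auto
    qed
    moreover have "\<delta> (1 / \<alpha>) x0 \<in> ?F 0" using x0 \<alpha> by (simp add: \<delta>_\<delta>)
    ultimately have c1: "ennreal c \<le> emeasure lborel (?F ?n)"
      using U[rule_format, of ?F "\<delta> (1 / \<alpha>) x0"] Fm by blast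
    have Fn [measurable]: "F ?n \<in> sets borel" using F by simp
    have "emeasure lborel (F ?n) = ennreal (\<alpha> ^ hom_dim r V) * (\<integral>\<^sup>+y. indicator (F ?n) (\<delta> \<alpha> y) \<partial>lborel)"
      unfolding emeasure_eq_nn_integral_indicator[OF Fn] by (rule nn_integral_\<delta>[OF \<alpha>]) measurable
    also have "(\<integral>\<^sup>+y. indicator (F ?n) (\<delta> \<alpha> y) \<partial>lborel) = emeasure lborel (?F ?n)"
      unfolding emeasure_eq_nn_integral_indicator[OF Fm[OF order_refl]]
      by (rule nn_integral_cong) (simp split: split_indicator)
    finally have "ennreal (\<alpha> ^ hom_dim r V) * ennreal c \<le> emeasure lborel (F ?n)"
      using mult_left_mono[OF c1, of "ennreal (\<alpha> ^ hom_dim r V)"] by simp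
    then show "ennreal (c * \<alpha> ^ hom_dim r V) \<le> emeasure lborel (F ?n)"
      using \<alpha> c by (simp add: ennreal_mult mult.commute)
  qed (use \<eta> c in auto)
qed

end

section \<open>One-dimensional estimates: total variation and level crossing\<close>

lemma ftc_nn_integral:
  fixes f :: "real \<Rightarrow> real"
  assumes d: "\<And>s. (f has_real_derivative f' s) (at s)" and c: "continuous_on UNIV f'" and "a \<le> b"
  shows "ennreal \<bar>f b - f a\<bar> \<le> (\<integral>\<^sup>+s. ennreal \<bar>f' s\<bar> * indicator {a..b} s \<partial>lborel)"
proof -
  have cont: "continuous_on {a..b} f'" using c continuous_on_subset by blast
  have 1: "(f' has_integral (f b - f a)) {a..b}"
    by (rule fundamental_theorem_of_calculus[OF assms(3)])
      (simp add: has_real_derivative_iff_has_vector_derivative[symmetric] has_field_derivative_at_within[OF d])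
  have 2: "(\<lambda>s. \<bar>f' s\<bar>) integrable_on {a..b}"
    by (intro integrable_continuous_real continuous_intros cont)
  have "\<bar>f b - f a\<bar> \<le> integral {a..b} (\<lambda>s. \<bar>f' s\<bar>)"
    using integral_norm_bound_integral[of f' "{a..b}" "\<lambda>s. \<bar>f' s\<bar>"] 1 2
    by (auto simp: has_integral_integrable integral_unique)
  moreover have "(\<integral>\<^sup>+s. ennreal \<bar>f' s\<bar> * indicator {a..b} s \<partial>lborel) = ennreal (integral {a..b} (\<lambda>s. \<bar>f' s\<bar>))"
    by (rule nn_integral_has_integral_lebesgue'[OF _ integrable_integral[OF 2]]) auto
  ultimately show ?thesis by (simp add: ennreal_leI)
qed

text \<open>\<open>s1\<close> is the first time after \<open>s0\<close> at height at most
  \<open>a\<close>, and \<open>s2\<close> the last time before \<open>s1\<close> at height at least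
  \<open>2 a\<close>. Between them the values stay in the band while \<open>f\<close> drops by at
  least \<open>a\<close>.\<close>

lemma level_crossing_pos:
  fixes f :: "real \<Rightarrow> real"
  assumes d: "\<And>s. (f has_real_derivative f' s) (at s)" and c: "continuous_on UNIV f'"
    and z: "\<And>s. s \<ge> S \<Longrightarrow> f s = 0" and a: "a > 0" "2 * a \<le> f s0"
  shows "ennreal a \<le> (\<integral>\<^sup>+s. ennreal \<bar>f' s\<bar> * indicator {s. a \<le> \<bar>f s\<bar> \<and> \<bar>f s\<bar> < 2 * a} s \<partial>lborel)"
proof -
  have fc: "continuous_on T f" for T
    by (intro continuous_at_imp_continuous_on ballI DERIV_isCont[OF d])
  have s0S: "s0 < S" using z[of s0] a by force
  let ?I = "{s \<in> {s0..S}. f s \<le> a}"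
  have "compact ({s0..S} \<inter> f -` {..a})"
    by (intro compact_Int_closed compact_Icc closed_vimage closed_atMost fc)
  moreover have "{s0..S} \<inter> f -` {..a} = ?I" by auto
  ultimately have "compact ?I" by (simp only:)
  moreover have "S \<in> ?I" using z[of S] a s0S by simp
  ultimately obtain s1 where s1: "s1 \<in> ?I" "\<And>s. s \<in> ?I \<Longrightarrow> s1 \<le> s"
    using continuous_attains_inf[of ?I "\<lambda>s. s"] by (auto intro: continuous_intros)
  let ?J = "{s \<in> {s0..s1}. 2 * a \<le> f s}"
  have "compact ({s0..s1} \<inter> f -` {2 * a..})"
    by (intro compact_Int_closed compact_Icc closed_vimage closed_atLeast fc)
  moreover have "{s0..s1} \<inter> f -` {2 * a..} = ?J" by auto
  ultimately have "compact ?J" by (simp only:)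
  moreover have "s0 \<in> ?J" using a s1 by simp
  ultimately obtain s2 where s2: "s2 \<in> ?J" "\<And>s. s \<in> ?J \<Longrightarrow> s \<le> s2"
    using continuous_attains_sup[of ?J "\<lambda>s. s"] by (auto intro: continuous_intros)
  have le: "s2 \<le> s1" using s2 by simp
  have in_level: "a \<le> \<bar>f s\<bar> \<and> \<bar>f s\<bar> < 2 * a" if "s2 < s" "s < s1" for s
  proof -
    have "\<not> f s \<le> a" using s1(2)[of s] that s1(1) s2(1) by auto
    moreover have "\<not> 2 * a \<le> f s" using s2(2)[of s] that s2(1) by auto
    ultimately show ?thesis using a by auto
  qed
  have "ennreal a \<le> ennreal \<bar>f s1 - f s2\<bar>" using s1(1) s2(1) by (intro ennreal_leI) auto
  also have "\<dots> \<le> (\<integral>\<^sup>+s. ennreal \<bar>f' s\<bar> * indicator {s2..s1} s \<partial>lborel)" by (rule ftc_nn_integral[OF d c le])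
  also have "\<dots> \<le> (\<integral>\<^sup>+s. ennreal \<bar>f' s\<bar> * indicator {s. a \<le> \<bar>f s\<bar> \<and> \<bar>f s\<bar> < 2 * a} s \<partial>lborel)"
  \<comment> \<open>At \<open>s2\<close> the strict upper bound of the band fails, so the endpoints
    are discarded as a null set.\<close>
  proof (rule nn_integral_mono_AE)
    have "{s1, s2} \<in> null_sets lborel" by (rule finite_imp_null_set_lborel) simp
    then have "AE s in lborel. s \<notin> {s1, s2}" by (rule AE_not_in)
    then show "AE s in lborel. ennreal \<bar>f' s\<bar> * indicator {s2..s1} s
        \<le> ennreal \<bar>f' s\<bar> * indicator {s. a \<le> \<bar>f s\<bar> \<and> \<bar>f s\<bar> < 2 * a} s"
      by (rule eventually_mono) (use in_level in \<open>auto split: split_indicator\<close>)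
  qed
  finally show ?thesis .
qed

lemma level_crossing:
  fixes f :: "real \<Rightarrow> real"
  assumes d: "\<And>s. (f has_real_derivative f' s) (at s)" and c: "continuous_on UNIV f'"
    and z: "\<And>s. s \<ge> S \<Longrightarrow> f s = 0" and a: "a > 0" "2 * a \<le> \<bar>f s0\<bar>"
  shows "ennreal a \<le> (\<integral>\<^sup>+s. ennreal \<bar>f' s\<bar> * indicator {s. a \<le> \<bar>f s\<bar> \<and> \<bar>f s\<bar> < 2 * a} s \<partial>lborel)"
proof (cases "f s0 \<ge> 0")
  case True
  then have "2 * a \<le> f s0" using a by simp
  with d c z a(1) show ?thesis by (rule level_crossing_pos)
next
  case False
  have "((\<lambda>s. - f s) has_real_derivative - f' s) (at s)" for s using d by (rule DERIV_minus)
  moreover have "continuous_on UNIV (\<lambda>s. - f' s)" using c by (rule continuous_on_minus)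
  ultimately show ?thesis
    using level_crossing_pos[of "\<lambda>s. - f s" "\<lambda>s. - f' s" S a s0] z a False by auto
qed

lemma total_variation_bound:
  fixes f :: "real \<Rightarrow> real"
  assumes d: "\<And>s. (f has_real_derivative f' s) (at s)" and c: "continuous_on UNIV f'"
    and z: "\<And>s. s \<ge> S \<Longrightarrow> f s = 0"
  shows "ennreal \<bar>f s0\<bar> \<le> (\<integral>\<^sup>+s. ennreal \<bar>f' s\<bar> \<partial>lborel)"
proof -
  have "ennreal \<bar>f s0\<bar> = ennreal \<bar>f (max s0 S) - f s0\<bar>" using z[of "max s0 S"] by simp
  also have "\<dots> \<le> (\<integral>\<^sup>+s. ennreal \<bar>f' s\<bar> * indicator {s0..max s0 S} s \<partial>lborel)"
    by (rule ftc_nn_integral[OF d c]) simp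
  also have "\<dots> \<le> (\<integral>\<^sup>+s. ennreal \<bar>f' s\<bar> \<partial>lborel)"
    by (rule nn_integral_mono) (auto split: split_indicator)
  finally show ?thesis .
qed

section \<open>Integration along horizontal lines\<close>

context strat_group begin

text \<open>Fubini, then the measure-preserving substitution
  \<open>y = x \<odot> s *\<^sub>R \<xi>\<close> for fixed \<open>s\<close>, Fubini again, and the
  reflection \<open>s \<mapsto> - s\<close>.\<close>

lemma line_duality:
  assumes [measurable]: "\<psi> \<in> borel_measurable borel" "g \<in> borel_measurable borel"
  shows "(\<integral>\<^sup>+x. \<psi> x * (\<integral>\<^sup>+s. g (x \<odot> s *\<^sub>R \<xi>) \<partial>lborel) \<partial>lborel)
    = (\<integral>\<^sup>+y. g y * (\<integral>\<^sup>+s. \<psi> (y \<odot> s *\<^sub>R \<xi>) \<partial>lborel) \<partial>(lborel :: 'a measure))"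
proof -
  have "(\<integral>\<^sup>+x. \<psi> x * (\<integral>\<^sup>+s. g (x \<odot> s *\<^sub>R \<xi>) \<partial>lborel) \<partial>lborel)
      = (\<integral>\<^sup>+x. (\<integral>\<^sup>+s. \<psi> x * g (x \<odot> s *\<^sub>R \<xi>) \<partial>lborel) \<partial>(lborel :: 'a measure))"
    by (intro nn_integral_cong nn_integral_cmult[symmetric]) measurable
  also have "\<dots> = (\<integral>\<^sup>+s. (\<integral>\<^sup>+x. \<psi> x * g (x \<odot> s *\<^sub>R \<xi>) \<partial>(lborel :: 'a measure)) \<partial>lborel)"
    by (rule lborel_pair.Fubini'[symmetric]) measurable
  also have "\<dots> = (\<integral>\<^sup>+s. (\<integral>\<^sup>+y. \<psi> (y \<odot> (- s) *\<^sub>R \<xi>) * g y \<partial>(lborel :: 'a measure)) \<partial>lborel)"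
  proof (rule nn_integral_cong)
    fix s :: real
    have "(\<integral>\<^sup>+x. \<psi> x * g (x \<odot> s *\<^sub>R \<xi>) \<partial>(lborel :: 'a measure))
      = (\<integral>\<^sup>+x. (\<lambda>y. \<psi> (y \<odot> (- s) *\<^sub>R \<xi>) * g y) (x \<odot> s *\<^sub>R \<xi>) \<partial>lborel)"
      by simp
    also have "\<dots> = (\<integral>\<^sup>+y. \<psi> (y \<odot> (- s) *\<^sub>R \<xi>) * g y \<partial>lborel)"
      by (rule nn_integral_right_translate) measurable
    finally show "(\<integral>\<^sup>+x. \<psi> x * g (x \<odot> s *\<^sub>R \<xi>) \<partial>(lborel :: 'a measure)) = (\<integral>\<^sup>+y. \<psi> (y \<odot> (- s) *\<^sub>R \<xi>) * g y \<partial>lborel)" .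
  qed
  also have "\<dots> = (\<integral>\<^sup>+y. (\<integral>\<^sup>+s. \<psi> (y \<odot> (- s) *\<^sub>R \<xi>) * g y \<partial>lborel) \<partial>(lborel :: 'a measure))"
    by (rule lborel_pair.Fubini') measurable
  also have "\<dots> = (\<integral>\<^sup>+y. g y * (\<integral>\<^sup>+s. \<psi> (y \<odot> s *\<^sub>R \<xi>) \<partial>lborel) \<partial>(lborel :: 'a measure))"
  proof (rule nn_integral_cong)
    fix y :: 'a
    have "(\<integral>\<^sup>+s. \<psi> (y \<odot> s *\<^sub>R \<xi>) \<partial>lborel) = (\<integral>\<^sup>+s. \<psi> (y \<odot> (- s) *\<^sub>R \<xi>) \<partial>lborel)"
      using nn_integral_real_affine[of "\<lambda>s. \<psi> (y \<odot> s *\<^sub>R \<xi>)" "-1" 0] by simp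
    then show "(\<integral>\<^sup>+s. \<psi> (y \<odot> (- s) *\<^sub>R \<xi>) * g y \<partial>lborel) = g y * (\<integral>\<^sup>+s. \<psi> (y \<odot> s *\<^sub>R \<xi>) \<partial>lborel)"
      by (subst nn_integral_multc) (auto simp: mult.commute)
  qed
  finally show ?thesis .
qed

text \<open>Left translation by \<open>- x\<close> turns the line into the straight line of all
  \<open>s *\<^sub>R \<xi>\<close>, which leaves every bounded set.\<close>

lemma line_leaves_compact:
  assumes "compact T" "\<xi> \<noteq> 0"
  obtains S where "\<And>s. s \<ge> S \<Longrightarrow> x \<odot> s *\<^sub>R \<xi> \<notin> T"
proof -
  have "compact ((\<lambda>k. - x \<odot> k) ` T)"
    by (intro compact_continuous_image assms gmul_continuous continuous_intros)
  then have "bounded ((\<lambda>k. - x \<odot> k) ` T)" by (rule compact_imp_bounded)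
  then obtain B where "\<forall>z\<in>(\<lambda>k. - x \<odot> k) ` T. norm z \<le> B" unfolding bounded_iff ..
  then have B: "\<And>k. k \<in> T \<Longrightarrow> norm (- x \<odot> k) \<le> B" by simp
  show thesis
  proof (rule that[of "max 0 ((B + 1) / norm \<xi>)"], rule notI)
    fix s assume s: "max 0 ((B + 1) / norm \<xi>) \<le> s" "x \<odot> s *\<^sub>R \<xi> \<in> T"
    have "norm (s *\<^sub>R \<xi>) \<le> B" using B[OF s(2)] by simp
    moreover have "B + 1 \<le> s * norm \<xi>" using s(1) assms(2) by (simp add: field_simps)
    ultimately show False using s(1) by simp
  qed
qed

lemma line_derivative: 
  assumes "(w has_derivative w') (at (x \<odot> s *\<^sub>R \<xi>))"
  shows "((\<lambda>s. w (x \<odot> s *\<^sub>R \<xi>)) has_real_derivative w' (A (x \<odot> s *\<^sub>R \<xi>) \<xi>)) (at s)"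
proof -
  have "((\<lambda>e. (x \<odot> s *\<^sub>R \<xi>) \<odot> e *\<^sub>R \<xi>) has_vector_derivative A (x \<odot> s *\<^sub>R \<xi>) \<xi>) (at 0)"
    by (rule left_line_velocity)
  then have "((\<lambda>e. x \<odot> (s + e) *\<^sub>R \<xi>) has_vector_derivative A (x \<odot> s *\<^sub>R \<xi>) \<xi>) (at 0)"
    by (simp add: gassoc gline)
  then have "((\<lambda>s. x \<odot> s *\<^sub>R \<xi>) has_vector_derivative A (x \<odot> s *\<^sub>R \<xi>) \<xi>) (at s)"
    by (rule has_vector_derivative_shift[THEN iffD1])
  from vector_derivative_chain[OF this assms] show ?thesis
    by (simp add: has_real_derivative_iff_has_vector_derivative)
qed

lemma lvf_eq: "(w has_derivative w') (at x) \<Longrightarrow> lvf gmul \<xi> w x = w' (A x \<xi>)"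
  unfolding lvf_def using line_derivative[of w w' x 0 \<xi>] by (simp add: DERIV_imp_deriv)

lemma smooth_has_derivative: "smooth_fun w \<Longrightarrow> (w has_derivative frechet_derivative w (at x)) (at x)"
  using smooth_fun_differentiable frechet_derivative_works by blast

lemma lvf_continuous:
  assumes "smooth_fun w" shows "continuous_on UNIV (lvf gmul \<xi> w)"
proof -
  have eq: "lvf gmul \<xi> w x = (\<Sum>b\<in>Basis. (A x \<xi> \<bullet> b) * frechet_derivative w (at x) b)" for x
    unfolding lvf_eq[OF smooth_has_derivative[OF assms]]
    by (rule frechet_derivative_Basis_expansion[OF smooth_fun_differentiable[OF assms]])
  have "continuous_on UNIV (\<lambda>x. A x \<xi>)"
    by (intro continuous_at_imp_continuous_on ballI differentiable_imp_continuous_within A_differentiable) auto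
  then show ?thesis
    unfolding eq[abs_def] by (intro continuous_intros smooth_fun_continuous smooth_fun_frechet assms)
qed

lemma lvf_line_derivative:
  assumes "smooth_fun w"
  shows "((\<lambda>s. w (x \<odot> s *\<^sub>R \<xi>)) has_real_derivative lvf gmul \<xi> w (x \<odot> s *\<^sub>R \<xi>)) (at s)"
  using line_derivative[OF smooth_has_derivative[OF assms]] lvf_eq[OF smooth_has_derivative[OF assms]] by simp

lemma test_function_vanishes_on_line:
  assumes "test_function w" "\<xi> \<noteq> 0"
  obtains S where "\<And>s. s \<ge> S \<Longrightarrow> w (x \<odot> s *\<^sub>R \<xi>) = 0"
proof -
  have cpt: "compact (closure {x. w x \<noteq> 0})" using assms(1) by (simp add: test_function_def)
  obtain S where S: "\<And>s. s \<ge> S \<Longrightarrow> x \<odot> s *\<^sub>R \<xi> \<notin> closure {x. w x \<noteq> 0}"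
    using line_leaves_compact[OF cpt assms(2), where x=x] by metis
  have "w (x \<odot> s *\<^sub>R \<xi>) = 0" if "s \<ge> S" for s
    using S[OF that] closure_subset[of "{x. w x \<noteq> 0}"] by auto
  then show thesis by (rule that)
qed

lemma lvf_line_continuous:
  assumes "smooth_fun w" shows "continuous_on UNIV (\<lambda>s. lvf gmul \<xi> w (x \<odot> s *\<^sub>R \<xi>))"
  by (rule continuous_on_compose2[OF lvf_continuous[OF assms]]) (auto intro!: continuous_intros)

lemma pointwise_line_bound:
  assumes w: "test_function w" "\<xi> \<noteq> 0"
  shows "ennreal \<bar>w x\<bar> \<le> (\<integral>\<^sup>+s. ennreal \<bar>lvf gmul \<xi> w (x \<odot> s *\<^sub>R \<xi>)\<bar> \<partial>lborel)"
proof -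
  have sm: "smooth_fun w" using w(1) by (simp add: test_function_def)
  obtain S where S: "\<And>s. s \<ge> S \<Longrightarrow> w (x \<odot> s *\<^sub>R \<xi>) = 0" using test_function_vanishes_on_line[OF w, where x=x] by metis
  have "ennreal \<bar>w (x \<odot> 0 *\<^sub>R \<xi>)\<bar> \<le> (\<integral>\<^sup>+s. ennreal \<bar>lvf gmul \<xi> w (x \<odot> s *\<^sub>R \<xi>)\<bar> \<partial>lborel)"
    by (rule total_variation_bound[OF lvf_line_derivative[OF sm] lvf_line_continuous[OF sm] S])
  then show ?thesis by simp
qed

lemma pointwise_level_bound:
  assumes w: "test_function w" "\<xi> \<noteq> 0" and a: "a > 0" "2 * a \<le> \<bar>w x\<bar>"
  shows "ennreal a \<le> (\<integral>\<^sup>+s. (\<lambda>y. ennreal \<bar>lvf gmul \<xi> w y\<bar> * indicator {y. a \<le> \<bar>w y\<bar> \<and> \<bar>w y\<bar> < 2 * a} y) (x \<odot> s *\<^sub>R \<xi>) \<partial>lborel)"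
proof -
  have sm: "smooth_fun w" using w(1) by (simp add: test_function_def)
  obtain S where S: "\<And>s. s \<ge> S \<Longrightarrow> w (x \<odot> s *\<^sub>R \<xi>) = 0" using test_function_vanishes_on_line[OF w, where x=x] by metis
  have "2 * a \<le> \<bar>w (x \<odot> 0 *\<^sub>R \<xi>)\<bar>" using a(2) by simp
  from level_crossing[OF lvf_line_derivative[OF sm] lvf_line_continuous[OF sm] S a(1) this]
  show ?thesis by (simp add: indicator_def)
qed

lemma lvf_measurable: "smooth_fun w \<Longrightarrow> lvf gmul \<xi> w \<in> borel_measurable borel"
  by (rule borel_measurable_continuous_onI[OF lvf_continuous])

text \<open>After bounding \<open>w\<close> by the line integral of its derivative,
  \<open>line_duality\<close> moves the line integral onto the weight.\<close>

lemma weighted_line_bound: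
  assumes w: "test_function w" "\<xi> \<noteq> 0" and \<psi>: "\<psi> \<in> borel_measurable borel"
    and C: "\<And>y. (\<integral>\<^sup>+s. \<psi> (y \<odot> s *\<^sub>R \<xi>) \<partial>lborel) \<le> C"
  shows "(\<integral>\<^sup>+x. \<psi> x * ennreal \<bar>w x\<bar> \<partial>lborel) \<le> C * (\<integral>\<^sup>+y. ennreal \<bar>lvf gmul \<xi> w y\<bar> \<partial>lborel)"
proof -
  have [measurable]: "lvf gmul \<xi> w \<in> borel_measurable borel"
    using w(1) by (intro lvf_measurable) (simp add: test_function_def)
  have "(\<integral>\<^sup>+x. \<psi> x * ennreal \<bar>w x\<bar> \<partial>lborel)
      \<le> (\<integral>\<^sup>+x. \<psi> x * (\<integral>\<^sup>+s. ennreal \<bar>lvf gmul \<xi> w (x \<odot> s *\<^sub>R \<xi>)\<bar> \<partial>lborel) \<partial>lborel)"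
    by (intro nn_integral_mono mult_left_mono pointwise_line_bound w) auto
  also have "\<dots> = (\<integral>\<^sup>+y. ennreal \<bar>lvf gmul \<xi> w y\<bar> * (\<integral>\<^sup>+s. \<psi> (y \<odot> s *\<^sub>R \<xi>) \<partial>lborel) \<partial>lborel)"
    using line_duality[OF \<psi>, of "\<lambda>y. ennreal \<bar>lvf gmul \<xi> w y\<bar>" \<xi>] by simp
  also have "\<dots> \<le> (\<integral>\<^sup>+y. ennreal \<bar>lvf gmul \<xi> w y\<bar> * C \<partial>lborel)"
    by (intro nn_integral_mono mult_left_mono C) auto
  also have "\<dots> = C * (\<integral>\<^sup>+y. ennreal \<bar>lvf gmul \<xi> w y\<bar> \<partial>lborel)"
    by (subst nn_integral_multc) (auto simp: mult.commute)
  finally show ?thesis .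
qed

text \<open>A cone around the line \<open>span {\<xi>}\<close>. Outside it \<open>1 / N\<close> has bounded integrals along all lines in
  direction \<open>\<xi>\<close>, and cones of independent directions are disjoint if they are thin.\<close>

definition cone_nbhd :: "real \<Rightarrow> 'a \<Rightarrow> 'a set" where
  "cone_nbhd \<epsilon> \<xi> = {x. \<exists>s. N (x \<odot> (- s) *\<^sub>R \<xi>) < \<epsilon> * \<bar>s\<bar>}"

lemma cone_nbhd_borel [measurable]: "cone_nbhd \<epsilon> \<xi> \<in> sets borel"
proof -
  have "cone_nbhd \<epsilon> \<xi> = (\<Union>s. {x. N (x \<odot> (- s) *\<^sub>R \<xi>) < \<epsilon> * \<bar>s\<bar>})" unfolding cone_nbhd_def by blast
  moreover have "open {x. N (x \<odot> (- s) *\<^sub>R \<xi>) < \<epsilon> * \<bar>s\<bar>}" for s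
    by (intro open_Collect_less continuous_on_compose2[OF N_continuous[of UNIV]] gmul_continuous continuous_intros) auto
  ultimately show ?thesis by (simp add: open_UN)
qed

definition hardy_weight :: "real \<Rightarrow> 'a \<Rightarrow> 'a \<Rightarrow> ennreal" where
  "hardy_weight \<epsilon> \<xi> x = (if x \<in> cone_nbhd \<epsilon> \<xi> then 0 else ennreal (1 / N x))"

lemma hardy_weight_measurable [measurable]: "hardy_weight \<epsilon> \<xi> \<in> borel_measurable borel"
  unfolding hardy_weight_def by measurable

text \<open>If the point at parameter \<open>s\<close> is outside the cone, then \<open>N\<close> at
  any parameter \<open>s0\<close> is at least \<open>\<epsilon> * \<bar>s - s0\<bar>\<close>. Taking
  \<open>N\<close> at \<open>s0\<close> below twice the infimum \<open>d > 0\<close> confines the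
  weight to an interval of length \<open>4 d / \<epsilon>\<close>, where it is at most
  \<open>1 / d\<close>.\<close>

lemma hardy_weight_line:
  assumes \<epsilon>: "\<epsilon> > 0"
  shows "(\<integral>\<^sup>+s. hardy_weight \<epsilon> \<xi> (x \<odot> s *\<^sub>R \<xi>) \<partial>lborel) \<le> ennreal (4 / \<epsilon>)"
proof -
  have zero: "hardy_weight \<epsilon> \<xi> (x \<odot> s *\<^sub>R \<xi>) = 0" if "N (x \<odot> s0 *\<^sub>R \<xi>) < \<epsilon> * \<bar>s - s0\<bar>" for s s0
  proof -
    have "(x \<odot> s *\<^sub>R \<xi>) \<odot> (- (s - s0)) *\<^sub>R \<xi> = x \<odot> s0 *\<^sub>R \<xi>"
      by (simp only: gassoc gline) simp
    then have "N ((x \<odot> s *\<^sub>R \<xi>) \<odot> (- (s - s0)) *\<^sub>R \<xi>) < \<epsilon> * \<bar>s - s0\<bar>" using that by (simp only:)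
    then have "x \<odot> s *\<^sub>R \<xi> \<in> cone_nbhd \<epsilon> \<xi>" unfolding cone_nbhd_def by (intro CollectI exI)
    then show ?thesis by (simp add: hardy_weight_def)
  qed
  define d where "d = (INF s. N (x \<odot> s *\<^sub>R \<xi>))"
  have bdd: "bdd_below (range (\<lambda>s. N (x \<odot> s *\<^sub>R \<xi>)))" by (rule bdd_belowI[of _ 0]) (auto simp: N_nonneg)
  have dle: "d \<le> N (x \<odot> s *\<^sub>R \<xi>)" for s unfolding d_def by (rule cINF_lower[OF bdd]) simp
  have d0: "d \<ge> 0" unfolding d_def by (rule cINF_greatest) (auto simp: N_nonneg)
  have near: "\<exists>s0. N (x \<odot> s0 *\<^sub>R \<xi>) < d + e" if "e > 0" for e
    using cINF_less_iff[of UNIV "\<lambda>s. N (x \<odot> s *\<^sub>R \<xi>)" "d + e"] bdd that unfolding d_def by auto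
  show ?thesis
  proof (cases "d = 0")
    case False
    then have dp: "d > 0" using d0 by simp
    obtain s0 where s0: "N (x \<odot> s0 *\<^sub>R \<xi>) < d + d" using near[OF dp] by blast
    have "hardy_weight \<epsilon> \<xi> (x \<odot> s *\<^sub>R \<xi>) \<le> ennreal (1 / d) * indicator {s0 - 2 * d / \<epsilon> .. s0 + 2 * d / \<epsilon>} s" for s
    proof (cases "s \<in> {s0 - 2 * d / \<epsilon> .. s0 + 2 * d / \<epsilon>}")
      case True
      have "1 / N (x \<odot> s *\<^sub>R \<xi>) \<le> 1 / d" using dle[of s] dp by (intro divide_left_mono) auto
      then show ?thesis using True by (simp add: hardy_weight_def ennreal_leI)
    next
      case False
      then have "2 * d / \<epsilon> < \<bar>s - s0\<bar>" by (auto simp: abs_if)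
      then have "2 * d < \<epsilon> * \<bar>s - s0\<bar>" using \<epsilon> by (simp add: field_simps)
      then show ?thesis using zero[of s0 s] s0 by simp
    qed
    then have "(\<integral>\<^sup>+s. hardy_weight \<epsilon> \<xi> (x \<odot> s *\<^sub>R \<xi>) \<partial>lborel)
        \<le> (\<integral>\<^sup>+s. ennreal (1 / d) * indicator {s0 - 2 * d / \<epsilon> .. s0 + 2 * d / \<epsilon>} s \<partial>lborel)"
      by (intro nn_integral_mono) auto
    also have "\<dots> = ennreal (1 / d) * ennreal (4 * d / \<epsilon>)"
      using dp \<epsilon> by (simp add: nn_integral_cmult_indicator)
    also have "\<dots> = ennreal (4 / \<epsilon>)" using dp \<epsilon> by (simp add: ennreal_mult[symmetric])
    finally show ?thesis .
  next
    case True
    \<comment> \<open>A zero infimum gives no upper bound for \<open>1 / N\<close>, but now the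
      support of the weight lies in intervals of arbitrarily small length and is null.\<close>
    let ?Z = "{s. hardy_weight \<epsilon> \<xi> (x \<odot> s *\<^sub>R \<xi>) \<noteq> 0}"
    have Z: "?Z \<in> sets borel"
    proof -
      have "(\<lambda>s. hardy_weight \<epsilon> \<xi> (x \<odot> s *\<^sub>R \<xi>)) \<in> borel_measurable borel" by measurable
      from measurable_sets[OF this, of "- {0}"] show ?thesis by (simp add: vimage_def)
    qed
    have Ze: "emeasure lborel ?Z \<le> ennreal e" if e: "e > 0" for e
    proof -
      obtain s0 where s0: "N (x \<odot> s0 *\<^sub>R \<xi>) < e * \<epsilon> / 2" using near[of "e * \<epsilon> / 2"] True e \<epsilon> by auto
      have "?Z \<subseteq> {s0 - e / 2 .. s0 + e / 2}"
      proof
        fix s assume s: "s \<in> ?Z"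
        show "s \<in> {s0 - e / 2 .. s0 + e / 2}"
        proof (rule ccontr)
          assume "s \<notin> {s0 - e / 2 .. s0 + e / 2}"
          then have "e / 2 < \<bar>s - s0\<bar>" by (auto simp: abs_if)
          then have "e * \<epsilon> / 2 < \<epsilon> * \<bar>s - s0\<bar>" using \<epsilon> by (simp add: field_simps)
          then show False using zero[of s0 s] s0 s by simp
        qed
      qed
      then have "emeasure lborel ?Z \<le> emeasure lborel {s0 - e / 2 .. s0 + e / 2}" by (intro emeasure_mono) auto
      then show ?thesis using e by simp
    qed
    have "emeasure lborel ?Z \<le> 0"
    proof (rule ennreal_le_epsilon)
      fix e :: real assume "0 < e"
      then show "emeasure lborel ?Z \<le> 0 + ennreal e" using Ze by (simp only: add_0)
    qed
    then have Z0: "emeasure lborel ?Z = 0" by (simp only: le_zero_eq)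
    have "?Z \<in> null_sets lborel" using Z Z0 by (intro null_setsI) simp_all
    then have "AE s in lborel. hardy_weight \<epsilon> \<xi> (x \<odot> s *\<^sub>R \<xi>) = 0"
      by (rule AE_I') auto
    then have "(\<integral>\<^sup>+s. hardy_weight \<epsilon> \<xi> (x \<odot> s *\<^sub>R \<xi>) \<partial>lborel) = 0"
      by (subst nn_integral_0_iff_AE) auto
    then show ?thesis by simp
  qed
qed

text \<open>\<open>P 1\<close> is additive and dominated by \<open>N\<close>, so a common point
  would give \<open>norm (s *\<^sub>R \<xi> - t *\<^sub>R \<zeta>) < \<epsilon> * (\<bar>s\<bar> +
  \<bar>t\<bar>)\<close>. Independence bounds the left side below by \<open>B * norm (s, t)\<close>,
  and \<open>\<epsilon> \<le> B / 2\<close> is enough because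
  \<open>\<bar>s\<bar> + \<bar>t\<bar> \<le> 2 * norm (s, t)\<close>.\<close>

lemma cone_nbhds_disjoint:
  assumes V: "\<xi> \<in> V 1" "\<zeta> \<in> V 1" and ind: "\<And>s t. s *\<^sub>R \<xi> = t *\<^sub>R \<zeta> \<Longrightarrow> s = 0 \<and> t = 0"
  shows "\<exists>\<epsilon>0>0. \<forall>\<epsilon>. 0 < \<epsilon> \<and> \<epsilon> \<le> \<epsilon>0 \<longrightarrow> cone_nbhd \<epsilon> \<xi> \<inter> cone_nbhd \<epsilon> \<zeta> = {}"
proof -
  let ?f = "\<lambda>p :: real \<times> real. fst p *\<^sub>R \<xi> - snd p *\<^sub>R \<zeta>"
  have lf: "linear ?f" by (rule linearI) (simp_all add: algebra_simps)
  have "inj ?f" unfolding linear_injective_0[OF lf] using ind by (auto simp: prod_eq_iff)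
  then obtain B where B: "B > 0" "\<And>p. B * norm p \<le> norm (?f p)"
    using linear_inj_bounded_below_pos[OF lf] by blast
  have "cone_nbhd \<epsilon> \<xi> \<inter> cone_nbhd \<epsilon> \<zeta> = {}" if \<epsilon>: "0 < \<epsilon>" "\<epsilon> \<le> B / 2" for \<epsilon>
  proof (rule ccontr)
    assume "\<not> ?thesis"
    then obtain x s t where s: "N (x \<odot> (- s) *\<^sub>R \<xi>) < \<epsilon> * \<bar>s\<bar>" and t: "N (x \<odot> (- t) *\<^sub>R \<zeta>) < \<epsilon> * \<bar>t\<bar>"
      unfolding cone_nbhd_def by blast
    have "1 \<in> {1..r}" using r_ge1 by simp
    then have P1: "P 1 (c *\<^sub>R v) = c *\<^sub>R v" if "v \<in> V 1" for v c
      using P_V[of 1 1 v] that by (simp add: linear_cmul[OF P_linear])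
    have "?f (s, t) = P 1 (x \<odot> (- t) *\<^sub>R \<zeta>) - P 1 (x \<odot> (- s) *\<^sub>R \<xi>)"
      by (simp only: P1_mult P1[OF V(1)] P1[OF V(2)]) simp
    then have "norm (?f (s, t)) \<le> N (x \<odot> (- t) *\<^sub>R \<zeta>) + N (x \<odot> (- s) *\<^sub>R \<xi>)"
      by (simp only:) (intro order_trans[OF norm_triangle_ineq4] add_mono norm_P1_le_N)
    also have "\<dots> < \<epsilon> * (\<bar>s\<bar> + \<bar>t\<bar>)" using s t by (simp add: distrib_left)
    also have "\<dots> \<le> B / 2 * (\<bar>s\<bar> + \<bar>t\<bar>)" using \<epsilon> by (intro mult_right_mono) auto
    also have "\<dots> \<le> B * norm (s, t)"
    proof -
      have "\<bar>s\<bar> \<le> norm (s, t)" "\<bar>t\<bar> \<le> norm (s, t)"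
        using norm_fst_le[of s t] norm_snd_le[of t s] by simp_all
      then have "B * ((\<bar>s\<bar> + \<bar>t\<bar>) / 2) \<le> B * norm (s, t)" using B(1) by (intro mult_left_mono) auto
      then show ?thesis by simp
    qed
    finally show False using B(2)[of "(s, t)"] by simp
  qed
  then show ?thesis using B(1) by (intro exI[of _ "B / 2"]) auto
qed

text \<open>Points whose fibre is short are discarded one direction at a time; they form a small set because
  every point of \<open>F0\<close> lies on a line on which \<open>G l\<close> has integral at least \<open>\<tau>\<close>.\<close>

primrec refine :: "(nat \<Rightarrow> 'a) \<Rightarrow> real \<Rightarrow> 'a set \<Rightarrow> nat \<Rightarrow> 'a set" where
  "refine \<zeta> \<alpha> F0 0 = F0"
| "refine \<zeta> \<alpha> F0 (Suc l) = {x \<in> refine \<zeta> \<alpha> F0 l. ennreal \<alpha> \<le> emeasure lborel {s. x \<odot> (s *\<^sub>R \<zeta> l) \<in> refine \<zeta> \<alpha> F0 l}}"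

lemma refine_borel: "F0 \<in> sets borel \<Longrightarrow> refine \<zeta> \<alpha> F0 l \<in> sets borel"
proof (induction l)
  case (Suc l)
  have [measurable]: "refine \<zeta> \<alpha> F0 l \<in> sets borel" using Suc by simp
  have S: "{s. x \<odot> (s *\<^sub>R \<zeta> l) \<in> refine \<zeta> \<alpha> F0 l} \<in> sets borel" for x
    using measurable_sets[of "\<lambda>s. x \<odot> (s *\<^sub>R \<zeta> l)" borel borel "refine \<zeta> \<alpha> F0 l"] by (simp add: vimage_def)
  have "emeasure lborel {s. x \<odot> (s *\<^sub>R \<zeta> l) \<in> refine \<zeta> \<alpha> F0 l}
      = (\<integral>\<^sup>+s. indicator (refine \<zeta> \<alpha> F0 l) (x \<odot> (s *\<^sub>R \<zeta> l)) \<partial>lborel)" for x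
    unfolding emeasure_eq_nn_integral_indicator[OF S] by (rule nn_integral_cong) (simp split: split_indicator)
  then have [measurable]: "(\<lambda>x. emeasure lborel {s. x \<odot> (s *\<^sub>R \<zeta> l) \<in> refine \<zeta> \<alpha> F0 l}) \<in> borel_measurable borel"
    by simp
  have "{x \<in> space borel. x \<in> refine \<zeta> \<alpha> F0 l \<and> ennreal \<alpha> \<le> emeasure lborel {s. x \<odot> (s *\<^sub>R \<zeta> l) \<in> refine \<zeta> \<alpha> F0 l}} \<in> sets borel"
    by measurable
  then show ?case by simp
qed simp

lemma refine_subset: "refine \<zeta> \<alpha> F0 l \<subseteq> F0"
  by (induction l) auto

lemma refine_loss:
  assumes F0: "F0 \<in> sets borel" and G: "G \<in> borel_measurable borel" and \<alpha>: "\<alpha> > 0"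
    and \<tau>: "\<And>x. x \<in> F0 \<Longrightarrow> \<tau> \<le> (\<integral>\<^sup>+s. G (x \<odot> s *\<^sub>R \<zeta> l) \<partial>lborel)"
  shows "\<tau> * emeasure lborel (refine \<zeta> \<alpha> F0 l - refine \<zeta> \<alpha> F0 (Suc l)) \<le> ennreal \<alpha> * (\<integral>\<^sup>+y. G y \<partial>lborel)"
proof -
  let ?F = "refine \<zeta> \<alpha> F0 l" let ?B = "?F - refine \<zeta> \<alpha> F0 (Suc l)"
  note G [measurable]
  have [measurable]: "?F \<in> sets borel" and B [measurable]: "?B \<in> sets borel"
    using refine_borel[OF F0] by blast+
  \<comment> \<open>If a line meets the discarded set at all, the line is re-based at such a point;
    by the reason for its removal, the whole fibre of \<open>?F\<close> through it has measure less
    than \<open>\<alpha>\<close>.\<close>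
  have fibre: "(\<integral>\<^sup>+s. indicator ?B (y \<odot> s *\<^sub>R \<zeta> l) \<partial>lborel) \<le> ennreal \<alpha>" for y
  proof (cases "\<exists>s0. y \<odot> s0 *\<^sub>R \<zeta> l \<in> ?B")
    case False
    then have "indicator ?B (y \<odot> s *\<^sub>R \<zeta> l) = (0::ennreal)" for s by (metis indicator_simps(2))
    then show ?thesis by (simp only: nn_integral_const mult_zero_left zero_le)
  next
    case True
    then obtain s0 where s0: "y \<odot> s0 *\<^sub>R \<zeta> l \<in> ?B" by blast
    let ?z = "y \<odot> s0 *\<^sub>R \<zeta> l"
    have S: "{s. ?z \<odot> (s *\<^sub>R \<zeta> l) \<in> ?F} \<in> sets borel"
      using measurable_sets[of "\<lambda>s. ?z \<odot> (s *\<^sub>R \<zeta> l)" borel borel ?F] by (simp add: vimage_def)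
    have "(\<integral>\<^sup>+s. indicator ?B (y \<odot> s *\<^sub>R \<zeta> l) \<partial>lborel) \<le> (\<integral>\<^sup>+s. indicator ?F (y \<odot> s *\<^sub>R \<zeta> l) \<partial>lborel)"
      by (intro nn_integral_mono) (auto split: split_indicator)
    also have "\<dots> = (\<integral>\<^sup>+s. indicator ?F (y \<odot> (s0 + 1 * s) *\<^sub>R \<zeta> l) \<partial>lborel)"
      using nn_integral_real_affine[of "\<lambda>s. indicator ?F (y \<odot> s *\<^sub>R \<zeta> l)" 1 s0] by simp
    also have "\<dots> = (\<integral>\<^sup>+s. indicator {s. ?z \<odot> (s *\<^sub>R \<zeta> l) \<in> ?F} s \<partial>lborel)"
      by (intro nn_integral_cong) (simp add: gassoc gline split: split_indicator)
    also have "\<dots> = emeasure lborel {s. ?z \<odot> (s *\<^sub>R \<zeta> l) \<in> ?F}" using S by simp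
    also have "\<dots> \<le> ennreal \<alpha>" using s0 by auto
    finally show ?thesis .
  qed
  have "\<tau> * emeasure lborel ?B = (\<integral>\<^sup>+x. \<tau> * indicator ?B x \<partial>lborel)" using B by (simp add: nn_integral_cmult_indicator)
  also have "\<dots> \<le> (\<integral>\<^sup>+x. indicator ?B x * (\<integral>\<^sup>+s. G (x \<odot> s *\<^sub>R \<zeta> l) \<partial>lborel) \<partial>lborel)"
    using \<tau> refine_subset[of \<zeta> \<alpha> F0 l] by (intro nn_integral_mono) (auto split: split_indicator)
  also have "\<dots> = (\<integral>\<^sup>+y. G y * (\<integral>\<^sup>+s. indicator ?B (y \<odot> s *\<^sub>R \<zeta> l) \<partial>lborel) \<partial>lborel)"
    by (rule line_duality) measurable
  also have "\<dots> \<le> (\<integral>\<^sup>+y. G y * ennreal \<alpha> \<partial>lborel)"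
    by (intro nn_integral_mono mult_left_mono fibre) auto
  also have "\<dots> = ennreal \<alpha> * (\<integral>\<^sup>+y. G y \<partial>lborel)" by (subst nn_integral_multc) (auto simp: mult.commute)
  finally show ?thesis .
qed

end

lemma test_function_lincomb:
  assumes "test_function u" "test_function v"
  shows "test_function (\<lambda>x. u x + c * v x)"
proof -
  let ?S = "closure {x. u x \<noteq> 0} \<union> closure {x. v x \<noteq> 0}"
  have "smooth_fun (\<lambda>x. u x + c * v x)"
    using assms by (simp add: test_function_def smooth_fun_def Ck_add Ck_cmul)
  moreover have "{x. u x + c * v x \<noteq> 0} \<subseteq> {x. u x \<noteq> 0} \<union> {x. v x \<noteq> 0}" by auto
  then have "closure {x. u x + c * v x \<noteq> 0} \<subseteq> ?S"
    unfolding closure_Un[symmetric] by (rule closure_mono)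
  then have "?S \<inter> closure {x. u x + c * v x \<noteq> 0} = closure {x. u x + c * v x \<noteq> 0}" by blast
  moreover have "compact ?S" using assms by (intro compact_Un) (auto simp: test_function_def)
  then have "compact (?S \<inter> closure {x. u x + c * v x \<noteq> 0})" by (rule compact_Int_closed) simp
  ultimately show ?thesis unfolding test_function_def by (simp only: simp_thms)
qed

lemma test_function_measurable: "test_function u \<Longrightarrow> u \<in> borel_measurable borel"
  unfolding test_function_def by (intro borel_measurable_continuous_onI smooth_fun_continuous) auto

section \<open>Left-invariant derivatives of test functions, and towers from refinement\<close>

context strat_group begin

lemma lvf_support:
  assumes "x \<notin> closure {x. w x \<noteq> 0}" shows "lvf gmul \<xi> w x = 0"
proof -
  have "(w has_derivative (\<lambda>_. 0)) (at x)"
  proof (rule has_derivative_transform_within_open[of "\<lambda>_. 0" "\<lambda>_. 0" x UNIV "- closure {x. w x \<noteq> 0}"])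
    show "0 = w y" if "y \<in> - closure {x. w x \<noteq> 0}" for y
      using that closure_subset[of "{x. w x \<noteq> 0}"] by auto
  qed (use assms in auto)
  then show ?thesis by (simp add: lvf_eq)
qed

text \<open>Guards against the default value: for a non-integrable function the integral in
  \<open>L1_norm\<close> would be 0 and would bound nothing.\<close>

lemma lvf_integrable:
  assumes "test_function w" shows "integrable lborel (lvf gmul \<xi> w)"
proof -
  let ?S = "closure {x. w x \<noteq> 0}"
  have "compact ?S" "smooth_fun w" using assms by (auto simp: test_function_def)
  then have "integrable lborel (\<lambda>x. indicator ?S x *\<^sub>R lvf gmul \<xi> w x)"
    by (intro borel_integrable_compact continuous_on_subset[OF lvf_continuous]) auto
  moreover have "(\<lambda>x. indicator ?S x *\<^sub>R lvf gmul \<xi> w x) = lvf gmul \<xi> w"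
    using lvf_support[of _ w \<xi>] by (auto simp: fun_eq_iff split: split_indicator)
  ultimately show ?thesis by simp
qed

lemma lvf_add_direction:
  assumes "test_function w" shows "lvf gmul (\<xi> + c *\<^sub>R \<zeta>) w x = lvf gmul \<xi> w x + c * lvf gmul \<zeta> w x"
proof -
  have sm: "smooth_fun w" using assms by (simp add: test_function_def)
  note d = smooth_has_derivative[OF sm]
  show ?thesis
    unfolding lvf_eq[OF d] linear_add[OF linear_A] linear_cmul[OF linear_A]
      linear_add[OF has_derivative_linear[OF d]] linear_cmul[OF has_derivative_linear[OF d]] by simp
qed

lemma lvf_add_function:
  assumes "test_function u" "test_function v"
  shows "lvf gmul \<xi> (\<lambda>x. u x + c * v x) x = lvf gmul \<xi> u x + c * lvf gmul \<xi> v x"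
proof -
  have sm: "smooth_fun u" "smooth_fun v" using assms by (auto simp: test_function_def)
  have "((\<lambda>x. u x + c * v x) has_derivative
      (\<lambda>h. frechet_derivative u (at x) h + c * frechet_derivative v (at x) h)) (at x)"
    by (intro has_derivative_add has_derivative_mult_right smooth_has_derivative sm)
  from lvf_eq[OF this] show ?thesis
    using lvf_eq[OF smooth_has_derivative[OF sm(1)]] lvf_eq[OF smooth_has_derivative[OF sm(2)]] by simp
qed

lemma br_self: "br x x = 0"
proof -
  have "Ad (t *\<^sub>R x) x = x" for t
  proof (rule vector_derivative_unique_at)
    show "((\<lambda>s. t *\<^sub>R x \<odot> s *\<^sub>R x \<odot> - (t *\<^sub>R x)) has_vector_derivative Ad (t *\<^sub>R x) x) (at 0)"
      by (rule Ad_velocity[OF line_velocity]) simp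
    have "t *\<^sub>R x \<odot> s *\<^sub>R x \<odot> - (t *\<^sub>R x) = s *\<^sub>R x" for s
      using gline[of "t + s" x "- t"] by (simp add: gline)
    then show "((\<lambda>s. t *\<^sub>R x \<odot> s *\<^sub>R x \<odot> - (t *\<^sub>R x)) has_vector_derivative x) (at 0)"
      using line_velocity by simp
  qed
  then have "((\<lambda>t::real. x) has_vector_derivative br x x) (at 0)" using Ad_line_velocity[of x x] by simp
  from vector_derivative_unique_at[OF this has_vector_derivative_const] show ?thesis .
qed

text \<open>All refinements together lose at most \<open>DIM('a) * \<alpha> * a / \<tau>\<close> of
  the measure, which is less than \<open>f\<close>, so some point survives them; read backwards, the
  refinements form a tower starting at that point.\<close>

lemma refined_tower:
  fixes G :: "nat \<Rightarrow> 'a \<Rightarrow> ennreal"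
  assumes tower: "\<forall>F x0 \<alpha>. \<alpha> > 0 \<longrightarrow> (\<forall>k\<le>DIM('a). F k \<in> sets borel) \<longrightarrow> x0 \<in> F 0 \<longrightarrow>
    (\<forall>k<DIM('a). \<forall>x\<in>F k. ennreal \<alpha> \<le> emeasure lborel {s. x \<odot> (s *\<^sub>R \<eta> k) \<in> F (Suc k)}) \<longrightarrow>
    ennreal (c * \<alpha> ^ hom_dim r V) \<le> emeasure lborel (F DIM('a))"
    and F0: "F0 \<in> sets borel" "emeasure lborel F0 = ennreal f" "0 \<le> f"
    and G: "\<And>l. l < DIM('a) \<Longrightarrow> G l \<in> borel_measurable borel"
      "\<And>l. l < DIM('a) \<Longrightarrow> (\<integral>\<^sup>+y. G l y \<partial>lborel) \<le> ennreal a"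
      "\<And>l x. l < DIM('a) \<Longrightarrow> x \<in> F0 \<Longrightarrow> ennreal \<tau> \<le> (\<integral>\<^sup>+s. G l (x \<odot> s *\<^sub>R \<eta> l) \<partial>lborel)"
    and pos: "\<tau> > 0" "a \<ge> 0" "\<alpha> > 0" and small: "real DIM('a) * \<alpha> * a < \<tau> * f"
  shows "c * \<alpha> ^ hom_dim r V \<le> f"
proof -
  let ?n = "DIM('a)"
  \<comment> \<open>Reversed, because the tower climbs from the most refined set to
    \<open>F0\<close>: the passage from stage \<open>Suc l\<close> to stage \<open>l\<close> uses
    the letter with index \<open>DIM('a) - 1 - l\<close>.\<close>
  let ?\<zeta> = "\<lambda>l. \<eta> (?n - 1 - l)"
  let ?R = "refine ?\<zeta> \<alpha> F0"
  have Rm: "?R l \<in> sets borel" for l by (rule refine_borel[OF F0(1)])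
  have loss: "ennreal \<tau> * emeasure lborel (?R l - ?R (Suc l)) \<le> ennreal (\<alpha> * a)" if "l < ?n" for l
  proof -
    have l: "?n - 1 - l < ?n" using that by simp
    have "ennreal \<tau> * emeasure lborel (?R l - ?R (Suc l)) \<le> ennreal \<alpha> * (\<integral>\<^sup>+y. G (?n - 1 - l) y \<partial>lborel)"
      by (rule refine_loss[OF F0(1) G(1)[OF l] pos(3)]) (rule G(3)[OF l])
    also have "\<dots> \<le> ennreal \<alpha> * ennreal a" by (intro mult_left_mono G(2)[OF l]) simp
    finally show ?thesis using pos by (simp add: ennreal_mult)
  qed
  have acc: "ennreal (\<tau> * f) \<le> ennreal \<tau> * emeasure lborel (?R l) + ennreal (real l * (\<alpha> * a))" if "l \<le> ?n" for l
    using that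
  proof (induction l)
    case 0
    then show ?case using F0 pos by (simp add: ennreal_mult)
  next
    case (Suc l)
    have sub: "?R (Suc l) \<subseteq> ?R l" by auto
    have "emeasure lborel (?R l) \<le> emeasure lborel (?R (Suc l)) + emeasure lborel (?R l - ?R (Suc l))"
      using emeasure_subadditive[of "?R (Suc l)" lborel "?R l - ?R (Suc l)"] Rm sub
      by (simp del: refine.simps add: Un_absorb1)
    then have "ennreal \<tau> * emeasure lborel (?R l)
        \<le> ennreal \<tau> * emeasure lborel (?R (Suc l)) + ennreal \<tau> * emeasure lborel (?R l - ?R (Suc l))"
      by (metis distrib_left mult_left_mono zero_le)
    also have "\<dots> \<le> ennreal \<tau> * emeasure lborel (?R (Suc l)) + ennreal (\<alpha> * a)"
      using loss[of l] Suc.prems by (intro add_left_mono) simp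
    finally have "ennreal (\<tau> * f) \<le> ennreal \<tau> * emeasure lborel (?R (Suc l)) + ennreal (\<alpha> * a) + ennreal (real l * (\<alpha> * a))"
      using Suc.IH Suc.prems by (meson Suc_leD add_right_mono order_trans)
    also have "\<dots> = ennreal \<tau> * emeasure lborel (?R (Suc l)) + (ennreal (\<alpha> * a) + ennreal (real l * (\<alpha> * a)))"
      by (simp only: add.assoc)
    also have "ennreal (\<alpha> * a) + ennreal (real l * (\<alpha> * a)) = ennreal (real (Suc l) * (\<alpha> * a))"
      using pos by (subst ennreal_plus[symmetric]) (auto simp: algebra_simps)
    finally show ?case .
  qed
  have "?R ?n \<noteq> {}"
  proof
    assume "?R ?n = {}"
    then have "ennreal (\<tau> * f) \<le> ennreal (real ?n * (\<alpha> * a))" using acc[OF order_refl] by simp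
    then have "\<tau> * f \<le> real ?n * (\<alpha> * a)" using pos by (subst (asm) ennreal_le_iff) auto
    then show False using small by (simp add: mult.assoc)
  qed
  then obtain x0 where x0: "x0 \<in> ?R ?n" by blast
  have "ennreal \<alpha> \<le> emeasure lborel {s. x \<odot> (s *\<^sub>R \<eta> k) \<in> ?R (?n - Suc k)}" if k: "k < ?n" and x: "x \<in> ?R (?n - k)" for k x
  proof -
    have "?n - k = Suc (?n - Suc k)" "?\<zeta> (?n - Suc k) = \<eta> k" using k by auto
    then show ?thesis using x by simp
  qed
  then have "ennreal (c * \<alpha> ^ hom_dim r V) \<le> emeasure lborel (?R (?n - ?n))"
    using tower[rule_format, of \<alpha> "\<lambda>k. ?R (?n - k)" x0] pos Rm x0 by simp
  then show ?thesis using F0(2,3) by (simp add: ennreal_le_iff)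
qed

end

text \<open>For \<open>a > 0\<close> the choice \<open>\<alpha> = \<tau> * f / (2 * n * a)\<close>,
  half of the admissible threshold, turns the tower bound into
  \<open>f ^ (Q - 1) \<le> (2 * n) ^ Q / c * (a / \<tau>) ^ Q\<close>.\<close>

lemma critical_exponent_bound:
  fixes c f a \<tau> n :: real and Q :: nat
  assumes Q: "Q \<ge> 2" and pos: "c > 0" "n > 0" "\<tau> > 0" "a \<ge> 0" "f \<ge> 0"
    and tower: "\<And>\<alpha>. \<alpha> > 0 \<Longrightarrow> n * \<alpha> * a < \<tau> * f \<Longrightarrow> c * \<alpha> ^ Q \<le> f"
  shows "f \<le> ((2 * n) ^ Q / c) powr (1 / (real Q - 1)) * (a / \<tau>) powr (real Q / (real Q - 1))"
proof (cases "f = 0")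
  case True
  then show ?thesis by simp
next
  case False
  then have f: "f > 0" using pos by simp
  have Q1: "real Q - 1 > 0" using Q by simp
  show ?thesis
  proof (cases "a = 0")
    case True
    \<comment> \<open>With \<open>a = 0\<close> every \<open>\<alpha>\<close> is admissible; this
      one makes \<open>c * \<alpha> = c + f + 1\<close> exceed \<open>f\<close>, a
      contradiction.\<close>
    let ?\<alpha> = "1 + (f + 1) / c"
    have \<alpha>: "?\<alpha> \<ge> 1" using f pos by simp
    have "c * ?\<alpha> ^ Q \<le> f" using tower[of ?\<alpha>] True f pos \<alpha> by simp
    moreover have "?\<alpha> \<le> ?\<alpha> ^ Q" using \<alpha> Q by (simp add: self_le_power)
    then have "c * ?\<alpha> \<le> c * ?\<alpha> ^ Q" using pos by (intro mult_left_mono) auto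
    moreover have "c * ?\<alpha> = c + (f + 1)" using pos by (simp add: field_simps)
    ultimately show ?thesis using pos by simp
  next
    case False
    then have a: "a > 0" using pos by simp
    let ?\<alpha> = "\<tau> * f / (2 * n * a)"
    have "c * ?\<alpha> ^ Q \<le> f" using tower[of ?\<alpha>] f pos a by (simp add: field_simps)
    then have "c * (\<tau> * f) ^ Q \<le> f * (2 * n * a) ^ Q"
      using a pos by (simp add: power_divide field_simps)
    moreover have "f ^ Q = f * f ^ (Q - 1)" using Q by (simp add: power_eq_if)
    ultimately have "c * \<tau> ^ Q * f ^ (Q - 1) \<le> (2 * n) ^ Q * a ^ Q"
      using f by (simp add: power_mult_distrib mult_ac)
    then have "f ^ (Q - 1) \<le> (2 * n) ^ Q / c * (a / \<tau>) ^ Q"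
      using pos by (simp add: power_divide field_simps)
    then have "(f ^ (Q - 1)) powr (1 / (real Q - 1)) \<le> ((2 * n) ^ Q / c * (a / \<tau>) ^ Q) powr (1 / (real Q - 1))"
      using f Q1 by (intro powr_mono2) auto
    also have "(f ^ (Q - 1)) powr (1 / (real Q - 1)) = f"
      using f Q Q1 by (simp add: powr_realpow[symmetric] powr_powr of_nat_diff)
    also have "((2 * n) ^ Q / c * (a / \<tau>) ^ Q) powr (1 / (real Q - 1))
        = ((2 * n) ^ Q / c) powr (1 / (real Q - 1)) * ((a / \<tau>) ^ Q) powr (1 / (real Q - 1))"
      by (rule powr_mult)
    also have "((a / \<tau>) ^ Q) powr (1 / (real Q - 1)) = (a / \<tau>) powr (real Q / (real Q - 1))"
      using a pos by (simp add: powr_realpow[symmetric] powr_powr)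
    finally show ?thesis .
  qed
qed

section \<open>Estimates for the symmetrised gradient\<close>

locale korn_group = strat_group gmul r V P
  for gmul :: "'a::euclidean_space \<Rightarrow> 'a \<Rightarrow> 'a" (infixl "\<odot>" 70) and r V P +
  fixes X :: "nat \<Rightarrow> 'a" and m :: nat
  assumes Q2: "hom_dim r V \<ge> 2" and m_def: "m = dim (V 1)"
    and X_inj: "inj_on X {1..m}" and X_ind: "independent (X ` {1..m})" and X_span: "span (X ` {1..m}) = V 1"
begin

lemma X_V1:
  assumes "i \<in> {1..m}" shows "X i \<in> V 1"
proof -
  have "X i \<in> span (X ` {1..m})" by (intro span_base imageI assms)
  then show ?thesis by (simp only: X_span)
qed

lemma X_pair_independent:
  assumes "i \<in> {1..m}" "j \<in> {1..m}" "i \<noteq> j" "a *\<^sub>R X i + b *\<^sub>R X j = 0"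
  shows "a = 0 \<and> b = 0"
proof -
  have ne: "X i \<noteq> X j" using inj_on_eq_iff[OF X_inj assms(1,2)] assms(3) by simp
  define w where "w v = (if v = X i then a else b)" for v
  have sub: "{X i, X j} \<subseteq> X ` {1..m}" using assms(1,2) by (intro insert_subsetI imageI empty_subsetI)
  have "(\<Sum>v\<in>{X i, X j}. w v *\<^sub>R v) = w (X i) *\<^sub>R X i + w (X j) *\<^sub>R X j"
    by (simp only: sum.insert finite.intros insert_iff empty_iff sum.empty ne simp_thms if_False not_False_eq_True) simp
  also have "\<dots> = 0" using assms(4) ne by (simp only: w_def if_True refl ne[symmetric] if_False)
  finally have z: "(\<Sum>v\<in>{X i, X j}. w v *\<^sub>R v) = 0" .
  have "w (X i) = 0" "w (X j) = 0"
    by (rule independentD[OF X_ind _ sub z]; simp)+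
  then show ?thesis using ne[symmetric] by (simp only: w_def if_True refl if_False simp_thms)
qed

text \<open>With at most one generator \<open>V 1\<close> is closed under brackets, so it is the
  whole algebra and \<open>hom_dim r V = m \<le> 1\<close>. Every index therefore has a partner
  \<open>j\<close>, on which the choice among \<open>X i\<close> and
  \<open>X i \<plusminus> X j\<close> relies.\<close>

lemma m_ge2: "2 \<le> m"
proof (rule ccontr)
  assume "\<not> 2 \<le> m"
  then have "{1..m} \<subseteq> {1}" by auto
  then have "X ` {1..m} \<subseteq> {X 1}" by blast
  from span_mono[OF this] have V1: "V 1 \<subseteq> span {X 1}" by (simp only: X_span)
  have 1: "1 \<in> {1..r}" using r_ge1 by simp
  have "br x y \<in> V 1" if "x \<in> V 1" "y \<in> V 1" for x y
  proof -
    have "x \<in> span {X 1}" "y \<in> span {X 1}" using V1 that by blast+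
    then obtain a b where "x = a *\<^sub>R X 1" "y = b *\<^sub>R X 1" unfolding span_singleton by (elim rangeE)
    then have "br x y = 0"
      using linear_cmul[OF linear_br_left] linear_cmul[OF linear_br_right] br_self by simp
    then show ?thesis using subspace_0[OF V_subspace[OF 1]] by simp
  qed
  then have U: "V 1 = UNIV" by (intro V1_generates[OF V_subspace[OF 1] order_refl])
  have "dim (V j) = 0" if "j \<in> {1..r}" "j \<noteq> 1" for j
  proof -
    have "v = 0" if "v \<in> V j" for v
    proof -
      have "P j v = v" using P_V[of j j v] \<open>j \<in> {1..r}\<close> that by simp
      moreover have "P j v = 0" using P_V[of 1 j v] 1 \<open>j \<in> {1..r}\<close> \<open>j \<noteq> 1\<close> U by simp
      ultimately show ?thesis by simp
    qed
    then have "V j \<subseteq> {0}" by blast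
    then show ?thesis by simp
  qed
  then have "hom_dim r V = (\<Sum>j=1..r. if j = 1 then m else 0)"
    unfolding hom_dim_def by (intro sum.cong) (auto simp: m_def)
  then show False using Q2 \<open>\<not> 2 \<le> m\<close> by (auto split: if_splits)
qed

text \<open>\<open>\<sigma> = 0\<close> encodes \<open>X i\<close> itself; keeping \<open>j\<close>
  in that triple pairs it with \<open>(i, j, 1)\<close> and \<open>(i, j, -1)\<close> when cones are
  compared.\<close>

definition dirs :: "(nat \<times> nat \<times> real) set" where
  "dirs = {(i, j, \<sigma>). i \<in> {1..m} \<and> j \<in> {1..m} \<and> i \<noteq> j \<and> \<sigma> \<in> {-1, 0, 1}}"

definition dvec :: "nat \<times> nat \<times> real \<Rightarrow> 'a" where
  "dvec d = (case d of (i, j, \<sigma>) \<Rightarrow> X i + \<sigma> *\<^sub>R X j)"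

definition dval :: "(nat \<Rightarrow> 'a \<Rightarrow> real) \<Rightarrow> nat \<times> nat \<times> real \<Rightarrow> 'a \<Rightarrow> real" where
  "dval u d = (case d of (i, j, \<sigma>) \<Rightarrow> (\<lambda>x. u i x + \<sigma> * u j x))"

definition energy :: "(nat \<Rightarrow> 'a \<Rightarrow> real) \<Rightarrow> real" where
  "energy u = (\<Sum>i=1..m. \<Sum>j=1..m. L1_norm (\<lambda>x. lvf gmul (X i) (u j) x + lvf gmul (X j) (u i) x))"

lemma finite_dirs: "finite dirs"
  by (rule finite_subset[of _ "{1..m} \<times> {1..m} \<times> {-1, 0, 1}"]) (auto simp: dirs_def)

lemma dvec_nonzero:
  assumes "d \<in> dirs" shows "dvec d \<noteq> 0"
proof
  assume z: "dvec d = 0"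
  obtain i j \<sigma> where d: "d = (i, j, \<sigma>)" by (cases d)
  have ij: "i \<in> {1..m}" "j \<in> {1..m}" "i \<noteq> j" using assms by (simp_all add: d dirs_def)
  have "1 *\<^sub>R X i + \<sigma> *\<^sub>R X j = 0" using z by (simp add: d dvec_def)
  from X_pair_independent[OF ij this] show False by simp
qed

lemma energy_nonneg: "0 \<le> energy u"
  unfolding energy_def L1_norm_def by (intro sum_nonneg integral_nonneg_AE) auto

lemma dval_test_function:
  "(\<And>j. j \<in> {1..m} \<Longrightarrow> test_function (u j)) \<Longrightarrow> d \<in> dirs \<Longrightarrow> test_function (dval u d)"
  by (auto simp: dirs_def dval_def intro!: test_function_lincomb)

text \<open>The derivative of \<open>u i + \<sigma> u j\<close> in the matching direction \<open>X i + \<sigma> X j\<close> is a combination of the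
  symmetrised derivatives alone.\<close>

lemma dval_energy:
  assumes u: "\<And>j. j \<in> {1..m} \<Longrightarrow> test_function (u j)" and d: "d \<in> dirs"
  shows "(\<integral>\<^sup>+x. ennreal \<bar>lvf gmul (dvec d) (dval u d) x\<bar> \<partial>lborel) \<le> ennreal (3 * energy u)"
proof -
  obtain i j \<sigma> where d': "d = (i, j, \<sigma>)" "i \<in> {1..m}" "j \<in> {1..m}" "\<sigma> \<in> {-1, 0, 1}"
    using d by (auto simp: dirs_def)
  let ?E = "\<lambda>i j x. lvf gmul (X i) (u j) x + lvf gmul (X j) (u i) x"
  have int: "integrable lborel (?E a b)" if "a \<in> {1..m}" "b \<in> {1..m}" for a b
    using lvf_integrable[OF u[OF that(1)]] lvf_integrable[OF u[OF that(2)]] by (intro Bochner_Integration.integrable_add)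
  have nn: "(\<integral>\<^sup>+x. ennreal \<bar>?E a b x\<bar> \<partial>lborel) \<le> ennreal (energy u)" if "a \<in> {1..m}" "b \<in> {1..m}" for a b
  proof -
    have "(\<integral>\<^sup>+x. ennreal \<bar>?E a b x\<bar> \<partial>lborel) = ennreal (L1_norm (?E a b))"
      unfolding L1_norm_def by (rule nn_integral_eq_integral[OF integrable_abs[OF int[OF that]]]) auto
    moreover have "L1_norm (?E a b) \<le> (\<Sum>j=1..m. L1_norm (?E a j))"
      by (rule member_le_sum[OF that(2)]) (auto simp: L1_norm_def)
    moreover have "(\<Sum>j=1..m. L1_norm (?E a j)) \<le> energy u"
      unfolding energy_def
      by (rule member_le_sum[OF that(1), of "\<lambda>i. \<Sum>j=1..m. L1_norm (?E i j)"]) (auto simp: L1_norm_def intro!: sum_nonneg)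
    ultimately show ?thesis by (simp add: ennreal_leI)
  qed
  have meas: "(\<lambda>x. ennreal \<bar>?E a b x\<bar>) \<in> borel_measurable lborel" if "a \<in> {1..m}" "b \<in> {1..m}" for a b
    using borel_measurable_integrable[OF int[OF that]] by measurable
  have pt: "\<bar>lvf gmul (dvec d) (dval u d) x\<bar> \<le> \<bar>?E i i x\<bar> + \<bar>?E i j x\<bar> + \<bar>?E j j x\<bar>" for x
  proof -
    let ?l = "\<lambda>a b. lvf gmul (X a) (u b) x"
    have "lvf gmul (dvec d) (dval u d) x = ?l i i + \<sigma> * ?l i j + \<sigma> * (?l j i + \<sigma> * ?l j j)"
      using u[OF d'(2)] u[OF d'(3)] by (simp add: d'(1) dvec_def dval_def lvf_add_direction lvf_add_function test_function_lincomb)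
        (simp add: algebra_simps)
    \<comment> \<open>The diagonal derivatives \<open>?l i i\<close> and \<open>?l j j\<close> are
      halves of \<open>?E i i x\<close> and \<open>?E j j x\<close>. All coefficients are at most 1
      in absolute value, and the three terms account for the constant 3.\<close>
    also have "\<dots> = ?E i i x / 2 + \<sigma> * ?E i j x + \<sigma>^2 * (?E j j x / 2)"
      by (simp add: algebra_simps power2_eq_square)
    finally have e: "lvf gmul (dvec d) (dval u d) x = ?E i i x / 2 + \<sigma> * ?E i j x + \<sigma>^2 * (?E j j x / 2)" .
    show ?thesis unfolding e using d'(4) by (auto simp: abs_if)
  qed
  have "(\<integral>\<^sup>+x. ennreal \<bar>lvf gmul (dvec d) (dval u d) x\<bar> \<partial>lborel)
      \<le> (\<integral>\<^sup>+x. ennreal \<bar>?E i i x\<bar> + ennreal \<bar>?E i j x\<bar> + ennreal \<bar>?E j j x\<bar> \<partial>lborel)"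
  proof (rule nn_integral_mono)
    fix x
    have "ennreal \<bar>lvf gmul (dvec d) (dval u d) x\<bar> \<le> ennreal (\<bar>?E i i x\<bar> + \<bar>?E i j x\<bar> + \<bar>?E j j x\<bar>)"
      by (rule ennreal_leI[OF pt])
    also have "\<dots> = ennreal \<bar>?E i i x\<bar> + ennreal \<bar>?E i j x\<bar> + ennreal \<bar>?E j j x\<bar>"
      by (subst ennreal_plus) (auto simp: ennreal_plus)
    finally show "ennreal \<bar>lvf gmul (dvec d) (dval u d) x\<bar> \<le> ennreal \<bar>?E i i x\<bar> + ennreal \<bar>?E i j x\<bar> + ennreal \<bar>?E j j x\<bar>" .
  qed
  also have "\<dots> = (\<integral>\<^sup>+x. ennreal \<bar>?E i i x\<bar> \<partial>lborel) + (\<integral>\<^sup>+x. ennreal \<bar>?E i j x\<bar> \<partial>lborel) + (\<integral>\<^sup>+x. ennreal \<bar>?E j j x\<bar> \<partial>lborel)"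
    by (subst nn_integral_add[OF borel_measurable_add[OF meas[OF d'(2,2)] meas[OF d'(2,3)]] meas[OF d'(3,3)]],
        subst nn_integral_add[OF meas[OF d'(2,2)] meas[OF d'(2,3)]], rule refl)
  also have "\<dots> \<le> ennreal (energy u) + ennreal (energy u) + ennreal (energy u)"
    by (intro add_mono nn d')
  also have "\<dots> = ennreal (3 * energy u)"
    using energy_nonneg[of u] by (simp add: ennreal_plus[symmetric] del: ennreal_plus)
  finally show ?thesis .
qed

lemma dominant_component:
  fixes u :: "nat \<Rightarrow> 'a \<Rightarrow> real"
  shows "\<exists>i\<in>{1..m}. \<forall>k\<in>{1..m}. \<bar>u k x\<bar> \<le> \<bar>u i x\<bar>"
proof -
  have ne: "(\<lambda>k. \<bar>u k x\<bar>) ` {1..m} \<noteq> {}" using m_ge2 by auto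
  from Max_in[OF _ ne] obtain i where i: "i \<in> {1..m}" "Max ((\<lambda>k. \<bar>u k x\<bar>) ` {1..m}) = \<bar>u i x\<bar>" by auto
  show ?thesis by (intro bexI[OF _ i(1)] ballI) (simp flip: i(2))
qed

lemma other_index: assumes "i \<in> {1..m}" obtains j where "j \<in> {1..m}" "j \<noteq> i"
  using m_ge2 by (cases "i = 1") (auto intro: that[of 1] that[of 2])

text \<open>Unlike \<open>sgn\<close> it is never 0, so that the direction
  \<open>X i + same_sign a b *\<^sub>R X j\<close> stays independent of \<open>X i\<close>.\<close>

definition same_sign :: "real \<Rightarrow> real \<Rightarrow> real" where
  "same_sign a b = (if a * b \<ge> 0 then 1 else -1)"

lemma same_sign: "\<bar>a\<bar> \<le> \<bar>a + same_sign a b * b\<bar>" "same_sign a b \<in> {-1, 1}"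
  by (auto simp: same_sign_def abs_if zero_le_mult_iff not_le mult_less_0_iff)

text \<open>The usable direction varies with the point. Replacing it by the sum over the finite set
  \<open>dirs\<close> removes the choice, and each summand is covered by
  \<open>weighted_line_bound\<close>.\<close>

lemma hardy_nn:
  "\<exists>C\<ge>0. \<forall>u k. (\<forall>j\<in>{1..m}. test_function (u j)) \<longrightarrow> k \<in> {1..m} \<longrightarrow>
    (\<integral>\<^sup>+x. ennreal (\<bar>u k x\<bar> / N x) \<partial>lborel) \<le> ennreal (C * energy u)"
proof -
  \<comment> \<open>For \<open>\<sigma> = 0\<close> the two cones coincide, hence the guard on the
    last component.\<close>
  have "\<forall>d\<in>dirs. \<exists>e0>0. \<forall>e. 0 < e \<and> e \<le> e0 \<longrightarrow> (snd (snd d) \<noteq> 0 \<longrightarrow>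
      cone_nbhd e (dvec (fst d, fst (snd d), 0)) \<inter> cone_nbhd e (dvec d) = {})"
  proof
    fix d assume "d \<in> dirs"
    then obtain i j \<sigma> where d: "d = (i, j, \<sigma>)" "i \<in> {1..m}" "j \<in> {1..m}" "i \<noteq> j" by (auto simp: dirs_def)
    show "\<exists>e0>0. \<forall>e. 0 < e \<and> e \<le> e0 \<longrightarrow> (snd (snd d) \<noteq> 0 \<longrightarrow>
      cone_nbhd e (dvec (fst d, fst (snd d), 0)) \<inter> cone_nbhd e (dvec d) = {})"
    proof (cases "\<sigma> = 0")
      case False
      have "1 \<in> {1..r}" using r_ge1 by simp
      then have V: "X i + \<sigma> *\<^sub>R X j \<in> V 1"
        using X_V1 d by (intro subspace_add subspace_scale V_subspace) auto
      have "s = 0 \<and> t = 0" if "s *\<^sub>R X i = t *\<^sub>R (X i + \<sigma> *\<^sub>R X j)" for s t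
      proof -
        have "(s - t) *\<^sub>R X i + (- (t * \<sigma>)) *\<^sub>R X j = 0" using that by (simp add: algebra_simps)
        from X_pair_independent[OF d(2-4) this] show ?thesis using False by simp
      qed
      from cone_nbhds_disjoint[OF X_V1[OF d(2)] V this] show ?thesis using False by (simp add: d(1) dvec_def)
    qed (auto simp: d intro: exI[of _ 1])
  qed
  from bchoice[OF this] obtain e0 where e0: "\<forall>d\<in>dirs. e0 d > 0 \<and> (\<forall>e. 0 < e \<and> e \<le> e0 d \<longrightarrow> (snd (snd d) \<noteq> 0 \<longrightarrow>
      cone_nbhd e (dvec (fst d, fst (snd d), 0)) \<inter> cone_nbhd e (dvec d) = {}))" ..
  \<comment> \<open>One aperture for all directions, since a pair of cones is disjoint only when
    both are thin.\<close>
  define e where "e = Min (insert 1 (e0 ` dirs))"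
  have fin: "finite (insert 1 (e0 ` dirs))" using finite_dirs by simp
  have e: "e > 0" unfolding e_def using fin e0 by (subst Min_gr_iff) auto
  have ele: "e \<le> e0 d" if "d \<in> dirs" for d unfolding e_def using fin that by (intro Min_le) auto
  have disj: "cone_nbhd e (dvec (i, j, 0)) \<inter> cone_nbhd e (dvec (i, j, \<sigma>)) = {}" if "(i, j, \<sigma>) \<in> dirs" "\<sigma> \<noteq> 0" for i j \<sigma>
    using e0[rule_format, OF that(1)] ele[OF that(1)] e that(2) by simp
  let ?C = "real (card dirs) * (4 / e * 3)"
  show ?thesis
  proof (intro exI[of _ ?C] conjI allI impI)
    show "0 \<le> ?C" using e by simp
    fix u :: "nat \<Rightarrow> 'a \<Rightarrow> real" and k assume u: "\<forall>j\<in>{1..m}. test_function (u j)" and k: "k \<in> {1..m}"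
    have tf: "test_function (dval u d)" if "d \<in> dirs" for d
      by (rule dval_test_function[OF u[rule_format] that])
    have pt: "ennreal (\<bar>u k x\<bar> / N x) \<le> (\<Sum>d\<in>dirs. hardy_weight e (dvec d) x * ennreal \<bar>dval u d x\<bar>)" for x
    proof -
      obtain i where i: "i \<in> {1..m}" "\<forall>k\<in>{1..m}. \<bar>u k x\<bar> \<le> \<bar>u i x\<bar>"
        using dominant_component[of u x] by (elim bexE)
      obtain j where j: "j \<in> {1..m}" "j \<noteq> i" by (rule other_index[OF i(1)])
      let ?\<sigma> = "same_sign (u i x) (u j x)"
      have d: "(i, j, 0) \<in> dirs" "(i, j, ?\<sigma>) \<in> dirs" "?\<sigma> \<noteq> 0"
        using i(1) j same_sign(2)[of "u i x" "u j x"] by (auto simp: dirs_def)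
      have "\<exists>d\<in>dirs. x \<notin> cone_nbhd e (dvec d) \<and> \<bar>u i x\<bar> \<le> \<bar>dval u d x\<bar>"
      proof (cases "x \<in> cone_nbhd e (dvec (i, j, 0))")
        case True
        then have "x \<notin> cone_nbhd e (dvec (i, j, ?\<sigma>))" using disj[OF d(2,3)] by blast
        moreover have "\<bar>u i x\<bar> \<le> \<bar>dval u (i, j, ?\<sigma>) x\<bar>" using same_sign(1) by (simp add: dval_def)
        ultimately show ?thesis using d(2) by blast
      next
        case False
        then show ?thesis using d(1) by (intro bexI[of _ "(i, j, 0)"]) (auto simp: dval_def)
      qed
      then obtain d where d: "d \<in> dirs" "x \<notin> cone_nbhd e (dvec d)" "\<bar>u i x\<bar> \<le> \<bar>dval u d x\<bar>" by blast
      have "\<bar>u k x\<bar> / N x \<le> 1 / N x * \<bar>dval u d x\<bar>"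
        using i(2)[rule_format, OF k] d(3) N_nonneg[of x] by (simp add: divide_right_mono)
      then have "ennreal (\<bar>u k x\<bar> / N x) \<le> ennreal (1 / N x * \<bar>dval u d x\<bar>)" by (rule ennreal_leI)
      also have "\<dots> = hardy_weight e (dvec d) x * ennreal \<bar>dval u d x\<bar>"
        using d(2) N_nonneg[of x] by (simp add: hardy_weight_def ennreal_mult[symmetric])
      also have "\<dots> \<le> (\<Sum>d\<in>dirs. hardy_weight e (dvec d) x * ennreal \<bar>dval u d x\<bar>)"
        by (rule member_le_sum[OF d(1)]) (auto simp: finite_dirs)
      finally show ?thesis .
    qed
    have wm: "(\<lambda>x. hardy_weight e (dvec d) x * ennreal \<bar>dval u d x\<bar>) \<in> borel_measurable lborel" if "d \<in> dirs" for d
      using test_function_measurable[OF tf[OF that]] by measurable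
    have "(\<integral>\<^sup>+x. ennreal (\<bar>u k x\<bar> / N x) \<partial>lborel) \<le> (\<integral>\<^sup>+x. (\<Sum>d\<in>dirs. hardy_weight e (dvec d) x * ennreal \<bar>dval u d x\<bar>) \<partial>lborel)"
      by (rule nn_integral_mono[OF pt])
    also have "\<dots> = (\<Sum>d\<in>dirs. \<integral>\<^sup>+x. hardy_weight e (dvec d) x * ennreal \<bar>dval u d x\<bar> \<partial>lborel)"
      by (rule nn_integral_sum[OF wm])
    also have "\<dots> \<le> (\<Sum>d\<in>dirs. ennreal (4 / e) * ennreal (3 * energy u))"
    proof (rule sum_mono)
      fix d assume d: "d \<in> dirs"
      have "(\<integral>\<^sup>+x. hardy_weight e (dvec d) x * ennreal \<bar>dval u d x\<bar> \<partial>lborel)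
          \<le> ennreal (4 / e) * (\<integral>\<^sup>+y. ennreal \<bar>lvf gmul (dvec d) (dval u d) y\<bar> \<partial>lborel)"
        by (rule weighted_line_bound[OF tf[OF d] dvec_nonzero[OF d] hardy_weight_measurable hardy_weight_line[OF e]])
      also have "\<dots> \<le> ennreal (4 / e) * ennreal (3 * energy u)"
        using u d by (intro mult_left_mono dval_energy) auto
      finally show "(\<integral>\<^sup>+x. hardy_weight e (dvec d) x * ennreal \<bar>dval u d x\<bar> \<partial>lborel) \<le> ennreal (4 / e) * ennreal (3 * energy u)" .
    qed
    also have "\<dots> = ennreal (?C * energy u)"
      using e energy_nonneg[of u]
      by (simp add: ennreal_mult[symmetric] ennreal_of_nat_eq_real_of_nat mult_ac)
    finally show "(\<integral>\<^sup>+x. ennreal (\<bar>u k x\<bar> / N x) \<partial>lborel) \<le> ennreal (?C * energy u)" .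
  qed
qed

end

text \<open>All powers of 2 with integer exponent, enumerated by \<open>nat\<close> through
  \<open>int_decode\<close> so that sums over scales become series over \<open>nat\<close>.\<close>

definition dyadic :: "nat \<Rightarrow> real" where
  "dyadic n = 2 powr (real_of_int (int_decode n) - 1)"

lemma dyadic_pos: "dyadic n > 0" by (simp add: dyadic_def)

lemma dyadic_exists:
  assumes "b > 0" shows "\<exists>n. 2 * dyadic n \<le> b \<and> b < 4 * dyadic n"
proof -
  let ?z = "\<lfloor>log 2 b\<rfloor>"
  have d: "dyadic (int_encode ?z) = 2 powr real_of_int ?z / 2" by (simp add: dyadic_def powr_diff)
  have "2 powr real_of_int ?z \<le> b" using assms by (simp add: le_log_iff[symmetric])
  moreover have "log 2 b < real_of_int ?z + 1" by linarith
  then have "b < 2 powr (real_of_int ?z + 1)" by (subst (asm) log_less_iff) (use assms in auto)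
  then have "b < 2 * 2 powr real_of_int ?z" by (simp add: powr_add)
  ultimately show ?thesis using d by (intro exI[of _ "int_encode ?z"]) auto
qed

lemma dyadic_disjoint: "disjoint_family (\<lambda>n. {y. dyadic n \<le> \<bar>w y\<bar> \<and> \<bar>w y\<bar> < 2 * dyadic n})"
  unfolding disjoint_family_on_def
proof (intro ballI impI)
  have less: "2 * dyadic k \<le> dyadic n" if "int_decode k < int_decode n" for k n
  proof -
    have "2 * dyadic k = 2 powr (1 + (real_of_int (int_decode k) - 1))"
      unfolding dyadic_def by (subst powr_add) simp
    also have "\<dots> \<le> dyadic n" unfolding dyadic_def using that by (intro powr_mono) auto
    finally show ?thesis .
  qed
  fix k n :: nat assume "k \<noteq> n"
  then have "int_decode k \<noteq> int_decode n" by (metis int_decode_inverse)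
  then show "{y. dyadic k \<le> \<bar>w y\<bar> \<and> \<bar>w y\<bar> < 2 * dyadic k} \<inter> {y. dyadic n \<le> \<bar>w y\<bar> \<and> \<bar>w y\<bar> < 2 * dyadic n} = {}"
    using less[of k n] less[of n k] by fastforce
qed

section \<open>Level sets and the critical Sobolev bound\<close>

context korn_group begin

text \<open>The directions usable at points where \<open>u i\<close> is dominant and
  \<open>\<sigma> j\<close> is the sign of \<open>u j\<close> relative to \<open>u i\<close>; the
  value \<open>s = 0\<close> supplies \<open>X i\<close>.\<close>

definition good_dirs :: "nat \<Rightarrow> (nat \<Rightarrow> real) \<Rightarrow> (nat \<times> nat \<times> real) set" where
  "good_dirs i \<sigma> = {(i, j, s) | j s. j \<in> {1..m} \<and> j \<noteq> i \<and> s \<in> {0, \<sigma> j}}"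

lemma good_dirs_subset:
  "i \<in> {1..m} \<Longrightarrow> (\<And>j. j \<in> {1..m} \<Longrightarrow> \<sigma> j \<in> {-1, 1}) \<Longrightarrow> good_dirs i \<sigma> \<subseteq> dirs"
  by (fastforce simp: good_dirs_def dirs_def)

text \<open>\<open>X i\<close> comes from \<open>s = 0\<close>, and \<open>X j\<close> is recovered
  because \<open>\<sigma> j\<close> squares to 1. Spanning \<open>V 1\<close> is what the
  construction of words asks of its letters.\<close>

lemma span_good_dirs:
  assumes i: "i \<in> {1..m}" and \<sigma>: "\<And>j. j \<in> {1..m} \<Longrightarrow> \<sigma> j \<in> {-1, 1}"
  shows "span (dvec ` good_dirs i \<sigma>) = V 1"
proof
  have V1: "subspace (V 1)" using r_ge1 by (intro V_subspace) simp
  show "span (dvec ` good_dirs i \<sigma>) \<subseteq> V 1"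
  proof (rule span_minimal[OF _ V1])
    show "dvec ` good_dirs i \<sigma> \<subseteq> V 1"
    proof (rule image_subsetI)
      fix d assume "d \<in> good_dirs i \<sigma>"
      then obtain j s where d: "d = (i, j, s)" "j \<in> {1..m}" by (auto simp: good_dirs_def)
      show "dvec d \<in> V 1"
        unfolding d(1) dvec_def prod.case by (intro subspace_add[OF V1] subspace_scale[OF V1] X_V1 i d(2))
    qed
  qed
  have Xi: "X i \<in> span (dvec ` good_dirs i \<sigma>)"
  proof -
    obtain j where "j \<in> {1..m}" "j \<noteq> i" by (rule other_index[OF i])
    then have "(i, j, 0) \<in> good_dirs i \<sigma>" by (simp add: good_dirs_def)
    then have "dvec (i, j, 0) \<in> span (dvec ` good_dirs i \<sigma>)" by (intro span_base imageI)
    then show ?thesis by (simp add: dvec_def)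
  qed
  have "X j \<in> span (dvec ` good_dirs i \<sigma>)" if j: "j \<in> {1..m}" for j
  proof (cases "j = i")
    case False
    then have "(i, j, \<sigma> j) \<in> good_dirs i \<sigma>" using j by (simp add: good_dirs_def)
    then have "dvec (i, j, \<sigma> j) \<in> span (dvec ` good_dirs i \<sigma>)" by (intro span_base imageI)
    then have "\<sigma> j *\<^sub>R (dvec (i, j, \<sigma> j) - X i) \<in> span (dvec ` good_dirs i \<sigma>)" using Xi by (intro span_scale span_diff)
    moreover have "\<sigma> j * \<sigma> j = 1" using \<sigma>[OF j] by auto
    ultimately show ?thesis by (simp add: dvec_def)
  qed (use Xi in simp)
  then have "span (X ` {1..m}) \<subseteq> span (dvec ` good_dirs i \<sigma>)"
    by (intro span_minimal subspace_span) blast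
  then show "V 1 \<subseteq> span (dvec ` good_dirs i \<sigma>)" by (simp only: X_span)
qed

definition level_density :: "(nat \<Rightarrow> 'a \<Rightarrow> real) \<Rightarrow> real \<Rightarrow> nat \<times> nat \<times> real \<Rightarrow> 'a \<Rightarrow> ennreal" where
  "level_density u \<tau> d y = ennreal \<bar>lvf gmul (dvec d) (dval u d) y\<bar> *
     indicator {y. \<tau> \<le> \<bar>dval u d y\<bar> \<and> \<bar>dval u d y\<bar> < 2 * \<tau>} y"

definition level_set :: "(nat \<Rightarrow> 'a \<Rightarrow> real) \<Rightarrow> nat \<Rightarrow> (nat \<Rightarrow> real) \<Rightarrow> real \<Rightarrow> 'a set" where
  "level_set u i \<sigma> \<tau> = {x. \<forall>d\<in>good_dirs i \<sigma>. 2 * \<tau> \<le> \<bar>dval u d x\<bar>}"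

abbreviation qexp :: real where "qexp \<equiv> real (hom_dim r V) / (real (hom_dim r V) - 1)"

lemma level_density_measurable:
  assumes "test_function (dval u d)" shows "level_density u \<tau> d \<in> borel_measurable borel"
proof -
  have [measurable]: "dval u d \<in> borel_measurable borel" by (rule test_function_measurable[OF assms])
  have [measurable]: "lvf gmul (dvec d) (dval u d) \<in> borel_measurable borel"
    using assms by (intro lvf_measurable) (simp add: test_function_def)
  show ?thesis unfolding level_density_def[abs_def] by measurable
qed

lemma level_set_borel:
  assumes "\<And>d. d \<in> dirs \<Longrightarrow> test_function (dval u d)" "good_dirs i \<sigma> \<subseteq> dirs"
  shows "level_set u i \<sigma> \<tau> \<in> sets borel"
proof -
  have fin: "finite (good_dirs i \<sigma>)" using assms(2) finite_dirs by (rule finite_subset)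
  have "{x \<in> space borel. \<forall>d\<in>good_dirs i \<sigma>. 2 * \<tau> \<le> \<bar>dval u d x\<bar>} \<in> sets borel"
  proof (rule sets.sets_Collect_finite_All[OF _ fin])
    fix d assume "d \<in> good_dirs i \<sigma>"
    then have [measurable]: "dval u d \<in> borel_measurable borel" using assms by (intro test_function_measurable) blast
    show "{x \<in> space borel. 2 * \<tau> \<le> \<bar>dval u d x\<bar>} \<in> sets borel" by measurable
  qed
  then show ?thesis by (simp add: level_set_def)
qed

text \<open>The word and its constant depend on the pattern \<open>(i, \<sigma>)\<close>, hence
  \<open>C\<close> is chosen after the pattern but before \<open>u\<close>, \<open>\<tau>\<close>
  and \<open>a\<close>. Points of the level set satisfy \<open>pointwise_level_bound\<close> for
  every letter, so the tower can be built inside it.\<close>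

lemma level_set_bound:
  assumes i: "i \<in> {1..m}" and \<sigma>: "\<And>j. j \<in> {1..m} \<Longrightarrow> \<sigma> j \<in> {-1, 1}"
  shows "\<exists>C\<ge>0. \<forall>u \<tau> a. (\<forall>j\<in>{1..m}. test_function (u j)) \<longrightarrow> \<tau> > 0 \<longrightarrow> a \<ge> 0 \<longrightarrow>
    (\<forall>d\<in>dirs. (\<integral>\<^sup>+y. level_density u \<tau> d y \<partial>lborel) \<le> ennreal a) \<longrightarrow>
    emeasure lborel (level_set u i \<sigma> \<tau>) \<le> ennreal (C * (a / \<tau>) powr qexp)"
proof -
  let ?n = "DIM('a)" and ?Q = "hom_dim r V"
  have gd: "good_dirs i \<sigma> \<subseteq> dirs" by (rule good_dirs_subset[OF i \<sigma>])
  have sp: "span (dvec ` good_dirs i \<sigma>) = V 1" by (rule span_good_dirs[OF i \<sigma>])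
  from tower_bound[OF sp] obtain \<eta> c where
    \<eta>: "\<forall>l<?n. \<eta> l \<in> dvec ` good_dirs i \<sigma>" and c: "c > 0" and tower:
    "\<forall>F x0 \<alpha>. \<alpha> > 0 \<longrightarrow> (\<forall>k\<le>?n. F k \<in> sets borel) \<longrightarrow> x0 \<in> F 0 \<longrightarrow>
    (\<forall>k<?n. \<forall>x\<in>F k. ennreal \<alpha> \<le> emeasure lborel {s. x \<odot> (s *\<^sub>R \<eta> k) \<in> F (Suc k)}) \<longrightarrow>
    ennreal (c * \<alpha> ^ ?Q) \<le> emeasure lborel (F ?n)" by (elim exE conjE)
  have "\<forall>l. \<exists>d. l < ?n \<longrightarrow> d \<in> good_dirs i \<sigma> \<and> \<eta> l = dvec d" using \<eta> by blast
  from choice[OF this] obtain dd where dd: "\<And>l. l < ?n \<Longrightarrow> dd l \<in> good_dirs i \<sigma>" "\<And>l. l < ?n \<Longrightarrow> \<eta> l = dvec (dd l)"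
    by blast
  let ?C = "((2 * real ?n) ^ ?Q / c) powr (1 / (real ?Q - 1))"
  show ?thesis
  proof (intro exI[of _ ?C] conjI allI impI)
    fix u :: "nat \<Rightarrow> 'a \<Rightarrow> real" and \<tau> a :: real
    assume u: "\<forall>j\<in>{1..m}. test_function (u j)" and \<tau>: "\<tau> > 0" and a: "a \<ge> 0"
      and le: "\<forall>d\<in>dirs. (\<integral>\<^sup>+y. level_density u \<tau> d y \<partial>lborel) \<le> ennreal a"
    have tf: "test_function (dval u d)" if "d \<in> dirs" for d
      by (rule dval_test_function[OF u[rule_format] that])
    let ?F = "level_set u i \<sigma> \<tau>"
    have Fb: "?F \<in> sets borel" by (rule level_set_borel[OF tf gd])
    obtain j0 where j0: "j0 \<in> {1..m}" "j0 \<noteq> i" by (rule other_index[OF i])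
    \<comment> \<open>Finiteness of the measure allows the comparison to be made in the reals. It
      comes from the direction \<open>(i, j0, 0)\<close>, along which the level condition says that
      \<open>u i\<close> does not vanish.\<close>
    have "?F \<subseteq> closure {x. u i x \<noteq> 0}"
    proof
      fix x assume x: "x \<in> ?F"
      have "(i, j0, 0) \<in> good_dirs i \<sigma>" using j0 by (simp add: good_dirs_def)
      then have "2 * \<tau> \<le> \<bar>dval u (i, j0, 0) x\<bar>" using x unfolding level_set_def by blast
      then have "u i x \<noteq> 0" using \<tau> by (auto simp: dval_def)
      then show "x \<in> closure {x. u i x \<noteq> 0}" using closure_subset[of "{x. u i x \<noteq> 0}"] by auto
    qed
    then have "emeasure lborel ?F \<le> emeasure lborel (closure {x. u i x \<noteq> 0})"
      by (intro emeasure_mono) auto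
    also have "\<dots> < \<infinity>" using u i by (intro emeasure_compact_finite) (auto simp: test_function_def)
    finally obtain f where f: "emeasure lborel ?F = ennreal f" "0 \<le> f"
      by (cases "emeasure lborel ?F") auto
    have "f \<le> ?C * (a / \<tau>) powr (real ?Q / (real ?Q - 1))"
    proof (rule critical_exponent_bound[OF Q2 c _ \<tau> a f(2)])
      show "real ?n > 0" by simp
      fix \<alpha> :: real assume \<alpha>: "\<alpha> > 0" and small: "real ?n * \<alpha> * a < \<tau> * f"
      show "c * \<alpha> ^ ?Q \<le> f"
      proof (rule refined_tower[OF tower Fb f, of "\<lambda>l. level_density u \<tau> (dd l)" a \<tau>])
        fix l assume l: "l < ?n"
        have d: "dd l \<in> dirs" using dd(1)[OF l] gd by blast
        show "level_density u \<tau> (dd l) \<in> borel_measurable borel" by (rule level_density_measurable[OF tf[OF d]])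
        show "(\<integral>\<^sup>+y. level_density u \<tau> (dd l) y \<partial>lborel) \<le> ennreal a" using le d by blast
        fix x assume "x \<in> ?F"
        then have "2 * \<tau> \<le> \<bar>dval u (dd l) x\<bar>" using dd(1)[OF l] unfolding level_set_def by blast
        from pointwise_level_bound[OF tf[OF d] dvec_nonzero[OF d] \<tau> this]
        show "ennreal \<tau> \<le> (\<integral>\<^sup>+s. level_density u \<tau> (dd l) (x \<odot> s *\<^sub>R \<eta> l) \<partial>lborel)"
          unfolding level_density_def dd(2)[OF l] .
      qed (use \<tau> a \<alpha> small in auto)
    qed
    then show "emeasure lborel ?F \<le> ennreal (?C * (a / \<tau>) powr qexp)" unfolding f(1) by (rule ennreal_leI)
  qed simp
qed

text \<open>At the scale \<open>\<tau> = dyadic n\<close> the level set bound decays like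
  \<open>\<tau> powr (- qexp)\<close>, which cancels the size of the integrand there. What remains
  is the sum of \<open>a n powr qexp\<close>, at most \<open>Atot powr (qexp - 1)\<close> times the
  sum of the \<open>a n\<close> because \<open>qexp > 1\<close>.\<close>

lemma sobolev_nn:
  "\<exists>C\<ge>0. \<forall>u k. (\<forall>j\<in>{1..m}. test_function (u j)) \<longrightarrow> k \<in> {1..m} \<longrightarrow>
    (\<integral>\<^sup>+x. ennreal (\<bar>u k x\<bar> powr qexp) \<partial>lborel) \<le> ennreal (C * energy u powr qexp)"
proof -
  let ?\<Sigma> = "PiE {1..m} (\<lambda>_. {-1, 1 :: real})"
  let ?I = "{1..m} \<times> ?\<Sigma>"
  have finI: "finite ?I" by (intro finite_cartesian_product finite_PiE) auto
  have q1: "qexp > 1" using Q2 by (simp add: field_simps)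
  have "\<forall>p\<in>?I. \<exists>C\<ge>0. \<forall>u \<tau> a. (\<forall>j\<in>{1..m}. test_function (u j)) \<longrightarrow> \<tau> > 0 \<longrightarrow> a \<ge> 0 \<longrightarrow>
    (\<forall>d\<in>dirs. (\<integral>\<^sup>+y. level_density u \<tau> d y \<partial>lborel) \<le> ennreal a) \<longrightarrow>
    emeasure lborel (level_set u (fst p) (snd p) \<tau>) \<le> ennreal (C * (a / \<tau>) powr qexp)"
  proof
    fix p assume p: "p \<in> ?I"
    show "\<exists>C\<ge>0. \<forall>u \<tau> a. (\<forall>j\<in>{1..m}. test_function (u j)) \<longrightarrow> \<tau> > 0 \<longrightarrow> a \<ge> 0 \<longrightarrow>
      (\<forall>d\<in>dirs. (\<integral>\<^sup>+y. level_density u \<tau> d y \<partial>lborel) \<le> ennreal a) \<longrightarrow>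
      emeasure lborel (level_set u (fst p) (snd p) \<tau>) \<le> ennreal (C * (a / \<tau>) powr qexp)"
      by (rule level_set_bound) (use p in auto)
  qed
  from bchoice[OF this] obtain C where C: "\<forall>p\<in>?I. C p \<ge> 0 \<and> (\<forall>u \<tau> a. (\<forall>j\<in>{1..m}. test_function (u j)) \<longrightarrow> \<tau> > 0 \<longrightarrow> a \<ge> 0 \<longrightarrow>
    (\<forall>d\<in>dirs. (\<integral>\<^sup>+y. level_density u \<tau> d y \<partial>lborel) \<le> ennreal a) \<longrightarrow>
    emeasure lborel (level_set u (fst p) (snd p) \<tau>) \<le> ennreal (C p * (a / \<tau>) powr qexp))" ..
  define Ct where "Ct = (\<Sum>p\<in>?I. C p)"
  have Ct0: "Ct \<ge> 0" unfolding Ct_def using C by (intro sum_nonneg) blast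
  let ?K = "4 powr qexp * Ct * (3 * real (card dirs)) powr qexp"
  show ?thesis
  proof (intro exI[of _ ?K] conjI allI impI)
    show "0 \<le> ?K" using Ct0 by simp
    fix u :: "nat \<Rightarrow> 'a \<Rightarrow> real" and k
    assume u: "\<forall>j\<in>{1..m}. test_function (u j)" and k: "k \<in> {1..m}"
    have tf: "test_function (dval u d)" if "d \<in> dirs" for d
      by (rule dval_test_function[OF u[rule_format] that])
    have uj: "\<And>j. j \<in> {1..m} \<Longrightarrow> test_function (u j)" using u by blast
    define Atot where "Atot = 3 * real (card dirs) * energy u"
    have A0: "Atot \<ge> 0" unfolding Atot_def using energy_nonneg by simp
    \<comment> \<open>Summing over \<open>dirs\<close> gives one mass per scale that dominates every
      direction. For each direction the bands of different scales are disjoint, so all these masses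
      add up to at most \<open>Atot\<close>.\<close>
    define H where "H n y = (\<Sum>d\<in>dirs. level_density u (dyadic n) d y)" for n y
    have ldm: "level_density u \<tau> d \<in> borel_measurable lborel" if "d \<in> dirs" for d \<tau>
      using level_density_measurable[OF tf[OF that]] by simp
    have Hm: "H n \<in> borel_measurable lborel" for n
      unfolding H_def[abs_def] by (intro borel_measurable_sum ldm)
    have Hsum: "(\<Sum>n. \<integral>\<^sup>+y. H n y \<partial>lborel) \<le> ennreal Atot"
    proof -
      have "(\<Sum>n. \<integral>\<^sup>+y. H n y \<partial>lborel) = (\<integral>\<^sup>+y. (\<Sum>n. H n y) \<partial>lborel)"
        by (rule nn_integral_suminf[OF Hm, symmetric])
      also have "\<dots> \<le> (\<integral>\<^sup>+y. (\<Sum>d\<in>dirs. ennreal \<bar>lvf gmul (dvec d) (dval u d) y\<bar>) \<partial>lborel)"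
      proof (rule nn_integral_mono)
        fix y
        have "(\<Sum>n. H n y) = (\<Sum>d\<in>dirs. \<Sum>n. level_density u (dyadic n) d y)"
          unfolding H_def by (rule suminf_sum) simp
        also have "\<dots> \<le> (\<Sum>d\<in>dirs. ennreal \<bar>lvf gmul (dvec d) (dval u d) y\<bar>)"
        proof (rule sum_mono)
          fix d
          have "(\<Sum>n. level_density u (dyadic n) d y) = ennreal \<bar>lvf gmul (dvec d) (dval u d) y\<bar> *
            (\<Sum>n. indicator {y. dyadic n \<le> \<bar>dval u d y\<bar> \<and> \<bar>dval u d y\<bar> < 2 * dyadic n} y)"
            unfolding level_density_def by (rule ennreal_suminf_cmult)
          also have "\<dots> = ennreal \<bar>lvf gmul (dvec d) (dval u d) y\<bar> *
            indicator (\<Union>n. {y. dyadic n \<le> \<bar>dval u d y\<bar> \<and> \<bar>dval u d y\<bar> < 2 * dyadic n}) y"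
            by (simp only: suminf_indicator[OF dyadic_disjoint])
          also have "\<dots> \<le> ennreal \<bar>lvf gmul (dvec d) (dval u d) y\<bar>" by (simp split: split_indicator)
          finally show "(\<Sum>n. level_density u (dyadic n) d y) \<le> ennreal \<bar>lvf gmul (dvec d) (dval u d) y\<bar>" .
        qed
        finally show "(\<Sum>n. H n y) \<le> (\<Sum>d\<in>dirs. ennreal \<bar>lvf gmul (dvec d) (dval u d) y\<bar>)" .
      qed
      also have "\<dots> = (\<Sum>d\<in>dirs. \<integral>\<^sup>+y. ennreal \<bar>lvf gmul (dvec d) (dval u d) y\<bar> \<partial>lborel)"
      proof (rule nn_integral_sum)
        fix d assume "d \<in> dirs"
        then have "lvf gmul (dvec d) (dval u d) \<in> borel_measurable borel"
          using tf by (intro lvf_measurable) (simp add: test_function_def)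
        then show "(\<lambda>y. ennreal \<bar>lvf gmul (dvec d) (dval u d) y\<bar>) \<in> borel_measurable lborel" by measurable
      qed
      also have "\<dots> \<le> (\<Sum>d\<in>dirs. ennreal (3 * energy u))" by (intro sum_mono dval_energy uj)
      also have "\<dots> = ennreal Atot"
        using energy_nonneg[of u] by (simp add: Atot_def ennreal_of_nat_eq_real_of_nat ennreal_mult[symmetric] mult_ac)
      finally show ?thesis .
    qed
    have Hle: "(\<integral>\<^sup>+y. H n y \<partial>lborel) \<le> ennreal Atot" for n
    proof -
      have "(\<integral>\<^sup>+y. H n y \<partial>lborel) \<le> (\<Sum>n. \<integral>\<^sup>+y. H n y \<partial>lborel)"
        using sum_le_suminf[of "\<lambda>n. \<integral>\<^sup>+y. H n y \<partial>lborel" "{n}"] by simp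
      then show ?thesis using Hsum by (rule order_trans)
    qed
    define a where "a n = enn2real (\<integral>\<^sup>+y. H n y \<partial>lborel)" for n
    have a: "ennreal (a n) = (\<integral>\<^sup>+y. H n y \<partial>lborel)" for n
      unfolding a_def using Hle[of n] by (intro ennreal_enn2real) (simp add: le_less_trans ennreal_less_top)
    have a0: "a n \<ge> 0" for n by (simp add: a_def)
    have aA: "a n \<le> Atot" for n using Hle[of n] A0 by (simp flip: a)
    have lev: "emeasure lborel (level_set u (fst p) (snd p) (dyadic n)) \<le> ennreal (C p * (a n / dyadic n) powr qexp)"
      if p: "p \<in> ?I" for p n
    proof -
      have "(\<integral>\<^sup>+y. level_density u (dyadic n) d y \<partial>lborel) \<le> ennreal (a n)" if "d \<in> dirs" for d
        unfolding a H_def using that finite_dirs by (intro nn_integral_mono member_le_sum) auto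
      then show ?thesis
        by (intro C[rule_format, OF p, THEN conjunct2, rule_format] u[rule_format] dyadic_pos a0)
    qed
    let ?S = "\<lambda>n x. \<Sum>p\<in>?I. ennreal ((4 * dyadic n) powr qexp) * indicator (level_set u (fst p) (snd p) (dyadic n)) x"
    have lsb: "level_set u (fst p) (snd p) \<tau> \<in> sets borel" if "p \<in> ?I" for p \<tau>
      by (rule level_set_borel[OF tf good_dirs_subset]) (use that in auto)
    have pt: "ennreal (\<bar>u k x\<bar> powr qexp) \<le> (\<Sum>n. ?S n x)" for x
    proof (cases "u k x = 0")
      case False
      obtain i where i: "i \<in> {1..m}" "\<forall>k\<in>{1..m}. \<bar>u k x\<bar> \<le> \<bar>u i x\<bar>"
        using dominant_component[of u x] by (elim bexE)
      have "\<bar>u i x\<bar> > 0" using i(2)[rule_format, OF k] False by simp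
      from dyadic_exists[OF this] obtain n where n: "2 * dyadic n \<le> \<bar>u i x\<bar>" "\<bar>u i x\<bar> < 4 * dyadic n" by blast
      \<comment> \<open>\<open>restrict\<close> puts the sign pattern into the extensional, hence
        finite, product \<open>?\<Sigma>\<close>.\<close>
      let ?\<sigma> = "restrict (\<lambda>j. same_sign (u i x) (u j x)) {1..m}"
      have p: "(i, ?\<sigma>) \<in> ?I" using i(1) same_sign(2) by auto
      have "\<bar>u i x\<bar> \<le> \<bar>dval u d x\<bar>" if "d \<in> good_dirs i ?\<sigma>" for d
        using that same_sign(1) by (auto simp: good_dirs_def dval_def)
      then have mem: "x \<in> level_set u i ?\<sigma> (dyadic n)" unfolding level_set_def using n(1) by fastforce
      have "ennreal (\<bar>u k x\<bar> powr qexp) \<le> ennreal ((4 * dyadic n) powr qexp)"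
        using i(2)[rule_format, OF k] n(2) q1 by (intro ennreal_leI powr_mono2) auto
      also have "\<dots> = ennreal ((4 * dyadic n) powr qexp) * indicator (level_set u (fst (i, ?\<sigma>)) (snd (i, ?\<sigma>)) (dyadic n)) x"
        using mem by simp
      also have "\<dots> \<le> ?S n x" by (rule member_le_sum[OF p]) (use finI in auto)
      also have "\<dots> \<le> (\<Sum>n. ?S n x)" using sum_le_suminf[of "\<lambda>n. ?S n x" "{n}"] by simp
      finally show ?thesis .
    qed simp
    have Sn: "(\<integral>\<^sup>+x. ?S n x \<partial>lborel) \<le> ennreal (4 powr qexp * Ct * Atot powr (qexp - 1)) * ennreal (a n)" for n
    proof -
      have "(\<integral>\<^sup>+x. ?S n x \<partial>lborel) = (\<Sum>p\<in>?I. \<integral>\<^sup>+x. ennreal ((4 * dyadic n) powr qexp) * indicator (level_set u (fst p) (snd p) (dyadic n)) x \<partial>lborel)"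
        by (rule nn_integral_sum) (use lsb in measurable)
      also have "\<dots> = (\<Sum>p\<in>?I. ennreal ((4 * dyadic n) powr qexp) * emeasure lborel (level_set u (fst p) (snd p) (dyadic n)))"
        by (rule sum.cong[OF refl], rule nn_integral_cmult_indicator) (use lsb in simp)
      also have "\<dots> \<le> (\<Sum>p\<in>?I. ennreal ((4 * dyadic n) powr qexp) * ennreal (C p * (a n / dyadic n) powr qexp))"
        by (intro sum_mono mult_left_mono lev) auto
      also have "\<dots> = (\<Sum>p\<in>?I. ennreal ((4 powr qexp * a n powr qexp) * C p))"
      proof (rule sum.cong[OF refl])
        fix p assume "p \<in> ?I"
        then have "C p \<ge> 0" using C by blast
        moreover have "(4 * dyadic n) powr qexp * (a n / dyadic n) powr qexp = 4 powr qexp * a n powr qexp"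
          using dyadic_pos[of n] a0[of n] by (simp add: powr_mult[symmetric])
        ultimately show "ennreal ((4 * dyadic n) powr qexp) * ennreal (C p * (a n / dyadic n) powr qexp)
            = ennreal ((4 powr qexp * a n powr qexp) * C p)"
          by (simp add: ennreal_mult[symmetric] mult.left_commute mult.commute)
      qed
      also have "\<dots> = ennreal ((4 powr qexp * a n powr qexp) * Ct)"
        unfolding Ct_def sum_distrib_left by (intro sum_ennreal mult_nonneg_nonneg C[rule_format, THEN conjunct1]) auto
      also have "\<dots> \<le> ennreal (4 powr qexp * Ct * Atot powr (qexp - 1) * a n)"
      proof (rule ennreal_leI)
        have "a n powr qexp = a n powr (qexp - 1) * a n powr 1" by (simp only: powr_add[symmetric]) simp
        also have "\<dots> \<le> Atot powr (qexp - 1) * a n"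
          using a0[of n] aA[of n] q1 by (intro mult_mono powr_mono2) auto
        finally have "4 powr qexp * Ct * a n powr qexp \<le> 4 powr qexp * Ct * (Atot powr (qexp - 1) * a n)"
          using Ct0 by (intro mult_left_mono) auto
        then show "4 powr qexp * a n powr qexp * Ct \<le> 4 powr qexp * Ct * Atot powr (qexp - 1) * a n"
          by (simp add: mult_ac)
      qed
      also have "\<dots> = ennreal (4 powr qexp * Ct * Atot powr (qexp - 1)) * ennreal (a n)"
        using Ct0 a0 by (intro ennreal_mult) auto
      finally show ?thesis .
    qed
    have "(\<integral>\<^sup>+x. ennreal (\<bar>u k x\<bar> powr qexp) \<partial>lborel) \<le> (\<integral>\<^sup>+x. (\<Sum>n. ?S n x) \<partial>lborel)"
      by (rule nn_integral_mono[OF pt])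
    also have "\<dots> = (\<Sum>n. \<integral>\<^sup>+x. ?S n x \<partial>lborel)"
      by (rule nn_integral_suminf) (use lsb in measurable)
    also have "\<dots> \<le> (\<Sum>n. ennreal (4 powr qexp * Ct * Atot powr (qexp - 1)) * ennreal (a n))"
      by (intro suminf_le Sn summableI)
    also have "\<dots> = ennreal (4 powr qexp * Ct * Atot powr (qexp - 1)) * (\<Sum>n. ennreal (a n))"
      by (rule ennreal_suminf_cmult)
    also have "\<dots> \<le> ennreal (4 powr qexp * Ct * Atot powr (qexp - 1)) * ennreal Atot"
      using Hsum by (intro mult_left_mono) (simp_all only: a zero_le)
    also have "\<dots> = ennreal (?K * energy u powr qexp)"
    proof -
      have "Atot powr (qexp - 1) * Atot = Atot powr (qexp - 1) * Atot powr 1" using A0 by simp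
      also have "\<dots> = Atot powr qexp" by (simp only: powr_add[symmetric]) simp
      also have "\<dots> = (3 * real (card dirs)) powr qexp * energy u powr qexp"
        unfolding Atot_def by (rule powr_mult)
      finally have e: "Atot powr (qexp - 1) * Atot = (3 * real (card dirs)) powr qexp * energy u powr qexp" .
      have "ennreal (4 powr qexp * Ct * Atot powr (qexp - 1)) * ennreal Atot = ennreal (4 powr qexp * Ct * (Atot powr (qexp - 1) * Atot))"
        using Ct0 A0 by (simp add: ennreal_mult[symmetric] mult.assoc)
      then show ?thesis unfolding e by (simp only: mult.assoc)
    qed
    finally show "(\<integral>\<^sup>+x. ennreal (\<bar>u k x\<bar> powr qexp) \<partial>lborel) \<le> ennreal (?K * energy u powr qexp)" .
  qed
qed

end

text \<open>Allows a proof to normalise by \<open>A + e > 0\<close> where \<open>A\<close> itself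
  may vanish.\<close>

lemma le_mult_by_approximation:
  fixes x c A :: real
  assumes "c \<ge> 0" "\<And>e. e > 0 \<Longrightarrow> x \<le> c * (A + e)"
  shows "x \<le> c * A"
proof (rule field_le_epsilon)
  fix e :: real assume e: "0 < e"
  have "x \<le> c * (A + e / (c + 1))" using assms e by simp
  also have "\<dots> = c * A + e * (c / (c + 1))" by (simp add: algebra_simps)
  also have "\<dots> \<le> c * A + e * 1" using assms(1) e by (intro add_left_mono mult_left_mono) auto
  finally show "x \<le> c * A + e" by simp
qed

section \<open>Intermediate exponents and passage to norms\<close>

context korn_group begin

text \<open>For \<open>x \<noteq> 0\<close> the integrand is
  \<open>(\<bar>u k x\<bar> / N x) powr \<alpha>\<close> times
  \<open>(\<bar>u k x\<bar> powr qexp) powr \<beta>\<close>. Dividing the two bases by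
  \<open>t\<close> and \<open>t powr qexp\<close>, the sizes of their integrals, makes the two terms
  of Young's inequality comparable.\<close>

lemma interpolation_nn:
  assumes p: "1 \<le> p" "p < qexp"
  shows "\<exists>C\<ge>0. \<forall>u k. (\<forall>j\<in>{1..m}. test_function (u j)) \<longrightarrow> k \<in> {1..m} \<longrightarrow>
    (\<integral>x. (N x powr (real (hom_dim r V) - 1) * \<bar>u k x\<bar>) powr p / N x powr real (hom_dim r V) \<partial>lborel) powr (1 / p)
      \<le> C * energy u"
proof -
  let ?Q = "real (hom_dim r V)"
  have Q: "?Q \<ge> 2" using Q2 by simp
  obtain C1 where C1: "C1 \<ge> 0" "\<forall>u k. (\<forall>j\<in>{1..m}. test_function (u j)) \<longrightarrow> k \<in> {1..m} \<longrightarrow>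
    (\<integral>\<^sup>+x. ennreal (\<bar>u k x\<bar> / N x) \<partial>lborel) \<le> ennreal (C1 * energy u)" using hardy_nn by (elim exE conjE)
  obtain C2 where C2: "C2 \<ge> 0" "\<forall>u k. (\<forall>j\<in>{1..m}. test_function (u j)) \<longrightarrow> k \<in> {1..m} \<longrightarrow>
    (\<integral>\<^sup>+x. ennreal (\<bar>u k x\<bar> powr qexp) \<partial>lborel) \<le> ennreal (C2 * energy u powr qexp)" using sobolev_nn by (elim exE conjE)
  \<comment> \<open>With \<open>Q\<close> the homogeneous dimension, matching the power of
    \<open>N\<close> forces \<open>\<alpha> = Q - (Q - 1) p\<close>, and matching the power of
    \<open>u\<close> forces \<open>\<alpha> + qexp * \<beta> = p\<close>; then
    \<open>\<alpha> + \<beta> = 1\<close>, as Young's inequality requires.\<close>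
  define \<alpha> where "\<alpha> = ?Q - (?Q - 1) * p"
  define \<beta> where "\<beta> = (p - 1) * (?Q - 1)"
  have ab: "\<alpha> \<ge> 0" "\<beta> \<ge> 0" "\<alpha> + \<beta> = 1" "\<alpha> + qexp * \<beta> = p"
    using p Q mult_nonneg_nonneg[of "p - 1" "?Q - 1"] by (auto simp: \<alpha>_def \<beta>_def field_simps)
  let ?f = "\<lambda>u k x. (N x powr (?Q - 1) * \<bar>u k x\<bar>) powr p / N x powr ?Q"
  let ?C = "(C1 + C2) powr (1 / p)"
  show ?thesis
  proof (intro exI[of _ ?C] conjI allI impI)
    fix u :: "nat \<Rightarrow> 'a \<Rightarrow> real" and k
    assume u: "\<forall>j\<in>{1..m}. test_function (u j)" and k: "k \<in> {1..m}"
    have um [measurable]: "u k \<in> borel_measurable borel" by (rule test_function_measurable[OF u[rule_format, OF k]])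
    have est: "(\<integral>x. ?f u k x \<partial>lborel) powr (1 / p) \<le> ?C * (energy u + e)" if e: "e > 0" for e
    proof -
      \<comment> \<open>The energy may be 0, so it is enlarged by \<open>e\<close> to permit
        division; \<open>le_mult_by_approximation\<close> removes \<open>e\<close> at the
        end.\<close>
      define t where "t = energy u + e"
      have t: "t > 0" "energy u \<le> t" using e energy_nonneg[of u] by (auto simp: t_def)
      have pt: "?f u k x \<le> t powr p * (\<bar>u k x\<bar> / N x / t) + t powr p * (\<bar>u k x\<bar> powr qexp / t powr qexp)" if "x \<noteq> 0" for x
      proof (cases "u k x = 0")
        case True
        then show ?thesis by simp
      next
        case False
        let ?v = "\<bar>u k x\<bar>"
        have pos: "?v > 0" "N x > 0" using False that N_eq_0[of x] N_nonneg[of x] by auto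
        have "?f u k x = N x powr ((?Q - 1) * p - ?Q) * ?v powr p"
          using pos by (simp only: powr_mult powr_powr powr_diff[of _ "(?Q - 1) * p"]) simp
        also have "(?Q - 1) * p - ?Q = - \<alpha>" by (simp add: \<alpha>_def)
        also have "N x powr (- \<alpha>) * ?v powr p = t powr p * ((?v / N x / t) powr \<alpha> * (?v powr qexp / t powr qexp) powr \<beta>)"
        proof -
          have "(?v / N x / t) powr \<alpha> * (?v powr qexp / t powr qexp) powr \<beta>
            = (?v powr \<alpha> * ?v powr (qexp * \<beta>)) * N x powr (- \<alpha>) / (t powr \<alpha> * t powr (qexp * \<beta>))"
            using pos t by (simp add: powr_divide powr_mult powr_powr powr_minus_divide)
          also have "\<dots> = ?v powr p * N x powr (- \<alpha>) / t powr p" by (simp only: powr_add[symmetric] ab(4))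
          finally show ?thesis using t by simp
        qed
        also have "\<dots> \<le> t powr p * (\<alpha> * (?v / N x / t) + \<beta> * (?v powr qexp / t powr qexp))"
          using pos t ab by (intro mult_left_mono Youngs_inequality_0) auto
        also have "\<dots> \<le> t powr p * ((?v / N x / t) + (?v powr qexp / t powr qexp))"
          using pos t ab by (intro mult_left_mono add_mono mult_left_le_one_le) auto
        finally show ?thesis by (simp only: distrib_left)
      qed
      have "(\<integral>\<^sup>+x. ennreal (?f u k x) \<partial>lborel) \<le> (\<integral>\<^sup>+x. ennreal (t powr p / t) * ennreal (\<bar>u k x\<bar> / N x)
          + ennreal (t powr p / t powr qexp) * ennreal (\<bar>u k x\<bar> powr qexp) \<partial>lborel)"
      proof (rule nn_integral_mono_AE)
        have "AE x in lborel. x \<notin> {0 :: 'a}" by (intro AE_not_in finite_imp_null_set_lborel) simp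
        then show "AE x in lborel. ennreal (?f u k x) \<le> ennreal (t powr p / t) * ennreal (\<bar>u k x\<bar> / N x)
          + ennreal (t powr p / t powr qexp) * ennreal (\<bar>u k x\<bar> powr qexp)"
        proof (rule eventually_mono)
          fix x :: 'a assume "x \<notin> {0}"
          then have "ennreal (?f u k x) \<le> ennreal ((t powr p / t) * (\<bar>u k x\<bar> / N x) + (t powr p / t powr qexp) * \<bar>u k x\<bar> powr qexp)"
            using pt[of x] by (intro ennreal_leI) (simp add: mult_ac)
          also have "\<dots> = ennreal (t powr p / t) * ennreal (\<bar>u k x\<bar> / N x) + ennreal (t powr p / t powr qexp) * ennreal (\<bar>u k x\<bar> powr qexp)"
            using t N_nonneg[of x] by (subst ennreal_plus) (auto simp: ennreal_mult[symmetric])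
          finally show "ennreal (?f u k x) \<le> ennreal (t powr p / t) * ennreal (\<bar>u k x\<bar> / N x)
            + ennreal (t powr p / t powr qexp) * ennreal (\<bar>u k x\<bar> powr qexp)" .
        qed
      qed
      also have "\<dots> = ennreal (t powr p / t) * (\<integral>\<^sup>+x. ennreal (\<bar>u k x\<bar> / N x) \<partial>lborel)
          + ennreal (t powr p / t powr qexp) * (\<integral>\<^sup>+x. ennreal (\<bar>u k x\<bar> powr qexp) \<partial>lborel)"
        by (simp add: nn_integral_add nn_integral_cmult)
      also have "\<dots> \<le> ennreal (t powr p / t) * ennreal (C1 * t) + ennreal (t powr p / t powr qexp) * ennreal (C2 * t powr qexp)"
      proof (intro add_mono mult_left_mono)
        have "(\<integral>\<^sup>+x. ennreal (\<bar>u k x\<bar> / N x) \<partial>lborel) \<le> ennreal (C1 * energy u)" by (rule C1(2)[rule_format, OF u[rule_format] k])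
        also have "\<dots> \<le> ennreal (C1 * t)" using t C1 by (intro ennreal_leI mult_left_mono) auto
        finally show "(\<integral>\<^sup>+x. ennreal (\<bar>u k x\<bar> / N x) \<partial>lborel) \<le> ennreal (C1 * t)" .
        have "(\<integral>\<^sup>+x. ennreal (\<bar>u k x\<bar> powr qexp) \<partial>lborel) \<le> ennreal (C2 * energy u powr qexp)" by (rule C2(2)[rule_format, OF u[rule_format] k])
        also have "\<dots> \<le> ennreal (C2 * t powr qexp)"
          using t C2 energy_nonneg[of u] p by (intro ennreal_leI mult_left_mono powr_mono2) auto
        finally show "(\<integral>\<^sup>+x. ennreal (\<bar>u k x\<bar> powr qexp) \<partial>lborel) \<le> ennreal (C2 * t powr qexp)" .
      qed auto
      also have "\<dots> = ennreal ((C1 + C2) * t powr p)"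
        using t C1 C2 by (simp add: ennreal_mult[symmetric] ennreal_plus[symmetric] distrib_right mult.commute del: ennreal_plus)
      finally have "(\<integral>x. ?f u k x \<partial>lborel) \<le> (C1 + C2) * t powr p"
        using C1 C2 by (intro integral_real_bounded) auto
      moreover have "0 \<le> (\<integral>x. ?f u k x \<partial>lborel)" by (intro integral_nonneg_AE) auto
      ultimately have "(\<integral>x. ?f u k x \<partial>lborel) powr (1 / p) \<le> ((C1 + C2) * t powr p) powr (1 / p)"
        using p by (intro powr_mono2) auto
      also have "\<dots> = ?C * (t powr p) powr (1 / p)" by (rule powr_mult)
      also have "(t powr p) powr (1 / p) = t" using t p by (simp add: powr_powr)
      finally show ?thesis by (simp only: t_def)
    qed
    show "(\<integral>x. ?f u k x \<partial>lborel) powr (1 / p) \<le> ?C * energy u"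
      by (rule le_mult_by_approximation[OF _ est]) simp
  qed simp
qed

lemma hardy_integral:
  "\<exists>C\<ge>0. \<forall>u k. (\<forall>j\<in>{1..m}. test_function (u j)) \<longrightarrow> k \<in> {1..m} \<longrightarrow>
    (\<integral>x. \<bar>u k x\<bar> / N x \<partial>lborel) \<le> C * energy u"
proof -
  obtain C where C: "C \<ge> 0" "\<forall>u k. (\<forall>j\<in>{1..m}. test_function (u j)) \<longrightarrow> k \<in> {1..m} \<longrightarrow>
    (\<integral>\<^sup>+x. ennreal (\<bar>u k x\<bar> / N x) \<partial>lborel) \<le> ennreal (C * energy u)" using hardy_nn by (elim exE conjE)
  show ?thesis
  proof (intro exI[of _ C] conjI allI impI C(1))
    fix u :: "nat \<Rightarrow> 'a \<Rightarrow> real" and k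
    assume u: "\<forall>j\<in>{1..m}. test_function (u j)" and k: "k \<in> {1..m}"
    show "(\<integral>x. \<bar>u k x\<bar> / N x \<partial>lborel) \<le> C * energy u"
      by (intro integral_real_bounded C(2)[rule_format, OF u[rule_format] k] mult_nonneg_nonneg C(1) energy_nonneg)
  qed
qed

lemma sobolev_norm:
  "\<exists>C\<ge>0. \<forall>u k. (\<forall>j\<in>{1..m}. test_function (u j)) \<longrightarrow> k \<in> {1..m} \<longrightarrow>
    Lp_norm qexp (u k) \<le> C * energy u"
proof -
  obtain C where C: "C \<ge> 0" "\<forall>u k. (\<forall>j\<in>{1..m}. test_function (u j)) \<longrightarrow> k \<in> {1..m} \<longrightarrow>
    (\<integral>\<^sup>+x. ennreal (\<bar>u k x\<bar> powr qexp) \<partial>lborel) \<le> ennreal (C * energy u powr qexp)" using sobolev_nn by (elim exE conjE)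
  have q: "qexp > 1" using Q2 by (simp add: field_simps)
  show ?thesis
  proof (intro exI[of _ "C powr (1 / qexp)"] conjI allI impI)
    fix u :: "nat \<Rightarrow> 'a \<Rightarrow> real" and k
    assume u: "\<forall>j\<in>{1..m}. test_function (u j)" and k: "k \<in> {1..m}"
    have "(\<integral>x. \<bar>u k x\<bar> powr qexp \<partial>lborel) \<le> C * energy u powr qexp"
      using C(1) C(2)[rule_format, OF u[rule_format] k] by (intro integral_real_bounded) auto
    moreover have "0 \<le> (\<integral>x. \<bar>u k x\<bar> powr qexp \<partial>lborel)" by (intro integral_nonneg_AE) auto
    ultimately have "Lp_norm qexp (u k) \<le> (C * energy u powr qexp) powr (1 / qexp)"
      unfolding Lp_norm_def using q Q2 by (intro powr_mono2 divide_nonneg_nonneg) auto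
    also have "\<dots> = C powr (1 / qexp) * (energy u powr qexp) powr (1 / qexp)" by (rule powr_mult)
    also have "(energy u powr qexp) powr (1 / qexp) = energy u" using energy_nonneg[of u] q Q2 by (simp only: powr_powr) auto
    finally show "Lp_norm qexp (u k) \<le> C powr (1 / qexp) * energy u" .
  qed simp
qed

lemma sum_bound:
  assumes "\<exists>C\<ge>0. \<forall>u k. (\<forall>j\<in>{1..m}. test_function (u j)) \<longrightarrow> k \<in> {1..m} \<longrightarrow> T u k \<le> C * energy u"
  shows "\<exists>C. \<forall>u. (\<forall>j\<in>{1..m}. test_function (u j)) \<longrightarrow> (\<Sum>j=1..m. T u j) \<le> C * energy u"
proof -
  obtain C where C: "\<forall>u k. (\<forall>j\<in>{1..m}. test_function (u j)) \<longrightarrow> k \<in> {1..m} \<longrightarrow> T u k \<le> C * energy u"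
    using assms by (elim exE conjE)
  show ?thesis
  proof (intro exI[of _ "real m * C"] allI impI)
    fix u :: "nat \<Rightarrow> 'a \<Rightarrow> real" assume u: "\<forall>j\<in>{1..m}. test_function (u j)"
    have "(\<Sum>j=1..m. T u j) \<le> (\<Sum>j=1..m. C * energy u)" by (intro sum_mono C[rule_format] u[rule_format])
    then show "(\<Sum>j=1..m. T u j) \<le> real m * C * energy u" by simp
  qed
qed

end

theorem theorem7p3:
  fixes gmul :: "'a::euclidean_space \<Rightarrow> 'a \<Rightarrow> 'a"
    and r :: nat and V :: "nat \<Rightarrow> 'a set" and P :: "nat \<Rightarrow> 'a \<Rightarrow> 'a"
    and X :: "nat \<Rightarrow> 'a" and m :: nat
  assumes G: "stratified_group gmul r V P"
    and Q2: "hom_dim r V \<ge> 2"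
    and m_def: "m = dim (V 1)"
    and X_basis: "inj_on X {1..m}" "independent (X ` {1..m})" "span (X ` {1..m}) = V 1"
  shows
    "(\<exists>C. \<forall>u :: nat \<Rightarrow> 'a \<Rightarrow> real. (\<forall>j\<in>{1..m}. test_function (u j)) \<longrightarrow>
        (\<Sum>j=1..m. Lp_norm (real (hom_dim r V) / (real (hom_dim r V) - 1)) (u j))
          \<le> C * (\<Sum>i=1..m. \<Sum>j=1..m.
                   L1_norm (\<lambda>x. lvf gmul (X i) (u j) x + lvf gmul (X j) (u i) x)))
     \<and> (\<exists>C. \<forall>u :: nat \<Rightarrow> 'a \<Rightarrow> real. (\<forall>j\<in>{1..m}. test_function (u j)) \<longrightarrow>
        (\<Sum>j=1..m. (\<integral>x. \<bar>u j x\<bar> / hom_norm r P x \<partial>lborel))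
          \<le> C * (\<Sum>i=1..m. \<Sum>j=1..m.
                   L1_norm (\<lambda>x. lvf gmul (X i) (u j) x + lvf gmul (X j) (u i) x)))
     \<and> (\<forall>p::real. 1 \<le> p \<and> p < real (hom_dim r V) / (real (hom_dim r V) - 1) \<longrightarrow>
        (\<exists>C. \<forall>u :: nat \<Rightarrow> 'a \<Rightarrow> real. (\<forall>j\<in>{1..m}. test_function (u j)) \<longrightarrow>
          (\<Sum>j=1..m. (\<integral>x. (hom_norm r P x powr (real (hom_dim r V) - 1) * \<bar>u j x\<bar>) powr p
                            / hom_norm r P x powr real (hom_dim r V) \<partial>lborel) powr (1 / p))
            \<le> C * (\<Sum>i=1..m. \<Sum>j=1..m.
                     L1_norm (\<lambda>x. lvf gmul (X i) (u j) x + lvf gmul (X j) (u i) x))))"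
proof -
  interpret korn_group gmul r V P X m
    using assms by unfold_locales
  show ?thesis
    using sum_bound[OF sobolev_norm] sum_bound[OF hardy_integral] sum_bound[OF interpolation_nn]
    unfolding energy_def by blast
qed

end
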